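(* There is the following asymptotic as $x\to\infty$. Suppose $N=N(x)$ satisfies $N>\exp(3.42\sqrt{\log x})$. Then for any positive constant $D$, $$ \frac1N\sum_{a\leq N}\sum_{p\leq x}\frac{\ell_a(p)}{p-1}=C\,\mathrm{Li}(x)+O\!\left(\frac{x}{(\log x)^D}\right), $$ where the implied constant depends only on $D$.
   Context: $a$ runs over positive integers and $p$ over primes. For a prime $p$ and an integer $a$ coprime to $p$, $\ell_a(p)$ denotes the multiplicative order of $a$ modulo $p$ (terms with $p\mid a$, where the order is undefined, are taken to be $0$). $\mathrm{Li}(x)=\int_2^x\frac{dt}{\log t}$. $C$ is Stephens' constant $C=\prod_p\left(1-\frac{p}{p^3-1}\right)$, the product over all primes. *)

theory Defs
  imports "HOL-Analysis.Analysis" "HOL-Number_Theory.Number_Theory"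
begin

definition Li :: "real \<Rightarrow> real" where
  "Li x = integral {2..x} (\<lambda>t. 1 / ln t)"

definition stephens_C :: real where
  "stephens_C = lim (\<lambda>n. \<Prod>p\<in>{p::nat. prime p \<and> p \<le> n}. 1 - real p / (real p ^ 3 - 1))"

(* \<ell>_a(p): multiplicative order of a mod p; library ord gives 0 when p | a *)
abbreviation ell :: "nat \<Rightarrow> nat \<Rightarrow> nat" where
  "ell a p \<equiv> ord p a"

end

theory Submission
 imports Defs "HOL-Complex_Analysis.Complex_Analysis" "HOL-Real_Asymp.Real_Asymp"
begin

text \<open>Write \<open>index_coeff d\<close> for the product of \<open>1 - q\<close> over the primes \<open>q\<close> dividing \<open>d\<close>. For a prime \<open>p\<close>,
 \<open>ord p a / (p - 1)\<close> is the sum over \<open>d\<close> dividing \<open>p - 1\<close> of \<open>index_coeff d / d\<^sup>2\<close> times the sum of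
 \<open>\<chi> a\<close> over the characters \<open>\<chi>\<close> modulo \<open>p\<close> with \<open>\<chi>\<^sup>d = 1\<close>. The principal character gives the main term:
 summed over \<open>p \<le> x\<close> it is evaluated by the Siegel-Walfisz theorem for \<open>d\<close> up to a power of \<open>ln x\<close>
 and trivially for larger \<open>d\<close>. A nonprincipal character sum over \<open>a \<le> N\<close> is either at most \<open>N / V\<close>,
 \<open>V\<close> a power of \<open>ln x\<close>, or is dominated by \<open>V ^ (2 r - 1)\<close> times its \<open>2 r\<close>-th power. The large sieve
 bounds the \<open>2 r\<close>-th moment by \<open>N ^ r + x\<^sup>2 ln x\<close> times the number of solutions of
 \<open>a\<^sub>1 \<dots> a\<^sub>r = b\<^sub>1 \<dots> b\<^sub>r\<close>, which Rankin's trick estimates; \<open>r\<close> is the least exponent with \<open>x\<^sup>2 \<le> N ^ r\<close>.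

 No zero-free region is needed for the Siegel-Walfisz theorem. The inequality \<open>3 + 4 cos t + cos 2t \<ge> 0\<close>
 and growth bounds on a slightly larger half plane control all derivatives of \<open>L'/L\<close> on the lines
 \<open>Re s = 1 + 1 / ln x\<close>; Perron's formula for the \<open>2 m\<close>-th derivative then saves \<open>(ln x) ^ m\<close>. For real
 characters the bounds degrade with \<open>L(1)\<close>, which Siegel's theorem bounds below by Estermann's argument.\<close>

section \<open>Dirichlet characters\<close>

text \<open>The saving of \<open>m\<close> logarithms is a balance. Weighting by
  \<open>ln n ^ (2 m)\<close> raises the trivial size of the sum to about
  \<open>x (ln x) ^ (2 m + 1)\<close>, while the bounded derivative gives a smoothed weighted sum
  free of logarithms. Undoing the smoothing over an interval of length \<open>x / (ln x) ^ m\<close>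
  returns \<open>m + 1\<close> of them, and partial summation divides the weight out. For
  \<open>Re s \<ge> 1 - \<eta>\<close> the L-functions are at most about
  \<open>(q (|t| + 2)) ^ (2 \<eta>)\<close> with \<eta> free, so a fixed power of this bound lost in
  the lower bound costs nothing, and Perron's kernel, of quadratic decay, absorbs the growth in
  \<open>t\<close>. The obstacle is uniformity in the modulus. Siegel's bound has exceptions: the
  real characters that agree with one of finitely many fixed characters at all \<open>n\<close>
  prime to both moduli. They are replaced by that fixed character, at the cost of few primes. In the
  moments \<open>r\<close> may grow like the square root of \<open>ln x\<close>, so the number of
  solutions has to be bounded explicitly in \<open>r\<close>; its factor exponential in
  \<open>r ^ 2\<close> is what limits how small \<open>N\<close> may be.\<close>

definition dchar :: "nat \<Rightarrow> (nat \<Rightarrow> complex) \<Rightarrow> bool" where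
 "dchar q \<phi> \<longleftrightarrow> \<phi> 1 = 1 \<and> (\<forall>m n. \<phi> (m * n) = \<phi> m * \<phi> n) \<and>
   (\<forall>m n. [m = n] (mod q) \<longrightarrow> \<phi> m = \<phi> n) \<and> (\<forall>n. \<phi> n \<noteq> 0 \<longleftrightarrow> coprime n q)"

text \<open>A character on a subgroup of the units modulo \<open>q\<close>, the subgroup being
  stored as the set \<open>H\<close> of all naturals in its residue classes. Inverses arise as
  powers, the group being finite.\<close>

definition partial_char :: "nat \<Rightarrow> nat set \<Rightarrow> (nat \<Rightarrow> complex) \<Rightarrow> bool" where
 "partial_char q H f \<longleftrightarrow> (\<forall>n\<in>H. coprime n q) \<and> 1 \<in> H \<and> (\<forall>m\<in>H. \<forall>n\<in>H. m * n \<in> H) \<and>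
   (\<forall>m n. n \<in> H \<longrightarrow> [m = n] (mod q) \<longrightarrow> m \<in> H \<and> f m = f n) \<and> f 1 = 1 \<and>
   (\<forall>m\<in>H. \<forall>n\<in>H. f (m * n) = f m * f n) \<and> (\<forall>n\<in>H. f n \<noteq> 0)"

lemma partial_charD:
 assumes "partial_char q H f"
 shows "n \<in> H \<Longrightarrow> coprime n q" "1 \<in> H"
  "m \<in> H \<Longrightarrow> n \<in> H \<Longrightarrow> m * n \<in> H"
  "n \<in> H \<Longrightarrow> [m = n] (mod q) \<Longrightarrow> m \<in> H"
  "n \<in> H \<Longrightarrow> [m = n] (mod q) \<Longrightarrow> f m = f n" "f 1 = 1"
  "m \<in> H \<Longrightarrow> n \<in> H \<Longrightarrow> f (m * n) = f m * f n" "n \<in> H \<Longrightarrow> f n \<noteq> 0"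
 using assms unfolding partial_char_def by meson+

lemma cong_mult_power_totient:
 fixes a q :: nat
 assumes "coprime a q" "q > 0"
 shows "[a * a ^ (totient q - 1) = 1] (mod q)"
proof -
 have "a * a ^ (totient q - 1) = a ^ totient q"
  using assms totient_gt_0_iff[of q] by (cases "totient q") auto
 then show ?thesis using euler_theorem[OF assms(1)] by simp
qed

lemma partial_char_power:
 assumes "partial_char q H f" "n \<in> H"
 shows "n ^ k \<in> H" "f (n ^ k) = f n ^ k"
proof -
 have "n ^ k \<in> H \<and> f (n ^ k) = f n ^ k"
 proof (induction k)
  case 0
  then show ?case using partial_charD(2,6)[OF assms(1)] by simp
 next
  case (Suc k)
  then show ?case
   using partial_charD(3,7)[OF assms(1) assms(2), of "n ^ k"] by simp
 qed
 then show "n ^ k \<in> H" "f (n ^ k) = f n ^ k" by auto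
qed

text \<open>Division with remainder: \<open>a ^ (j mod m)\<close> is \<open>a ^ j\<close> times an
  inverse of a power of \<open>a ^ m\<close>, hence lies in \<open>H\<close>, and minimality of
  \<open>m\<close> forces the remainder to be 0.\<close>

lemma partial_char_power_dvd:
 assumes pc: "partial_char q H f" and a: "coprime a q" and q: "q > 0"
  and m: "m > 0" "a ^ m \<in> H" "\<And>i. 0 < i \<Longrightarrow> i < m \<Longrightarrow> a ^ i \<notin> H" and j: "a ^ j \<in> H"
 shows "m dvd j"
proof -
 define t s where "t = j div m" and "s = j mod m"
 have js: "j = m * t + s" by (simp add: t_def s_def)
 define b where "b = (a ^ m) ^ t"
 have bH: "b \<in> H" unfolding b_def using partial_char_power(1)[OF pc m(2)] .
 have bc: "coprime b q" using a by (simp add: b_def)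
 have "[b * b ^ (totient q - 1) * a ^ s = 1 * a ^ s] (mod q)"
  by (intro cong_mult cong_mult_power_totient bc q cong_refl)
 moreover have "b * b ^ (totient q - 1) * a ^ s = b ^ (totient q - 1) * a ^ j"
  by (simp only: js b_def power_add power_mult mult_ac)
 ultimately have c: "[a ^ s = b ^ (totient q - 1) * a ^ j] (mod q)"
  by (metis cong_sym mult_1)
 have "b ^ (totient q - 1) * a ^ j \<in> H"
  using partial_charD(3)[OF pc] j partial_char_power(1)[OF pc bH] by blast
 then have "a ^ s \<in> H" using partial_charD(4)[OF pc] c by blast
 moreover have "s < m" using m(1) by (simp add: s_def)
 ultimately have "s = 0" using m(3) by blast
 then show ?thesis using js by simp
qed

text \<open>Adjoins one element \<open>a\<close> whose least positive power in \<open>H\<close> is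
  \<open>a ^ m\<close>. Any \<open>m\<close>-th root of \<open>f (a ^ m)\<close> is a consistent
  value at \<open>a\<close>; the choice is left open because separating characters needs a
  particular root.\<close>

lemma partial_char_extend_step:
 assumes pc: "partial_char q H f" and a: "coprime a q" and q: "q > 0"
  and m: "m > 0" "a ^ m \<in> H" "\<And>i. 0 < i \<Longrightarrow> i < m \<Longrightarrow> a ^ i \<notin> H" and z: "z ^ m = f (a ^ m)"
 shows "\<exists>H' f'. partial_char q H' f' \<and> H \<subseteq> H' \<and> a \<in> H' \<and> (\<forall>n\<in>H. f' n = f n) \<and> f' a = z"
proof -
 note Hc = partial_charD(1)[OF pc] and H1 = partial_charD(2)[OF pc] and Hm = partial_charD(3)[OF pc]
  and Hcong = partial_charD(4)[OF pc] and fcong = partial_charD(5)[OF pc] and f1 = partial_charD(6)[OF pc]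
  and fm = partial_charD(7)[OF pc] and f0 = partial_charD(8)[OF pc]
 have z0: "z \<noteq> 0"
 proof
  assume "z = 0"
  then have "z ^ m = 0" using m(1) by simp
  then show False using z f0[OF m(2)] by metis
 qed
 \<comment> \<open>Independence of the representation \<open>h * a ^ k\<close>: cancelling
   \<open>a ^ k\<close> leaves \<open>h = h' * a ^ j\<close> modulo \<open>q\<close>, so
   \<open>a ^ j\<close> lies in \<open>H\<close>, \<open>m\<close> divides \<open>j\<close>, and
   \<open>f (a ^ j) = z ^ j\<close>.\<close>
 have wd1: "f h * z ^ k = f h' * z ^ (k + j)"
  if "h \<in> H" "h' \<in> H" "[h * a ^ k = h' * a ^ (k + j)] (mod q)" for h h' k j
 proof -
  have "[h * a ^ k = (h' * a ^ j) * a ^ k] (mod q)"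
   using that(3) by (simp add: power_add mult_ac)
  then have c1: "[h = h' * a ^ j] (mod q)"
   using a by (subst (asm) cong_mult_rcancel_nat) (auto simp: coprime_commute)
  have "[a ^ j = h' * h' ^ (totient q - 1) * a ^ j] (mod q)"
   using cong_mult[OF cong_mult_power_totient[OF Hc[OF that(2)] q] cong_refl[of "a ^ j"]]
   by (simp add: cong_sym)
  also have "h' * h' ^ (totient q - 1) * a ^ j = h' ^ (totient q - 1) * (h' * a ^ j)"
   by (simp only: mult_ac)
  also have "[\<dots> = h' ^ (totient q - 1) * h] (mod q)"
   by (intro cong_mult cong_refl cong_sym[OF c1])
  finally have "[a ^ j = h' ^ (totient q - 1) * h] (mod q)" .
  moreover have "h' ^ (totient q - 1) * h \<in> H"
   using that Hm partial_char_power(1)[OF pc] by blast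
  ultimately have aj: "a ^ j \<in> H" using Hcong by blast
  then have "m dvd j" by (intro partial_char_power_dvd[OF pc a q m]) auto
  then obtain t where t: "j = m * t" by auto
  have "f h = f h' * f (a ^ j)" using fcong[OF Hm[OF that(2) aj] c1] fm[OF that(2) aj] by simp
  also have "f (a ^ j) = z ^ j"
   using partial_char_power(2)[OF pc m(2)] z by (simp add: t power_mult)
  finally show ?thesis by (simp add: power_add)
 qed
 have wd: "f h * z ^ k = f h' * z ^ k'"
  if "h \<in> H" "h' \<in> H" "[h * a ^ k = h' * a ^ k'] (mod q)" for h h' k k'
 proof (cases "k \<le> k'")
  case True
  then show ?thesis using wd1[of h h' k "k' - k"] that by simp
 next
  case False
  then show ?thesis using wd1[of h' h k' "k - k'"] that by (simp add: cong_sym)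
 qed
 define R where "R n v \<longleftrightarrow> (\<exists>h\<in>H. \<exists>k. [n = h * a ^ k] (mod q) \<and> v = f h * z ^ k)" for n v
 define H' where "H' = {n. \<exists>v. R n v}"
 define f' where "f' n = (SOME v. R n v)" for n
 have Runique: "v = w" if vw: "R n v" "R n w" for n v w
 proof -
  obtain h k where 1: "h \<in> H" "[n = h * a ^ k] (mod q)" "v = f h * z ^ k"
   using vw(1) unfolding R_def by blast
  obtain h' k' where 2: "h' \<in> H" "[n = h' * a ^ k'] (mod q)" "w = f h' * z ^ k'"
   using vw(2) unfolding R_def by blast
  have "[h * a ^ k = h' * a ^ k'] (mod q)" using 1(2) 2(2) by (metis cong_sym cong_trans)
  then show ?thesis using wd 1 2 by blast
 qed
 have f'eq: "f' n = v" if "R n v" for n v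
  unfolding f'_def using that Runique by (metis someI)
 have RH: "R n (f n)" if "n \<in> H" for n
  unfolding R_def using that by (intro bexI[of _ n] exI[of _ 0]) auto
 have Ra: "R a z" unfolding R_def using H1 f1 by (intro bexI[of _ 1] exI[of _ 1]) auto
 have Rm: "R (n1 * n2) (v1 * v2)" if r: "R n1 v1" "R n2 v2" for n1 n2 v1 v2
 proof -
  obtain h k where 1: "h \<in> H" "[n1 = h * a ^ k] (mod q)" "v1 = f h * z ^ k"
   using r(1) unfolding R_def by blast
  obtain h' k' where 2: "h' \<in> H" "[n2 = h' * a ^ k'] (mod q)" "v2 = f h' * z ^ k'"
   using r(2) unfolding R_def by blast
  have "[n1 * n2 = (h * a ^ k) * (h' * a ^ k')] (mod q)" by (intro cong_mult 1 2)
  then have "[n1 * n2 = (h * h') * a ^ (k + k')] (mod q)" by (simp add: power_add mult_ac)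
  moreover have "v1 * v2 = f (h * h') * z ^ (k + k')"
   using 1 2 fm by (simp add: power_add mult_ac)
  ultimately show ?thesis unfolding R_def using Hm[OF 1(1) 2(1)] by blast
 qed
 have Rcong: "R n1 v" if "R n2 v" "[n1 = n2] (mod q)" for n1 n2 v
  using that unfolding R_def by (meson cong_trans)
 have Rcop: "coprime n q \<and> v \<noteq> 0" if r: "R n v" for n v
 proof -
  obtain h k where 1: "h \<in> H" "[n = h * a ^ k] (mod q)" "v = f h * z ^ k"
   using r unfolding R_def by blast
  have "coprime (h * a ^ k) q" using Hc[OF 1(1)] a by simp
  then have "coprime n q" using 1(2) by (metis cong_imp_coprime cong_sym)
  then show ?thesis using 1 f0 z0 by simp
 qed
 have R1: "R 1 1" using RH[OF H1] f1 by simp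
 have mem: "n \<in> H'" if "R n v" for n v using that unfolding H'_def by blast
 have mem': "R n (f' n)" if n: "n \<in> H'" for n
 proof -
  obtain v where "R n v" using n unfolding H'_def by blast
  with f'eq[OF this] show ?thesis by simp
 qed
 have "partial_char q H' f'"
  unfolding partial_char_def
 proof (intro conjI ballI allI impI)
  show "coprime n q" if "n \<in> H'" for n using mem'[OF that] Rcop by blast
  show "1 \<in> H'" using mem R1 by blast
  show "u * n \<in> H'" if "u \<in> H'" "n \<in> H'" for u n using Rm[OF mem'[OF that(1)] mem'[OF that(2)]] mem by blast
  show "u \<in> H'" if "n \<in> H'" "[u = n] (mod q)" for u n using mem[OF Rcong[OF mem'[OF that(1)] that(2)]] .
  show "f' u = f' n" if "n \<in> H'" "[u = n] (mod q)" for u n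
   using f'eq[OF Rcong[OF mem'[OF that(1)] that(2)]] .
  show "f' 1 = 1" using f'eq[OF R1] .
  show "f' (u * n) = f' u * f' n" if "u \<in> H'" "n \<in> H'" for u n
   using f'eq[OF Rm[OF mem'[OF that(1)] mem'[OF that(2)]]] .
  show "f' n \<noteq> 0" if "n \<in> H'" for n using mem'[OF that] Rcop by blast
 qed
 moreover have "H \<subseteq> H'" using RH mem by blast
 moreover have "a \<in> H'" using Ra mem by blast
 moreover have "\<forall>n\<in>H. f' n = f n" using f'eq[OF RH] by blast
 moreover have "f' a = z" using f'eq[OF Ra] .
 ultimately show ?thesis by blast
qed

lemma complex_root_exists:
 fixes w :: complex
 assumes "m > 0"
 shows "\<exists>z. z ^ m = w"
proof (cases "w = 0")
 case True
 then show ?thesis using assms by (intro exI[of _ 0]) (auto simp: power_0_left)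
next
 case False
 have "exp (Ln w / of_nat m) ^ m = exp (of_nat m * (Ln w / of_nat m))"
  by (rule exp_of_nat_mult[symmetric])
 also have "\<dots> = w" using False assms by simp
 finally show ?thesis by blast
qed

text \<open>Units are adjoined one at a time; the number of units below \<open>q\<close> still
  outside \<open>H\<close> decreases. Once \<open>H\<close> contains all units, the value 0
  elsewhere completes a Dirichlet character.\<close>

lemma partial_char_extend:
 assumes "partial_char q H f" and q: "q > 0"
 shows "\<exists>\<phi>. dchar q \<phi> \<and> (\<forall>n\<in>H. \<phi> n = f n)"
 using assms(1)
proof (induction "card ({n. n < q \<and> coprime n q} - H)" arbitrary: H f rule: less_induct)
 case less
 note pc = less.prems
 show ?case
 proof (cases "{n. n < q \<and> coprime n q} \<subseteq> H")
  case True
  have Hall: "n \<in> H" if "coprime n q" for n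
  proof -
   have "n mod q \<in> H" using True that q by auto
   moreover have "[n = n mod q] (mod q)" by (simp add: cong_def)
   ultimately show ?thesis using partial_charD(4)[OF pc] by blast
  qed
  have Hcop: "coprime n q" if "n \<in> H" for n using that partial_charD(1)[OF pc] by blast
  define \<phi> where "\<phi> n = (if coprime n q then f n else 0)" for n
  have "dchar q \<phi>"
   unfolding dchar_def
  proof (intro conjI allI impI)
   show "\<phi> 1 = 1" using partial_charD(6)[OF pc] by (simp add: \<phi>_def)
   show "\<phi> (m * n) = \<phi> m * \<phi> n" for m n
    using partial_charD(7)[OF pc] Hall by (simp add: \<phi>_def)
   show "\<phi> m = \<phi> n" if "[m = n] (mod q)" for m n
   proof -
    have "coprime m q \<longleftrightarrow> coprime n q" using that by (metis cong_imp_coprime cong_sym)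
    then show ?thesis using partial_charD(5)[OF pc Hall that] unfolding \<phi>_def by metis
   qed
   show "(\<phi> n \<noteq> 0) = coprime n q" for n using partial_charD(8)[OF pc] Hall by (simp add: \<phi>_def)
  qed
  then show ?thesis using Hcop by (intro exI[of _ \<phi>]) (auto simp: \<phi>_def)
 next
  case False
  then obtain a where a: "a < q" "coprime a q" "a \<notin> H" by auto
  define P where "P i \<longleftrightarrow> i > 0 \<and> a ^ i \<in> H" for i
  have "[a ^ totient q = 1] (mod q)" using a euler_theorem by blast
  then have "P (totient q)" using partial_charD(2,4)[OF pc] q unfolding P_def by simp
  then have P: "P (Least P)" and Pl: "\<And>i. i < Least P \<Longrightarrow> \<not> P i" by (auto intro: LeastI dest: not_less_Least)
  define m where "m = Least P"
  have m: "m > 0" "a ^ m \<in> H" "\<And>i. 0 < i \<Longrightarrow> i < m \<Longrightarrow> a ^ i \<notin> H"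
   using P Pl unfolding P_def m_def by blast+
  obtain z where z: "z ^ m = f (a ^ m)" using complex_root_exists[OF m(1)] by blast
  obtain H' f' where H': "partial_char q H' f'" "H \<subseteq> H'" "a \<in> H'" "\<forall>n\<in>H. f' n = f n"
   using partial_char_extend_step[OF pc a(2) q m z] by blast
  have "{n. n < q \<and> coprime n q} - H' \<subset> {n. n < q \<and> coprime n q} - H"
   using H' a by blast
  then have "card ({n. n < q \<and> coprime n q} - H') < card ({n. n < q \<and> coprime n q} - H)"
   by (intro psubset_card_mono) auto
  from less.hyps[OF this H'(1)] show ?thesis using H' by (metis subsetD)
 qed
qed

text \<open>The residue class of 1 carries the trivial character. Adjoining \<open>h\<close> with a
  primitive root of unity of order \<open>ord q h\<close> as its value gives a partial character
  that is not 1 at \<open>h\<close>, and this one extends.\<close>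

lemma dchar_separates:
 assumes q: "q > 0" and h: "coprime h q" "\<not> [h = 1] (mod q)"
 shows "\<exists>\<phi>. dchar q \<phi> \<and> \<phi> h \<noteq> 1"
proof -
 define H where "H = {n::nat. [n = 1] (mod q)}"
 define f where "f = (\<lambda>_::nat. 1::complex)"
 have pc: "partial_char q H f"
  unfolding partial_char_def
 proof (intro conjI ballI allI impI)
  show "coprime n q" if "n \<in> H" for n
   using that unfolding H_def by (metis coprime_1_left cong_imp_coprime cong_sym mem_Collect_eq)
  show "m * n \<in> H" if "m \<in> H" "n \<in> H" for m n
   using that cong_mult[of m 1 q n 1] unfolding H_def by simp
  show "m \<in> H" if "n \<in> H" "[m = n] (mod q)" for m n
   using that unfolding H_def by (auto intro: cong_trans)
 qed (auto simp: f_def H_def)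
 define m where "m = ord q h"
 have m0: "m > 0" using h by (simp add: m_def coprime_commute)
 have m1: "m \<noteq> 1" using h(2) by (simp add: m_def ord_eq_Suc_0_iff)
 have mH: "h ^ m \<in> H" unfolding H_def m_def using ord by auto
 have mH': "h ^ i \<notin> H" if "0 < i" "i < m" for i
  using ord_minimal that unfolding H_def m_def by auto
 define z where "z = cis (2 * pi / real m)"
 have z: "z ^ m = f (h ^ m)" using m0 by (simp add: z_def Complex.DeMoivre f_def cis_2pi)
 have "z \<noteq> 1"
 proof
  assume "z = 1"
  then have "cos (2 * pi / real m) = 1" by (simp add: z_def complex_eq_iff)
  moreover have "2 * pi / real m \<le> pi" using m0 m1 by (simp add: field_simps)
  moreover have "2 * pi / real m > 0" using m0 by simp
  ultimately show False using cos_monotone_0_pi[of 0 "2 * pi / real m"] by simp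
 qed
 obtain H' f' where H': "partial_char q H' f'" "h \<in> H'" "f' h = z"
  using partial_char_extend_step[OF pc h(1) q m0 mH mH' z] by blast
 then show ?thesis using partial_char_extend[OF H'(1) q] \<open>z \<noteq> 1\<close> by metis
qed

context
 fixes q :: nat and \<phi> :: "nat \<Rightarrow> complex"
 assumes dc: "dchar q \<phi>" and q: "q > 0"
begin

lemma dchar_1 [simp]: "\<phi> 1 = 1" and dchar_Suc_0 [simp]: "\<phi> (Suc 0) = 1"
 and dchar_mult: "\<phi> (m * n) = \<phi> m * \<phi> n"
 and dchar_cong: "[m = n] (mod q) \<Longrightarrow> \<phi> m = \<phi> n"
 and dchar_eq_0_iff: "\<phi> n = 0 \<longleftrightarrow> \<not> coprime n q"
 using dc unfolding dchar_def by auto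

lemma dchar_power: "\<phi> (n ^ k) = \<phi> n ^ k"
 by (induction k) (auto simp: dchar_mult)

lemma dchar_power_totient: "coprime n q \<Longrightarrow> \<phi> n ^ totient q = 1"
 using dchar_cong[OF euler_theorem[of n q]] by (simp add: dchar_power)

lemma norm_dchar: "norm (\<phi> n) = (if coprime n q then 1 else 0)"
proof (cases "coprime n q")
 case True
 have "norm (\<phi> n) = 1"
  using power_eq_1_iff[OF dchar_power_totient[OF True]] q by simp
 then show ?thesis using True by simp
qed (use dchar_eq_0_iff in auto)

lemma norm_dchar_le_1: "norm (\<phi> n) \<le> 1"
 by (simp add: norm_dchar)

text \<open>Multiplication by \<open>a\<close> permutes the residues, so the sum equals
  \<open>\<phi> a\<close> times itself.\<close>

lemma sum_dchar_period:
 assumes "coprime a q" "\<phi> a \<noteq> 1"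
 shows "(\<Sum>n<q. \<phi> n) = 0"
proof -
 have inj: "inj_on (\<lambda>n. a * n mod q) {..<q}"
 proof (rule inj_onI)
  fix x y assume xy: "x \<in> {..<q}" "y \<in> {..<q}" "a * x mod q = a * y mod q"
  then have "[a * x = a * y] (mod q)" by (simp add: cong_def)
  then have "[x = y] (mod q)" using assms(1) by (simp add: cong_mult_lcancel_nat coprime_commute)
  then show "x = y" using xy by (simp add: cong_def)
 qed
 have "bij_betw (\<lambda>n. a * n mod q) {..<q} {..<q}"
  unfolding bij_betw_def using inj q by (intro conjI endo_inj_surj) auto
 then have "(\<Sum>n<q. \<phi> n) = (\<Sum>n<q. \<phi> (a * n mod q))"
  by (rule sum.reindex_bij_betw[symmetric])
 also have "\<dots> = (\<Sum>n<q. \<phi> a * \<phi> n)"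
 proof (intro sum.cong refl)
  fix n
  have "\<phi> (a * n mod q) = \<phi> (a * n)" by (rule dchar_cong) (simp add: cong_def)
  then show "\<phi> (a * n mod q) = \<phi> a * \<phi> n" by (simp add: dchar_mult)
 qed
 also have "\<dots> = \<phi> a * (\<Sum>n<q. \<phi> n)" by (simp add: sum_distrib_left)
 finally show ?thesis using assms(2) by auto
qed

lemma dchar_add_period: "\<phi> (n + q) = \<phi> n"
 by (rule dchar_cong) (simp add: cong_def)

lemma norm_sum_dchar_le:
 assumes "coprime a q" "\<phi> a \<noteq> 1"
 shows "norm (\<Sum>n<m. \<phi> n) \<le> real q"
proof (induction m rule: less_induct)
 case (less m)
 show ?case
 proof (cases "m \<le> q")
  case True
  have "norm (\<Sum>n<m. \<phi> n) \<le> (\<Sum>n<m. 1)" by (intro sum_norm_le norm_dchar_le_1)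
  then show ?thesis using True by simp
 next
  case False
  define k where "k = m - q"
  have m: "m = q + k" using False by (simp add: k_def)
  have "(\<Sum>n<m. \<phi> n) = (\<Sum>n<q. \<phi> n) + (\<Sum>n=q..<q+k. \<phi> n)"
   unfolding m lessThan_atLeast0 by (subst sum.atLeastLessThan_concat) auto
  also have "(\<Sum>n=q..<q+k. \<phi> n) = (\<Sum>n<k. \<phi> n)"
   using sum.shift_bounds_nat_ivl[of \<phi> 0 q k]
   by (simp add: lessThan_atLeast0 add.commute dchar_add_period)
  finally show ?thesis using less[of k] q m sum_dchar_period[OF assms] by simp
 qed
qed

end

section \<open>Orthogonality of characters\<close>

definition dchars :: "nat \<Rightarrow> (nat \<Rightarrow> complex) set" where "dchars q = {\<phi>. dchar q \<phi>}"

definition principal :: "nat \<Rightarrow> nat \<Rightarrow> complex" where "principal q n = (if coprime n q then 1 else 0)"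

lemma dchar_principal: "dchar q (principal q)"
 unfolding dchar_def principal_def by (auto dest: cong_imp_coprime cong_sym)

lemma dchar_times:
 assumes "dchar q \<phi>" "dchar r \<psi>"
 shows "dchar (q * r) (\<lambda>n. \<phi> n * \<psi> n)"
proof -
 have "[m = n] (mod q) \<and> [m = n] (mod r)" if "[m = n] (mod (q * r))" for m n
  using that cong_modulus_mult_nat[of m n q r] cong_modulus_mult_nat[of m n r q] by (simp add: mult.commute)
 then show ?thesis using assms unfolding dchar_def by (simp add: mult_ac) metis
qed

lemma dchar_times_same:
 assumes "dchar q \<phi>" "dchar q \<psi>"
 shows "dchar q (\<lambda>n. \<phi> n * \<psi> n)"
 using assms unfolding dchar_def by (simp add: mult_ac)

lemma nonprincipal_witness:
 assumes "dchar q \<phi>" "q > 0" "\<phi> \<noteq> principal q"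
 obtains a where "coprime a q" "\<phi> a \<noteq> 1"
 using assms dchar_eq_0_iff[OF assms(1,2)] unfolding principal_def fun_eq_iff by metis

text \<open>A character is determined by its values on one period, and each of these is 0 or a root
  of unity of exponent \<open>totient q\<close>.\<close>

lemma finite_dchars:
 assumes q: "q > 0"
 shows "finite (dchars q)"
proof -
 define Z where "Z = insert 0 {z::complex. z ^ totient q = 1}"
 have "finite {z::complex. z ^ totient q = 1}"
  using q by (intro finite_roots_unity) (simp_all add: Suc_le_eq)
 then have fin: "finite (PiE {..<q} (\<lambda>_. Z))" by (intro finite_PiE) (auto simp: Z_def)
 have "inj_on (\<lambda>\<phi>. restrict \<phi> {..<q}) (dchars q)"
 proof (rule inj_onI)
  fix \<phi> \<psi> assume 1: "\<phi> \<in> dchars q" "\<psi> \<in> dchars q" "restrict \<phi> {..<q} = restrict \<psi> {..<q}"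
  show "\<phi> = \<psi>"
  proof
   fix n
   have c: "[n = n mod q] (mod q)" by (simp add: cong_def)
   have "\<phi> (n mod q) = \<psi> (n mod q)" using 1(3) q by (metis lessThan_iff mod_less_divisor restrict_apply')
   then show "\<phi> n = \<psi> n" using 1(1,2) dchar_cong[OF _ q c] unfolding dchars_def by (metis mem_Collect_eq)
  qed
 qed
 moreover have "(\<lambda>\<phi>. restrict \<phi> {..<q}) ` dchars q \<subseteq> PiE {..<q} (\<lambda>_. Z)"
 proof (rule image_subsetI)
  fix \<phi> assume p: "\<phi> \<in> dchars q"
  have "\<phi> n \<in> Z" for n
   using dchar_power_totient[of q \<phi> n] dchar_eq_0_iff[of q \<phi> n] q p
   unfolding dchars_def Z_def by auto
  then show "restrict \<phi> {..<q} \<in> PiE {..<q} (\<lambda>_. Z)" by auto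
 qed
 ultimately show ?thesis using fin finite_subset inj_on_finite by metis
qed

text \<open>Dual of \<open>sum_dchar_period\<close>: multiplying all characters by one that is not 1
  at \<open>n\<close> permutes them.\<close>

lemma sum_dchars_eq_0:
 assumes q: "q > 0" and n: "\<not> [n = 1] (mod q)"
 shows "(\<Sum>\<phi>\<in>dchars q. \<phi> n) = 0"
proof (cases "coprime n q")
 case False
 then show ?thesis using dchar_eq_0_iff[OF _ q] by (intro sum.neutral) (auto simp: dchars_def)
next
 case True
 obtain \<psi> where \<psi>: "dchar q \<psi>" "\<psi> n \<noteq> 1" using dchar_separates[OF q True n] by blast
 define M where "M \<phi> = (\<lambda>k. \<psi> k * \<phi> k)" for \<phi> :: "nat \<Rightarrow> complex"
 have inj: "inj_on M (dchars q)"
 proof (rule inj_onI)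
  fix \<phi> \<theta> assume 1: "\<phi> \<in> dchars q" "\<theta> \<in> dchars q" "M \<phi> = M \<theta>"
  show "\<phi> = \<theta>"
  proof
   fix k
   have "\<psi> k * \<phi> k = \<psi> k * \<theta> k" using 1(3) unfolding M_def by metis
   then show "\<phi> k = \<theta> k"
    using dchar_eq_0_iff[OF _ q] \<psi>(1) 1(1,2) unfolding dchars_def by (metis mem_Collect_eq mult_left_cancel)
  qed
 qed
 moreover have "M ` dchars q \<subseteq> dchars q" using dchar_times_same[OF \<psi>(1)] by (auto simp: M_def dchars_def)
 ultimately have "bij_betw M (dchars q) (dchars q)"
  unfolding bij_betw_def using finite_dchars[OF q] by (intro conjI endo_inj_surj) auto
 then have "(\<Sum>\<phi>\<in>dchars q. \<phi> n) = (\<Sum>\<phi>\<in>dchars q. M \<phi> n)"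
  by (rule sum.reindex_bij_betw[symmetric, of M _ _ "\<lambda>\<phi>. \<phi> n"])
 also have "\<dots> = \<psi> n * (\<Sum>\<phi>\<in>dchars q. \<phi> n)" by (simp add: M_def sum_distrib_left)
 finally show ?thesis using \<psi>(2) by auto
qed

text \<open>The double sum of \<open>\<phi> n\<close> over characters and residues is evaluated in
  both orders: summing over characters first leaves only the residue of 1, summing over residues
  first only the principal character.\<close>

lemma card_dchars:
 assumes q: "q > 0"
 shows "card (dchars q) = totient q"
proof -
 \<comment> \<open>\<open>1 mod q\<close> rather than 1, so that the modulus 1 is covered, where the
   residue is 0.\<close>
 have c: "n = 1 mod q" if "n < q" "[n = 1] (mod q)" for n
  using that unfolding cong_def by (metis mod_less)
 have "(\<Sum>n<q. \<Sum>\<phi>\<in>dchars q. \<phi> n) = (\<Sum>n\<in>{1 mod q}. \<Sum>\<phi>\<in>dchars q. \<phi> n)"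
 proof (rule sum.mono_neutral_right)
  show "\<forall>n\<in>{..<q} - {1 mod q}. (\<Sum>\<phi>\<in>dchars q. \<phi> n) = 0"
   using c sum_dchars_eq_0[OF q] by blast
 next
  show "{1 mod q} \<subseteq> {..<q}" using q by (metis empty_subsetI insert_subset lessThan_iff mod_less_divisor)
 qed simp
 also have "\<dots> = (\<Sum>\<phi>\<in>dchars q. 1)"
 proof -
  have "(\<Sum>\<phi>\<in>dchars q. \<phi> (1 mod q)) = (\<Sum>\<phi>\<in>dchars q. 1)"
  proof (rule sum.cong[OF refl])
   fix \<phi> assume "\<phi> \<in> dchars q"
   then have d: "dchar q \<phi>" by (simp add: dchars_def)
   have "[1 mod q = 1] (mod q)" unfolding cong_def by (rule mod_mod_trivial)
   then show "\<phi> (1 mod q) = 1" using dchar_cong[OF d q] dchar_1[OF d q] by metis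
  qed
  then show ?thesis by simp
 qed
 finally have 1: "(\<Sum>n<q. \<Sum>\<phi>\<in>dchars q. \<phi> n) = of_nat (card (dchars q))" by simp
 have "(\<Sum>n<q. \<Sum>\<phi>\<in>dchars q. \<phi> n) = (\<Sum>\<phi>\<in>dchars q. \<Sum>n<q. \<phi> n)" by (rule sum.swap)
 also have "\<dots> = (\<Sum>\<phi>\<in>{principal q}. \<Sum>n<q. \<phi> n)"
 proof (rule sum.mono_neutral_right[OF finite_dchars[OF q]])
  show "\<forall>\<phi>\<in>dchars q - {principal q}. (\<Sum>n<q. \<phi> n) = 0"
  proof
   fix \<phi> assume "\<phi> \<in> dchars q - {principal q}"
   then have d: "dchar q \<phi>" "\<phi> \<noteq> principal q" by (auto simp: dchars_def)
   obtain a where "coprime a q" "\<phi> a \<noteq> 1" using nonprincipal_witness[OF d(1) q d(2)] .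
   then show "(\<Sum>n<q. \<phi> n) = 0" using sum_dchar_period[OF d(1) q] by blast
  qed
 qed (auto simp: dchars_def dchar_principal)
 also have "\<dots> = (\<Sum>n<q. principal q n)" by simp
 also have "\<dots> = of_nat (totient q)"
 proof -
  have "(\<Sum>n<q. principal q n) = (\<Sum>n\<in>{0<..q}. principal q n)"
  proof -
   have "(\<Sum>n<q. principal q n) = (\<Sum>n\<in>insert 0 {0<..<q}. principal q n)"
    using q by (intro sum.cong) auto
   also have "\<dots> = (\<Sum>n\<in>insert q {0<..<q}. principal q n)"
    by (simp add: principal_def)
   also have "insert q {0<..<q} = {0<..q}" using q by auto
   finally show ?thesis .
  qed
  also have "\<dots> = (\<Sum>n\<in>totatives q. 1)"
   by (intro sum.mono_neutral_cong_right) (auto simp: totatives_def principal_def)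
  finally show ?thesis by (simp add: totient_def)
 qed
 finally show ?thesis using 1 by (metis of_nat_eq_iff)
qed

lemma sum_dchars:
 assumes q: "q > 0"
 shows "(\<Sum>\<phi>\<in>dchars q. \<phi> n) = (if [n = 1] (mod q) then of_nat (totient q) else 0)"
proof (cases "[n = 1] (mod q)")
 case True
 have "(\<Sum>\<phi>\<in>dchars q. \<phi> n) = (\<Sum>\<phi>\<in>dchars q. 1)"
 proof (rule sum.cong[OF refl])
  fix \<phi> assume "\<phi> \<in> dchars q"
  then have d: "dchar q \<phi>" by (simp add: dchars_def)
  show "\<phi> n = 1" using dchar_cong[OF d q True] dchar_1[OF d q] by metis
 qed
 then show ?thesis using True card_dchars[OF q] by simp
qed (use sum_dchars_eq_0[OF q] in auto)

section \<open>Absolutely convergent Dirichlet series\<close>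

definition abs_conv :: "(nat \<Rightarrow> complex) \<Rightarrow> bool" where
 "abs_conv a \<longleftrightarrow> (\<forall>\<sigma>>1. summable (\<lambda>n. norm (a n) * real n powr (-\<sigma>)))"

abbreviation cln :: "nat \<Rightarrow> complex" where "cln n \<equiv> of_real (ln (real n))"

text \<open>The value \<open>a 0\<close> has no influence, because
  \<open>0 powr s = 0\<close>.\<close>

definition dirichlet :: "(nat \<Rightarrow> complex) \<Rightarrow> complex \<Rightarrow> complex" where
 "dirichlet a s = (\<Sum>n. a n * of_nat n powr (-s))"

lemma norm_nat_powr: "norm (of_nat n powr (s::complex)) = real n powr Re s"
 by (subst norm_powr_real_powr) auto

lemma abs_convI:
 assumes "\<And>n. n > 0 \<Longrightarrow> norm (a n) \<le> norm (b n)" "abs_conv b"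
 shows "abs_conv a"
 unfolding abs_conv_def
proof (intro allI impI)
 fix \<sigma> :: real assume "\<sigma> > 1"
 then have "summable (\<lambda>n. norm (b n) * real n powr (-\<sigma>))" using assms(2) by (simp add: abs_conv_def)
 then show "summable (\<lambda>n. norm (a n) * real n powr (-\<sigma>))"
 proof (rule summable_comparison_test'[where N = 1])
  fix n :: nat assume "n \<ge> 1"
  then show "norm (norm (a n) * real n powr - \<sigma>) \<le> norm (b n) * real n powr - \<sigma>"
   using assms(1)[of n] by (simp add: mult_right_mono)
 qed
qed

lemma abs_conv_const: "abs_conv (\<lambda>_. c)"
 unfolding abs_conv_def by (auto intro!: summable_mult simp: summable_real_powr_iff)

lemma abs_conv_bounded: "(\<And>n. n > 0 \<Longrightarrow> norm (a n) \<le> 1) \<Longrightarrow> abs_conv a"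
 by (rule abs_convI[OF _ abs_conv_const[of 1]]) simp

lemma abs_conv_add:
 assumes "abs_conv a" "abs_conv b"
 shows "abs_conv (\<lambda>n. a n + b n)"
 unfolding abs_conv_def
proof (intro allI impI)
 fix \<sigma> :: real assume "\<sigma> > 1"
 then have "summable (\<lambda>n. norm (a n) * real n powr (-\<sigma>) + norm (b n) * real n powr (-\<sigma>))"
  using assms by (intro summable_add) (auto simp: abs_conv_def)
 then show "summable (\<lambda>n. norm (a n + b n) * real n powr (-\<sigma>))"
 proof (rule summable_comparison_test'[where N = 0])
  fix n :: nat
  show "norm (norm (a n + b n) * real n powr - \<sigma>) \<le> norm (a n) * real n powr - \<sigma> + norm (b n) * real n powr - \<sigma>"
   using norm_triangle_ineq[of "a n" "b n"] by (simp add: distrib_right[symmetric] mult_right_mono)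
 qed
qed

lemma abs_conv_uminus: "abs_conv a \<Longrightarrow> abs_conv (\<lambda>n. - a n)"
 unfolding abs_conv_def by simp

lemma abs_conv_diff:
 assumes "abs_conv a" "abs_conv b"
 shows "abs_conv (\<lambda>n. a n - b n)"
 using abs_conv_add[OF assms(1) abs_conv_uminus[OF assms(2)]] by simp

text \<open>The logarithm is absorbed by a power of \<open>n\<close> that uses up half of the
  distance from \<sigma> to 1.\<close>

lemma abs_conv_ln:
 assumes "abs_conv a"
 shows "abs_conv (\<lambda>n. a n * cln n)"
 unfolding abs_conv_def
proof (intro allI impI)
 fix \<sigma> :: real assume s: "\<sigma> > 1"
 define d where "d = (\<sigma> - 1) / 2"
 have d: "d > 0" "\<sigma> - d > 1" using s by (auto simp: d_def field_simps)
 have "summable (\<lambda>n. norm (a n) * real n powr (-(\<sigma> - d)) * (1/d))"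
  using assms d unfolding abs_conv_def by (intro summable_mult2) auto
 then show "summable (\<lambda>n. norm (a n * cln n) * real n powr (-\<sigma>))"
 proof (rule summable_comparison_test'[where N = 1])
  fix n :: nat assume n: "n \<ge> 1"
  have "ln (real n) \<le> real n powr d / d" using n d by (intro ln_powr_bound) auto
  then have "ln (real n) * real n powr (-\<sigma>) \<le> real n powr d / d * real n powr (-\<sigma>)"
   by (intro mult_right_mono) auto
  also have "\<dots> = real n powr (-(\<sigma> - d)) * (1/d)"
   using n by (simp add: powr_add[symmetric])
  finally have "norm (a n) * (ln (real n) * real n powr (-\<sigma>)) \<le> norm (a n) * (real n powr (-(\<sigma> - d)) * (1/d))"
   by (intro mult_left_mono) auto
  then show "norm (norm (a n * cln n) * real n powr - \<sigma>)
    \<le> norm (a n) * real n powr (-(\<sigma> - d)) * (1/d)"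
   using n by (simp add: norm_mult mult_ac)
 qed
qed

lemma abs_conv_ln_power:
 assumes "abs_conv a"
 shows "abs_conv (\<lambda>n. a n * cln n ^ k)"
proof (induction k)
 case (Suc k)
 from abs_conv_ln[OF this] show ?case by (simp add: mult_ac)
qed (use assms in simp)

lemma summable_norm_dirichlet:
 assumes "abs_conv a" "Re s > 1"
 shows "summable (\<lambda>n. norm (a n * of_nat n powr (-s)))"
 using assms unfolding abs_conv_def by (simp add: norm_mult norm_nat_powr)

lemma sums_dirichlet:
 assumes "abs_conv a" "Re s > 1"
 shows "(\<lambda>n. a n * of_nat n powr (-s)) sums dirichlet a s"
 unfolding dirichlet_def using summable_norm_cancel[OF summable_norm_dirichlet[OF assms]]
 by (rule summable_sums)

lemma has_sum_dirichlet:
 assumes "abs_conv a" "Re s > 1"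
 shows "((\<lambda>n. a n * of_nat n powr (-s)) has_sum dirichlet a s) UNIV"
 by (rule norm_summable_imp_has_sum[OF summable_norm_dirichlet sums_dirichlet]) (fact assms)+

lemma dirichlet_cong:
 assumes "\<And>n. n > 0 \<Longrightarrow> a n = b n"
 shows "dirichlet a s = dirichlet b s"
 unfolding dirichlet_def
proof (rule suminf_cong)
 fix n show "a n * of_nat n powr (-s) = b n * of_nat n powr (-s)" using assms[of n] by (cases "n = 0") auto
qed

lemma dirichlet_add:
 assumes "abs_conv a" "abs_conv b" "Re s > 1"
 shows "dirichlet (\<lambda>n. a n + b n) s = dirichlet a s + dirichlet b s"
 using sums_add[OF sums_dirichlet[OF assms(1,3)] sums_dirichlet[OF assms(2,3)]]
 unfolding dirichlet_def[of "\<lambda>n. a n + b n"] by (auto simp: sums_iff distrib_right)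

lemma dirichlet_uminus:
 assumes "abs_conv a" "Re s > 1"
 shows "dirichlet (\<lambda>n. - a n) s = - dirichlet a s"
 using sums_minus[OF sums_dirichlet[OF assms]] unfolding dirichlet_def[of "\<lambda>n. - a n"] by (auto simp: sums_iff)

lemma dirichlet_diff:
 assumes "abs_conv a" "abs_conv b" "Re s > 1"
 shows "dirichlet (\<lambda>n. a n - b n) s = dirichlet a s - dirichlet b s"
 using dirichlet_add[OF assms(1) abs_conv_uminus[OF assms(2)] assms(3)] dirichlet_uminus[OF assms(2,3)] by simp

text \<open>Termwise differentiation in the half plane \<open>Re z > \<delta>\<close>, with \<delta>
  halfway between 1 and \<open>Re s\<close>; the series at \<delta> dominates there.\<close>

lemma has_field_derivative_dirichlet:
 assumes "abs_conv a" "Re s > 1"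
 shows "(dirichlet a has_field_derivative - dirichlet (\<lambda>n. a n * cln n) s) (at s)"
proof -
 define \<delta> where "\<delta> = (1 + Re s) / 2"
 have \<delta>: "\<delta> > 1" "\<delta> < Re s" using assms by (auto simp: \<delta>_def)
 define S where "S = {z. \<delta> < Re z}"
 have S: "open S" unfolding S_def by (rule open_halfspace_Re_gt)
 define f where "f = (\<lambda>n z. a n * of_nat n powr (-z))"
 define f' where "f' = (\<lambda>n z. - (a n * cln n * of_nat n powr (-z)))"
 have sm: "summable (\<lambda>n. norm (a n) * real n powr (-\<delta>))" using assms \<delta> by (simp add: abs_conv_def)
 have df: "(f n has_field_derivative f' n x) (at x)" for n x
 proof (cases "n = 0")
  case False
  then have "Ln (of_nat n) = cln n" by (metis Ln_of_real of_nat_0_less_iff of_real_of_nat_eq not_gr_zero)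
  moreover have "((\<lambda>z. (of_nat n :: complex) powr (-z)) has_field_derivative Ln (of_nat n) * of_nat n powr (-x) * (-1)) (at x)"
   using False by (intro DERIV_chain2[OF has_field_derivative_powr_right]) (auto intro!: derivative_eq_intros)
  ultimately show ?thesis unfolding f_def f'_def by (auto intro!: derivative_eq_intros)
 qed (simp add: f_def f'_def)
 have bd: "\<forall>\<^sub>F n in sequentially. \<forall>x\<in>S. norm (f n x) \<le> norm (a n) * real n powr (-\<delta>)"
 proof (intro eventually_sequentiallyI[of 1] ballI)
  fix n :: nat and x assume "n \<ge> 1" "x \<in> S"
  then have "real n powr (- Re x) \<le> real n powr (-\<delta>)" by (intro powr_mono) (auto simp: S_def)
  then show "norm (f n x) \<le> norm (a n) * real n powr (-\<delta>)"
   by (simp add: f_def norm_mult norm_nat_powr mult_left_mono)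
 qed
 obtain g g' where g: "\<forall>x \<in> S. ((\<lambda>n. f n x) sums g x) \<and> ((\<lambda>n. f' n x) sums g' x) \<and> (g has_field_derivative g' x) (at x)"
  using series_and_derivative_comparison[OF S sm df bd] by metis
 have sS: "s \<in> S" using \<delta> by (simp add: S_def)
 have geq: "g x = dirichlet a x" if "x \<in> S" for x
 proof -
  have "(\<lambda>n. f n x) sums g x" using g that by blast
  then show ?thesis by (simp add: dirichlet_def f_def sums_iff)
 qed
 have g'eq: "g' s = - dirichlet (\<lambda>n. a n * cln n) s"
 proof -
  have "(\<lambda>n. f' n s) sums g' s" using g sS by blast
  moreover have "(\<lambda>n. f' n s) sums - dirichlet (\<lambda>n. a n * cln n) s"
   unfolding f'_def by (intro sums_minus sums_dirichlet abs_conv_ln assms)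
  ultimately show ?thesis by (rule sums_unique2)
 qed
 have "(g has_field_derivative g' s) (at s)" using g sS by blast
 then show ?thesis unfolding g'eq
  by (rule has_field_derivative_transform_within_open[OF _ S sS]) (use geq in auto)
qed

lemma holomorphic_dirichlet:
 assumes "abs_conv a"
 shows "dirichlet a holomorphic_on {s. Re s > 1}"
 by (subst holomorphic_on_open) (auto simp: open_halfspace_Re_gt intro: has_field_derivative_dirichlet[OF assms])

lemma higher_deriv_dirichlet:
 assumes "abs_conv a" "Re s > 1"
 shows "(deriv ^^ k) (dirichlet a) s = (-1) ^ k * dirichlet (\<lambda>n. a n * cln n ^ k) s"
 using assms(2)
proof (induction k arbitrary: s)
 case (Suc k)
 have op: "open {s. Re s > 1}" by (rule open_halfspace_Re_gt)
 have "((deriv ^^ k) (dirichlet a) has_field_derivative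
   (-1) ^ k * - dirichlet (\<lambda>n. a n * cln n ^ k * cln n) s) (at s)"
 proof (rule has_field_derivative_transform_within_open[OF _ op])
  show "((\<lambda>z. (-1) ^ k * dirichlet (\<lambda>n. a n * cln n ^ k) z) has_field_derivative
   (-1) ^ k * - dirichlet (\<lambda>n. a n * cln n ^ k * cln n) s) (at s)"
   by (intro DERIV_cmult has_field_derivative_dirichlet abs_conv_ln_power assms(1) Suc.prems)
 qed (use Suc in auto)
 from DERIV_imp_deriv[OF this] show ?case by (simp add: mult_ac)
qed simp

definition conv :: "(nat \<Rightarrow> complex) \<Rightarrow> (nat \<Rightarrow> complex) \<Rightarrow> nat \<Rightarrow> complex" where
 "conv a b n = (\<Sum>d | d dvd n. a d * b (n div d))"

text \<open>The product is a sum over pairs \<open>(d, e)\<close>, regrouped by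
  \<open>n = d * e\<close> along the bijection between \<open>(d, e)\<close> and
  \<open>(n, d)\<close> with \<open>d dvd n\<close>. Absolute summability over the pairs permits the
  regrouping.\<close>

lemma dirichlet_conv:
 assumes "abs_conv a" "abs_conv b" "Re s > 1" "abs_conv (conv a b)"
 shows "dirichlet (conv a b) s = dirichlet a s * dirichlet b s"
proof -
 \<comment> \<open>Positive integers only: every number divides 0, so the group belonging to
   \<open>n = 0\<close> would be infinite.\<close>
 define A :: "nat set" where "A = {0<..}"
 define f where "f = (\<lambda>n. a n * of_nat n powr (-s))"
 define g where "g = (\<lambda>n. b n * of_nat n powr (-s))"
 have hs: "(h has_sum S) A" if "(h has_sum S) UNIV" "h 0 = 0" for h :: "nat \<Rightarrow> 'b::topological_comm_monoid_add" and S
 proof -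
  have "(h has_sum S) A \<longleftrightarrow> (h has_sum S) UNIV"
   by (rule has_sum_cong_neutral) (use that in \<open>auto simp: A_def\<close>)
  then show ?thesis using that by simp
 qed
 have f: "(f has_sum dirichlet a s) A" and g: "(g has_sum dirichlet b s) A"
  unfolding f_def g_def by (intro hs has_sum_dirichlet assms; simp)+
 have nf: "(\<lambda>n. norm (f n)) summable_on A" "(\<lambda>n. norm (g n)) summable_on A"
 proof -
  have "(\<lambda>n. norm (f n)) summable_on UNIV" "(\<lambda>n. norm (g n)) summable_on UNIV"
   unfolding f_def g_def using assms by (intro norm_summable_imp_summable_on; simp add: summable_norm_dirichlet)+
  then show "(\<lambda>n. norm (f n)) summable_on A" "(\<lambda>n. norm (g n)) summable_on A"
   by (auto intro: summable_on_subset_banach)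
 qed
 have "(\<lambda>z. norm (case z of (d, e) \<Rightarrow> f d * g e)) summable_on (A \<times> A)"
 proof (rule summable_on_SigmaI)
  fix d assume "d \<in> A"
  have "((\<lambda>e. norm (f d) * norm (g e)) has_sum norm (f d) * infsum (\<lambda>e. norm (g e)) A) A"
   by (intro has_sum_cmult_right has_sum_infsum nf)
  then show "((\<lambda>e. norm (case (d, e) of (d, e) \<Rightarrow> f d * g e)) has_sum norm (f d) * infsum (\<lambda>e. norm (g e)) A) A"
   by (simp add: norm_mult)
 next
  show "(\<lambda>d. norm (f d) * infsum (\<lambda>e. norm (g e)) A) summable_on A"
   by (intro summable_on_cmult_left nf)
 qed simp
 then have sm: "(\<lambda>(d, e). f d * g e) summable_on (A \<times> A)" by (rule abs_summable_summable)
 have 1: "((\<lambda>(d, e). f d * g e) has_sum (dirichlet a s * dirichlet b s)) (A \<times> A)"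
 proof (rule has_sum_SigmaI)
  show "((\<lambda>e. case (d, e) of (d, e) \<Rightarrow> f d * g e) has_sum f d * dirichlet b s) A" for d
   using has_sum_cmult_right[OF g] by simp
  show "((\<lambda>d. f d * dirichlet b s) has_sum dirichlet a s * dirichlet b s) A"
   by (rule has_sum_cmult_left[OF f])
 qed (rule sm)
 have bij: "((\<lambda>(n, d). f d * g (n div d)) has_sum (dirichlet a s * dirichlet b s)) (Sigma A (\<lambda>n. {d. d dvd n}))
   = ((\<lambda>(d, e). f d * g e) has_sum (dirichlet a s * dirichlet b s)) (A \<times> A)"
  by (rule has_sum_reindex_bij_witness[where i = "\<lambda>(d, e). (d * e, d)" and j = "\<lambda>(n, d). (d, n div d)"])
    (auto simp: A_def elim!: dvdE intro: Nat.gr0I)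
 have "((\<lambda>n. \<Sum>d | d dvd n. f d * g (n div d)) has_sum (dirichlet a s * dirichlet b s)) A"
 proof (rule has_sum_SigmaD)
  show "((\<lambda>(n, d). f d * g (n div d)) has_sum (dirichlet a s * dirichlet b s)) (Sigma A (\<lambda>n. {d. d dvd n}))"
   using 1 bij by blast
  show "((\<lambda>d. case (n, d) of (n, d) \<Rightarrow> f d * g (n div d)) has_sum (\<Sum>d | d dvd n. f d * g (n div d))) {d. d dvd n}"
   if "n \<in> A" for n
   using that has_sum_finite[of "{d. d dvd n}" "\<lambda>d. f d * g (n div d)"] by (simp add: A_def)
 qed
 moreover have "(\<Sum>d | d dvd n. f d * g (n div d)) = conv a b n * of_nat n powr (-s)" if "n \<in> A" for n
  unfolding conv_def sum_distrib_right
 proof (rule sum.cong[OF refl])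
  fix d assume "d \<in> {d. d dvd n}"
  then obtain e where e: "n = d * e" by auto
  have "(of_nat n :: complex) powr (-s) = of_nat d powr (-s) * of_nat e powr (-s)"
   unfolding e by (simp add: powr_times_real)
  then show "f d * g (n div d) = a d * b (n div d) * of_nat n powr (-s)"
   using e that by (auto simp: f_def g_def A_def)
 qed
 ultimately have 2: "((\<lambda>n. conv a b n * of_nat n powr (-s)) has_sum (dirichlet a s * dirichlet b s)) A"
  by (subst (asm) has_sum_cong) auto
 have "((\<lambda>n. conv a b n * of_nat n powr (-s)) has_sum dirichlet (conv a b) s) A"
  by (intro hs has_sum_dirichlet assms) simp
 from has_sum_unique[OF this 2] show ?thesis .
qed

lemma norm_dirichlet_diff_le:
 assumes "abs_conv a"
 shows "\<exists>K. \<forall>\<sigma>\<ge>2. norm (dirichlet a (of_real \<sigma>) - a 1) \<le> K * 2 powr (-\<sigma>)"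
proof -
 define M where "M = (\<Sum>n. norm (a n) * real n powr (-2))"
 have sm: "summable (\<lambda>n. norm (a n) * real n powr (-2))" using assms by (simp add: abs_conv_def)
 have "norm (dirichlet a (of_real \<sigma>) - a 1) \<le> 4 * M * 2 powr (-\<sigma>)" if "\<sigma> \<ge> 2" for \<sigma>
 proof -
  define h where "h n = (if n = 1 then 0 else a n * of_nat n powr (- complex_of_real \<sigma>))" for n :: nat
  have "(\<lambda>n. a n * of_nat n powr (- complex_of_real \<sigma>)) sums dirichlet a (of_real \<sigma>)"
   using that assms by (intro sums_dirichlet) auto
  moreover have "(\<lambda>n. if n = 1 then a 1 else 0) sums a 1" by (rule sums_single[of 1 "\<lambda>_. a 1"])
  ultimately have "(\<lambda>n. a n * of_nat n powr (- complex_of_real \<sigma>) - (if n = 1 then a 1 else 0)) sums (dirichlet a (of_real \<sigma>) - a 1)"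
   by (rule sums_diff)
  also have "(\<lambda>n. a n * of_nat n powr (- complex_of_real \<sigma>) - (if n = 1 then a 1 else 0)) = h"
   by (auto simp: h_def fun_eq_iff)
  finally have h: "h sums (dirichlet a (of_real \<sigma>) - a 1)" .
  have hb: "norm (h n) \<le> (norm (a n) * real n powr (-2)) * (4 * 2 powr (-\<sigma>))" for n
  proof (cases "n \<ge> 2")
   case True
   have "real n powr (-(\<sigma> - 2)) \<le> 2 powr (-(\<sigma> - 2))"
    using True that by (intro powr_mono2') auto
   also have "\<dots> = 4 * 2 powr (-\<sigma>)" by (simp add: powr_diff powr_minus divide_simps)
   finally have "real n powr (-2) * real n powr (-(\<sigma> - 2)) \<le> real n powr (-2) * (4 * 2 powr (-\<sigma>))"
    by (intro mult_left_mono) auto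
   moreover have "real n powr (-2) * real n powr (-(\<sigma> - 2)) = real n powr (-\<sigma>)"
    by (simp add: powr_add[symmetric])
   ultimately have "real n powr (-\<sigma>) \<le> real n powr (-2) * (4 * 2 powr (-\<sigma>))" by simp
   from mult_left_mono[OF this, of "norm (a n)"] show ?thesis
    by (simp add: h_def norm_mult norm_nat_powr mult_ac)
  next
   case False
   then have "n = 0 \<or> n = 1" by auto
   then show ?thesis by (auto simp: h_def)
  qed
  have "norm (suminf h) \<le> (\<Sum>n. (norm (a n) * real n powr (-2)) * (4 * 2 powr (-\<sigma>)))"
   by (intro norm_suminf_le hb summable_mult2 sm)
  also have "\<dots> = M * (4 * 2 powr (-\<sigma>))" unfolding M_def using sm by (simp add: suminf_mult2)
  finally show ?thesis using h by (simp add: sums_iff mult_ac)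
 qed
 then show ?thesis by blast
qed

text \<open>Supplies the normalisation at infinity that identifies the constant in
  \<open>dirichlet_eq_exp\<close>.\<close>

lemma dirichlet_tendsto:
 assumes "abs_conv a"
 shows "((\<lambda>\<sigma>. dirichlet a (of_real \<sigma>)) \<longlongrightarrow> a 1) at_top"
proof -
 obtain K where K: "\<forall>\<sigma>\<ge>2. norm (dirichlet a (of_real \<sigma>) - a 1) \<le> K * 2 powr (-\<sigma>)"
  using norm_dirichlet_diff_le[OF assms] by blast
 have "((\<lambda>\<sigma>::real. K * 2 powr (-\<sigma>)) \<longlongrightarrow> 0) at_top" by real_asymp
 then have "((\<lambda>\<sigma>. dirichlet a (of_real \<sigma>) - a 1) \<longlongrightarrow> 0) at_top"
  by (rule Lim_null_comparison[rotated]) (use K in \<open>auto intro: eventually_at_top_linorderI[of 2]\<close>)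
 then show ?thesis by (simp add: LIM_zero_iff)
qed

section \<open>Completely multiplicative functions\<close>

definition cmult :: "(nat \<Rightarrow> complex) \<Rightarrow> bool" where
 "cmult f \<longleftrightarrow> f 1 = 1 \<and> (\<forall>m n. f (m * n) = f m * f n) \<and> (\<forall>n. norm (f n) \<le> 1)"

lemma dchar_imp_cmult: "dchar q \<phi> \<Longrightarrow> q > 0 \<Longrightarrow> cmult \<phi>"
 unfolding cmult_def using dchar_1[of q \<phi>] dchar_mult[of q \<phi>] norm_dchar_le_1[of q \<phi>] by blast

lemma cmult_const_1: "cmult (\<lambda>_. 1)" by (simp add: cmult_def)

text \<open>Equal to \<open>1 / k\<close> at a prime power \<open>p ^ k\<close> with
  \<open>k > 0\<close> and to 0 elsewhere: the coefficients of the logarithm of the zeta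
  function.\<close>

definition \<Lambda>0 :: "nat \<Rightarrow> real" where "\<Lambda>0 n = mangoldt n / ln (real n)"

lemma \<Lambda>0_nonneg: "\<Lambda>0 n \<ge> 0"
 unfolding \<Lambda>0_def by (cases "n = 0") (auto intro!: divide_nonneg_nonneg mangoldt_nonneg)

lemma \<Lambda>0_le_1: "\<Lambda>0 n \<le> 1"
proof (cases "n \<ge> 2")
 case True
 then show ?thesis using mangoldt_le[of n] by (simp add: \<Lambda>0_def)
next
 case False
 then have "n = 0 \<or> n = 1" by auto
 then show ?thesis by (auto simp: \<Lambda>0_def)
qed

lemma \<Lambda>0_times_ln: "\<Lambda>0 n * ln (real n) = mangoldt n"
proof (cases "n \<ge> 2")
 case False
 then have "n = 0 \<or> n = 1" by auto
 then show ?thesis by (auto simp: \<Lambda>0_def)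
qed (simp add: \<Lambda>0_def)

context
 fixes f :: "nat \<Rightarrow> complex"
 assumes f: "cmult f"
begin

lemma cmult_1: "f 1 = 1" and cmult_mult: "f (m * n) = f m * f n" and cmult_norm: "norm (f n) \<le> 1"
 using f unfolding cmult_def by auto

lemma abs_conv_cmult_fun: "abs_conv f"
 by (rule abs_conv_bounded) (rule cmult_norm)

lemma abs_conv_mangoldt_times: "abs_conv (\<lambda>n. mangoldt n * f n)"
proof (rule abs_convI[OF _ abs_conv_ln[OF abs_conv_const[of 1]]])
 fix n :: nat assume n: "n > 0"
 have "\<bar>mangoldt n :: real\<bar> * norm (f n) \<le> ln (real n) * 1"
  using mangoldt_le[OF n] mangoldt_nonneg[of n] by (intro mult_mono cmult_norm) auto
 then show "norm (mangoldt n * f n) \<le> norm (1 * cln n)"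
  using n by (simp add: norm_mult)
qed

lemma abs_conv_\<Lambda>0_times: "abs_conv (\<lambda>n. of_real (\<Lambda>0 n) * f n)"
proof (rule abs_conv_bounded)
 fix n :: nat
 show "norm (of_real (\<Lambda>0 n) * f n) \<le> 1"
  using \<Lambda>0_nonneg[of n] \<Lambda>0_le_1[of n] cmult_norm[of n] by (simp add: norm_mult mult_le_one)
qed

text \<open>Complete multiplicativity takes \<open>f n\<close> out of the sum, and the von Mangoldt
  function sums to the logarithm over the divisors.\<close>

lemma conv_mangoldt:
 assumes "n > 0"
 shows "conv (\<lambda>n. mangoldt n * f n) f n = f n * cln n"
proof -
 have "conv (\<lambda>n. mangoldt n * f n) f n = (\<Sum>d | d dvd n. mangoldt d * f n)"
  unfolding conv_def
 proof (rule sum.cong[OF refl])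
  fix d assume "d \<in> {d. d dvd n}"
  then have "f n = f d * f (n div d)" using cmult_mult[of d "n div d"] by simp
  then show "mangoldt d * f d * f (n div d) = mangoldt d * f n" by simp
 qed
 also have "\<dots> = of_real (\<Sum>d | d dvd n. mangoldt d) * f n"
  by (simp add: sum_distrib_right)
 also have "(\<Sum>d | d dvd n. mangoldt d) = ln (real n)"
  using mangoldt_sum[of n, where ?'a = real] assms by simp
 finally show ?thesis by simp
qed

lemma dirichlet_ln_eq:
 assumes "Re s > 1"
 shows "dirichlet (\<lambda>n. f n * cln n) s = dirichlet (\<lambda>n. mangoldt n * f n) s * dirichlet f s"
proof -
 have ac: "abs_conv (conv (\<lambda>n. mangoldt n * f n) f)"
  by (rule abs_convI[OF _ abs_conv_ln[OF abs_conv_cmult_fun]]) (simp add: conv_mangoldt)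
 have "dirichlet (\<lambda>n. f n * cln n) s = dirichlet (conv (\<lambda>n. mangoldt n * f n) f) s"
  by (rule dirichlet_cong) (simp add: conv_mangoldt)
 also have "\<dots> = dirichlet (\<lambda>n. mangoldt n * f n) s * dirichlet f s"
  by (rule dirichlet_conv) (fact assms ac abs_conv_mangoldt_times abs_conv_cmult_fun)+
 finally show ?thesis .
qed

text \<open>Plays the part of the Euler product. With \<open>P\<close> the series in the exponent,
  \<open>dirichlet f * exp (- P)\<close> has derivative 0 by \<open>dirichlet_ln_eq\<close>, and it
  tends to 1 at infinity.\<close>

lemma dirichlet_eq_exp:
 assumes "Re s > 1"
 shows "dirichlet f s = exp (dirichlet (\<lambda>n. of_real (\<Lambda>0 n) * f n) s)"
proof -
 define P where "P = dirichlet (\<lambda>n. of_real (\<Lambda>0 n) * f n)"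
 define S where "S = {s. Re s > 1}"
 have cv: "convex S" "open S" unfolding S_def by (auto simp: convex_halfspace_Re_gt open_halfspace_Re_gt)
 have dP: "(P has_field_derivative - dirichlet (\<lambda>n. mangoldt n * f n) z) (at z)" if "z \<in> S" for z
 proof -
  have "(\<lambda>n. mangoldt n * f n) = (\<lambda>n. of_real (\<Lambda>0 n) * f n * cln n)"
  proof
   fix n
   have "mangoldt n = complex_of_real (\<Lambda>0 n * ln (real n))"
    unfolding \<Lambda>0_times_ln by simp
   then show "mangoldt n * f n = of_real (\<Lambda>0 n) * f n * cln n"
    by (simp add: mult_ac)
  qed
  then show ?thesis unfolding P_def
   using has_field_derivative_dirichlet[OF abs_conv_\<Lambda>0_times, of z] that by (simp add: S_def)
 qed
 have "((\<lambda>z. dirichlet f z * exp (- P z)) has_field_derivative 0) (at z within S)" if z: "z \<in> S" for z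
 proof -
  have z1: "Re z > 1" using z by (simp add: S_def)
  have "((\<lambda>z. exp (- P z)) has_field_derivative
    exp (- P z) * - (- dirichlet (\<lambda>n. mangoldt n * f n) z)) (at z)"
   by (rule DERIV_chain2[OF DERIV_exp DERIV_minus[OF dP[OF z]]])
  from DERIV_mult[OF has_field_derivative_dirichlet[OF abs_conv_cmult_fun z1] this]
  have "((\<lambda>z. dirichlet f z * exp (- P z)) has_field_derivative
    (- dirichlet (\<lambda>n. f n * cln n) z * exp (- P z)
     + exp (- P z) * - (- dirichlet (\<lambda>n. mangoldt n * f n) z) * dirichlet f z)) (at z)" .
  also have "(- dirichlet (\<lambda>n. f n * cln n) z * exp (- P z)
     + exp (- P z) * - (- dirichlet (\<lambda>n. mangoldt n * f n) z) * dirichlet f z) = 0"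
   using z by (simp add: dirichlet_ln_eq S_def)
  finally show ?thesis by (rule DERIV_subset) simp
 qed
 then obtain c where c: "\<And>z. z \<in> S \<Longrightarrow> dirichlet f z * exp (- P z) = c"
  using has_field_derivative_zero_constant[OF cv(1), of "\<lambda>z. dirichlet f z * exp (- P z)"] by metis
 have "((\<lambda>\<sigma>. dirichlet f (of_real \<sigma>) * exp (- P (of_real \<sigma>))) \<longlongrightarrow> f 1 * exp (- (of_real (\<Lambda>0 1) * f 1))) at_top"
  unfolding P_def by (intro tendsto_intros dirichlet_tendsto abs_conv_cmult_fun abs_conv_\<Lambda>0_times)
 then have "((\<lambda>\<sigma>. dirichlet f (of_real \<sigma>) * exp (- P (of_real \<sigma>))) \<longlongrightarrow> 1) at_top"
  by (simp add: cmult_1[unfolded One_nat_def] \<Lambda>0_def)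
 moreover have "eventually (\<lambda>\<sigma>. dirichlet f (of_real \<sigma>) * exp (- P (of_real \<sigma>)) = c) at_top"
  using eventually_gt_at_top[of "1::real"] by eventually_elim (rule c, simp add: S_def)
 ultimately have "((\<lambda>\<sigma>::real. c) \<longlongrightarrow> 1) at_top" by (rule Lim_transform_eventually)
 then have "c = 1" by (simp add: tendsto_const_iff)
 then have "dirichlet f s * exp (- P s) = 1" using c[of s] assms by (simp add: S_def)
 then have "dirichlet f s = exp (P s)" by (simp add: exp_minus field_simps)
 then show ?thesis unfolding P_def .
qed

lemma dirichlet_nonzero: "Re s > 1 \<Longrightarrow> dirichlet f s \<noteq> 0"
 by (simp add: dirichlet_eq_exp)

lemma dirichlet_mangoldt_eq:
 assumes "Re s > 1"
 shows "dirichlet (\<lambda>n. mangoldt n * f n) s = - (deriv (dirichlet f) s / dirichlet f s)"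
proof -
 have "deriv (dirichlet f) s = - dirichlet (\<lambda>n. f n * cln n) s"
  by (rule DERIV_imp_deriv[OF has_field_derivative_dirichlet[OF abs_conv_cmult_fun assms]])
 then show ?thesis using dirichlet_ln_eq[OF assms] dirichlet_nonzero[OF assms] by simp
qed

end

text \<open>The logarithm of the right-hand side is a series whose terms are nonnegative multiples
  of the trigonometric expression in \<open>nonneg\<close>. \<open>f\<close> and \<open>g\<close>
  are kept separate, so that \<open>g\<close> can be the square of a character or, for a real
  character, the constant 1.\<close>

lemma three_four_one:
 fixes f g :: "nat \<Rightarrow> complex"
 assumes f: "cmult f" and g: "cmult g" and \<sigma>: "\<sigma> > 1"
  and nonneg: "\<And>n u. n > 0 \<Longrightarrow> norm u = 1 \<Longrightarrow> 0 \<le> 3 + 4 * Re (f n * u) + Re (g n * u ^ 2)"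
 shows "1 \<le> norm (dirichlet (\<lambda>_. 1) (of_real \<sigma>)) ^ 3 * norm (dirichlet f (Complex \<sigma> t)) ^ 4 *
       norm (dirichlet g (Complex \<sigma> (2 * t)))"
proof -
 define h where "h = (\<lambda>_::nat. 1::complex)"
 have h: "cmult h" by (simp add: h_def cmult_def)
 define p where "p a s n = complex_of_real (\<Lambda>0 n) * a n * of_nat n powr (-s)" for a s n
 have sms: "(\<lambda>n. p a s n) sums dirichlet (\<lambda>n. of_real (\<Lambda>0 n) * a n) s" if "cmult a" "Re s > 1" for a s
  unfolding p_def by (rule sums_dirichlet[OF abs_conv_\<Lambda>0_times[OF that(1)] that(2)])
 define E where "E = 3 * Re (dirichlet (\<lambda>n. of_real (\<Lambda>0 n) * h n) (of_real \<sigma>))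
   + 4 * Re (dirichlet (\<lambda>n. of_real (\<Lambda>0 n) * f n) (Complex \<sigma> t))
   + Re (dirichlet (\<lambda>n. of_real (\<Lambda>0 n) * g n) (Complex \<sigma> (2 * t)))"
 define F where "F n = 3 * Re (p h (of_real \<sigma>) n) + 4 * Re (p f (Complex \<sigma> t) n) + Re (p g (Complex \<sigma> (2*t)) n)" for n
 have r: "Re (complex_of_real \<sigma>) > 1" "Re (Complex \<sigma> t) > 1" "Re (Complex \<sigma> (2 * t)) > 1" using \<sigma> by simp_all
 have S: "F sums E"
  unfolding E_def F_def
  by (rule sums_add[OF sums_add[OF sums_mult[OF sums_Re[OF sms[OF h r(1)]], of 3]
     sums_mult[OF sums_Re[OF sms[OF f r(2)]], of 4]] sums_Re[OF sms[OF g r(3)]]])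
 have nn: "0 \<le> F n" for n
 proof (cases "n = 0")
  case False
  \<comment> \<open>The twist \<open>n\<close> to the power \<open>- i t\<close>: the factors at
    heights \<open>t\<close> and \<open>2 t\<close> are \<open>u\<close> and
    \<open>u ^ 2\<close>.\<close>
  define u where "u = (of_nat n :: complex) powr (- Complex 0 t)"
  have u: "norm u = 1" using False by (simp add: u_def norm_nat_powr)
  have r: "(of_nat n :: complex) powr (- of_real \<sigma>) = of_real (real n powr (-\<sigma>))"
   using powr_of_real[of "real n" "-\<sigma>"] by simp
  have e1: "(of_nat n :: complex) powr (- Complex \<sigma> t) = of_real (real n powr (-\<sigma>)) * u"
  proof -
   have "- Complex \<sigma> t = - of_real \<sigma> + - Complex 0 t" by (simp add: complex_eq_iff)
   then show ?thesis unfolding u_def r[symmetric] by (simp only: powr_add)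
  qed
  have e2: "(of_nat n :: complex) powr (- Complex \<sigma> (2 * t)) = of_real (real n powr (-\<sigma>)) * u ^ 2"
  proof -
   have "- Complex \<sigma> (2 * t) = - of_real \<sigma> + (- Complex 0 t + - Complex 0 t)" by (simp add: complex_eq_iff)
   then show ?thesis unfolding u_def r[symmetric] power2_eq_square by (simp only: powr_add)
  qed
  have "F n
    = \<Lambda>0 n * real n powr (-\<sigma>) * (3 + 4 * Re (f n * u) + Re (g n * u ^ 2))"
   unfolding F_def p_def e1 e2 r h_def by (simp add: algebra_simps)
  also have "\<dots> \<ge> 0"
   using nonneg[of n u] False u \<Lambda>0_nonneg[of n] by (intro mult_nonneg_nonneg) auto
  finally show ?thesis .
 qed (simp add: p_def F_def)
 have "E \<ge> 0" using sums_le[of "\<lambda>_. 0" F 0 E] nn S by auto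
 have n: "norm (dirichlet a s) = exp (Re (dirichlet (\<lambda>n. of_real (\<Lambda>0 n) * a n) s))"
  if "cmult a" "Re s > 1" for a s
  unfolding dirichlet_eq_exp[OF that] by (rule norm_exp_eq_Re)
 have e3: "exp (3 * x) = exp x ^ 3" and e4: "exp (4 * x) = exp x ^ 4" for x :: real
  by (rule exp_of_nat_mult[of 3 x, unfolded of_nat_numeral], rule exp_of_nat_mult[of 4 x, unfolded of_nat_numeral])
 have "1 \<le> exp E" using \<open>E \<ge> 0\<close> by simp
 also have "exp E = norm (dirichlet h (of_real \<sigma>)) ^ 3 * norm (dirichlet f (Complex \<sigma> t)) ^ 4 * norm (dirichlet g (Complex \<sigma> (2 * t)))"
  unfolding n[OF h r(1)] n[OF f r(2)] n[OF g r(3)] E_def exp_add e3 e4 ..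
 finally show ?thesis unfolding h_def .
qed

section \<open>Continuation to the right half plane\<close>

lemma powr_neg_diff_bound:
 fixes x y :: real and s :: complex
 assumes "1 \<le> x" "x \<le> y" "y \<le> x + 1" "Re s \<ge> -1"
 shows "norm (complex_of_real x powr (-s) - complex_of_real y powr (-s)) \<le> norm s * x powr (- Re s - 1)"
proof -
 let ?S = "closed_segment (complex_of_real x) (complex_of_real y)"
 have seg: "\<exists>u. z = complex_of_real u \<and> x \<le> u \<and> u \<le> y" if "z \<in> ?S" for z
  using that assms closed_segment_of_real[of x y, where ?'a = complex]
  by (auto simp: closed_segment_eq_real_ivl)
 have "norm (complex_of_real x powr (-s) - complex_of_real y powr (-s))
   \<le> (norm s * x powr (- Re s - 1)) * norm (complex_of_real x - complex_of_real y)"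
 proof (rule field_differentiable_bound[where S = ?S and f' = "\<lambda>z. - s * z powr (- s - 1)"])
  fix z assume "z \<in> ?S"
  then obtain u where u: "z = complex_of_real u" "x \<le> u" "u \<le> y" using seg by blast
  show "((\<lambda>z. z powr - s) has_field_derivative - s * z powr (- s - 1)) (at z within ?S)"
   using u assms by (intro DERIV_subset[OF has_field_derivative_powr]) auto
  have "norm (z powr (- s - 1)) = u powr (- Re s - 1)"
   using u assms by (subst norm_powr_real_powr) auto
  also have "\<dots> \<le> x powr (- Re s - 1)" using u assms by (intro powr_mono2') auto
  finally show "norm (- s * z powr (- s - 1)) \<le> norm s * x powr (- Re s - 1)"
   by (simp add: norm_mult mult_left_mono)
 qed auto
 also have "norm (complex_of_real x - complex_of_real y) = y - x"
  using assms by (simp flip: of_real_diff)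
 also have "(norm s * x powr (- Re s - 1)) * (y - x) \<le> (norm s * x powr (- Re s - 1)) * 1"
  using assms by (intro mult_left_mono) auto
 finally show ?thesis by simp
qed

text \<open>This is the error of replacing \<open>x powr (-s)\<close> by its mean over
  \<open>[x, x + 1]\<close>, multiplied by \<open>s - 1\<close> to avoid the pole. The auxiliary
  \<open>f\<close> is chosen so that its derivative is a first difference, to which
  \<open>powr_neg_diff_bound\<close> applies.\<close>

lemma powr_second_diff_bound:
 fixes x :: real and s :: complex
 assumes x: "1 \<le> x" and s: "Re s \<ge> -1"
 shows "norm ((s - 1) * complex_of_real x powr (-s) - complex_of_real x powr (1 - s)
      + complex_of_real (x + 1) powr (1 - s)) \<le> norm s * norm (s - 1) * x powr (- Re s - 1)"
proof -
 let ?S = "closed_segment (complex_of_real x) (complex_of_real (x + 1))"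
 define f where "f z = z powr (1 - s) + (s - 1) * complex_of_real x powr (-s) * z" for z
 have seg: "\<exists>u. z = complex_of_real u \<and> x \<le> u \<and> u \<le> x + 1" if "z \<in> ?S" for z
  using that assms closed_segment_of_real[of x "x + 1", where ?'a = complex]
  by (auto simp: closed_segment_eq_real_ivl)
 have "norm (f (complex_of_real (x + 1)) - f (complex_of_real x))
   \<le> (norm (s - 1) * (norm s * x powr (- Re s - 1))) * norm (complex_of_real (x + 1) - complex_of_real x)"
 proof (rule field_differentiable_bound[where S = ?S
    and f' = "\<lambda>z. (s - 1) * (complex_of_real x powr (-s) - z powr (-s))"])
  fix z assume "z \<in> ?S"
  then obtain u where u: "z = complex_of_real u" "x \<le> u" "u \<le> x + 1" using seg by blast
  have zn: "z \<notin> \<real>\<^sub>\<le>\<^sub>0" using u x by auto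
  from has_field_derivative_powr[OF zn, of "1 - s"] zn
  have "(f has_field_derivative ((1 - s) * z powr (- s) + (s - 1) * complex_of_real x powr (-s))) (at z)"
   unfolding f_def by (auto intro!: derivative_eq_intros)
  then show "(f has_field_derivative (s - 1) * (complex_of_real x powr (-s) - z powr (-s))) (at z within ?S)"
   by (intro DERIV_subset[where t = ?S and s = UNIV]) (simp_all add: algebra_simps)
  show "norm ((s - 1) * (complex_of_real x powr (-s) - z powr (-s))) \<le> norm (s - 1) * (norm s * x powr (- Re s - 1))"
   unfolding norm_mult u(1) by (intro mult_left_mono powr_neg_diff_bound x u s) auto
 qed auto
 also have "norm (complex_of_real (x + 1) - complex_of_real x) = 1" by simp
 also have "f (complex_of_real (x + 1)) - f (complex_of_real x) =
   (s - 1) * complex_of_real x powr (-s) - complex_of_real x powr (1 - s) + complex_of_real (x + 1) powr (1 - s)"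
  by (simp add: f_def algebra_simps)
 finally show ?thesis by (simp add: mult_ac)
qed

lemma tail_term_le:
 fixes \<sigma> :: real
 assumes "\<sigma> > 0" "n \<ge> 1"
 shows "real (Suc n) powr (-\<sigma> - 1) \<le> (real n powr (-\<sigma>) - real (Suc n) powr (-\<sigma>)) / \<sigma>"
proof -
 have "\<exists>z. real n < z \<and> z < real (Suc n) \<and>
   real (Suc n) powr (-\<sigma>) - real n powr (-\<sigma>) = (real (Suc n) - real n) * (- \<sigma> * z powr (-\<sigma> - 1))"
  using assms by (intro MVT2) (auto intro!: derivative_eq_intros)
 then obtain z where z: "real n < z" "z < real (Suc n)"
  "real n powr (-\<sigma>) - real (Suc n) powr (-\<sigma>) = \<sigma> * z powr (-\<sigma> - 1)" by (auto simp: algebra_simps)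
 have "real (Suc n) powr (-\<sigma> - 1) \<le> z powr (-\<sigma> - 1)" using z assms by (intro powr_mono2') auto
 then show ?thesis using z(3) assms by (simp add: field_simps)
qed

text \<open>By \<open>tail_term_le\<close> the terms are dominated by differences of
  \<open>n powr (-\<sigma>) / \<sigma>\<close>, which telescope.\<close>

lemma tail_sum:
 fixes \<sigma> :: real
 assumes s: "\<sigma> > 0" and M: "M \<ge> 1"
 shows "summable (\<lambda>n. real (Suc (n + M)) powr (-\<sigma> - 1))"
  and "(\<Sum>n. real (Suc (n + M)) powr (-\<sigma> - 1)) \<le> real M powr (-\<sigma>) / \<sigma>"
proof -
 define g where "g n = - (real (n + M) powr (-\<sigma>)) / \<sigma>" for n
 have "(\<lambda>n. - (real (n + M) powr (-\<sigma>)) / \<sigma>) \<longlonglongrightarrow> 0" using s by real_asymp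
 then have "g \<longlonglongrightarrow> 0" by (simp add: g_def[abs_def])
 then have g: "(\<lambda>n. g (Suc n) - g n) sums (0 - g 0)" by (rule telescope_sums)
 have le: "real (Suc (n + M)) powr (-\<sigma> - 1) \<le> g (Suc n) - g n" for n
  using tail_term_le[OF s, of "n + M"] M by (simp add: g_def diff_divide_distrib)
 show sm: "summable (\<lambda>n. real (Suc (n + M)) powr (-\<sigma> - 1))"
  by (rule summable_comparison_test'[OF sums_summable[OF g], of 0]) (use le in simp)
 show "(\<Sum>n. real (Suc (n + M)) powr (-\<sigma> - 1)) \<le> real M powr (-\<sigma>) / \<sigma>"
  using suminf_le[OF le sm sums_summable[OF g]] sums_unique[OF g] by (simp add: g_def)
qed

lemma summable_Suc_powr: "\<sigma> > 0 \<Longrightarrow> summable (\<lambda>n. real (Suc n) powr (-\<sigma> - 1))"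
 for \<sigma> :: real
 using tail_sum(1)[of \<sigma> 1] by (subst summable_Suc_iff[symmetric]) simp

text \<open>Around \<open>x\<close> the disc of radius \<open>d = Re x / 2\<close> stays in
  \<open>Re y \<ge> d\<close>, where the exponent \<open>- d - 1\<close> dominates every term;
  \<open>B\<close> makes the factor \<open>C\<close> locally bounded.\<close>

lemma holomorphic_series_half_plane:
 fixes f :: "nat \<Rightarrow> complex \<Rightarrow> complex"
 assumes hol: "\<And>n. f n holomorphic_on UNIV"
  and bd: "\<And>n s. Re s > 0 \<Longrightarrow> norm (f n s) \<le> C s * real (Suc n) powr (- Re s - 1)"
  and C: "\<And>s r. norm s \<le> r \<Longrightarrow> C s \<le> B r"
 shows "(\<lambda>s. \<Sum>n. f n s) holomorphic_on {s. Re s > 0}"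
proof -
 define S where "S = {s::complex. Re s > 0}"
 have S: "open S" unfolding S_def by (rule open_halfspace_Re_gt)
 have A: "f n field_differentiable (at x)" for n x
  using hol holomorphic_on_imp_differentiable_at by blast
 have B: "\<exists>d h. 0 < d \<and> summable (h::nat \<Rightarrow> complex) \<and> range h \<subseteq> \<real>\<^sub>\<ge>\<^sub>0 \<and>
    (\<forall>\<^sub>F n in sequentially. \<forall>y\<in>ball x d \<inter> S. norm (f n y) \<le> norm (h n))" if x: "x \<in> S" for x
 proof -
  define d where "d = Re x / 2"
  have d: "d > 0" using x by (simp add: d_def S_def)
  define h where "h n = complex_of_real (max 0 (B (norm x + d)) * real (Suc n) powr (- d - 1))" for n
  have "summable h" unfolding h_def
   by (intro summable_of_real summable_mult summable_Suc_powr d)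
  moreover have "range h \<subseteq> \<real>\<^sub>\<ge>\<^sub>0" by (auto simp: h_def)
  moreover have "norm (f n y) \<le> norm (h n)" if y: "y \<in> ball x d \<inter> S" for n y
  proof -
   have yx: "norm (y - x) < d" using y by (simp add: dist_norm norm_minus_commute)
   have "Re x - Re y \<le> norm (y - x)" by (metis abs_Re_le_cmod abs_le_D2 minus_complex.sel(1) minus_diff_eq uminus_complex.sel(1))
   then have Rey: "Re y \<ge> d" using yx by (simp add: d_def)
   have ny: "norm y \<le> norm x + d" using yx norm_triangle_ineq[of x "y - x"] by simp
   have "norm (f n y) \<le> C y * real (Suc n) powr (- Re y - 1)" using bd Rey d by auto
   also have "\<dots> \<le> max 0 (B (norm x + d)) * real (Suc n) powr (- d - 1)"
    using C[OF ny] Rey by (intro mult_mono powr_mono) auto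
   also have "\<dots> = norm (h n)" unfolding h_def norm_of_real by (rule abs_of_nonneg[symmetric]) auto
   finally show ?thesis .
  qed
  ultimately show ?thesis using d by (intro exI[of _ d] exI[of _ h]) auto
 qed
 obtain g where "\<forall>x\<in>S. ((\<lambda>n. f n x) sums g x) \<and> g field_differentiable (at x)"
  using series_differentiable_comparison_complex[OF S A B] by metis
 then have g: "\<And>x. x \<in> S \<Longrightarrow> (\<lambda>n. f n x) sums g x" "\<And>x. x \<in> S \<Longrightarrow> g field_differentiable (at x)"
  by auto
 have "g holomorphic_on S" using g(2) by (auto simp: holomorphic_on_def intro: field_differentiable_at_within)
 then show ?thesis unfolding S_def[symmetric]
  by (rule holomorphic_transform) (use g(1) in \<open>simp add: sums_iff\<close>)
qed

text \<open>\<open>Lfun f\<close> is the Dirichlet series of \<open>f\<close> summed by parts, and \<open>zeta1 s\<close> is \<open>(s - 1) \<zeta>(s)\<close>; these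
 expressions still converge for \<open>Re s > 0\<close>.\<close>

definition Lfun :: "(nat \<Rightarrow> complex) \<Rightarrow> complex \<Rightarrow> complex" where
 "Lfun f s = (\<Sum>n. (\<Sum>m\<le>Suc n. f m) * (of_nat (Suc n) powr (-s) - of_nat (Suc (Suc n)) powr (-s)))"

definition zeta1 :: "complex \<Rightarrow> complex" where
 "zeta1 s = 1 + (\<Sum>n. (s - 1) * of_nat (Suc n) powr (-s) - of_nat (Suc n) powr (1 - s) + of_nat (Suc (Suc n)) powr (1 - s))"

text \<open>All that the analytic estimates use of a nonprincipal character modulo \<open>q\<close>.
  With \<open>f 0 = 0\<close> the partial sums may start at 0 although the Dirichlet series
  effectively starts at 1.\<close>

definition bounded_sums :: "real \<Rightarrow> (nat \<Rightarrow> complex) \<Rightarrow> bool" where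
 "bounded_sums q f \<longleftrightarrow> cmult f \<and> f 0 = 0 \<and> (\<forall>n. norm (\<Sum>m\<le>n. f m) \<le> q)"

lemma dchar_bounded_sums:
 assumes d: "dchar q \<phi>" and q: "q > 0" and np: "\<phi> \<noteq> principal q"
 shows "bounded_sums (real q) \<phi>"
proof -
 obtain a where a: "coprime a q" "\<phi> a \<noteq> 1" using nonprincipal_witness[OF d q np] .
 have "q \<noteq> 1"
 proof
  assume "q = 1"
  then have "[a = 1] (mod q)" by (simp add: cong_def)
  then have "\<phi> a = 1" using dchar_cong[OF d q] dchar_1[OF d q] by metis
  then show False using a by simp
 qed
 then have "\<phi> 0 = 0" using dchar_eq_0_iff[OF d q, of 0] by simp
 moreover have "norm (\<Sum>m\<le>n. \<phi> m) \<le> real q" for n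
  using norm_sum_dchar_le[OF d q a, of "Suc n"] by (simp add: lessThan_Suc_atMost)
 ultimately show ?thesis using dchar_imp_cmult[OF d q] by (simp add: bounded_sums_def)
qed

lemma Lfun_term_bound:
 assumes "bounded_sums q f" "Re s > 0"
 shows "norm ((\<Sum>m\<le>Suc n. f m) * (of_nat (Suc n) powr (-s) - of_nat (Suc (Suc n)) powr (-s)))
   \<le> q * norm s * real (Suc n) powr (- Re s - 1)"
proof -
 have 1: "norm (\<Sum>m\<le>Suc n. f m) \<le> q" using assms(1) unfolding bounded_sums_def by blast
 have 2: "norm (of_nat (Suc n) powr (-s) - of_nat (Suc (Suc n)) powr (-s)) \<le> norm s * real (Suc n) powr (- Re s - 1)"
  using powr_neg_diff_bound[of "real (Suc n)" "real (Suc (Suc n))" s] assms by simp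
 have "0 \<le> q" using 1 norm_ge_zero order_trans by blast
 then have "norm (\<Sum>m\<le>Suc n. f m) * norm (of_nat (Suc n) powr (-s) - of_nat (Suc (Suc n)) powr (-s))
   \<le> q * (norm s * real (Suc n) powr (- Re s - 1))" by (intro mult_mono 1 2) auto
 then show ?thesis by (simp only: norm_mult mult.assoc)
qed

lemma holomorphic_Lfun:
 assumes "bounded_sums q f"
 shows "Lfun f holomorphic_on {s. Re s > 0}"
proof -
 have q: "0 \<le> q" using assms norm_ge_zero order_trans unfolding bounded_sums_def by blast
 show ?thesis unfolding Lfun_def[abs_def]
 proof (rule holomorphic_series_half_plane[where C = "\<lambda>s. q * norm s" and B = "\<lambda>r. q * r"])
  show "norm ((\<Sum>m\<le>Suc n. f m) * (of_nat (Suc n) powr (-s) - of_nat (Suc (Suc n)) powr (-s)))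
   \<le> q * norm s * real (Suc n) powr (- Re s - 1)" if "Re s > 0" for n s
   by (rule Lfun_term_bound[OF assms that])
  show "(\<lambda>s. (\<Sum>m\<le>Suc n. f m) * (of_nat (Suc n) powr (-s) - of_nat (Suc (Suc n)) powr (-s))) holomorphic_on UNIV" for n
   by (intro holomorphic_intros) (simp_all del: of_nat_Suc)
 qed (use q in \<open>simp add: mult_left_mono\<close>)
qed

lemma zeta1_term_bound:
 assumes "Re s > 0"
 shows "norm ((s - 1) * of_nat (Suc n) powr (-s) - of_nat (Suc n) powr (1 - s) + of_nat (Suc (Suc n)) powr (1 - s))
   \<le> norm s * norm (s - 1) * real (Suc n) powr (- Re s - 1)"
 using powr_second_diff_bound[of "real (Suc n)" s] assms by (simp add: add_ac)

lemma holomorphic_zeta1: "zeta1 holomorphic_on {s. Re s > 0}"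
 unfolding zeta1_def[abs_def]
proof (intro holomorphic_intros holomorphic_series_half_plane[where C = "\<lambda>s. norm s * norm (s - 1)" and B = "\<lambda>r. \<bar>r\<bar> * (\<bar>r\<bar> + 1)"])
 show "norm ((s - 1) * of_nat (Suc n) powr (-s) - of_nat (Suc n) powr (1 - s) + of_nat (Suc (Suc n)) powr (1 - s))
   \<le> norm s * norm (s - 1) * real (Suc n) powr (- Re s - 1)" if "Re s > 0" for n s
  by (rule zeta1_term_bound[OF that])
 show "norm s * norm (s - 1) \<le> \<bar>r\<bar> * (\<bar>r\<bar> + 1)" if "norm s \<le> r" for s :: complex and r
  using that norm_triangle_ineq4[of s 1] by (intro mult_mono) auto
qed

lemma Lfun_partial:
 assumes "f 0 = 0"
 shows "(\<Sum>n<M. (\<Sum>m\<le>Suc n. f m) * (of_nat (Suc n) powr (-s) - of_nat (Suc (Suc n)) powr (-s)))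
  = (\<Sum>n=1..M. f n * of_nat n powr (-s)) - (\<Sum>m\<le>M. f m) * of_nat (Suc M) powr (-s)"
proof (induction M)
 case (Suc M)
 then show ?case by (simp add: algebra_simps del: of_nat_Suc)
qed (use assms in simp)

lemma zeta1_partial:
 "1 + (\<Sum>n<M. (s - 1) * of_nat (Suc n) powr (-s) - of_nat (Suc n) powr (1 - s) + of_nat (Suc (Suc n)) powr (1 - s))
  = (s - 1) * (\<Sum>n=1..M. of_nat n powr (-s)) + of_nat (Suc M) powr (1 - s)"
proof (induction M)
 case (Suc M)
 then show ?case by (simp add: algebra_simps del: of_nat_Suc)
qed simp

lemma sums_split_tail_bound:
 fixes f :: "nat \<Rightarrow> complex"
 assumes bd: "\<And>n. norm (f n) \<le> c * real (Suc n) powr (-\<sigma> - 1)" and s: "\<sigma> > 0" and M: "M \<ge> 1" and c: "c \<ge> 0"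
 shows "summable f" "norm ((\<Sum>n. f n) - (\<Sum>n<M. f n)) \<le> c * (real M powr (-\<sigma>) / \<sigma>)"
proof -
 show sm: "summable f"
  by (rule summable_comparison_test'[OF summable_mult[OF summable_Suc_powr[OF s]], of 0 f c]) (rule bd)
 have "(\<Sum>n. f n) - (\<Sum>n<M. f n) = (\<Sum>n. f (n + M))" using suminf_split_initial_segment[OF sm, of M] by simp
 also have "norm \<dots> \<le> (\<Sum>n. c * real (Suc (n + M)) powr (-\<sigma> - 1))"
  by (rule norm_suminf_le[OF bd summable_mult[OF tail_sum(1)[OF s M]]])
 also have "\<dots> = c * (\<Sum>n. real (Suc (n + M)) powr (-\<sigma> - 1))"
  by (rule suminf_mult[OF tail_sum(1)[OF s M]])
 also have "\<dots> \<le> c * (real M powr (-\<sigma>) / \<sigma>)" by (intro mult_left_mono tail_sum(2) s M c)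
 finally show "norm ((\<Sum>n. f n) - (\<Sum>n<M. f n)) \<le> c * (real M powr (-\<sigma>) / \<sigma>)" .
qed

lemma norm_sum_powr_le:
 assumes "\<And>n. norm (f n) \<le> (1::real)"
 shows "norm (\<Sum>n=1..M. f n * (of_nat n :: complex) powr (-s)) \<le> (\<Sum>n=1..M. real n powr (- Re s))"
proof (rule sum_norm_le)
 fix n
 show "norm (f n * (of_nat n :: complex) powr (-s)) \<le> real n powr (- Re s)"
  using mult_right_mono[OF assms[of n], of "real n powr (- Re s)"] by (simp add: norm_mult norm_nat_powr)
qed

text \<open>The first \<open>M\<close> terms of the Dirichlet series are estimated trivially, the
  rest through the summed-by-parts form. \<open>M\<close> is free: about \<open>q (|t| + 2)\<close>
  in the growth bound, and 1 on the disc of Estermann's argument.\<close>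

lemma norm_Lfun_le:
 assumes f: "bounded_sums q f" and s: "Re s > 0" and M: "M \<ge> 1"
 shows "norm (Lfun f s) \<le> (\<Sum>n=1..M. real n powr (- Re s)) + q * real (Suc M) powr (- Re s)
      + q * norm s * (real M powr (- Re s) / Re s)"
proof -
 have q: "0 \<le> q" using f norm_ge_zero order_trans unfolding bounded_sums_def by blast
 define g where "g n = (\<Sum>m\<le>Suc n. f m) * (of_nat (Suc n) powr (-s) - of_nat (Suc (Suc n)) powr (-s))" for n
 have L: "Lfun f s = (\<Sum>n. g n)" by (simp add: Lfun_def g_def)
 have 1: "norm ((\<Sum>n. g n) - (\<Sum>n<M. g n)) \<le> q * norm s * (real M powr (- Re s) / Re s)"
  by (rule sums_split_tail_bound(2)) (use Lfun_term_bound[OF f s] q s M in \<open>auto simp: g_def simp del: of_nat_Suc\<close>)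
 have 2: "(\<Sum>n<M. g n) = (\<Sum>n=1..M. f n * of_nat n powr (-s)) - (\<Sum>m\<le>M. f m) * of_nat (Suc M) powr (-s)"
  unfolding g_def using f by (intro Lfun_partial) (simp add: bounded_sums_def)
 have 3: "norm (\<Sum>n=1..M. f n * of_nat n powr (-s)) \<le> (\<Sum>n=1..M. real n powr (- Re s))"
  using f by (intro norm_sum_powr_le) (simp add: bounded_sums_def cmult_def)
 have 4: "norm ((\<Sum>m\<le>M. f m) * of_nat (Suc M) powr (-s)) \<le> q * real (Suc M) powr (- Re s)"
  unfolding norm_mult norm_nat_powr uminus_complex.sel using f by (intro mult_right_mono) (auto simp: bounded_sums_def)
 have "norm (\<Sum>n<M. g n) \<le> (\<Sum>n=1..M. real n powr (- Re s)) + q * real (Suc M) powr (- Re s)"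
  unfolding 2 by (rule order_trans[OF norm_triangle_ineq4 add_mono[OF 3 4]])
 then show ?thesis using 1 norm_triangle_ineq[of "(\<Sum>n. g n) - (\<Sum>n<M. g n)" "\<Sum>n<M. g n"] unfolding L by simp
qed

lemma norm_zeta1_le:
 assumes s: "Re s > 0" and M: "M \<ge> 1"
 shows "norm (zeta1 s) \<le> norm (s - 1) * (\<Sum>n=1..M. real n powr (- Re s)) + real (Suc M) powr (1 - Re s)
      + norm s * norm (s - 1) * (real M powr (- Re s) / Re s)"
proof -
 define g where "g n = (s - 1) * of_nat (Suc n) powr (-s) - of_nat (Suc n) powr (1 - s) + of_nat (Suc (Suc n)) powr (1 - s)" for n
 have L: "zeta1 s = 1 + (\<Sum>n. g n)" by (simp add: zeta1_def g_def)
 have 1: "norm ((\<Sum>n. g n) - (\<Sum>n<M. g n)) \<le> norm s * norm (s - 1) * (real M powr (- Re s) / Re s)"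
  by (rule sums_split_tail_bound(2)) (use zeta1_term_bound[OF s] s M in \<open>auto simp: g_def simp del: of_nat_Suc\<close>)
 have 2: "1 + (\<Sum>n<M. g n) = (s - 1) * (\<Sum>n=1..M. of_nat n powr (-s)) + of_nat (Suc M) powr (1 - s)"
  unfolding g_def by (rule zeta1_partial)
 have 3: "norm (\<Sum>n=1..M. (of_nat n :: complex) powr (-s)) \<le> (\<Sum>n=1..M. real n powr (- Re s))"
  using norm_sum_powr_le[of "\<lambda>_. 1" s M] by simp
 have 4: "norm ((of_nat (Suc M) :: complex) powr (1 - s)) = real (Suc M) powr (1 - Re s)"
  unfolding norm_nat_powr by simp
 have "norm (1 + (\<Sum>n<M. g n)) \<le> norm ((s - 1) * (\<Sum>n=1..M. (of_nat n :: complex) powr (-s))) + norm ((of_nat (Suc M) :: complex) powr (1 - s))"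
  unfolding 2 by (rule norm_triangle_ineq)
 also have "\<dots> \<le> norm (s - 1) * (\<Sum>n=1..M. real n powr (- Re s)) + real (Suc M) powr (1 - Re s)"
  unfolding 4 norm_mult by (intro add_mono mult_left_mono 3) auto
 finally show ?thesis
  using 1 norm_triangle_ineq[of "(\<Sum>n. g n) - (\<Sum>n<M. g n)" "1 + (\<Sum>n<M. g n)"] unfolding L by (simp add: algebra_simps)
qed

lemma tendsto_powr_neg_complex:
 assumes "Re s > 0"
 shows "(\<lambda>M. (of_nat (Suc M) :: complex) powr (-s)) \<longlonglongrightarrow> 0"
proof (rule tendsto_norm_zero_cancel)
 have "(\<lambda>M. real (Suc M) powr (- Re s)) \<longlonglongrightarrow> 0" using assms by real_asymp
 then show "(\<lambda>M. norm ((of_nat (Suc M) :: complex) powr (-s))) \<longlonglongrightarrow> 0"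
  by (simp add: norm_nat_powr del: of_nat_Suc)
qed

lemma dirichlet_partial_tendsto:
 assumes "abs_conv f" "Re s > 1"
 shows "(\<lambda>M. \<Sum>n=1..M. f n * of_nat n powr (-s)) \<longlonglongrightarrow> dirichlet f s"
proof -
 have "(\<lambda>M. \<Sum>n<Suc M. f n * of_nat n powr (-s)) \<longlonglongrightarrow> dirichlet f s"
  using sums_dirichlet[OF assms] LIMSEQ_Suc unfolding sums_def by blast
 moreover have "(\<Sum>n<Suc M. f n * of_nat n powr (-s)) = (\<Sum>n=1..M. f n * of_nat n powr (-s))" for M
  by (rule sum.mono_neutral_right) (auto simp: Suc_le_eq)
 ultimately show ?thesis by simp
qed

lemma Lfun_eq_dirichlet:
 assumes f: "bounded_sums q f" and s: "Re s > 1"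
 shows "Lfun f s = dirichlet f s"
proof -
 define g where "g n = (\<Sum>m\<le>Suc n. f m) * (of_nat (Suc n) powr (-s) - of_nat (Suc (Suc n)) powr (-s))" for n
 have s0: "Re s > 0" using s by simp
 have q: "0 \<le> q" using f norm_ge_zero order_trans unfolding bounded_sums_def by blast
 have "summable g"
  by (rule sums_split_tail_bound(1)[where c = "q * norm s" and \<sigma> = "Re s" and M = 1]) (use Lfun_term_bound[OF f s0] q s in \<open>auto simp: g_def simp del: of_nat_Suc\<close>)
 then have "(\<lambda>M. \<Sum>n<M. g n) \<longlonglongrightarrow> (\<Sum>n. g n)" by (rule summable_LIMSEQ)
 then have 1: "(\<lambda>M. \<Sum>n<M. g n) \<longlonglongrightarrow> Lfun f s" by (simp add: Lfun_def g_def)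
 have f0: "f 0 = 0" and fc: "cmult f" using f unfolding bounded_sums_def by blast+
 have "(\<lambda>M. (\<Sum>m\<le>M. f m) * of_nat (Suc M) powr (-s)) \<longlonglongrightarrow> 0"
 proof (rule Lim_null_comparison)
  show "eventually (\<lambda>M. norm ((\<Sum>m\<le>M. f m) * of_nat (Suc M) powr (-s)) \<le> q * real (Suc M) powr (- Re s)) sequentially"
   unfolding norm_mult norm_nat_powr uminus_complex.sel
   using f by (intro always_eventually allI mult_right_mono) (auto simp: bounded_sums_def)
  show "(\<lambda>M. q * real (Suc M) powr (- Re s)) \<longlonglongrightarrow> 0" using s0 by real_asymp
 qed
 then have "(\<lambda>M. (\<Sum>n=1..M. f n * of_nat n powr (-s)) - (\<Sum>m\<le>M. f m) * of_nat (Suc M) powr (-s)) \<longlonglongrightarrow> dirichlet f s - 0"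
  by (intro tendsto_diff dirichlet_partial_tendsto abs_conv_cmult_fun fc s)
 then have "(\<lambda>M. \<Sum>n<M. g n) \<longlonglongrightarrow> dirichlet f s"
  unfolding g_def Lfun_partial[where f = f, OF f0] by simp
 from LIMSEQ_unique[OF 1 this] show ?thesis .
qed

lemma zeta1_eq_dirichlet:
 assumes s: "Re s > 1"
 shows "zeta1 s = (s - 1) * dirichlet (\<lambda>_. 1) s"
proof -
 define g where "g n = (s - 1) * of_nat (Suc n) powr (-s) - of_nat (Suc n) powr (1 - s) + of_nat (Suc (Suc n)) powr (1 - s)" for n
 have s0: "Re s > 0" using s by simp
 have "summable g"
  by (rule sums_split_tail_bound(1)[where c = "norm s * norm (s - 1)" and \<sigma> = "Re s" and M = 1])
    (use zeta1_term_bound[OF s0] s in \<open>auto simp: g_def simp del: of_nat_Suc\<close>)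
 then have "(\<lambda>M. 1 + (\<Sum>n<M. g n)) \<longlonglongrightarrow> 1 + (\<Sum>n. g n)" by (intro tendsto_add summable_LIMSEQ tendsto_const)
 then have 1: "(\<lambda>M. 1 + (\<Sum>n<M. g n)) \<longlonglongrightarrow> zeta1 s" by (simp add: zeta1_def g_def)
 have "(\<lambda>M. (of_nat (Suc M) :: complex) powr (1 - s)) \<longlonglongrightarrow> 0"
  using tendsto_powr_neg_complex[of "s - 1"] s by simp
 then have "(\<lambda>M. (s - 1) * (\<Sum>n=1..M. 1 * of_nat n powr (-s)) + of_nat (Suc M) powr (1 - s)) \<longlonglongrightarrow> (s - 1) * dirichlet (\<lambda>_. 1) s + 0"
  by (intro tendsto_add tendsto_mult tendsto_const dirichlet_partial_tendsto abs_conv_const s)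
 then have "(\<lambda>M. 1 + (\<Sum>n<M. g n)) \<longlonglongrightarrow> (s - 1) * dirichlet (\<lambda>_. 1) s"
  unfolding g_def zeta1_partial by simp
 from LIMSEQ_unique[OF 1 this] show ?thesis .
qed

lemma zeta1_1: "zeta1 1 = 1"
 by (simp add: zeta1_def del: of_nat_Suc)

section \<open>Growth and lower bounds near the line \<open>Re s = 1\<close>\<close>

lemma sum_inverse_le_ln:
 assumes "M \<ge> 1"
 shows "(\<Sum>n=1..M. 1 / real n) \<le> 1 + ln (real M)"
 using assms
proof (induction M rule: nat_induct_at_least)
 case (Suc n)
 have "ln (real n / real (Suc n)) \<le> real n / real (Suc n) - 1" using Suc.hyps by (intro ln_le_minus_one) auto
 then have "1 / real (Suc n) \<le> ln (real (Suc n)) - ln (real n)"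
  using Suc.hyps by (simp add: ln_div field_simps)
 then show ?case using Suc by simp
qed simp

lemma sum_powr_le:
 assumes M: "M \<ge> 1" and \<eta>: "\<eta> > 0" and \<sigma>: "\<sigma> \<ge> 1 - \<eta>"
 shows "(\<Sum>n=1..M. real n powr (-\<sigma>)) \<le> real M powr \<eta> * (1 + ln (real M))"
proof -
 have "(\<Sum>n=1..M. real n powr (-\<sigma>)) \<le> (\<Sum>n=1..M. real M powr \<eta> * (1 / real n))"
 proof (rule sum_mono)
  fix n assume n: "n \<in> {1..M}"
  have "real n powr (1 - \<sigma>) \<le> real n powr \<eta>" using n \<sigma> by (intro powr_mono) auto
  also have "\<dots> \<le> real M powr \<eta>" using n \<eta> by (intro powr_mono2) auto
  finally have "real n powr (1 - \<sigma>) \<le> real M powr \<eta>" .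
  moreover have "real n powr (-\<sigma>) = real n powr (1 - \<sigma>) * (1 / real n)"
   using n by (simp add: powr_diff powr_minus divide_simps)
  ultimately show "real n powr (-\<sigma>) \<le> real M powr \<eta> * (1 / real n)" using n by (simp add: divide_right_mono)
 qed
 also have "\<dots> = real M powr \<eta> * (\<Sum>n=1..M. 1 / real n)" by (simp add: sum_distrib_left)
 also have "\<dots> \<le> real M powr \<eta> * (1 + ln (real M))" using M by (intro mult_left_mono sum_inverse_le_ln) auto
 finally show ?thesis .
qed

lemma powr_neg_le:
 assumes "M \<ge> 1" "\<sigma> \<ge> 1 - \<eta>"
 shows "real M powr (-\<sigma>) \<le> real M powr \<eta> / real M"
proof -
 have "real M powr (-\<sigma>) \<le> real M powr (\<eta> - 1)" using assms by (intro powr_mono) auto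
 then show ?thesis using assms by (simp add: powr_diff)
qed

lemma ceiling_nat_bounds:
 fixes T :: real
 assumes "T \<ge> 1"
 obtains M :: nat where "M \<ge> 1" "T \<le> real M" "real M \<le> 2 * T"
proof
 show "nat \<lceil>T\<rceil> \<ge> 1" "T \<le> real (nat \<lceil>T\<rceil>)" "real (nat \<lceil>T\<rceil>) \<le> 2 * T" using assms by linarith+
qed

lemma two_powr_le:
 fixes T \<eta> c :: real
 assumes "0 < \<eta>" "\<eta> \<le> 1/2" "T \<ge> 1" "0 \<le> m" "m \<le> 2 * T"
 shows "m powr (2 * \<eta>) \<le> 2 * T powr (2 * \<eta>)"
proof -
 have "m powr (2 * \<eta>) \<le> (2 * T) powr (2 * \<eta>)" using assms by (intro powr_mono2) auto
 also have "\<dots> = 2 powr (2 * \<eta>) * T powr (2 * \<eta>)" using assms by (simp add: powr_mult)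
 also have "\<dots> \<le> 2 powr 1 * T powr (2 * \<eta>)" using assms by (intro mult_right_mono powr_mono) auto
 finally show ?thesis by simp
qed

lemma powr_log_le:
 fixes M :: nat
 assumes "M \<ge> 1" "\<eta> > 0" "c \<ge> 0"
 shows "real M powr \<eta> * (c + ln (real M)) \<le> (c + 1 / \<eta>) * real M powr (2 * \<eta>)"
proof -
 have "ln (real M) \<le> real M powr \<eta> / \<eta>" using assms by (intro ln_powr_bound) auto
 moreover have "1 \<le> real M powr \<eta>" using assms by (intro ge_one_powr_ge_zero) auto
 then have "c * 1 \<le> c * real M powr \<eta>" using assms by (intro mult_left_mono) auto
 ultimately have "c + ln (real M) \<le> (c + 1 / \<eta>) * real M powr \<eta>" by (simp add: algebra_simps)
 then have "real M powr \<eta> * (c + ln (real M)) \<le> real M powr \<eta> * ((c + 1 / \<eta>) * real M powr \<eta>)"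
  by (intro mult_left_mono) auto
 also have "\<dots> = (c + 1 / \<eta>) * real M powr (2 * \<eta>)" by (simp add: powr_add[symmetric] mult_ac)
 finally show ?thesis .
qed

text \<open>A cut at \<open>M\<close> of size \<open>q (t + 2)\<close> brings the tail down to about
  \<open>M powr \<eta>\<close>, the size of the head up to a logarithm. A second factor
  \<open>M powr \<eta>\<close> absorbs that logarithm, hence the exponent
  \<open>2 * \<eta>\<close>.\<close>

lemma norm_Lfun_growth0:
 assumes \<eta>: "0 < \<eta>" "\<eta> \<le> 1/2" and q: "1 \<le> q" and f: "bounded_sums q f"
  and s: "1 - \<eta> \<le> Re s" "Re s \<le> 3" and t: "t \<ge> \<bar>Im s\<bar>"
 shows "norm (Lfun f s) \<le> 2 * (5 + 1 / \<eta>) * (q * (t + 2)) powr (2 * \<eta>)"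
proof -
 define T where "T = q * (t + 2)"
 have tT: "t + 2 \<le> T" unfolding T_def using q t mult_right_mono[of 1 q "t + 2"] by simp
 then have T: "T \<ge> 1" using t by simp
 obtain M :: nat where M: "M \<ge> 1" "T \<le> real M" "real M \<le> 2 * T" using ceiling_nat_bounds[OF T] .
 have s0: "Re s > 0" "Re s \<ge> 1/2" using s \<eta> by auto
 have "\<bar>Re s\<bar> \<le> 3" using s s0 by linarith
 then have ns: "norm s \<le> 3 / 2 * (t + 2)" using cmod_le[of s] t by argo
 have A: "(\<Sum>n=1..M. real n powr (- Re s)) \<le> real M powr \<eta> * (1 + ln (real M))"
  by (rule sum_powr_le) (use M \<eta> s in auto)
 have pM: "real M powr (- Re s) \<le> real M powr \<eta> / real M" by (rule powr_neg_le) (use M s in auto)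
 have "q * 1 \<le> q * (t + 2)" using q t by (intro mult_left_mono) auto
 then have qM: "q \<le> real M" using M(2) by (simp add: T_def)
 have "real (Suc M) powr (- Re s) \<le> real M powr (- Re s)" using M s0 by (intro powr_mono2') auto
 then have "q * real (Suc M) powr (- Re s) \<le> real M * (real M powr \<eta> / real M)"
  using pM qM q by (intro mult_mono) auto
 then have B: "q * real (Suc M) powr (- Re s) \<le> real M powr \<eta>" using M by simp
 have "q * norm s \<le> q * (3 / 2 * (t + 2))" using ns q by (intro mult_left_mono) auto
 also have "\<dots> = 3 / 2 * T" by (simp add: T_def)
 also have "\<dots> \<le> 3 / 2 * real M" using M(2) by simp
 finally have qs: "q * norm s \<le> 3 / 2 * real M" .
 have "real M powr (- Re s) / Re s \<le> (real M powr \<eta> / real M) / (1/2)"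
  using pM s0 by (intro frac_le) auto
 then have "q * norm s * (real M powr (- Re s) / Re s) \<le> 3 / 2 * real M * ((real M powr \<eta> / real M) / (1/2))"
  by (rule mult_mono[OF qs]) (use s0 in auto)
 also have "\<dots> = 3 * real M powr \<eta>" using M by simp
 finally have C: "q * norm s * (real M powr (- Re s) / Re s) \<le> 3 * real M powr \<eta>" .
 have "norm (Lfun f s) \<le> real M powr \<eta> * (1 + ln (real M)) + real M powr \<eta> + 3 * real M powr \<eta>"
  using norm_Lfun_le[OF f s0(1) M(1)] A B C by linarith
 also have "\<dots> = real M powr \<eta> * (5 + ln (real M))" by (simp add: algebra_simps)
 also have "\<dots> \<le> (5 + 1 / \<eta>) * real M powr (2 * \<eta>)" using M \<eta> by (intro powr_log_le) auto
 also have "\<dots> \<le> (5 + 1 / \<eta>) * (2 * T powr (2 * \<eta>))"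
  using \<eta> T M by (intro mult_left_mono two_powr_le) auto
 finally show ?thesis by (simp add: T_def algebra_simps add_divide_distrib)
qed

lemma norm_zeta1_growth0:
 assumes \<eta>: "0 < \<eta>" "\<eta> \<le> 1/2" and s: "1 - \<eta> \<le> Re s" "Re s \<le> 3" and t: "t \<ge> \<bar>Im s\<bar>"
 shows "norm (zeta1 s) \<le> 2 * (6 + 1 / \<eta>) * (norm (s - 1) + 1) * (t + 2) powr (2 * \<eta>)"
proof -
 define T where "T = t + 2"
 have T: "T \<ge> 1" using t by (simp add: T_def)
 obtain M :: nat where M: "M \<ge> 1" "T \<le> real M" "real M \<le> 2 * T" using ceiling_nat_bounds[OF T] .
 have s0: "Re s > 0" "Re s \<ge> 1/2" using s \<eta> by auto
 have "\<bar>Re s\<bar> \<le> 3" using s s0 by linarith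
 then have ns: "norm s \<le> 3 / 2 * real M" using cmod_le[of s] t M(2) unfolding T_def by argo
 have A: "(\<Sum>n=1..M. real n powr (- Re s)) \<le> real M powr \<eta> * (1 + ln (real M))"
  by (rule sum_powr_le) (use M \<eta> s in auto)
 have pM: "real M powr (- Re s) \<le> real M powr \<eta> / real M" by (rule powr_neg_le) (use M s in auto)
 have "real (Suc M) powr (1 - Re s) \<le> real (Suc M) powr \<eta>" using s by (intro powr_mono) auto
 also have "\<dots> \<le> (2 * real M) powr \<eta>" using M \<eta> by (intro powr_mono2) auto
 also have "\<dots> = 2 powr \<eta> * real M powr \<eta>" by (simp add: powr_mult)
 also have "\<dots> \<le> 2 powr 1 * real M powr \<eta>" using \<eta> by (intro mult_right_mono powr_mono) auto
 finally have B: "real (Suc M) powr (1 - Re s) \<le> 2 * real M powr \<eta>" by simp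
 have "real M powr (- Re s) / Re s \<le> (real M powr \<eta> / real M) / (1/2)"
  using pM s0 by (intro frac_le) auto
 then have "norm s * (real M powr (- Re s) / Re s) \<le> 3 / 2 * real M * ((real M powr \<eta> / real M) / (1/2))"
  by (rule mult_mono[OF ns]) (use s0 in auto)
 also have "\<dots> = 3 * real M powr \<eta>" using M by simp
 finally have C: "norm (s - 1) * (norm s * (real M powr (- Re s) / Re s)) \<le> norm (s - 1) * (3 * real M powr \<eta>)"
  by (intro mult_left_mono) auto
 have A': "norm (s - 1) * (\<Sum>n=1..M. real n powr (- Re s)) \<le> norm (s - 1) * (real M powr \<eta> * (1 + ln (real M)))"
  using A by (intro mult_left_mono) auto
 have l: "0 \<le> ln (real M)" using M by simp
 have "norm (zeta1 s) \<le> norm (s - 1) * (real M powr \<eta> * (1 + ln (real M))) + 2 * real M powr \<eta> + norm (s - 1) * (3 * real M powr \<eta>)"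
  using norm_zeta1_le[OF s0(1) M(1)] A' B C by (simp add: mult_ac)
 also have "\<dots> = norm (s - 1) * (real M powr \<eta> * (4 + ln (real M))) + 2 * real M powr \<eta>" by (simp add: algebra_simps)
 also have "\<dots> \<le> norm (s - 1) * (real M powr \<eta> * (6 + ln (real M))) + real M powr \<eta> * (6 + ln (real M))"
  using l by (intro add_mono mult_left_mono) (auto simp: algebra_simps)
 also have "\<dots> = (norm (s - 1) + 1) * (real M powr \<eta> * (6 + ln (real M)))" by (simp add: algebra_simps)
 also have "\<dots> \<le> (norm (s - 1) + 1) * ((6 + 1 / \<eta>) * real M powr (2 * \<eta>))"
  using M \<eta> by (intro mult_left_mono powr_log_le) auto
 also have "\<dots> \<le> (norm (s - 1) + 1) * ((6 + 1 / \<eta>) * (2 * T powr (2 * \<eta>)))"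
  using \<eta> T M by (intro mult_left_mono two_powr_le) auto
 finally show ?thesis by (simp add: T_def algebra_simps add_divide_distrib)
qed

lemma growth_shift:
 fixes q t \<eta> :: real
 assumes "0 < \<eta>" "\<eta> \<le> 1/2" "1 \<le> q" "0 \<le> t"
 shows "(q * (t + 1 + 2)) powr (2 * \<eta>) \<le> 2 * (q * (t + 2)) powr (2 * \<eta>)"
proof (rule two_powr_le)
 show "1 \<le> q * (t + 2)" using assms mult_mono[of 1 q 1 "t + 2"] by simp
 show "q * (t + 1 + 2) \<le> 2 * (q * (t + 2))"
  using assms mult_left_mono[of "t + 1 + 2" "2 * (t + 2)" q] by (simp add: algebra_simps add_divide_distrib)
qed (use assms in auto)

text \<open>\<open>t\<close> may differ from \<open>Im z\<close> by 1, so that one bound covers the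
  discs used in Cauchy's estimates around a point of height \<open>t\<close>. \<open>K\<close>
  depends on \<eta> alone, not on the modulus.\<close>

lemma Lfun_growth:
 assumes \<eta>: "0 < \<eta>" "\<eta> \<le> 1/2"
 obtains K where "K \<ge> 1" "\<And>q f t z. 1 \<le> q \<Longrightarrow> bounded_sums q f \<Longrightarrow> 1 - \<eta> \<le> Re z \<Longrightarrow> Re z \<le> 3 \<Longrightarrow> \<bar>Im z - t\<bar> \<le> 1 \<Longrightarrow>
  norm (Lfun f z) \<le> K * (q * (\<bar>t\<bar> + 2)) powr (2 * \<eta>)"
proof
 have i: "1 / \<eta> > 0" using \<eta> by simp
 then show "4 * (5 + 1 / \<eta>) \<ge> 1" by simp
 fix q f t and z :: complex
 assume 1: "1 \<le> q" "bounded_sums q f" "1 - \<eta> \<le> Re z" "Re z \<le> 3" "\<bar>Im z - t\<bar> \<le> 1"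
 have "norm (Lfun f z) \<le> 2 * (5 + 1 / \<eta>) * (q * (\<bar>t\<bar> + 1 + 2)) powr (2 * \<eta>)"
  by (rule norm_Lfun_growth0) (use \<eta> 1 in auto)
 also have "\<dots> \<le> 2 * (5 + 1 / \<eta>) * (2 * (q * (\<bar>t\<bar> + 2)) powr (2 * \<eta>))"
  using i \<eta> 1 by (intro mult_left_mono growth_shift) auto
 finally show "norm (Lfun f z) \<le> 4 * (5 + 1 / \<eta>) * (q * (\<bar>t\<bar> + 2)) powr (2 * \<eta>)" by (simp add: algebra_simps add_divide_distrib)
qed

lemma zeta1_growth:
 assumes \<eta>: "0 < \<eta>" "\<eta> \<le> 1/2"
 obtains K where "K \<ge> 1" "\<And>t z. 1 - \<eta> \<le> Re z \<Longrightarrow> Re z \<le> 3 \<Longrightarrow> \<bar>Im z - t\<bar> \<le> 1 \<Longrightarrow>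
  norm (zeta1 z) \<le> K * (norm (z - 1) + 1) * (\<bar>t\<bar> + 2) powr (2 * \<eta>)"
proof
 have i: "1 / \<eta> > 0" using \<eta> by simp
 then show "4 * (6 + 1 / \<eta>) \<ge> 1" by simp
 fix t and z :: complex
 assume 1: "1 - \<eta> \<le> Re z" "Re z \<le> 3" "\<bar>Im z - t\<bar> \<le> 1"
 have "norm (zeta1 z) \<le> 2 * (6 + 1 / \<eta>) * (norm (z - 1) + 1) * (\<bar>t\<bar> + 1 + 2) powr (2 * \<eta>)"
  by (rule norm_zeta1_growth0) (use \<eta> 1 in auto)
 also have "\<dots> \<le> 2 * (6 + 1 / \<eta>) * (norm (z - 1) + 1) * (2 * (\<bar>t\<bar> + 2) powr (2 * \<eta>))"
  using i \<eta> 1 growth_shift[of \<eta> 1 "\<bar>t\<bar>"] by (intro mult_left_mono) auto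
 finally show "norm (zeta1 z) \<le> 4 * (6 + 1 / \<eta>) * (norm (z - 1) + 1) * (\<bar>t\<bar> + 2) powr (2 * \<eta>)" by (simp add: algebra_simps add_divide_distrib)
qed

section \<open>Logarithmic derivatives and lower bounds from the 3-4-1 inequality\<close>

lemma norm_deriv_le_of_bound:
 assumes hol: "f holomorphic_on S" "open S" and R: "R > 0" "cball z R \<subseteq> S" and A: "\<And>w. w \<in> cball z R \<Longrightarrow> norm (f w) \<le> A"
 shows "norm (deriv f z) \<le> A / R"
proof -
 have "norm ((deriv ^^ 1) f z) \<le> fact 1 * A / R ^ 1"
 proof (rule Cauchy_inequality)
  show "f holomorphic_on ball z R" using hol R by (meson ball_subset_cball holomorphic_on_subset order_trans)
  show "continuous_on (cball z R) f" using hol R by (meson holomorphic_on_imp_continuous_on holomorphic_on_subset)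
  show "norm (f x) \<le> A" if "norm (z - x) = R" for x using A[of x] that by (simp add: dist_norm)
 qed (use R in auto)
 then show ?thesis by simp
qed

text \<open>On the half-sized disc \<open>f'\<close> is at most \<open>4 A / R\<close>, so
  \<open>f\<close> stays above \<open>m / 2\<close> up to the distance \<open>R m / (8 A)\<close>
  from \<open>s\<close>, and Cauchy's inequality on that circle bounds the derivatives of
  \<open>f' / f\<close>. The disc free of zeros is produced by the lower bound at its centre and
  shrinks with it.\<close>

lemma log_deriv_bound:
 assumes hol: "f holomorphic_on ball s R" and R: "R > 0" and A: "\<And>z. z \<in> ball s R \<Longrightarrow> norm (f z) \<le> A"
  and m: "m > 0" "m \<le> norm (f s)"
 shows "norm ((deriv ^^ k) (\<lambda>z. deriv f z / f z) s) \<le> fact k * (8 * A / (R * m)) ^ (k + 1)"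
proof -
 have Am: "m \<le> A" using A[of s] R m by simp
 then have A0: "A > 0" using m by simp
 define \<rho> where "\<rho> = R * m / (8 * A)"
 have \<rho>: "\<rho> > 0" "\<rho> \<le> R / 8" using R m A0 Am by (auto simp: \<rho>_def field_simps)
 have d: "norm (deriv f z) \<le> 4 * A / R" if "z \<in> cball s (R / 2)" for z
 proof -
  have sub: "cball z (R / 4) \<subseteq> ball s R"
  proof
   fix w assume "w \<in> cball z (R / 4)"
   then show "w \<in> ball s R" using that R dist_triangle[of s w z] by auto
  qed
  have "norm (deriv f z) \<le> A / (R / 4)"
   by (rule norm_deriv_le_of_bound[OF hol open_ball _ sub]) (use R A sub in auto)
  then show ?thesis by (simp add: mult.commute)
 qed
 have low: "m / 2 \<le> norm (f z)" if z: "z \<in> cball s \<rho>" for z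
 proof -
  have "norm (f z - f s) \<le> 4 * A / R * norm (z - s)"
  proof (rule field_differentiable_bound[where S = "cball s (R / 2)" and f' = "deriv f"])
   fix w assume w: "w \<in> cball s (R / 2)"
   then have "w \<in> ball s R" using R by auto
   then show "(f has_field_derivative deriv f w) (at w within cball s (R / 2))"
    using hol holomorphic_derivI by (metis open_ball has_field_derivative_at_within)
  qed (use d z \<rho> R in auto)
  also have "\<dots> \<le> 4 * A / R * \<rho>" using z A0 R by (intro mult_left_mono) (auto simp: dist_norm norm_minus_commute)
  also have "\<dots> = m / 2" using A0 R by (simp add: \<rho>_def)
  finally have "norm (f z - f s) \<le> m / 2" .
  then show ?thesis using m norm_triangle_ineq2[of "f s" "f z"] by (simp add: norm_minus_commute)
 qed
 have sub: "cball s \<rho> \<subseteq> ball s R" using \<rho> R by auto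
 have nz: "f z \<noteq> 0" if "z \<in> cball s \<rho>" for z using low[OF that] m by auto
 define B where "B = 8 * A / (R * m)"
 have hol2: "(\<lambda>z. deriv f z / f z) holomorphic_on ball s \<rho>"
  using nz sub by (intro holomorphic_on_divide holomorphic_deriv holomorphic_on_subset[OF hol]) auto
 have cont: "continuous_on (cball s \<rho>) (\<lambda>z. deriv f z / f z)"
 proof (rule continuous_on_divide)
  have "deriv f holomorphic_on ball s R" by (rule holomorphic_deriv[OF hol open_ball])
  then show "continuous_on (cball s \<rho>) (deriv f)" using sub holomorphic_on_imp_continuous_on continuous_on_subset by blast
  show "continuous_on (cball s \<rho>) f" using hol sub holomorphic_on_imp_continuous_on continuous_on_subset by blast
 qed (use nz in auto)
 have "norm ((deriv ^^ k) (\<lambda>z. deriv f z / f z) s) \<le> fact k * B / \<rho> ^ k"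
 proof (rule Cauchy_inequality[OF hol2 cont \<rho>(1)])
  fix z assume "norm (s - z) = \<rho>"
  then have z: "z \<in> cball s \<rho>" by (simp add: dist_norm)
  have "norm (deriv f z) / norm (f z) \<le> (4 * A / R) / (m / 2)"
   using low[OF z] d[of z] z \<rho> R m A0 by (intro frac_le) auto
  then show "norm (deriv f z / f z) \<le> B" by (simp add: norm_divide B_def)
 qed
 also have "\<dots> = fact k * B ^ (k + 1)"
  using A0 R m by (simp add: B_def \<rho>_def power_divide power_mult_distrib divide_simps)
 finally show ?thesis unfolding B_def .
qed

lemma cball_Re_Im:
 assumes "v \<in> cball u r"
 shows "\<bar>Re v - Re u\<bar> \<le> r" "\<bar>Im v - Im u\<bar> \<le> r"
proof -
 have "norm (v - u) \<le> r" using assms by (simp add: dist_norm norm_minus_commute)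
 then show "\<bar>Re v - Re u\<bar> \<le> r" "\<bar>Im v - Im u\<bar> \<le> r"
  using abs_Re_le_cmod[of "v - u"] abs_Im_le_cmod[of "v - u"] by simp_all
qed

lemma lipschitz_holomorphic:
 assumes hol: "f holomorphic_on U" "open U" and S: "convex S" "r > 0" and sub: "\<And>u. u \<in> S \<Longrightarrow> cball u r \<subseteq> U"
  and A: "\<And>u v. u \<in> S \<Longrightarrow> v \<in> cball u r \<Longrightarrow> norm (f v) \<le> A" and zw: "z \<in> S" "w \<in> S"
 shows "norm (f z - f w) \<le> A / r * norm (z - w)"
proof (rule field_differentiable_bound[where S = S and f' = "deriv f"])
 fix u assume u: "u \<in> S"
 show "(f has_field_derivative deriv f u) (at u within S)"
  by (rule has_field_derivative_at_within[OF holomorphic_derivI[OF hol]]) (use sub[OF u] S(2) in auto)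
 show "norm (deriv f u) \<le> A / r" by (rule norm_deriv_le_of_bound[OF hol S(2) sub[OF u] A[OF u]])
qed (use S zw in auto)

lemma lipschitz_near_line:
 assumes hol: "f holomorphic_on {s. Re s > 0}" and \<eta>: "0 < \<eta>" "\<eta> \<le> 1/2"
  and A: "\<And>z. 1 - \<eta> \<le> Re z \<Longrightarrow> Re z \<le> 3 \<Longrightarrow> \<bar>Im z - t\<bar> \<le> 1 \<Longrightarrow> norm (f z) \<le> A"
  and z: "1 \<le> Re z" "Re z \<le> 2" "\<bar>Im z - t\<bar> \<le> 1/2" and w: "1 \<le> Re w" "Re w \<le> 2" "\<bar>Im w - t\<bar> \<le> 1/2"
 shows "norm (f z - f w) \<le> 2 * A / \<eta> * norm (z - w)"
proof -
 define S where "S = cbox (Complex 1 (t - 1/2)) (Complex 2 (t + 1/2))"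
 have S: "u \<in> S \<longleftrightarrow> 1 \<le> Re u \<and> Re u \<le> 2 \<and> \<bar>Im u - t\<bar> \<le> 1/2" for u
  unfolding S_def in_cbox_complex_iff complex.sel atLeastAtMost_iff abs_diff_le_iff by (intro iffI conjI; elim conjE; assumption)
 have c: "1 - \<eta> \<le> Re v \<and> Re v \<le> 3 \<and> \<bar>Im v - t\<bar> \<le> 1" if "u \<in> S" "v \<in> cball u (\<eta> / 2)" for u v
 proof -
  have "1 \<le> Re u" "Re u \<le> 2" "\<bar>Im u - t\<bar> \<le> 1/2" using that(1) unfolding S by blast+
  then show ?thesis using cball_Re_Im[OF that(2)] \<eta> by (intro conjI; linarith)
 qed
 have "norm (f z - f w) \<le> A / (\<eta> / 2) * norm (z - w)"
 proof (rule lipschitz_holomorphic[OF hol open_halfspace_Re_gt])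
  show "convex S" by (simp add: S_def convex_box)
  show "cball u (\<eta> / 2) \<subseteq> {s. 0 < Re s}" if "u \<in> S" for u
  proof
   fix v assume "v \<in> cball u (\<eta> / 2)"
   from c[OF that this] show "v \<in> {s. 0 < Re s}" using \<eta> by simp
  qed
  show "norm (f v) \<le> A" if "u \<in> S" "v \<in> cball u (\<eta> / 2)" for u v by (intro A) (use c[OF that] in simp_all)
  show "z \<in> S" "w \<in> S" using z w by (simp_all only: S)
 qed (use \<eta> in simp)
 then show ?thesis by (simp add: mult.commute)
qed

lemma norm_zeta_real_le:
 assumes "1 < \<sigma>" "\<sigma> \<le> 2"
 shows "norm (dirichlet (\<lambda>_. 1) (of_real \<sigma>)) \<le> 2 / (\<sigma> - 1)"
proof -
 have s: "(\<lambda>n. 1 * of_nat n powr (- complex_of_real \<sigma>)) sums dirichlet (\<lambda>_. 1) (of_real \<sigma>)"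
  using assms by (intro sums_dirichlet abs_conv_const) auto
 have n: "norm (1 * of_nat n powr (- complex_of_real \<sigma>)) = real n powr (-\<sigma>)" for n
  by (simp add: norm_nat_powr)
 have sm: "summable (\<lambda>n. real n powr (-\<sigma>))" using assms by (simp add: summable_real_powr_iff)
 have "norm (dirichlet (\<lambda>_. 1) (of_real \<sigma>)) \<le> (\<Sum>n. real n powr (-\<sigma>))"
  using norm_suminf_le[of "\<lambda>n. 1 * of_nat n powr (- complex_of_real \<sigma>)" "\<lambda>n. real n powr (-\<sigma>)"] sm n s
  by (simp add: sums_iff)
 also have "\<dots> = 1 + (\<Sum>n. real (Suc (n + 1)) powr (-(\<sigma> - 1) - 1))"
  using suminf_split_initial_segment[OF sm, of 2] by (simp add: numeral_2_eq_2 add_ac)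
 also have "\<dots> \<le> 1 + real 1 powr (-(\<sigma> - 1)) / (\<sigma> - 1)"
  using assms by (intro add_left_mono tail_sum(2)) auto
 also have "\<dots> = \<sigma> / (\<sigma> - 1)" using assms by (simp add: field_simps)
 also have "\<dots> \<le> 2 / (\<sigma> - 1)" using assms by (intro divide_right_mono) auto
 finally show ?thesis .
qed

text \<open>Comparing the logarithms term by term shows that the norm is at least the reciprocal of
  the zeta function at \<open>Re s\<close>, which \<open>norm_zeta_real_le\<close>
  estimates.\<close>

lemma norm_dirichlet_trivial_lower:
 assumes f: "cmult f" and s: "1 < Re s" "Re s \<le> 2"
 shows "(Re s - 1) / 2 \<le> norm (dirichlet f s)"
proof -
 define P where "P = dirichlet (\<lambda>n. of_real (\<Lambda>0 n) * f n) s"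
 define P1 where "P1 = dirichlet (\<lambda>n. of_real (\<Lambda>0 n) * 1) (of_real (Re s))"
 have s1: "Re (complex_of_real (Re s)) > 1" using s by simp
 have sP: "(\<lambda>n. of_real (\<Lambda>0 n) * f n * of_nat n powr (-s)) sums P"
  unfolding P_def by (rule sums_dirichlet[OF abs_conv_\<Lambda>0_times[OF f] s(1)])
 have R1: "(\<lambda>n. Re (of_real (\<Lambda>0 n) * 1 * of_nat n powr (- complex_of_real (Re s)))) sums Re P1"
  unfolding P1_def by (rule sums_Re[OF sums_dirichlet[OF abs_conv_\<Lambda>0_times[OF cmult_const_1] s1]])
 have R2: "Re (of_real (\<Lambda>0 n) * 1 * of_nat n powr (- complex_of_real (Re s))) = \<Lambda>0 n * real n powr (- Re s)" for n
  using powr_of_real[of "real n" "- Re s"] by simp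
 have sP1: "(\<lambda>n. \<Lambda>0 n * real n powr (- Re s)) sums Re P1" using R1 unfolding R2 .
 have "norm P \<le> Re P1"
 proof -
  have "norm (suminf (\<lambda>n. of_real (\<Lambda>0 n) * f n * of_nat n powr (-s))) \<le> (\<Sum>n. \<Lambda>0 n * real n powr (- Re s))"
  proof (rule norm_suminf_le)
   fix n
   have "norm (f n) \<le> 1" by (rule cmult_norm[OF f])
   then have "\<Lambda>0 n * norm (f n) * real n powr (- Re s) \<le> \<Lambda>0 n * 1 * real n powr (- Re s)"
    using \<Lambda>0_nonneg by (intro mult_left_mono mult_right_mono) auto
   then show "norm (of_real (\<Lambda>0 n) * f n * of_nat n powr (-s)) \<le> \<Lambda>0 n * real n powr (- Re s)"
    using \<Lambda>0_nonneg[of n] by (simp add: norm_mult norm_nat_powr)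
  qed (rule sums_summable[OF sP1])
  then show ?thesis using sP sP1 by (simp add: sums_iff)
 qed
 then have "- Re P1 \<le> Re P" using abs_Re_le_cmod[of P] by linarith
 then have "exp (- Re P1) \<le> norm (dirichlet f s)"
  unfolding dirichlet_eq_exp[OF f s(1)] P_def[symmetric] norm_exp_eq_Re by simp
 moreover have "exp (Re P1) \<le> 2 / (Re s - 1)"
  using norm_zeta_real_le[OF s] unfolding dirichlet_eq_exp[OF cmult_const_1 s1] P1_def norm_exp_eq_Re .
 then have "(Re s - 1) / 2 \<le> exp (- Re P1)"
  using s by (simp add: exp_minus field_simps)
 ultimately show ?thesis by simp
qed

text \<open>At distance at least \<delta> from the line the 3-4-1 inequality with
  \<open>\<zeta>(\<sigma>) \<le> 2 / (\<sigma> - 1)\<close> gives a lower bound; closer to the line,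
  the Lipschitz bound \<open>L\<close> carries over the value at
  \<open>1 + \<delta>\<close>.\<close>

lemma three_four_one_lower:
 assumes f: "cmult f" and g: "cmult g"
  and nonneg: "\<And>n u. n > 0 \<Longrightarrow> norm u = 1 \<Longrightarrow> 0 \<le> 3 + 4 * Re (f n * u) + Re (g n * u ^ 2)"
  and B: "B \<ge> 1" "\<And>\<sigma>. 1 < \<sigma> \<Longrightarrow> \<sigma> \<le> 2 \<Longrightarrow> norm (dirichlet g (Complex \<sigma> (2 * t))) \<le> B"
  and L: "L \<ge> 1" "\<And>\<sigma> \<sigma>'. 1 < \<sigma> \<Longrightarrow> \<sigma> \<le> 2 \<Longrightarrow> 1 < \<sigma>' \<Longrightarrow> \<sigma>' \<le> 2 \<Longrightarrow>
    norm (dirichlet f (Complex \<sigma> t) - dirichlet f (Complex \<sigma>' t)) \<le> L * \<bar>\<sigma> - \<sigma>'\<bar>"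
  and \<sigma>: "1 < \<sigma>" "\<sigma> \<le> 2"
 shows "1 / (128 * L ^ 3 * B) \<le> norm (dirichlet f (Complex \<sigma> t))"
proof -
 \<comment> \<open>Chosen so that \<open>(2 * \<delta> * L) ^ 4 * (8 * B) = \<delta> ^ 3\<close>:
   the bound at distance \<delta> is then twice the Lipschitz loss
   \<open>\<delta> * L\<close>.\<close>
 define \<delta> where "\<delta> = 1 / (128 * L ^ 4 * B)"
 have LB: "L ^ 4 * B \<ge> 1" using mult_mono[of 1 "L ^ 4" 1 B] L(1) B(1) by (simp add: one_le_power)
 have \<delta>: "0 < \<delta>" "\<delta> \<le> 1" using LB B(1) L(1) by (auto simp: \<delta>_def divide_simps zero_less_mult_iff)
 have far: "2 * \<delta> * L \<le> norm (dirichlet f (Complex \<sigma> t))" if "1 + \<delta> \<le> \<sigma>" "\<sigma> \<le> 2" for \<sigma>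
 proof -
  define X where "X = norm (dirichlet f (Complex \<sigma> t))"
  have s1: "1 < \<sigma>" using that \<delta> by simp
  have X0: "X \<ge> 0" by (simp add: X_def)
  have "1 \<le> norm (dirichlet (\<lambda>_. 1) (of_real \<sigma>)) ^ 3 * X ^ 4 * norm (dirichlet g (Complex \<sigma> (2 * t)))"
   unfolding X_def by (rule three_four_one[OF f g s1 nonneg])
  also have "\<dots> \<le> (2 / (\<sigma> - 1)) ^ 3 * X ^ 4 * B"
   using s1 that X0 by (intro mult_mono power_mono norm_zeta_real_le B) auto
  also have "\<dots> \<le> (2 / \<delta>) ^ 3 * X ^ 4 * B"
   using s1 that \<delta> B(1) by (intro mult_right_mono power_mono frac_le) auto
  finally have "\<delta> ^ 3 \<le> 8 * B * X ^ 4" using \<delta> by (simp add: power_divide divide_simps mult_ac)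
  moreover have "(2 * \<delta> * L) ^ 4 * (8 * B) = \<delta> ^ 3 * (\<delta> * (128 * L ^ 4 * B))"
   by (simp add: power_mult_distrib eval_nat_numeral mult_ac)
  moreover have "\<delta> * (128 * L ^ 4 * B) = 1" using L(1) B(1) by (simp add: \<delta>_def)
  ultimately have "(2 * \<delta> * L) ^ 4 * (8 * B) \<le> 8 * B * X ^ 4" by (simp only: mult_1_right)
  then have "(2 * \<delta> * L) ^ 4 * (8 * B) \<le> X ^ 4 * (8 * B)" by (simp only: mult_ac)
  then have "(2 * \<delta> * L) ^ 4 \<le> X ^ 4" using B(1) by simp
  then show ?thesis using power_le_imp_le_base[of "2 * \<delta> * L" 3 X] by (simp add: X_def eval_nat_numeral)
 qed
 have e: "1 / (128 * L ^ 3 * B) = \<delta> * L" using L(1) by (simp add: \<delta>_def eval_nat_numeral)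
 have "\<delta> * L \<le> norm (dirichlet f (Complex \<sigma> t))"
 proof (cases "1 + \<delta> \<le> \<sigma>")
  case True
  then show ?thesis using far[OF True \<sigma>(2)] \<delta> L(1) mult_pos_pos[of \<delta> L] by linarith
 next
  case False
  have "norm (dirichlet f (Complex (1 + \<delta>) t) - dirichlet f (Complex \<sigma> t)) \<le> L * \<bar>1 + \<delta> - \<sigma>\<bar>"
   using L(2)[of "1 + \<delta>" \<sigma>] \<delta> \<sigma> by simp
  also have "\<dots> \<le> L * \<delta>" using False \<sigma> L(1) by (intro mult_left_mono) auto
  finally have "norm (dirichlet f (Complex (1 + \<delta>) t) - dirichlet f (Complex \<sigma> t)) \<le> \<delta> * L" by (simp add: mult.commute)
  moreover have "2 * \<delta> * L \<le> norm (dirichlet f (Complex (1 + \<delta>) t))" using far[of "1 + \<delta>"] \<delta> by simp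
  ultimately show ?thesis using norm_triangle_ineq2[of "dirichlet f (Complex (1 + \<delta>) t)" "dirichlet f (Complex \<sigma> t)"] by linarith
 qed
 then show ?thesis unfolding e .
qed

definition chi_sq :: "(nat \<Rightarrow> complex) \<Rightarrow> nat \<Rightarrow> complex" where "chi_sq f n = f n * f n"

definition nonprincipal :: "nat \<Rightarrow> (nat \<Rightarrow> complex) \<Rightarrow> bool" where
 "nonprincipal q \<phi> \<longleftrightarrow> q > 0 \<and> dchar q \<phi> \<and> \<phi> \<noteq> principal q"

text \<open>For a real character the lower bounds below have to be weakened by the (possibly very
 small) value at \<open>s = 1\<close>.\<close>

definition defect :: "nat \<Rightarrow> (nat \<Rightarrow> complex) \<Rightarrow> real" where
 "defect q \<phi> = (if chi_sq \<phi> = principal q then min 1 (norm (Lfun \<phi> 1)) else 1)"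

lemma nonprincipalD:
 assumes "nonprincipal q \<phi>"
 shows "q > 0" "dchar q \<phi>" "\<phi> \<noteq> principal q" "bounded_sums (real q) \<phi>" "cmult \<phi>" "real q \<ge> 1"
proof -
 show "q > 0" "dchar q \<phi>" "\<phi> \<noteq> principal q" using assms unfolding nonprincipal_def by blast+
 then show "bounded_sums (real q) \<phi>" "cmult \<phi>" "real q \<ge> 1"
  using dchar_bounded_sums dchar_imp_cmult by simp_all
qed

lemma three_four_one_trig:
 assumes "w = 0 \<or> norm w = 1"
 shows "0 \<le> 3 + 4 * Re w + Re (w ^ 2)"
proof (cases "w = 0")
 case False
 then have "(Re w)\<^sup>2 + (Im w)\<^sup>2 = 1" using assms by (simp add: norm_complex_def)
 then have "3 + 4 * Re w + Re (w ^ 2) = 2 * (1 + Re w)\<^sup>2"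
  by (simp add: power2_eq_square algebra_simps)
 then show ?thesis by simp
qed simp

lemma norm_dchar_cases: "nonprincipal q \<phi> \<Longrightarrow> \<phi> n = 0 \<or> norm (\<phi> n) = 1"
 using nonprincipalD(1,2) dchar_eq_0_iff norm_dchar by metis

lemma nonneg_341_square:
 assumes "nonprincipal q \<phi>" "norm u = 1"
 shows "0 \<le> 3 + 4 * Re (\<phi> n * u) + Re (chi_sq \<phi> n * u ^ 2)"
proof -
 have "\<phi> n * u = 0 \<or> norm (\<phi> n * u) = 1" using norm_dchar_cases[OF assms(1), of n] assms(2) by (auto simp: norm_mult)
 from three_four_one_trig[OF this] show ?thesis by (simp add: chi_sq_def power2_eq_square mult_ac)
qed

text \<open>For a real character the third function is the constant 1 instead of the principal
  character, so that the zeta function itself appears. Where \<open>\<phi> n = 0\<close> the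
  expression is still at least 2.\<close>

lemma nonneg_341_real:
 assumes np: "nonprincipal q \<phi>" and sq: "chi_sq \<phi> = principal q" and u: "norm u = 1"
 shows "0 \<le> 3 + 4 * Re (\<phi> n * u) + Re (1 * u ^ 2)"
proof (cases "\<phi> n = 0")
 case True
 have "\<bar>Re (u ^ 2)\<bar> \<le> 1" using abs_Re_le_cmod[of "u ^ 2"] u by (simp add: norm_power)
 then show ?thesis using True by simp
next
 case False
 then have "coprime n q" using nonprincipalD[OF np] dchar_eq_0_iff by blast
 then have "chi_sq \<phi> n = 1" by (simp add: sq principal_def)
 then show ?thesis using nonneg_341_square[OF np u, of n] by simp
qed

lemma nonprincipal_chi_sq:
 assumes "nonprincipal q \<phi>" "chi_sq \<phi> \<noteq> principal q"
 shows "nonprincipal q (chi_sq \<phi>)"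
 using assms dchar_times_same[of q \<phi> \<phi>] unfolding nonprincipal_def chi_sq_def[abs_def] by blast

text \<open>If the square of the character is nonprincipal, its L-function is bounded at height
  \<open>2 t\<close> and the 3-4-1 inequality applies directly. For a real character the pole of
  zeta interferes when \<open>t\<close> is small: for \<open>|t| > \<tau>\<close> the bound for zeta
  is of size \<open>X / \<tau>\<close>; for \<open>|t| \<le> \<tau>\<close> the value near
  \<open>s = 1\<close> is compared with \<open>L(1)\<close>, and further to the right the trivial
  lower bound suffices.\<close>

lemma Lfun_lower:
 assumes \<eta>: "0 < \<eta>" "\<eta> \<le> 1/2"
 obtains c where "c > 0" "\<And>q \<phi> s. nonprincipal q \<phi> \<Longrightarrow> 1 < Re s \<Longrightarrow> Re s \<le> 2 \<Longrightarrow> defect q \<phi> > 0 \<Longrightarrow>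
  c * defect q \<phi> / ((real q * (\<bar>Im s\<bar> + 2)) powr (2 * \<eta>)) ^ 5 \<le> norm (Lfun \<phi> s)"
proof -
 obtain K where K: "K \<ge> 1" "\<And>q f t z. 1 \<le> q \<Longrightarrow> bounded_sums q f \<Longrightarrow> 1 - \<eta> \<le> Re z \<Longrightarrow> Re z \<le> 3 \<Longrightarrow> \<bar>Im z - t\<bar> \<le> 1 \<Longrightarrow>
  norm (Lfun f z) \<le> K * (q * (\<bar>t\<bar> + 2)) powr (2 * \<eta>)" using Lfun_growth[OF \<eta>] by blast
 obtain K2 where K2: "K2 \<ge> 1" "\<And>t z. 1 - \<eta> \<le> Re z \<Longrightarrow> Re z \<le> 3 \<Longrightarrow> \<bar>Im z - t\<bar> \<le> 1 \<Longrightarrow>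
  norm (zeta1 z) \<le> K2 * (norm (z - 1) + 1) * (\<bar>t\<bar> + 2) powr (2 * \<eta>)" using zeta1_growth[OF \<eta>] by blast
 define a where "a = 2 * K / \<eta>"
 have aK: "a \<ge> 4 * K" using \<eta> K(1) by (simp add: a_def field_simps)
 then have a1: "a \<ge> 1" using K(1) by simp
 define c where "c = 1 / (128 * a ^ 3 * (16 * K2 * a * K))"
 have c0: "c > 0" using a1 K(1) K2(1) by (simp add: c_def)
 show ?thesis
 proof (rule that[OF c0])
  fix q \<phi> and s :: complex
  assume np: "nonprincipal q \<phi>" and s: "1 < Re s" "Re s \<le> 2" and d0: "defect q \<phi> > 0"
  note n = nonprincipalD[OF np]
  define t where "t = Im s"
  define X where "X = (real q * (\<bar>t\<bar> + 2)) powr (2 * \<eta>)"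
  define l where "l = defect q \<phi>"
  have l: "0 < l" "l \<le> 1" using d0 by (auto simp: l_def defect_def)
  have T1: "1 * 1 \<le> real q * (\<bar>t\<bar> + 2)" using n(6) by (intro mult_mono) auto
  then have X1: "X \<ge> 1" unfolding X_def using \<eta> by (intro ge_one_powr_ge_zero) auto
  have sC: "s = Complex (Re s) t" by (simp add: t_def)
  have hol: "Lfun \<phi> holomorphic_on {s. Re s > 0}" by (rule holomorphic_Lfun[OF n(4)])
  have bd: "norm (Lfun \<phi> z) \<le> K * X" if "1 - \<eta> \<le> Re z" "Re z \<le> 3" "\<bar>Im z - t\<bar> \<le> 1" for z
   unfolding X_def by (rule K(2)[OF n(6) n(4) that])
  have lip: "norm (Lfun \<phi> z - Lfun \<phi> w) \<le> a * X * norm (z - w)"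
   if "1 \<le> Re z" "Re z \<le> 2" "\<bar>Im z - t\<bar> \<le> 1/2" "1 \<le> Re w" "Re w \<le> 2" "\<bar>Im w - t\<bar> \<le> 1/2" for z w
   using lipschitz_near_line[OF hol \<eta> bd that] by (simp add: a_def)
  have pos: "a > 0" "K > 0" "K2 > 0" "X > 0" using a1 K(1) K2(1) X1 by linarith+
  have aX: "a * X \<ge> 1" using mult_mono[of 1 a 1 X] a1 X1 by simp
  have eqd: "Lfun \<phi> z = dirichlet \<phi> z" if "Re z > 1" for z by (rule Lfun_eq_dirichlet[OF n(4) that])
  have lipd: "norm (dirichlet \<phi> (Complex \<sigma> t) - dirichlet \<phi> (Complex \<sigma>' t)) \<le> a * X * \<bar>\<sigma> - \<sigma>'\<bar>"
   if "1 < \<sigma>" "\<sigma> \<le> 2" "1 < \<sigma>'" "\<sigma>' \<le> 2" for \<sigma> \<sigma>'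
   using lip[of "Complex \<sigma> t" "Complex \<sigma>' t"] that by (simp add: eqd cmod_eq_Re)
  \<comment> \<open>In both applications the third function is at most of this size:
    \<open>X ^ 3\<close> from the Lipschitz constant and \<open>X ^ 2\<close> from \<open>B\<close>
    add up to the fifth power.\<close>
  have final: "c * l / X ^ 5 \<le> 1 / (128 * (a * X) ^ 3 * B)" if B: "B \<ge> 1" "B \<le> 16 * K2 * a * K * X ^ 2 / l" for B
  proof -
   have "128 * (a * X) ^ 3 * B \<le> 128 * (a * X) ^ 3 * (16 * K2 * a * K * X ^ 2 / l)"
    using B aX by (intro mult_left_mono) auto
   also have "\<dots> = (128 * a ^ 3 * (16 * K2 * a * K)) * X ^ 5 / l"
    by (simp add: power_mult_distrib eval_nat_numeral)
   finally have "1 / ((128 * a ^ 3 * (16 * K2 * a * K)) * X ^ 5 / l) \<le> 1 / (128 * (a * X) ^ 3 * B)"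
    using B pos by (intro frac_le) auto
   then show ?thesis by (simp add: c_def)
  qed
  have triv: "c * l / X ^ 5 \<le> l / (8 * (a * X))"
  proof -
   have p1: "1 \<le> 16 * K2 * a * K * X ^ 2"
    using mult_mono[of 1 "K2 * a * K" 1 "16 * X ^ 2"] mult_mono[of 1 "K2 * a" 1 K] mult_mono[of 1 K2 1 a] a1 K(1) K2(1) X1 one_le_power[OF X1, of 2]
    by (simp add: mult_ac)
   have "c * l / X ^ 5 \<le> l * (1 / (128 * (a * X) ^ 3 * 1))"
   proof -
    have "c / X ^ 5 \<le> 1 / (128 * (a * X) ^ 3 * 1)"
    proof -
     have "128 * (a * X) ^ 3 * 1 \<le> 128 * (a * X) ^ 3 * (16 * K2 * a * K * X ^ 2)"
      using p1 aX by (intro mult_left_mono) auto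
     also have "\<dots> = (128 * a ^ 3 * (16 * K2 * a * K)) * X ^ 5"
      by (simp add: power_mult_distrib eval_nat_numeral)
     finally have "1 / ((128 * a ^ 3 * (16 * K2 * a * K)) * X ^ 5) \<le> 1 / (128 * (a * X) ^ 3 * 1)"
      using pos by (intro frac_le) auto
     then show ?thesis by (simp add: c_def)
    qed
    from mult_left_mono[OF this, of l] l show ?thesis by (simp add: mult_ac)
   qed
   also have "\<dots> \<le> l * (1 / (8 * (a * X)))"
   proof -
    have "8 * (a * X) \<le> 128 * (a * X) ^ 3"
    proof -
     have "(a * X) ^ 1 \<le> (a * X) ^ 3" using aX by (intro power_increasing) auto
     then show ?thesis unfolding power_one_right using aX by linarith
    qed
    then show ?thesis using pos l by (intro mult_left_mono frac_le) auto
   qed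
   finally show ?thesis by simp
  qed
  have "c * l / X ^ 5 \<le> norm (Lfun \<phi> s)"
  proof (cases "chi_sq \<phi> = principal q")
   case False
   note n2 = nonprincipalD[OF nonprincipal_chi_sq[OF np False]]
   have "norm (dirichlet (chi_sq \<phi>) (Complex \<sigma> (2 * t))) \<le> 2 * K * X" if "1 < \<sigma>" "\<sigma> \<le> 2" for \<sigma>
   proof -
    have "norm (Lfun (chi_sq \<phi>) (Complex \<sigma> (2 * t))) \<le> K * (real q * (\<bar>2 * t\<bar> + 2)) powr (2 * \<eta>)"
     by (rule K(2)[OF n2(6) n2(4)]) (use that \<eta> in auto)
    also have "\<dots> \<le> K * (2 * (real q * (\<bar>t\<bar> + 2)) powr (2 * \<eta>))"
     using K(1) T1 n(6) \<eta> by (intro mult_left_mono two_powr_le) (auto simp: algebra_simps abs_mult)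
    finally show ?thesis using that by (simp add: Lfun_eq_dirichlet[OF n2(4)] X_def)
   qed
   then have "1 / (128 * (a * X) ^ 3 * (2 * K * X)) \<le> norm (dirichlet \<phi> (Complex (Re s) t))"
    using three_four_one_lower[OF n(5) n2(5) nonneg_341_square[OF np] _ _ aX lipd s, of "2 * K * X"]
     mult_mono[of 1 K 1 X] K(1) X1 by auto
   moreover have "c * l / X ^ 5 \<le> 1 / (128 * (a * X) ^ 3 * (2 * K * X))"
   proof (rule final)
    show "1 \<le> 2 * K * X" using mult_mono[of 1 K 1 X] K(1) X1 by simp
    have "K * X * 1 \<le> K * X * (X * (K2 * a))"
     using mult_mono[of 1 X 1 "K2 * a"] mult_mono[of 1 K2 1 a] a1 K2(1) X1 K(1) by (intro mult_left_mono) auto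
    then have "2 * K * X \<le> 16 * (K * X * (X * (K2 * a)))" using K(1) X1 mult_nonneg_nonneg[of K X] by linarith
    also have "\<dots> = 16 * K2 * a * K * X ^ 2 / 1" by (simp add: power2_eq_square)
    also have "\<dots> \<le> 16 * K2 * a * K * X ^ 2 / l" using l a1 K(1) K2(1) by (intro divide_left_mono) auto
    finally show "2 * K * X \<le> 16 * K2 * a * K * X ^ 2 / l" .
   qed
   ultimately show ?thesis using s by (simp add: eqd sC[symmetric])
  next
   case True
   \<comment> \<open>Within distance \<open>2 * \<tau>\<close> of 1 the Lipschitz bound
     \<open>a * X\<close> changes the value by at most \<open>l / 2\<close>, so half of the lower
     bound at 1 survives.\<close>
   define \<tau> where "\<tau> = l / (4 * (a * X))"
   have \<tau>: "\<tau> > 0" "\<tau> \<le> 1/4" using l aX by (auto simp: \<tau>_def field_simps)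
   have lL: "l \<le> norm (Lfun \<phi> 1)" using True by (simp add: l_def defect_def)
   show ?thesis
   proof (cases "\<bar>t\<bar> \<le> \<tau>")
    case t: True
    show ?thesis
    proof (cases "Re s - 1 \<le> \<tau>")
     case True
     have "norm (s - 1) \<le> \<bar>Re (s - 1)\<bar> + \<bar>Im (s - 1)\<bar>" by (rule cmod_le)
     then have "norm (s - 1) \<le> 2 * \<tau>" using True t s by (simp add: t_def)
     then have "a * X * norm (s - 1) \<le> a * X * (2 * \<tau>)" using aX by (intro mult_left_mono) auto
     also have "\<dots> = l / 2" using pos by (simp add: \<tau>_def)
     finally have "a * X * norm (s - 1) \<le> l / 2" .
     moreover have "norm (Lfun \<phi> s - Lfun \<phi> 1) \<le> a * X * norm (s - 1)"
      by (rule lip) (use s t \<tau> in \<open>auto simp: t_def\<close>)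
     ultimately have "l / 2 \<le> norm (Lfun \<phi> s)"
      using lL norm_triangle_ineq2[of "Lfun \<phi> 1" "Lfun \<phi> s"] by (simp add: norm_minus_commute)
     moreover have "2 \<le> 8 * (a * X)" using aX by linarith
     then have "l / (8 * (a * X)) \<le> l / 2" using l by (intro frac_le) auto
     ultimately show ?thesis using triv by linarith
    next
     case False
     have "\<tau> / 2 \<le> (Re s - 1) / 2" using False by simp
     also have "\<dots> \<le> norm (dirichlet \<phi> s)" by (rule norm_dirichlet_trivial_lower[OF n(5) s])
     finally show ?thesis using triv s by (simp add: eqd \<tau>_def)
    qed
   next
    case t: False
    define B where "B = 4 * K2 * X / \<tau>"
    have B1: "norm (dirichlet (\<lambda>_. 1) (Complex \<sigma> (2 * t))) \<le> B" if sg: "1 < \<sigma>" "\<sigma> \<le> 2" for \<sigma>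
    proof -
     define z where "z = Complex \<sigma> (2 * t)"
     have nz: "norm (z - 1) \<ge> \<tau>" using abs_Im_le_cmod[of "z - 1"] t by (simp add: z_def)
     have "norm (zeta1 z) \<le> K2 * (norm (z - 1) + 1) * (\<bar>2 * t\<bar> + 2) powr (2 * \<eta>)"
      by (rule K2(2)) (use sg \<eta> in \<open>auto simp: z_def\<close>)
     also have "(\<bar>2 * t\<bar> + 2) powr (2 * \<eta>) \<le> 2 * X"
     proof -
      have "1 * (\<bar>t\<bar> + 2) \<le> real q * (\<bar>t\<bar> + 2)" using n(6) by (intro mult_right_mono) auto
      then show ?thesis unfolding X_def using \<eta> T1 by (intro two_powr_le) auto
     qed
     finally have 1: "norm (zeta1 z) \<le> K2 * (norm (z - 1) + 1) * (2 * X)" using K2(1) by (simp add: mult_left_mono)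
     have zz: "zeta1 z = (z - 1) * dirichlet (\<lambda>_. 1) z" by (rule zeta1_eq_dirichlet) (use sg in \<open>simp add: z_def\<close>)
     have "\<tau> * (norm (z - 1) + 1) \<le> 2 * norm (z - 1)"
      using nz \<tau> mult_right_mono[of \<tau> 1 "norm (z - 1)"] by (simp add: distrib_left)
     then have "norm (z - 1) + 1 \<le> 2 * norm (z - 1) / \<tau>" using \<tau> by (simp add: field_simps)
     then have "K2 * (norm (z - 1) + 1) * (2 * X) \<le> K2 * (2 * norm (z - 1) / \<tau>) * (2 * X)"
      using K2(1) X1 by (intro mult_right_mono mult_left_mono) auto
     also have "\<dots> = norm (z - 1) * B" by (simp add: B_def)
     finally have "norm (z - 1) * norm (dirichlet (\<lambda>_. 1) z) \<le> norm (z - 1) * B"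
      using 1 unfolding zz norm_mult by linarith
     moreover have "norm (z - 1) > 0" using nz \<tau> by linarith
     ultimately show ?thesis unfolding z_def[symmetric] by simp
    qed
    have Beq: "B = 16 * K2 * a * X ^ 2 / l" using aX l by (simp add: B_def \<tau>_def power2_eq_square field_simps)
    have B2: "B \<ge> 1"
    proof -
     have "1 \<le> 4 * K2 * X" using mult_mono[of 1 K2 1 X] K2(1) X1 by simp
     then show ?thesis using \<tau> by (simp add: B_def field_simps)
    qed
    have "1 / (128 * (a * X) ^ 3 * B) \<le> norm (dirichlet \<phi> (Complex (Re s) t))"
     by (rule three_four_one_lower[OF n(5) cmult_const_1 nonneg_341_real[OF np True] B2 B1 aX lipd s])
    moreover have "c * l / X ^ 5 \<le> 1 / (128 * (a * X) ^ 3 * B)"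
    proof (rule final[OF B2])
     have "16 * K2 * a * X ^ 2 * 1 \<le> 16 * K2 * a * X ^ 2 * K"
      using K(1) K2(1) a1 by (intro mult_left_mono) auto
     then show "B \<le> 16 * K2 * a * K * X ^ 2 / l" unfolding Beq using l by (intro divide_right_mono) (auto simp: mult_ac)
    qed
    ultimately show ?thesis using s by (simp add: eqd sC[symmetric])
   qed
  qed
  then show "c * defect q \<phi> / ((real q * (\<bar>Im s\<bar> + 2)) powr (2 * \<eta>)) ^ 5 \<le> norm (Lfun \<phi> s)"
   by (simp add: l_def X_def t_def)
 qed
qed

text \<open>\<open>F\<close> is a continuation beyond \<open>Re s = 1\<close>. Expressing the series
  through \<open>F\<close> allows Cauchy estimates on discs that cross that line, with a radius
  independent of the distance of \<open>s\<close> to it.\<close>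

lemma higher_deriv_mangoldt_dirichlet:
 assumes f: "cmult f" and F: "open U" "F holomorphic_on U" "\<And>z. z \<in> U \<Longrightarrow> Re z > 1 \<Longrightarrow> F z = dirichlet f z"
  and s: "s \<in> U" "Re s > 1"
 shows "dirichlet (\<lambda>n. mangoldt n * f n * cln n ^ k) s
   = (-1) ^ (k + 1) * (deriv ^^ k) (\<lambda>z. deriv F z / F z) s"
proof -
 define S where "S = U \<inter> {z. Re z > 1}"
 have S: "open S" unfolding S_def by (intro open_Int F open_halfspace_Re_gt)
 have sS: "s \<in> S" using s by (simp add: S_def)
 have nz: "F z \<noteq> 0" if "z \<in> S" for z using that F(3) dirichlet_nonzero[OF f] by (simp add: S_def)
 have dF: "deriv F z = deriv (dirichlet f) z" if z: "z \<in> S" for z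
 proof (rule complex_derivative_transform_within_open[OF _ _ S z])
  show "F holomorphic_on S" using F by (auto simp: S_def intro: holomorphic_on_subset)
  show "dirichlet f holomorphic_on S" using holomorphic_dirichlet[OF abs_conv_cmult_fun[OF f]]
   by (rule holomorphic_on_subset) (auto simp: S_def)
 qed (use F in \<open>auto simp: S_def\<close>)
 have h1: "(\<lambda>z. deriv F z / F z) holomorphic_on S"
  using nz F S by (intro holomorphic_on_divide holomorphic_deriv) (auto simp: S_def intro: holomorphic_on_subset)
 have h2: "dirichlet (\<lambda>n. mangoldt n * f n) holomorphic_on S"
  using holomorphic_dirichlet[OF abs_conv_mangoldt_times[OF f]] by (rule holomorphic_on_subset) (auto simp: S_def)
 have "(deriv ^^ k) (dirichlet (\<lambda>n. mangoldt n * f n)) s = (deriv ^^ k) (\<lambda>z. - (deriv F z / F z)) s"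
 proof (rule higher_deriv_transform_within_open[OF h2 _ S sS])
  show "(\<lambda>z. - (deriv F z / F z)) holomorphic_on S" by (intro holomorphic_intros h1)
  fix z assume z: "z \<in> S"
  show "dirichlet (\<lambda>n. mangoldt n * f n) z = - (deriv F z / F z)"
   using dirichlet_mangoldt_eq[OF f, of z] z dF[OF z] F(3) by (simp add: S_def)
 qed
 also have "\<dots> = - (deriv ^^ k) (\<lambda>z. deriv F z / F z) s"
  using higher_deriv_uminus[OF h1 S sS] by simp
 finally show ?thesis
  using higher_deriv_dirichlet[OF abs_conv_mangoldt_times[OF f] s(2), of k]
  by (cases "even k") (auto simp: minus_equation_iff)
qed

lemma mangoldt_dirichlet_bound:
 assumes \<epsilon>: "\<epsilon> > 0"
 obtains C where "C \<ge> 0" "\<And>q \<phi> s. nonprincipal q \<phi> \<Longrightarrow> 1 < Re s \<Longrightarrow> Re s \<le> 2 \<Longrightarrow> defect q \<phi> > 0 \<Longrightarrow>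
  norm (dirichlet (\<lambda>n. mangoldt n * \<phi> n * cln n ^ k) s)
   \<le> C * (real q * (\<bar>Im s\<bar> + 2)) powr \<epsilon> / defect q \<phi> ^ (k + 1)"
proof -
 \<comment> \<open>With \<open>X = T powr (2 * \<eta>)\<close> one factor comes from the upper and
   five from the lower bound, so \<open>X ^ 6\<close> enters to the power \<open>k + 1\<close>; this
   \<eta> keeps the result below \<open>T powr \<epsilon>\<close>.\<close>
 define \<eta> where "\<eta> = min (1/2) (\<epsilon> / (12 * real (k + 1)))"
 have \<eta>: "0 < \<eta>" "\<eta> \<le> 1/2" "12 * real (k + 1) * \<eta> \<le> \<epsilon>"
 proof -
  show "0 < \<eta>" using \<epsilon> by (simp add: \<eta>_def)
  show "\<eta> \<le> 1/2" unfolding \<eta>_def by (rule min.cobounded1)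
  have "\<eta> \<le> \<epsilon> / (12 * real (k + 1))" by (simp add: \<eta>_def)
  then show "12 * real (k + 1) * \<eta> \<le> \<epsilon>" by (simp add: field_simps)
 qed
 obtain K where K: "K \<ge> 1" "\<And>q f t z. 1 \<le> q \<Longrightarrow> bounded_sums q f \<Longrightarrow> 1 - \<eta> \<le> Re z \<Longrightarrow> Re z \<le> 3 \<Longrightarrow> \<bar>Im z - t\<bar> \<le> 1 \<Longrightarrow>
  norm (Lfun f z) \<le> K * (q * (\<bar>t\<bar> + 2)) powr (2 * \<eta>)" using Lfun_growth[OF \<eta>(1,2)] by blast
 obtain c where c: "c > 0" "\<And>q \<phi> s. nonprincipal q \<phi> \<Longrightarrow> 1 < Re s \<Longrightarrow> Re s \<le> 2 \<Longrightarrow> defect q \<phi> > 0 \<Longrightarrow>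
  c * defect q \<phi> / ((real q * (\<bar>Im s\<bar> + 2)) powr (2 * \<eta>)) ^ 5 \<le> norm (Lfun \<phi> s)" using Lfun_lower[OF \<eta>(1,2)] by blast
 define C where "C = fact k * (8 * K / (\<eta> * c)) ^ (k + 1)"
 have C0: "C \<ge> 0" using K(1) \<eta> c(1) by (simp add: C_def)
 show ?thesis
 proof (rule that[OF C0])
  fix q \<phi> and s :: complex
  assume np: "nonprincipal q \<phi>" and s: "1 < Re s" "Re s \<le> 2" and d0: "defect q \<phi> > 0"
  note n = nonprincipalD[OF np]
  define T where "T = real q * (\<bar>Im s\<bar> + 2)"
  define X where "X = T powr (2 * \<eta>)"
  define l where "l = defect q \<phi>"
  have T1: "T \<ge> 1" using mult_mono[of 1 "real q" 1 "\<bar>Im s\<bar> + 2"] n(6) by (simp add: T_def)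
  then have X1: "X \<ge> 1" unfolding X_def using \<eta> by (intro ge_one_powr_ge_zero) auto
  have hol: "Lfun \<phi> holomorphic_on {s. Re s > 0}" by (rule holomorphic_Lfun[OF n(4)])
  have reg: "1 - \<eta> \<le> Re z \<and> Re z \<le> 3 \<and> \<bar>Im z - Im s\<bar> \<le> 1" if "z \<in> ball s \<eta>" for z
  proof -
   have "norm (z - s) < \<eta>" using that by (simp add: dist_norm norm_minus_commute)
   then have "\<bar>Re z - Re s\<bar> < \<eta>" "\<bar>Im z - Im s\<bar> < \<eta>"
    using abs_Re_le_cmod[of "z - s"] abs_Im_le_cmod[of "z - s"] by auto
   then show ?thesis using s \<eta> by (intro conjI; linarith)
  qed
  have hol2: "Lfun \<phi> holomorphic_on ball s \<eta>"
  proof (rule holomorphic_on_subset[OF hol])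
   show "ball s \<eta> \<subseteq> {s. 0 < Re s}" using reg \<eta> by fastforce
  qed
  have m: "0 < c * l / X ^ 5" using c(1) d0 X1 by (simp add: l_def)
  have "norm ((deriv ^^ k) (\<lambda>z. deriv (Lfun \<phi>) z / Lfun \<phi> z) s) \<le> fact k * (8 * (K * X) / (\<eta> * (c * l / X ^ 5))) ^ (k + 1)"
  proof (rule log_deriv_bound[OF hol2 \<eta>(1) _ m])
   show "norm (Lfun \<phi> z) \<le> K * X" if "z \<in> ball s \<eta>" for z
    unfolding X_def T_def using K(2)[OF n(6) n(4)] reg[OF that] by blast
   show "c * l / X ^ 5 \<le> norm (Lfun \<phi> s)" unfolding X_def T_def l_def by (rule c(2)[OF np s d0])
  qed
  also have "\<dots> = C * (X ^ 6) ^ (k + 1) / l ^ (k + 1)"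
  proof -
   have "8 * (K * X) / (\<eta> * (c * l / X ^ 5)) = 8 * K / (\<eta> * c) * X ^ 6 / l"
    using X1 by (simp add: eval_nat_numeral)
   moreover have "fact k * (Y * Z / l) ^ (k + 1) = fact k * Y ^ (k + 1) * Z ^ (k + 1) / l ^ (k + 1)" for Y Z :: real
    by (simp only: power_mult_distrib power_divide times_divide_eq_right mult.assoc)
   ultimately show ?thesis unfolding C_def by metis
  qed
  also have "(X ^ 6) ^ (k + 1) = T powr (12 * real (k + 1) * \<eta>)"
   using T1 X1 by (simp add: X_def powr_powr powr_realpow[symmetric] power_mult[symmetric] del: powr_realpow) (simp add: algebra_simps powr_add)
  also have "C * T powr (12 * real (k + 1) * \<eta>) / l ^ (k + 1) \<le> C * T powr \<epsilon> / l ^ (k + 1)"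
   using C0 T1 \<eta>(3) d0 by (intro divide_right_mono mult_left_mono powr_mono) (auto simp: l_def)
  finally have "norm ((deriv ^^ k) (\<lambda>z. deriv (Lfun \<phi>) z / Lfun \<phi> z) s) \<le> C * T powr \<epsilon> / l ^ (k + 1)" .
  moreover have "dirichlet (\<lambda>n. mangoldt n * \<phi> n * cln n ^ k) s
   = (-1) ^ (k + 1) * (deriv ^^ k) (\<lambda>z. deriv (Lfun \<phi>) z / Lfun \<phi> z) s"
   by (rule higher_deriv_mangoldt_dirichlet[OF n(5) open_halfspace_Re_gt[of 0] hol])
     (use Lfun_eq_dirichlet[OF n(4)] s in auto)
  ultimately show "norm (dirichlet (\<lambda>n. mangoldt n * \<phi> n * cln n ^ k) s)
   \<le> C * (real q * (\<bar>Im s\<bar> + 2)) powr \<epsilon> / defect q \<phi> ^ (k + 1)"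
   by (simp add: norm_mult norm_power T_def l_def)
 qed
qed

text \<open>Up to sign the \<open>k\<close>-th derivative of
  \<open>- \<zeta>'/\<zeta> - \<zeta>\<close>, in which the two simple poles at 1 cancel.\<close>

abbreviation mangoldt_error :: "nat \<Rightarrow> complex \<Rightarrow> complex" where
 "mangoldt_error k \<equiv> dirichlet (\<lambda>n. (mangoldt n - 1) * cln n ^ k)"

lemma zeta1_quotient_bound:
 assumes \<eta>: "0 < \<eta>" "\<eta> \<le> 1/2" and \<rho>: "0 < \<rho>"
 obtains K where "K \<ge> 1" "\<And>t z. 1 - \<eta> \<le> Re z \<Longrightarrow> Re z \<le> 3 \<Longrightarrow> \<bar>Im z - t\<bar> \<le> 1 \<Longrightarrow> \<rho> \<le> norm (z - 1) \<Longrightarrow>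
  norm (zeta1 z / (z - 1)) \<le> K * (\<bar>t\<bar> + 2) powr (2 * \<eta>)"
proof -
 obtain K2 where K2: "K2 \<ge> 1" "\<And>t z. 1 - \<eta> \<le> Re z \<Longrightarrow> Re z \<le> 3 \<Longrightarrow> \<bar>Im z - t\<bar> \<le> 1 \<Longrightarrow>
  norm (zeta1 z) \<le> K2 * (norm (z - 1) + 1) * (\<bar>t\<bar> + 2) powr (2 * \<eta>)" using zeta1_growth[OF \<eta>] by blast
 have "1 * 1 \<le> K2 * (1 + 1 / \<rho>)" using K2(1) \<rho> by (intro mult_mono) auto
 then have K: "K2 * (1 + 1 / \<rho>) \<ge> 1" by simp
 show ?thesis
 proof (rule that[OF K])
  fix t and z :: complex
  assume z: "1 - \<eta> \<le> Re z" "Re z \<le> 3" "\<bar>Im z - t\<bar> \<le> 1" "\<rho> \<le> norm (z - 1)"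
  define X where "X = (\<bar>t\<bar> + 2) powr (2 * \<eta>)"
  have X: "X \<ge> 0" by (simp add: X_def)
  have p: "norm (z - 1) > 0" using z \<rho> by linarith
  have "norm (zeta1 z / (z - 1)) \<le> K2 * (norm (z - 1) + 1) * X / norm (z - 1)"
   unfolding norm_divide X_def using K2(2)[OF z(1-3)] by (intro divide_right_mono) auto
  also have "\<dots> = K2 * X * (1 + 1 / norm (z - 1))" using p by (simp add: field_simps)
  also have "\<dots> \<le> K2 * X * (1 + 1 / \<rho>)"
   using z \<rho> K2(1) X by (intro mult_left_mono add_left_mono frac_le) auto
  finally show "norm (zeta1 z / (z - 1)) \<le> K2 * (1 + 1 / \<rho>) * (\<bar>t\<bar> + 2) powr (2 * \<eta>)"
   by (simp add: X_def mult_ac)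
 qed
qed

text \<open>For \<open>|t| < \<rho>\<close> the distance condition forces
  \<open>Re s - 1 \<ge> \<rho>\<close> and the trivial lower bound applies. Otherwise the heights
  \<open>t\<close> and \<open>2 t\<close> both keep away from the pole, and the 3-4-1 inequality is
  used with both functions equal to 1.\<close>

lemma zeta_far_lower:
 assumes \<eta>: "0 < \<eta>" "\<eta> \<le> 1/2" and \<rho>: "0 < \<rho>" "\<rho> \<le> 1/2"
 obtains c where "c > 0" "\<And>s. 1 < Re s \<Longrightarrow> Re s \<le> 2 \<Longrightarrow> 2 * \<rho> \<le> norm (s - 1) \<Longrightarrow>
  c / ((\<bar>Im s\<bar> + 2) powr (2 * \<eta>)) ^ 4 \<le> norm (dirichlet (\<lambda>_. 1) s)"
proof -
 obtain K where K: "K \<ge> 1" "\<And>t z. 1 - \<eta> \<le> Re z \<Longrightarrow> Re z \<le> 3 \<Longrightarrow> \<bar>Im z - t\<bar> \<le> 1 \<Longrightarrow> \<rho> / 2 \<le> norm (z - 1) \<Longrightarrow>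
  norm (zeta1 z / (z - 1)) \<le> K * (\<bar>t\<bar> + 2) powr (2 * \<eta>)"
  using zeta1_quotient_bound[OF \<eta>, of "\<rho> / 2"] \<rho> by auto
 define r where "r = min \<eta> \<rho> / 2"
 have r: "r > 0" "r \<le> \<eta>" "r \<le> \<rho> / 2" "r \<le> 1/4" using \<eta> \<rho> unfolding r_def by linarith+
 define a where "a = K / r"
 have a1: "a \<ge> 1" using r K(1) by (simp add: a_def field_simps)
 define c where "c = min (\<rho> / 2) (1 / (128 * a ^ 3 * (2 * K)))"
 have c0: "c > 0" using \<rho> a1 K(1) by (simp add: c_def)
 have eqd: "zeta1 z / (z - 1) = dirichlet (\<lambda>_. 1) z" if "Re z > 1" for z
  using zeta1_eq_dirichlet[OF that] that by (cases "z = 1") auto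
 define S where "S = {z::complex. Re z > 0} - {1}"
 have S: "open S" unfolding S_def by (intro open_Diff open_halfspace_Re_gt) auto
 have hol: "(\<lambda>z. zeta1 z / (z - 1)) holomorphic_on S"
  unfolding S_def by (intro holomorphic_intros holomorphic_on_subset[OF holomorphic_zeta1]) auto
 show ?thesis
 proof (rule that[OF c0])
  fix s :: complex
  assume s: "1 < Re s" "Re s \<le> 2" "2 * \<rho> \<le> norm (s - 1)"
  define t where "t = Im s"
  define X where "X = (\<bar>t\<bar> + 2) powr (2 * \<eta>)"
  have X1: "X \<ge> 1" unfolding X_def using \<eta> by (intro ge_one_powr_ge_zero) auto
  have "c / X ^ 4 \<le> norm (dirichlet (\<lambda>_. 1) s)"
  proof (cases "\<bar>t\<bar> < \<rho>")
   case True
   have "norm (s - 1) \<le> \<bar>Re (s - 1)\<bar> + \<bar>Im (s - 1)\<bar>" by (rule cmod_le)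
   then have "\<rho> \<le> Re s - 1" using True s by (simp add: t_def)
   then have "\<rho> / 2 \<le> (Re s - 1) / 2" by simp
   also have "\<dots> \<le> norm (dirichlet (\<lambda>_. 1) s)"
    by (rule norm_dirichlet_trivial_lower[OF cmult_const_1 s(1,2)])
   finally have "\<rho> / 2 \<le> norm (dirichlet (\<lambda>_. 1) s)" .
   moreover have "c \<le> \<rho> / 2" by (simp add: c_def)
   moreover have "c / X ^ 4 \<le> c / 1" using X1 c0 by (intro divide_left_mono) (auto simp: one_le_power)
   ultimately show ?thesis by linarith
  next
   case False
   have lipd: "norm (dirichlet (\<lambda>_. 1) (Complex \<sigma> t) - dirichlet (\<lambda>_. 1) (Complex \<sigma>' t)) \<le> a * X * \<bar>\<sigma> - \<sigma>'\<bar>"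
    if sg: "1 < \<sigma>" "\<sigma> \<le> 2" "1 < \<sigma>'" "\<sigma>' \<le> 2" for \<sigma> \<sigma>'
   proof -
    let ?B = "cbox (Complex 1 t) (Complex 2 t)"
    define D where "D z = zeta1 z / (z - 1)" for z
    have c: "1 - \<eta> \<le> Re v \<and> Re v \<le> 3 \<and> \<bar>Im v - t\<bar> \<le> 1 \<and> \<rho> / 2 \<le> norm (v - 1)" if "u \<in> ?B" "v \<in> cball u r" for u v
    proof -
     have u: "1 \<le> Re u" "Re u \<le> 2" "Im u = t" using that(1) by (auto simp: in_cbox_complex_iff)
     have "\<bar>Im (v - 1)\<bar> \<le> norm (v - 1)" by (rule abs_Im_le_cmod)
     then have "\<rho> / 2 \<le> norm (v - 1)" using cball_Re_Im[OF that(2)] u r False by simp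
     then show ?thesis using cball_Re_Im[OF that(2)] u r \<eta> by (intro conjI; linarith)
    qed
    have "norm (D (Complex \<sigma> t) - D (Complex \<sigma>' t)) \<le> K * X / r * norm (Complex \<sigma> t - Complex \<sigma>' t)"
    proof (rule lipschitz_holomorphic[OF hol[folded D_def] S convex_box(1) r(1)])
     show "cball u r \<subseteq> S" if "u \<in> ?B" for u
     proof
      fix v assume "v \<in> cball u r"
      then have "Re v > 0" "norm (v - 1) > 0" using c[OF that, of v] \<eta> \<rho> by linarith+
      then show "v \<in> S" by (auto simp: S_def)
     qed
     show "norm (D w) \<le> K * X" if "u \<in> ?B" "w \<in> cball u r" for u w
      unfolding D_def X_def using K(2) c[OF that] by blast
    qed (use sg in \<open>auto simp: in_cbox_complex_iff\<close>)
    then show ?thesis using sg by (simp add: D_def eqd a_def cmod_eq_Re)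
   qed
   have aX: "a * X \<ge> 1" using mult_mono[of 1 a 1 X] a1 X1 by simp
   have KX: "2 * K * X \<ge> 1" using mult_mono[of 1 K 1 X] K(1) X1 by simp
   have B: "norm (dirichlet (\<lambda>_. 1) (Complex \<sigma> (2 * t))) \<le> 2 * K * X" if sg: "1 < \<sigma>" "\<sigma> \<le> 2" for \<sigma>
   proof -
    define z where "z = Complex \<sigma> (2 * t)"
    have nz: "norm (z - 1) \<ge> \<rho> / 2" using abs_Im_le_cmod[of "z - 1"] False \<rho> by (simp add: z_def)
    have "norm (zeta1 z / (z - 1)) \<le> K * (\<bar>2 * t\<bar> + 2) powr (2 * \<eta>)"
     by (rule K(2)) (use sg \<eta> nz in \<open>auto simp: z_def\<close>)
    also have "\<dots> \<le> K * (2 * (\<bar>t\<bar> + 2) powr (2 * \<eta>))"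
     using \<eta> K(1) by (intro mult_left_mono two_powr_le) auto
    finally show ?thesis using sg by (simp add: eqd z_def X_def)
   qed
   have nn: "0 \<le> 3 + 4 * Re (1 * u) + Re (1 * u ^ 2)" if "norm u = 1" for u :: complex
    using three_four_one_trig[of u] that by simp
   have "1 / (128 * (a * X) ^ 3 * (2 * K * X)) \<le> norm (dirichlet (\<lambda>_. 1) (Complex (Re s) t))"
    by (rule three_four_one_lower[OF cmult_const_1 cmult_const_1 nn KX B aX lipd s(1,2)])
   moreover have "1 / (128 * (a * X) ^ 3 * (2 * K * X)) = (1 / (128 * a ^ 3 * (2 * K))) / X ^ 4"
    by (simp add: power_mult_distrib power3_eq_cube power4_eq_xxxx)
   moreover have "c / X ^ 4 \<le> (1 / (128 * a ^ 3 * (2 * K))) / X ^ 4"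
    using X1 by (intro divide_right_mono) (auto simp: c_def)
   ultimately have "c / X ^ 4 \<le> norm (dirichlet (\<lambda>_. 1) (Complex (Re s) t))" by linarith
   then show ?thesis by (simp add: t_def)
  qed
  then show "c / ((\<bar>Im s\<bar> + 2) powr (2 * \<eta>)) ^ 4 \<le> norm (dirichlet (\<lambda>_. 1) s)" by (simp add: X_def t_def)
 qed
qed

text \<open>Away from the pole no cancellation is called for: the part with
  \<open>\<zeta>'/\<zeta>\<close> is estimated by \<open>log_deriv_bound\<close>, the part with
  \<zeta> by Cauchy's inequality.\<close>

lemma zeta_far_bound:
 assumes \<epsilon>: "\<epsilon> > 0" and \<rho>: "0 < \<rho>" "\<rho> \<le> 1/2"
 obtains C where "C \<ge> 0" "\<And>s. 1 < Re s \<Longrightarrow> Re s \<le> 2 \<Longrightarrow> 2 * \<rho> \<le> norm (s - 1) \<Longrightarrow>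
  norm (mangoldt_error k s) \<le> C * (\<bar>Im s\<bar> + 2) powr \<epsilon>"
proof -
 define \<eta> where "\<eta> = min (1/2) (\<epsilon> / (10 * real (k + 1)))"
 have \<eta>: "0 < \<eta>" "\<eta> \<le> 1/2" "10 * real (k + 1) * \<eta> \<le> \<epsilon>"
 proof -
  show "0 < \<eta>" using \<epsilon> by (simp add: \<eta>_def)
  show "\<eta> \<le> 1/2" unfolding \<eta>_def by (rule min.cobounded1)
  have "\<eta> \<le> \<epsilon> / (10 * real (k + 1))" by (simp add: \<eta>_def)
  then show "10 * real (k + 1) * \<eta> \<le> \<epsilon>" by (simp add: field_simps)
 qed
 obtain c where c: "c > 0" "\<And>s. 1 < Re s \<Longrightarrow> Re s \<le> 2 \<Longrightarrow> 2 * \<rho> \<le> norm (s - 1) \<Longrightarrow>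
  c / ((\<bar>Im s\<bar> + 2) powr (2 * \<eta>)) ^ 4 \<le> norm (dirichlet (\<lambda>_. 1) s)" using zeta_far_lower[OF \<eta>(1,2) \<rho>] by blast
 obtain K where K: "K \<ge> 1" "\<And>t z. 1 - \<eta> \<le> Re z \<Longrightarrow> Re z \<le> 3 \<Longrightarrow> \<bar>Im z - t\<bar> \<le> 1 \<Longrightarrow> \<rho> \<le> norm (z - 1) \<Longrightarrow>
  norm (zeta1 z / (z - 1)) \<le> K * (\<bar>t\<bar> + 2) powr (2 * \<eta>)"
  using zeta1_quotient_bound[OF \<eta>(1,2) \<rho>(1)] by blast
 define R where "R = min \<eta> \<rho>"
 have R: "R > 0" "R \<le> \<eta>" "R \<le> \<rho>" using \<eta> \<rho> by (auto simp: R_def)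
 define C1 where "C1 = fact k * (8 * K / (R * c)) ^ (k + 1)"
 define C2 where "C2 = fact k * K / (R / 2) ^ k"
 have C0: "C1 \<ge> 0" "C2 \<ge> 0" using K(1) R c(1) by (simp_all add: C1_def C2_def)
 define D where "D z = zeta1 z / (z - 1)" for z
 have eqd: "D z = dirichlet (\<lambda>_. 1) z" if "Re z > 1" for z
  using zeta1_eq_dirichlet[OF that] that unfolding D_def by (cases "z = 1") auto
 define S where "S = {z::complex. Re z > 0} - {1}"
 have S: "open S" unfolding S_def by (intro open_Diff open_halfspace_Re_gt) auto
 have hol: "D holomorphic_on S"
  unfolding S_def D_def[abs_def] by (intro holomorphic_intros holomorphic_on_subset[OF holomorphic_zeta1]) auto
 show ?thesis
 proof (rule that[of "C1 + C2"])
  show "C1 + C2 \<ge> 0" using C0 by simp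
  fix s :: complex
  assume s: "1 < Re s" "Re s \<le> 2" "2 * \<rho> \<le> norm (s - 1)"
  define T where "T = \<bar>Im s\<bar> + 2"
  define X where "X = T powr (2 * \<eta>)"
  have T1: "T \<ge> 1" by (simp add: T_def)
  then have X1: "X \<ge> 1" unfolding X_def using \<eta> by (intro ge_one_powr_ge_zero) auto
  have reg: "1 - \<eta> \<le> Re z \<and> Re z \<le> 3 \<and> \<bar>Im z - Im s\<bar> \<le> 1 \<and> \<rho> \<le> norm (z - 1)" if "z \<in> ball s R" for z
  proof -
   have zs: "norm (z - s) < R" using that by (simp add: dist_norm norm_minus_commute)
   then have "\<bar>Re z - Re s\<bar> < R" "\<bar>Im z - Im s\<bar> < R"
    using abs_Re_le_cmod[of "z - s"] abs_Im_le_cmod[of "z - s"] by auto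
   moreover have "norm (s - 1) \<le> norm (z - 1) + norm (z - s)" by norm
   ultimately show ?thesis using s \<eta> R zs by (intro conjI; linarith)
  qed
  have subS: "ball s R \<subseteq> S"
  proof
   fix v assume "v \<in> ball s R"
   then have "Re v > 0" "norm (v - 1) > 0" using reg[of v] \<eta> \<rho> by linarith+
   then show "v \<in> S" by (auto simp: S_def)
  qed
  have hol2: "D holomorphic_on ball s R" by (rule holomorphic_on_subset[OF hol subS])
  have Db: "norm (D z) \<le> K * X" if "z \<in> ball s R" for z
   unfolding X_def T_def D_def using K(2) reg[OF that] by blast
  have sS: "s \<in> S" using subS R by auto
  have m: "0 < c / X ^ 4" using c(1) X1 by simp
  have Xk: "X \<le> (X ^ 5) ^ (k + 1)"
   using power_increasing[of 1 "5 * (k + 1)" X] X1 unfolding power_mult[symmetric] by simp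
  have Xe: "(X ^ 5) ^ (k + 1) \<le> T powr \<epsilon>"
  proof -
   have "(X ^ 5) ^ (k + 1) = T powr (10 * real (k + 1) * \<eta>)"
    using T1 X1 by (simp add: X_def powr_powr powr_realpow[symmetric] power_mult[symmetric] del: powr_realpow) (simp add: algebra_simps powr_add)
   also have "\<dots> \<le> T powr \<epsilon>" using T1 \<eta>(3) by (intro powr_mono) auto
   finally show ?thesis .
  qed
  have "norm ((deriv ^^ k) (\<lambda>z. deriv D z / D z) s) \<le> fact k * (8 * (K * X) / (R * (c / X ^ 4))) ^ (k + 1)"
  proof (rule log_deriv_bound[OF hol2 R(1) Db m])
   show "c / X ^ 4 \<le> norm (D s)" unfolding X_def T_def eqd[OF s(1)] by (rule c(2)[OF s])
  qed
  also have "\<dots> = C1 * (X ^ 5) ^ (k + 1)"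
  proof -
   have "8 * (K * X) / (R * (c / X ^ 4)) = 8 * K / (R * c) * X ^ 5" using X1 by (simp add: eval_nat_numeral)
   moreover have "fact k * (Y * Z) ^ (k + 1) = fact k * Y ^ (k + 1) * Z ^ (k + 1)" for Y Z :: real
    by (simp only: power_mult_distrib mult.assoc)
   ultimately show ?thesis unfolding C1_def by metis
  qed
  also have "\<dots> \<le> C1 * T powr \<epsilon>" using C0 Xe by (intro mult_left_mono) auto
  finally have 1: "norm ((deriv ^^ k) (\<lambda>z. deriv D z / D z) s) \<le> C1 * T powr \<epsilon>" .
  have "norm ((deriv ^^ k) D s) \<le> fact k * (K * X) / (R / 2) ^ k"
  proof (rule Cauchy_inequality)
   have sub2: "cball s (R / 2) \<subseteq> ball s R" using R by auto
   show "D holomorphic_on ball s (R / 2)" by (rule holomorphic_on_subset[OF hol2]) (use R in auto)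
   show "continuous_on (cball s (R / 2)) D"
    using holomorphic_on_imp_continuous_on[OF hol2] sub2 by (rule continuous_on_subset)
   show "norm (D z) \<le> K * X" if "norm (s - z) = R / 2" for z
    by (rule Db) (use that R in \<open>auto simp: dist_norm\<close>)
  qed (use R in auto)
  also have "\<dots> = C2 * X" by (simp add: C2_def)
  also have "\<dots> \<le> C2 * T powr \<epsilon>" using C0 Xe Xk by (intro mult_left_mono) linarith+
  finally have 2: "norm ((deriv ^^ k) D s) \<le> C2 * T powr \<epsilon>" .
  have e1: "dirichlet (\<lambda>n. mangoldt n * 1 * cln n ^ k) s = (-1) ^ (k + 1) * (deriv ^^ k) (\<lambda>z. deriv D z / D z) s"
   by (rule higher_deriv_mangoldt_dirichlet[OF cmult_const_1 S hol eqd sS s(1)])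
  have "(deriv ^^ k) D s = (deriv ^^ k) (dirichlet (\<lambda>_. 1)) s"
  proof (rule higher_deriv_transform_within_open)
   show "open {z. Re z > 1}" by (rule open_halfspace_Re_gt)
   show "D holomorphic_on {z. Re z > 1}" by (rule holomorphic_on_subset[OF hol]) (auto simp: S_def)
   show "dirichlet (\<lambda>_. 1) holomorphic_on {z. Re z > 1}" by (rule holomorphic_dirichlet[OF abs_conv_const])
  qed (use s eqd in auto)
  also have "\<dots> = (-1) ^ k * dirichlet (\<lambda>n. 1 * cln n ^ k) s"
   by (rule higher_deriv_dirichlet[OF abs_conv_const s(1)])
  finally have e2: "norm (dirichlet (\<lambda>n. 1 * cln n ^ k) s) = norm ((deriv ^^ k) D s)"
   by (simp add: norm_mult norm_power)
  have "mangoldt_error k s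
    = dirichlet (\<lambda>n. mangoldt n * 1 * cln n ^ k - 1 * cln n ^ k) s"
   by (simp add: left_diff_distrib)
  also have "\<dots> = dirichlet (\<lambda>n. mangoldt n * 1 * cln n ^ k) s - dirichlet (\<lambda>n. 1 * cln n ^ k) s"
   by (intro dirichlet_diff abs_conv_ln_power abs_conv_const abs_conv_mangoldt_times[OF cmult_const_1] s(1))
  finally have "norm (mangoldt_error k s)
    \<le> norm ((deriv ^^ k) (\<lambda>z. deriv D z / D z) s) + norm ((deriv ^^ k) D s)"
   using norm_triangle_ineq4[of "dirichlet (\<lambda>n. mangoldt n * 1 * cln n ^ k) s" "dirichlet (\<lambda>n. 1 * cln n ^ k) s"]
   unfolding e2 unfolding e1 by (simp add: norm_mult norm_power)
  then show "norm (mangoldt_error k s) \<le> (C1 + C2) * (\<bar>Im s\<bar> + 2) powr \<epsilon>"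
   using 1 2 by (simp add: T_def distrib_right)
 qed
qed

lemma norm_minus_one_power_mult: "norm ((-1) ^ k * x) = norm x" for x :: complex
 by (simp add: norm_mult norm_power)

text \<open>With \<open>zeta1 = (z - 1) \<zeta>\<close> the difference
  \<open>- \<zeta>'/\<zeta> - \<zeta>\<close> becomes
  \<open>- zeta1'/zeta1 - (zeta1 - 1) / (z - 1)\<close>, which is holomorphic near 1 since
  \<open>zeta1 1 = 1\<close>; compactness then bounds each derivative. The radius comes from the
  nonvanishing of \<open>zeta1\<close> and serves all \<open>k\<close> at once.\<close>

lemma zeta_near_bound:
 obtains \<rho> where "0 < \<rho>" "\<rho> \<le> 1/2" "\<And>k. \<exists>C. \<forall>s. 1 < Re s \<longrightarrow> norm (s - 1) \<le> 2 * \<rho> \<longrightarrow>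
  norm (mangoldt_error k s) \<le> C"
proof -
 have op0: "open {s::complex. Re s > 0}" by (rule open_halfspace_Re_gt)
 have "isCont zeta1 1"
  using holomorphic_on_imp_continuous_on[OF holomorphic_zeta1] op0 by (simp add: continuous_on_eq_continuous_at)
 then obtain d where d: "d > 0" "\<And>z. dist 1 z < d \<Longrightarrow> zeta1 z \<noteq> 0"
  using continuous_at_avoid[of 1 zeta1 0] zeta1_1 by auto
 define \<rho> where "\<rho> = min d (1/2) / 4"
 have \<rho>: "0 < \<rho>" "\<rho> \<le> 1/8" "4 * \<rho> \<le> d" using d(1) by (auto simp: \<rho>_def)
 define U where "U = ball (1::complex) (4 * \<rho>)"
 have U: "open U" by (simp add: U_def)
 have U0: "U \<subseteq> {s. Re s > 0}"
 proof
  fix z assume "z \<in> U"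
  then have "norm (1 - z) < 1/2" using \<rho> by (simp add: U_def dist_norm)
  then show "z \<in> {s. Re s > 0}" using abs_Re_le_cmod[of "1 - z"] by simp
 qed
 have nz: "zeta1 z \<noteq> 0" if "z \<in> U" for z using d(2)[of z] that \<rho> by (simp add: U_def)
 have hz: "zeta1 holomorphic_on U" by (rule holomorphic_on_subset[OF holomorphic_zeta1 U0])
 define P where "P = (\<lambda>z. if z = 1 then deriv zeta1 1 else (zeta1 z - zeta1 1) / (z - 1))"
 define G where "G = (\<lambda>z. - (deriv zeta1 z / zeta1 z) - P z)"
 have hG: "G holomorphic_on U"
  unfolding G_def P_def using nz by (intro holomorphic_intros pole_lemma_open hz U holomorphic_deriv) auto
 define V where "V = U \<inter> {z. Re z > 1}"
 have V: "open V" unfolding V_def by (intro open_Int U open_halfspace_Re_gt)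
 have ac: "abs_conv (\<lambda>n. mangoldt n - 1)"
  using abs_conv_diff[OF abs_conv_mangoldt_times[OF cmult_const_1] abs_conv_const[of 1]] by simp
 have eq: "dirichlet (\<lambda>n. mangoldt n - 1) z = G z" if z: "z \<in> V" for z
 proof -
  have z1: "Re z > 1" using z by (simp add: V_def)
  then have zn: "z \<noteq> 1" by auto
  define E where "E = dirichlet (\<lambda>_. 1)"
  have E0: "E z \<noteq> 0" unfolding E_def by (rule dirichlet_nonzero[OF cmult_const_1 z1])
  have "deriv zeta1 z = deriv (\<lambda>z. (z - 1) * E z) z"
  proof (rule complex_derivative_transform_within_open[OF _ _ V z])
   show "zeta1 holomorphic_on V" by (rule holomorphic_on_subset[OF hz]) (auto simp: V_def)
   show "(\<lambda>z. (z - 1) * E z) holomorphic_on V"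
    unfolding E_def by (intro holomorphic_intros holomorphic_on_subset[OF holomorphic_dirichlet[OF abs_conv_const]]) (auto simp: V_def)
  qed (use zeta1_eq_dirichlet in \<open>auto simp: V_def E_def\<close>)
  also have "\<dots> = E z + (z - 1) * deriv E z"
  proof -
   have "(E has_field_derivative deriv E z) (at z)"
    unfolding E_def using holomorphic_derivI[OF holomorphic_dirichlet[OF abs_conv_const] open_halfspace_Re_gt] z1 by auto
   then have "((\<lambda>z. (z - 1) * E z) has_field_derivative (E z + (z - 1) * deriv E z)) (at z)"
    by (auto intro!: derivative_eq_intros)
   then show ?thesis by (rule DERIV_imp_deriv)
  qed
  finally have dz: "deriv zeta1 z = E z + (z - 1) * deriv E z" .
  have zz: "zeta1 z = (z - 1) * E z" unfolding E_def by (rule zeta1_eq_dirichlet[OF z1])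
  have "G z = - (deriv E z / E z) - E z"
  proof -
   define w where "w = z - 1"
   have w: "w \<noteq> 0" using zn by (simp add: w_def)
   have "G z = - ((E z + w * deriv E z) / (w * E z)) - (w * E z - 1) / w"
    unfolding G_def P_def dz zz zeta1_1 w_def using zn by simp
   also have "\<dots> = - (deriv E z / E z) - E z" using w E0 by (simp add: add_divide_distrib diff_divide_distrib)
   finally show ?thesis .
  qed
  moreover have "dirichlet (\<lambda>n. mangoldt n - 1) z = dirichlet (\<lambda>n. mangoldt n * 1) z - E z"
   unfolding E_def using dirichlet_diff[OF abs_conv_mangoldt_times[OF cmult_const_1] abs_conv_const[of 1] z1] by simp
  moreover have "dirichlet (\<lambda>n. mangoldt n * 1) z = - (deriv E z / E z)"
   unfolding E_def by (rule dirichlet_mangoldt_eq[OF cmult_const_1 z1])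
  ultimately show ?thesis by simp
 qed
 show ?thesis
 proof (rule that[OF \<rho>(1)])
  show "\<rho> \<le> 1/2" using \<rho> by simp
  fix k
  have "continuous_on (cball 1 (2 * \<rho>)) ((deriv ^^ k) G)"
   using holomorphic_on_imp_continuous_on[OF holomorphic_higher_deriv[OF hG U]]
   by (rule continuous_on_subset) (use \<rho> in \<open>auto simp: U_def\<close>)
  then have "compact ((deriv ^^ k) G ` cball 1 (2 * \<rho>))" by (intro compact_continuous_image) auto
  then obtain C where C: "\<And>z. z \<in> cball 1 (2 * \<rho>) \<Longrightarrow> norm ((deriv ^^ k) G z) \<le> C"
   using compact_imp_bounded bounded_iff by (metis imageI)
  have "norm (mangoldt_error k s) \<le> C"
   if s: "1 < Re s" "norm (s - 1) \<le> 2 * \<rho>" for s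
  proof -
   have sV: "s \<in> V" using s \<rho> by (simp add: V_def U_def dist_norm norm_minus_commute)
   have "(deriv ^^ k) (dirichlet (\<lambda>n. mangoldt n - 1)) s = (deriv ^^ k) G s"
   proof (rule higher_deriv_transform_within_open[OF _ _ V sV eq])
    show "dirichlet (\<lambda>n. mangoldt n - 1) holomorphic_on V"
     by (rule holomorphic_on_subset[OF holomorphic_dirichlet[OF ac]]) (auto simp: V_def)
    show "G holomorphic_on V" by (rule holomorphic_on_subset[OF hG]) (auto simp: V_def)
   qed
   then have "(-1) ^ k * mangoldt_error k s = (deriv ^^ k) G s"
    using higher_deriv_dirichlet[OF ac s(1), of k] by simp
   then have "norm (mangoldt_error k s) = norm ((deriv ^^ k) G s)"
    by (metis (no_types, lifting) norm_minus_one_power_mult)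
   also have "\<dots> \<le> C" by (rule C) (use s in \<open>simp add: dist_norm norm_minus_commute\<close>)
   finally show ?thesis .
  qed
  then show "\<exists>C. \<forall>s. 1 < Re s \<longrightarrow> norm (s - 1) \<le> 2 * \<rho> \<longrightarrow>
   norm (mangoldt_error k s) \<le> C" by blast
 qed
qed

lemma zeta_mangoldt_bound:
 assumes \<epsilon>: "\<epsilon> > 0"
 obtains C where "C \<ge> 0" "\<And>s. 1 < Re s \<Longrightarrow> Re s \<le> 2 \<Longrightarrow>
  norm (mangoldt_error k s) \<le> C * (\<bar>Im s\<bar> + 2) powr \<epsilon>"
proof -
 obtain \<rho> where \<rho>: "0 < \<rho>" "\<rho> \<le> 1/2" and near: "\<And>k. \<exists>C. \<forall>s. 1 < Re s \<longrightarrow> norm (s - 1) \<le> 2 * \<rho> \<longrightarrow>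
  norm (mangoldt_error k s) \<le> C" using zeta_near_bound by blast
 obtain C1 where C1: "C1 \<ge> 0" "\<And>s. 1 < Re s \<Longrightarrow> Re s \<le> 2 \<Longrightarrow> 2 * \<rho> \<le> norm (s - 1) \<Longrightarrow>
  norm (mangoldt_error k s) \<le> C1 * (\<bar>Im s\<bar> + 2) powr \<epsilon>"
  using zeta_far_bound[OF \<epsilon> \<rho>] by blast
 obtain C2 where C2: "\<And>s. 1 < Re s \<Longrightarrow> norm (s - 1) \<le> 2 * \<rho> \<Longrightarrow>
  norm (mangoldt_error k s) \<le> C2" using near by blast
 show ?thesis
 proof (rule that[of "max C1 C2"])
  show "max C1 C2 \<ge> 0" using C1(1) by simp
  fix s :: complex assume s: "1 < Re s" "Re s \<le> 2"
  have T1: "(\<bar>Im s\<bar> + 2) powr \<epsilon> \<ge> 1" using \<epsilon> by (intro ge_one_powr_ge_zero) auto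
  show "norm (mangoldt_error k s) \<le> max C1 C2 * (\<bar>Im s\<bar> + 2) powr \<epsilon>"
  proof (cases "norm (s - 1) \<le> 2 * \<rho>")
   case True
   have "norm (mangoldt_error k s) \<le> max C1 C2 * 1"
    using C2[OF s(1) True] by simp
   also have "\<dots> \<le> max C1 C2 * (\<bar>Im s\<bar> + 2) powr \<epsilon>" using C1(1) T1 by (intro mult_left_mono) auto
   finally show ?thesis .
  next
   case False
   have "norm (mangoldt_error k s) \<le> C1 * (\<bar>Im s\<bar> + 2) powr \<epsilon>"
    using C1(2)[OF s] False by simp
   also have "\<dots> \<le> max C1 C2 * (\<bar>Im s\<bar> + 2) powr \<epsilon>" by (intro mult_right_mono) auto
   finally show ?thesis .
  qed
 qed
qed

section \<open>A smoothed Perron formula\<close>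

text \<open>The denominator \<open>s (s + 1)\<close> instead of \<open>s\<close> smooths the cut-off
  to \<open>max 0 (1 - 1 / y)\<close> and decays quadratically, so that a growth of order
  \<open>|t|\<close> to the power 1/2 remains integrable.\<close>

definition perron_kernel :: "real \<Rightarrow> complex \<Rightarrow> complex" where
 "perron_kernel y s = of_real y powr s / (s * (s + 1))"

lemma norm_of_real_powr: "y > 0 \<Longrightarrow> norm (complex_of_real y powr s) = y powr Re s"
 by (subst norm_powr_real_powr) auto

lemma perron_kernel_bound:
 assumes "y > 0" "A > 0" "B > 0" "A \<le> norm s" "B \<le> norm (s + 1)" "y powr Re s \<le> M"
 shows "norm (perron_kernel y s) \<le> M / (A * B)"
 unfolding perron_kernel_def norm_divide norm_mult norm_of_real_powr[OF assms(1)]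
 using assms by (intro frac_le mult_mono) (auto intro: order_trans[OF powr_ge_zero])

lemma isCont_perron_kernel: "y > 0 \<Longrightarrow> s \<noteq> 0 \<Longrightarrow> s \<noteq> -1 \<Longrightarrow> isCont (perron_kernel y) s"
 unfolding perron_kernel_def[abs_def] by (intro continuous_intros) (auto simp: add_eq_0_iff2)

lemma path_image_rectpath':
 "path_image (rectpath (Complex \<rho> u) (Complex \<sigma> v)) =
   {s. Re s \<in> closed_segment \<rho> \<sigma> \<and> Im s \<in> {u, v}} \<union> {s. Re s \<in> {\<rho>, \<sigma>} \<and> Im s \<in> closed_segment u v}"
 by (auto simp: rectpath_def Let_def path_image_join closed_segment_same_Re closed_segment_same_Im closed_segment_commute)

text \<open>Compares the wanted right side of a rectangle with the closed contour; each of the other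
  three sides has length at most \<open>2 * T\<close>.\<close>

lemma rectpath_side_bound:
 assumes cont: "\<And>s. s \<in> path_image (rectpath (Complex \<rho> (-T)) (Complex \<sigma> T)) \<Longrightarrow> isCont f s"
  and B: "\<And>s. Re s \<in> closed_segment \<rho> \<sigma> \<Longrightarrow> \<bar>Im s\<bar> = T \<or> Re s = \<rho> \<Longrightarrow> norm (f s) \<le> B"
  and T: "T > 0" "\<bar>\<sigma> - \<rho>\<bar> \<le> 2 * T"
 shows "norm (contour_integral (linepath (Complex \<sigma> (-T)) (Complex \<sigma> T)) f
      - contour_integral (rectpath (Complex \<rho> (-T)) (Complex \<sigma> T)) f) \<le> 6 * B * T"
proof -
 define a b c d where "a = Complex \<rho> (-T)" and "b = Complex \<sigma> (-T)" and "c = Complex \<sigma> T" and "d = Complex \<rho> T"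
 have int: "f contour_integrable_on linepath u v" if "(u, v) \<in> {(a, b), (b, c), (c, d), (d, a)}" for u v
  by (intro contour_integrable_continuous_linepath continuous_at_imp_continuous_on ballI cont)
    (use that in \<open>auto simp: path_image_rectpath' a_def b_def c_def d_def closed_segment_same_Re closed_segment_same_Im closed_segment_commute\<close>)
 have "0 \<le> norm (f a)" by simp
 also have "\<dots> \<le> B" by (rule B) (simp_all add: a_def)
 finally have B0: "B \<ge> 0" .
 have bd: "norm (contour_integral (linepath u v) f) \<le> B * (2 * T)" if "(u, v) \<in> {(a, b), (c, d), (d, a)}" for u v
 proof (rule order_trans[OF contour_integral_bound_linepath mult_left_mono[OF _ B0]])
  show "f contour_integrable_on linepath u v" using that by (intro int) auto
  show "norm (v - u) \<le> 2 * T" using that T by (auto simp: a_def b_def c_def d_def cmod_eq_Re cmod_eq_Im)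
  show "norm (f s) \<le> B" if "s \<in> closed_segment u v" for s
   by (rule B) (use that \<open>(u, v) \<in> _\<close> T in \<open>auto simp: a_def b_def c_def d_def closed_segment_same_Re closed_segment_same_Im closed_segment_commute\<close>)
 qed (rule B0)
 define I where "I u v = contour_integral (linepath u v) f" for u v
 have "rectpath a c = linepath a b +++ linepath b c +++ linepath c d +++ linepath d a"
  by (simp add: rectpath_def Let_def a_def b_def c_def d_def)
 then have "contour_integral (rectpath a c) f = I a b + (I b c + (I c d + I d a))"
  using int by (simp add: contour_integrable_joinI I_def)
 then have "I b c - contour_integral (rectpath a c) f = - (I a b + (I c d + I d a))" by (simp add: algebra_simps)
 also have "norm \<dots> \<le> B * (2 * T) + (B * (2 * T) + B * (2 * T))"
  unfolding norm_minus_cancel I_def by (intro norm_triangle_mono bd) auto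
 finally show ?thesis by (simp add: I_def a_def b_def c_def mult_ac)
qed

text \<open>For \<open>y \<le> 1\<close> the line is closed to the right, where the kernel is
  holomorphic, otherwise to the left, enclosing the poles 0 and -1 with residues 1 and
  \<open>- 1 / y\<close>.\<close>

lemma perron_kernel_integral:
 assumes y: "0 < y" and \<sigma>: "1 < \<sigma>" "\<sigma> \<le> 2" and T: "T \<ge> 2"
 shows "norm (contour_integral (linepath (Complex \<sigma> (-T)) (Complex \<sigma> T)) (perron_kernel y)
    - 2 * pi * \<i> * of_real (max 0 (1 - 1 / y))) \<le> 12 * y powr \<sigma> / T"
proof -
 define \<rho> where "\<rho> = (if y \<le> 1 then \<sigma> + T else - T)"
 define R where "R = rectpath (Complex \<rho> (-T)) (Complex \<sigma> T)"
 have nz: "s \<noteq> 0 \<and> s \<noteq> -1" if "s \<in> path_image R" for s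
  using that \<sigma> T by (auto simp: R_def path_image_rectpath' \<rho>_def closed_segment_eq_real_ivl split: if_splits)
 have "contour_integral R (perron_kernel y) = 2 * pi * \<i> * of_real (max 0 (1 - 1 / y))"
 proof (cases "y \<le> 1")
  case True
  have img: "path_image R \<subseteq> {s. Re s > 0}"
   using True \<sigma> T by (auto simp: R_def path_image_rectpath' \<rho>_def closed_segment_eq_real_ivl)
  have "perron_kernel y holomorphic_on {s. Re s > 0}"
   unfolding perron_kernel_def[abs_def] using y by (intro holomorphic_intros) (auto simp: add_eq_0_iff2)
  then have "(perron_kernel y has_contour_integral 0) R"
   by (rule Cauchy_theorem_convex_simple) (use img in \<open>auto simp: convex_halfspace_Re_gt R_def\<close>)
  moreover have "max 0 (1 - 1 / y) = 0" using True y by (simp add: max_def field_simps)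
  ultimately show ?thesis by (simp add: contour_integral_unique)
 next
  case False
  have inb: "0 \<in> box (Complex \<rho> (-T)) (Complex \<sigma> T)" "-1 \<in> box (Complex \<rho> (-T)) (Complex \<sigma> T)"
   using \<sigma> T False by (auto simp: \<rho>_def in_box_complex_iff)
  have hol: "(\<lambda>s. complex_of_real y powr s) holomorphic_on UNIV" using y by (intro holomorphic_intros) auto
  have ci: "((\<lambda>w. of_real y powr w / (w - z)) has_contour_integral (2 * pi * \<i> * of_real y powr z)) R"
   if "z = 0 \<or> z = -1" for z
  proof -
   have "winding_number R z = 1" unfolding R_def by (rule winding_number_rectpath) (use inb that in auto)
   then show ?thesis
    using Cauchy_integral_formula_convex_simple[OF convex_UNIV hol, of z R] nz that by (fastforce simp: R_def)
  qed
  \<comment> \<open>Partial fractions turn the kernel into two Cauchy integrals, at 0 and at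
    -1.\<close>
  have "((\<lambda>w. of_real y powr w / (w - 0) - of_real y powr w / (w - (-1))) has_contour_integral
    (2 * pi * \<i> * of_real y powr 0 - 2 * pi * \<i> * of_real y powr (-1))) R"
   by (intro has_contour_integral_diff ci) auto
  then have "(perron_kernel y has_contour_integral
    (2 * pi * \<i> * of_real y powr 0 - 2 * pi * \<i> * of_real y powr (-1))) R"
  proof (rule has_contour_integral_eq)
   fix s assume "s \<in> path_image R"
   then have "s \<noteq> 0" "s + 1 \<noteq> 0" using nz by (auto simp: add_eq_0_iff2)
   then show "of_real y powr s / (s - 0) - of_real y powr s / (s - (-1)) = perron_kernel y s"
    by (simp add: perron_kernel_def field_simps)
  qed
  moreover have "2 * pi * \<i> * of_real y powr 0 - 2 * pi * \<i> * of_real y powr (-1) = 2 * pi * \<i> * of_real (1 - 1 / y)"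
   using y by (simp add: powr_minus right_diff_distrib divide_inverse)
  moreover have "max 0 (1 - 1 / y) = 1 - 1 / y" using False by (simp add: max_def field_simps)
  ultimately show ?thesis by (simp add: contour_integral_unique)
 qed
 moreover have "norm (contour_integral (linepath (Complex \<sigma> (-T)) (Complex \<sigma> T)) (perron_kernel y)
   - contour_integral R (perron_kernel y)) \<le> 6 * (y powr \<sigma> / (T * (T / 2))) * T"
  unfolding R_def
 proof (rule rectpath_side_bound)
  fix s assume s: "Re s \<in> closed_segment \<rho> \<sigma>" "\<bar>Im s\<bar> = T \<or> Re s = \<rho>"
  have "T \<le> norm s" "T / 2 \<le> norm (s + 1)"
   using s(2) \<sigma> T abs_Re_le_cmod[of s] abs_Re_le_cmod[of "s + 1"] abs_Im_le_cmod[of s] abs_Im_le_cmod[of "s + 1"]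
   by (auto simp: \<rho>_def split: if_splits)
  moreover have "y powr Re s \<le> y powr \<sigma>"
   using s(1) y T \<sigma> powr_mono'[of \<sigma> "Re s" y] powr_mono[of "Re s" \<sigma> y]
   by (auto simp: \<rho>_def closed_segment_eq_real_ivl split: if_splits)
  ultimately show "norm (perron_kernel y s) \<le> y powr \<sigma> / (T * (T / 2))" using y T by (intro perron_kernel_bound) auto
 qed (use nz y \<sigma> T in \<open>auto simp: R_def \<rho>_def intro!: isCont_perron_kernel\<close>)
 ultimately show ?thesis using T by (simp add: field_simps)
qed

text \<open>On unit segments at height \<open>j\<close> the integrand is of size \<open>j\<close> to
  the power -3/2, so the truncated integral is bounded independently of the truncation. The error of
  truncating the kernel is \<open>O(1 / M)\<close>, uniformly enough to be summed against the
  absolutely convergent series, and disappears as \<open>M\<close> tends to infinity.\<close>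

lemma perron_bound:
 assumes a: "abs_conv a" and \<sigma>: "1 < \<sigma>" "\<sigma> \<le> 2" and x: "x > 0"
  and B: "\<And>t. norm (dirichlet a (Complex \<sigma> t)) \<le> B * (\<bar>t\<bar> + 2) powr (1/2)"
 shows "norm (\<Sum>n | 0 < n \<and> real n \<le> x. a n * of_real (1 - real n / x)) \<le> 8 * B * x powr \<sigma>"
proof -
 define G where "G s = dirichlet a s * perron_kernel x s" for s
 define I where "I M = contour_integral (linepath (Complex \<sigma> (- real M)) (Complex \<sigma> (real M))) G" for M :: nat
 have B0: "B \<ge> 0"
  using order_trans[OF norm_ge_zero B[of 0]] by (simp add: zero_le_mult_iff)
 have contG: "continuous_on (closed_segment (Complex \<sigma> u) (Complex \<sigma> v)) G" for u v
 proof -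
  have re: "Re s = \<sigma>" if "s \<in> closed_segment (Complex \<sigma> u) (Complex \<sigma> v)" for s
   using that by (simp add: closed_segment_same_Re)
  have "continuous_on (closed_segment (Complex \<sigma> u) (Complex \<sigma> v)) (dirichlet a)"
   using holomorphic_on_imp_continuous_on[OF holomorphic_dirichlet[OF a]]
   by (rule continuous_on_subset) (use re \<sigma> in auto)
  moreover have "continuous_on (closed_segment (Complex \<sigma> u) (Complex \<sigma> v)) (perron_kernel x)"
   using re \<sigma> by (intro continuous_at_imp_continuous_on ballI isCont_perron_kernel x) force+
  ultimately show ?thesis unfolding G_def[abs_def] by (intro continuous_on_mult)
 qed
 \<comment> \<open>With \<open>n = j + 1\<close> both \<open>|s|\<close> and \<open>|s + 1|\<close>
   are at least \<open>n / 2\<close>, and \<open>(|t| + 2)\<close> to the power 1/2 is at most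
   \<open>2 * n powr (1/2)\<close>; hence the factor \<open>4 * 2 = 8\<close>.\<close>
 define b where "b j = 8 * B * x powr \<sigma> * real (Suc j) powr (-(1/2) - 1)" for j
 have unit: "norm (contour_integral (linepath (Complex \<sigma> u) (Complex \<sigma> v)) G) \<le> b j"
  if uv: "v = u + 1" "\<And>t. u \<le> t \<Longrightarrow> t \<le> v \<Longrightarrow> real j \<le> \<bar>t\<bar> \<and> \<bar>t\<bar> \<le> real (Suc j)" for u v j
 proof -
  have "norm (contour_integral (linepath (Complex \<sigma> u) (Complex \<sigma> v)) G) \<le> b j * norm (Complex \<sigma> v - Complex \<sigma> u)"
  proof (rule contour_integral_bound_linepath)
   show "G contour_integrable_on linepath (Complex \<sigma> u) (Complex \<sigma> v)"
    by (rule contour_integrable_continuous_linepath[OF contG])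
   show "0 \<le> b j" using B0 by (simp add: b_def)
   fix s assume s: "s \<in> closed_segment (Complex \<sigma> u) (Complex \<sigma> v)"
   have R: "Re s = \<sigma>" and "u \<le> Im s" "Im s \<le> v"
    using s uv(1) by (auto simp: closed_segment_same_Re closed_segment_eq_real_ivl)
   from uv(2)[OF this(2,3)] have t: "real j \<le> \<bar>Im s\<bar>" "\<bar>Im s\<bar> \<le> real (Suc j)" by auto
   define N where "N = real (Suc j)"
   have N: "N \<ge> 1" by (simp add: N_def)
   have s2: "N / 2 \<le> norm s" "N / 2 \<le> norm (s + 1)"
    using abs_Im_le_cmod[of s] abs_Im_le_cmod[of "s + 1"] abs_Re_le_cmod[of s] abs_Re_le_cmod[of "s + 1"] t(1) R \<sigma>
    by (auto simp: N_def)
   have k: "norm (perron_kernel x s) \<le> x powr \<sigma> / (N / 2 * (N / 2))"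
    by (rule perron_kernel_bound) (use x s2 N R in auto)
   have sC: "s = Complex \<sigma> (Im s)" using R by (simp add: complex_eq_iff)
   have "norm (dirichlet a s) \<le> B * (\<bar>Im s\<bar> + 2) powr (1/2)" using B[of "Im s"] sC by simp
   also have "\<dots> \<le> B * (4 * N) powr (1/2)" using B0 t(2) N by (intro mult_left_mono powr_mono2) (auto simp: N_def)
   also have "(4 * N) powr (1/2) = 2 * N powr (1/2)" using N by (simp add: powr_mult powr_half_sqrt real_sqrt_mult)
   finally have d: "norm (dirichlet a s) \<le> B * (2 * N powr (1/2))" .
   have "norm (G s) \<le> B * (2 * N powr (1/2)) * (x powr \<sigma> / (N / 2 * (N / 2)))"
    unfolding G_def norm_mult using d k B0 by (intro mult_mono) auto
   also have "\<dots> = 8 * B * x powr \<sigma> * (N powr (1/2) / N powr 2)" using N by (simp add: field_simps power2_eq_square)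
   also have "N powr (1/2) / N powr 2 = N powr (-(1/2) - 1)" unfolding powr_diff[symmetric] by simp
   finally show "norm (G s) \<le> b j" by (simp add: b_def N_def)
  qed
  also have "norm (Complex \<sigma> v - Complex \<sigma> u) = 1" using uv(1) by (simp add: cmod_eq_Im)
  finally show ?thesis by simp
 qed
 have seg: "Complex \<sigma> w \<in> closed_segment (Complex \<sigma> u) (Complex \<sigma> v)" if "u \<le> w" "w \<le> v" "u < v" for u v w
  using that by (simp add: closed_segment_same_Re closed_segment_eq_real_ivl)
 have IM: "norm (I M) \<le> (\<Sum>j<M. 2 * b j)" for M
 proof (induction M)
  case (Suc M)
  define A where "A u v = contour_integral (linepath (Complex \<sigma> u) (Complex \<sigma> v)) G" for u v
  have split: "A u v = A u w + A w v" if "u \<le> w" "w \<le> v" "u < v" for u v w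
   unfolding A_def by (rule contour_integral_split_linepath[OF contG seg[OF that]])
  have "I (Suc M) = A (- real (Suc M)) (- real M) + A (- real M) (real (Suc M))"
   unfolding I_def A_def[symmetric] by (rule split) auto
  also have "A (- real M) (real (Suc M)) = I M + A (real M) (real (Suc M))"
   unfolding I_def A_def[symmetric] by (rule split) auto
  finally have "norm (I (Suc M)) \<le> norm (A (- real (Suc M)) (- real M)) + (norm (I M) + norm (A (real M) (real (Suc M))))"
   by (simp only:) (intro order_trans[OF norm_triangle_ineq] add_left_mono norm_triangle_ineq)
  moreover have "norm (A (- real (Suc M)) (- real M)) \<le> b M" unfolding A_def by (rule unit) auto
  moreover have "norm (A (real M) (real (Suc M))) \<le> b M" unfolding A_def by (rule unit) auto
  ultimately show ?case using Suc by simp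
 qed (simp add: I_def)
 have sumb: "(\<Sum>j<M. 2 * b j) \<le> 48 * B * x powr \<sigma>" for M
 proof -
  have sm: "summable (\<lambda>j. real (Suc j) powr (-(1/2) - 1))" by (rule summable_Suc_powr) simp
  have "(\<Sum>j<M. real (Suc j) powr (-(1/2) - 1)) \<le> (\<Sum>j. real (Suc j) powr (-(1/2) - 1))"
   by (rule sum_le_suminf[OF sm]) auto
  also have "\<dots> = 1 + (\<Sum>j. real (Suc (j + 1)) powr (-(1/2) - 1))"
   using suminf_split_initial_segment[OF sm, of 1] by simp
  also have "\<dots> \<le> 3" using tail_sum(2)[of "1/2" 1] by simp
  finally have "(\<Sum>j<M. real (Suc j) powr (-(1/2) - 1)) \<le> 3" .
  then have "16 * B * x powr \<sigma> * (\<Sum>j<M. real (Suc j) powr (-(1/2) - 1)) \<le> 16 * B * x powr \<sigma> * 3"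
   using B0 by (intro mult_left_mono) auto
  then show ?thesis by (simp add: b_def sum_distrib_left mult_ac)
 qed
 define A where "A = (\<Sum>n. norm (a n) * real n powr (-\<sigma>))"
 have smA: "summable (\<lambda>n. norm (a n) * real n powr (-\<sigma>))" using a \<sigma> by (simp add: abs_conv_def)
 define S where "S = (\<Sum>n | 0 < n \<and> real n \<le> x. a n * of_real (1 - real n / x))"
 have main: "norm (2 * pi * \<i> * S) \<le> 48 * B * x powr \<sigma> + 12 * x powr \<sigma> * A / real M" if M: "M \<ge> 2" for M :: nat
 proof -
  let ?L = "linepath (Complex \<sigma> (- real M)) (Complex \<sigma> (real M))"
  let ?C = "closed_segment (Complex \<sigma> (- real M)) (Complex \<sigma> (real M))"
  have re: "Re s = \<sigma>" if "s \<in> ?C" for s using that by (simp add: closed_segment_same_Re)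
  define f where "f n s = a n * of_nat n powr (-s) * perron_kernel x s" for n s
  have fb: "norm (f n s) \<le> norm (a n) * real n powr (-\<sigma>) * x powr \<sigma>" if "s \<in> ?C" for n s
  proof -
   have "norm (perron_kernel x s) \<le> x powr \<sigma> / (1 * 1)"
    by (rule perron_kernel_bound)
      (use x re[OF that] \<sigma> abs_Re_le_cmod[of s] abs_Re_le_cmod[of "s + 1"] in auto)
   then show ?thesis using re[OF that] unfolding f_def norm_mult norm_nat_powr by (intro mult_mono) auto
  qed
  have "uniform_limit ?C (\<lambda>N w. \<Sum>n<N. f n w) (\<lambda>w. \<Sum>n. f n w) sequentially"
   by (rule Weierstrass_m_test[OF fb summable_mult2[OF smA]])
  moreover have "(\<Sum>n. f n w) = G w" if "w \<in> ?C" for w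
  proof -
   have "Re w > 1" using re[OF that] \<sigma> by simp
   from sums_mult2[OF sums_dirichlet[OF a this], of "perron_kernel x w"]
   show ?thesis by (simp add: sums_iff f_def G_def)
  qed
  then have "uniform_limit ?C (\<lambda>N w. \<Sum>n<N. f n w) (\<lambda>w. \<Sum>n. f n w) sequentially
    = uniform_limit ?C (\<lambda>N w. \<Sum>n<N. f n w) G sequentially"
   by (intro uniform_limit_cong') auto
  ultimately have u: "uniform_limit ?C (\<lambda>N w. \<Sum>n<N. f n w) G sequentially" by blast
  have cf: "continuous_on ?C (f n)" for n
  proof (cases "n = 0")
   case False
   have "continuous_on ?C (perron_kernel x)"
    using re \<sigma> by (intro continuous_at_imp_continuous_on ballI isCont_perron_kernel x) force+
   then show ?thesis unfolding f_def[abs_def] using False by (intro continuous_intros) auto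
  qed (simp add: f_def[abs_def])
  obtain J where J: "(G has_contour_integral J) ?L"
   "(\<lambda>n. contour_integral ?L (f n)) sums J"
   using contour_integral_sums_linepath[OF u cf] by blast
  have JI: "J = I M" unfolding I_def using J(1) by (simp add: contour_integral_unique)
  define c where "c n = (if n = 0 then 0 else a n * (2 * pi * \<i> * of_real (max 0 (1 - real n / x))))" for n
  have tm: "norm (contour_integral ?L (f n) - c n)
    \<le> (norm (a n) * real n powr (-\<sigma>)) * (12 * x powr \<sigma> / real M)" for n
  proof (cases "n = 0")
   case True
   then show ?thesis by (simp add: f_def[abs_def] c_def)
  next
   case False
   have fk: "f n = (\<lambda>s. a n * perron_kernel (x / real n) s)"
   proof
    fix s
    have "complex_of_real x powr s = of_real (real n * (x / real n)) powr s" using False by simp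
    also have "\<dots> = of_nat n powr s * of_real (x / real n) powr s"
     unfolding of_real_mult by (subst powr_times_real) (use x in auto)
    finally have "of_nat n powr (-s) * complex_of_real x powr s = of_real (x / real n) powr s"
     using False by (simp add: powr_minus)
    then show "f n s = a n * perron_kernel (x / real n) s" by (simp add: f_def perron_kernel_def)
   qed
   define K where "K = contour_integral ?L (perron_kernel (x / real n))"
   have "perron_kernel (x / real n) contour_integrable_on ?L"
    using x False re \<sigma>
    by (intro contour_integrable_continuous_linepath continuous_at_imp_continuous_on ballI isCont_perron_kernel) force+
   then have "contour_integral ?L (f n) = a n * K"
    unfolding fk K_def by (rule contour_integral_lmul)
   moreover have "c n = a n * (2 * pi * \<i> * of_real (max 0 (1 - 1 / (x / real n))))" using False by (simp add: c_def)
   moreover have "norm (K - 2 * pi * \<i> * of_real (max 0 (1 - 1 / (x / real n)))) \<le> 12 * (x / real n) powr \<sigma> / real M"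
    unfolding K_def by (rule perron_kernel_integral) (use x False \<sigma> M in auto)
   ultimately have "norm (contour_integral ?L (f n) - c n)
     \<le> norm (a n) * (12 * (x / real n) powr \<sigma> / real M)"
    by (simp only: right_diff_distrib[symmetric] norm_mult) (rule mult_left_mono, auto)
   also have "(x / real n) powr \<sigma> = x powr \<sigma> * real n powr (-\<sigma>)"
    using x False by (simp add: powr_divide powr_minus field_simps)
   finally show ?thesis by (simp add: mult_ac)
  qed
  have csum: "c sums (2 * pi * \<i> * S)"
  proof -
   have fin: "finite {n. 0 < n \<and> real n \<le> x}"
    by (rule finite_subset[of _ "{..nat \<lfloor>x\<rfloor>}"]) (auto simp: le_nat_floor)
   have "c sums (\<Sum>n | 0 < n \<and> real n \<le> x. c n)"
    by (rule sums_finite[OF fin]) (use x in \<open>auto simp: c_def max_def field_simps\<close>)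
   also have "(\<Sum>n | 0 < n \<and> real n \<le> x. c n) = 2 * pi * \<i> * S"
    unfolding S_def sum_distrib_left by (rule sum.cong) (use x in \<open>auto simp: c_def max_def field_simps\<close>)
   finally show ?thesis .
  qed
  have "(\<lambda>n. contour_integral ?L (f n) - c n) sums (I M - 2 * pi * \<i> * S)"
   using sums_diff[OF J(2) csum] unfolding JI .
  then have "I M - 2 * pi * \<i> * S = (\<Sum>n. contour_integral ?L (f n) - c n)"
   by (simp add: sums_iff)
  also have "norm \<dots> \<le> (\<Sum>n. (norm (a n) * real n powr (-\<sigma>)) * (12 * x powr \<sigma> / real M))"
   by (rule norm_suminf_le[OF tm summable_mult2[OF smA]])
  also have "\<dots> = A * (12 * x powr \<sigma> / real M)" unfolding A_def by (rule suminf_mult2[OF smA, symmetric])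
  finally have "norm (I M - 2 * pi * \<i> * S) \<le> 12 * x powr \<sigma> * A / real M" by (simp add: mult_ac)
  moreover have "norm (2 * pi * \<i> * S) \<le> norm (I M) + norm (I M - 2 * pi * \<i> * S)"
   by (metis norm_triangle_sub norm_minus_commute)
  ultimately show ?thesis using IM[of M] sumb[of M] by linarith
 qed
 have "norm (2 * pi * \<i> * S) \<le> 48 * B * x powr \<sigma> + 0"
 proof (rule tendsto_lowerbound)
  show "(\<lambda>M. 48 * B * x powr \<sigma> + 12 * x powr \<sigma> * A / real M) \<longlonglongrightarrow> 48 * B * x powr \<sigma> + 0"
   by (intro tendsto_add tendsto_const) real_asymp
  show "eventually (\<lambda>M. norm (2 * pi * \<i> * S) \<le> 48 * B * x powr \<sigma> + 12 * x powr \<sigma> * A / real M) sequentially"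
   using main by (auto simp: eventually_sequentially)
 qed auto
 \<comment> \<open>The sum over both half lines was at most \<open>2 * 8 * 3 = 48\<close> times the
   scale; dividing by \<open>6 \<le> 2 * pi\<close> leaves the constant 8.\<close>
 moreover have "6 * norm S \<le> norm (2 * pi * \<i> * S)"
  using pi_gt3 by (simp add: norm_mult mult_right_mono)
 ultimately show ?thesis by (simp add: S_def)
qed

section \<open>From Dirichlet series to sums over primes\<close>

definition upto_real :: "real \<Rightarrow> nat set" where "upto_real x = {n. 0 < n \<and> real n \<le> x}"

lemma finite_upto_real [simp]: "finite (upto_real x)"
 by (rule finite_subset[of _ "{..nat \<lfloor>x\<rfloor>}"]) (auto simp: upto_real_def le_nat_floor)

definition primes_upto :: "real \<Rightarrow> nat set" where "primes_upto x = {p. prime p \<and> real p \<le> x}"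

lemma finite_primes_upto [simp]: "finite (primes_upto x)"
 by (rule finite_subset[OF _ finite_upto_real[of x]]) (auto simp: primes_upto_def upto_real_def prime_gt_0_nat)

lemma abs_conv_ln_bounded:
 assumes "\<And>n. n > 0 \<Longrightarrow> norm (a n) \<le> 1 + ln (real n)"
 shows "abs_conv a"
proof (rule abs_convI)
 show "abs_conv (\<lambda>n. 1 + 1 * cln n)"
  by (intro abs_conv_add abs_conv_ln abs_conv_const)
 fix n :: nat assume n: "n > 0"
 then have "ln (real n) \<ge> 0" by simp
 then have "norm (1 + 1 * cln n) = 1 + ln (real n)"
  by (metis abs_of_nonneg add_nonneg_nonneg mult_1 norm_of_real of_real_1 of_real_add zero_le_one)
 then show "norm (a n) \<le> norm (1 + 1 * cln n)" using assms[OF n] by simp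
qed

lemma one_plus_ln_le:
 assumes "ln x \<ge> 1" "0 < n" "real n \<le> 2 * x"
 shows "1 + ln (real n) \<le> 3 * ln x"
proof -
 have x: "x > 0" using assms by linarith
 have "ln (real n) \<le> ln (2 * x)" using assms x by simp
 also have "\<dots> = ln 2 + ln x" using x by (simp add: ln_mult)
 also have "ln 2 \<le> (1::real)" using ln_le_minus_one[of 2] by simp
 finally show ?thesis using assms(1) by simp
qed

lemma card_interval_le:
 assumes "h \<ge> 0" "x \<ge> 0"
 shows "real (card {n. x < real n \<and> real n \<le> x + h}) \<le> h + 1"
proof -
 have "{n. x < real n \<and> real n \<le> x + h} \<subseteq> {nat \<lfloor>x\<rfloor> <.. nat \<lfloor>x + h\<rfloor>}"
 proof
  fix n assume "n \<in> {n. x < real n \<and> real n \<le> x + h}"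
  then have n: "x < real n" "real n \<le> x + h" by auto
  have "\<lfloor>x\<rfloor> < int n" using n(1) by (simp add: floor_less_iff)
  then have "nat \<lfloor>x\<rfloor> < n" using assms by linarith
  moreover have "n \<le> nat \<lfloor>x + h\<rfloor>" by (rule le_nat_floor[OF n(2)])
  ultimately show "n \<in> {nat \<lfloor>x\<rfloor> <.. nat \<lfloor>x + h\<rfloor>}" by simp
 qed
 then have "card {n. x < real n \<and> real n \<le> x + h} \<le> nat \<lfloor>x + h\<rfloor> - nat \<lfloor>x\<rfloor>"
  using card_mono[of "{nat \<lfloor>x\<rfloor> <.. nat \<lfloor>x + h\<rfloor>}"] by simp
 also have "real (nat \<lfloor>x + h\<rfloor> - nat \<lfloor>x\<rfloor>) \<le> h + 1" using assms by linarith
 finally show ?thesis by simp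
qed

text \<open>The smoothed sums at \<open>x + h\<close> and at \<open>x\<close> differ by
  \<open>h\<close> times the plain sum, apart from the at most \<open>h + 1\<close> terms in
  \<open>(x, x + h]\<close>, for which only the pointwise bound \<open>V\<close> is used.\<close>

lemma desmooth:
 fixes b :: "nat \<Rightarrow> complex"
 assumes U: "\<And>y. y > 0 \<Longrightarrow> ln y \<ge> 1 \<Longrightarrow> norm (\<Sum>n\<in>upto_real y. b n * of_real (y - real n)) \<le> E * y ^ 2"
  and E: "E \<ge> 0" and x: "ln x \<ge> 1" and h: "1 \<le> h" "h \<le> x"
  and b: "\<And>n. 0 < n \<Longrightarrow> real n \<le> 2 * x \<Longrightarrow> norm (b n) \<le> V"
 shows "norm (\<Sum>n\<in>upto_real x. b n) \<le> 5 * E * x ^ 2 / h + 2 * h * V"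
proof -
 have x0: "x > 0" using h by linarith
 define W where "W = (\<Sum>n\<in>upto_real x. b n)"
 define J where "J = {n. x < real n \<and> real n \<le> x + h}"
 have Un: "upto_real (x + h) = upto_real x \<union> J" "upto_real x \<inter> J = {}"
  using h x0 by (auto simp: upto_real_def J_def)
 then have fJ: "finite J" by (metis finite_Un finite_upto_real)
 define R where "R = (\<Sum>n\<in>J. b n * of_real (x + h - real n))"
 have "(\<Sum>n\<in>upto_real (x + h). b n * of_real (x + h - real n))
   = (\<Sum>n\<in>upto_real x. b n * of_real (x + h - real n)) + R"
  unfolding Un(1) R_def using Un(2) fJ by (intro sum.union_disjoint) auto
 also have "(\<Sum>n\<in>upto_real x. b n * of_real (x + h - real n)) = (\<Sum>n\<in>upto_real x. b n * of_real (x - real n)) + of_real h * W"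
  unfolding W_def sum_distrib_left sum.distrib[symmetric] by (rule sum.cong) (auto simp: algebra_simps)
 finally have eq: "of_real h * W = (\<Sum>n\<in>upto_real (x + h). b n * of_real (x + h - real n))
   - (\<Sum>n\<in>upto_real x. b n * of_real (x - real n)) - R" by simp
 have lxh: "ln (x + h) \<ge> 1" using x x0 h by (intro order_trans[OF x]) simp
 have "norm R \<le> (\<Sum>n\<in>J. V * h)"
  unfolding R_def
 proof (rule sum_norm_le)
  fix n assume n: "n \<in> J"
  then have n0: "0 < n" "real n \<le> 2 * x" using x0 h by (auto simp: J_def intro: gr0I)
  have "\<bar>x + h - real n\<bar> \<le> h" using n by (auto simp: J_def)
  then have "norm (b n) * \<bar>x + h - real n\<bar> \<le> V * h"
   using b[OF n0] order_trans[OF norm_ge_zero b[OF n0]] by (intro mult_mono) auto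
  then show "norm (b n * complex_of_real (x + h - real n)) \<le> V * h" by (simp only: norm_mult norm_of_real)
 qed
 also have "\<dots> = real (card J) * (V * h)" by simp
 also have "\<dots> \<le> (h + 1) * (V * h)"
 proof (rule mult_right_mono)
  show "real (card J) \<le> h + 1" unfolding J_def using card_interval_le h x0 by simp
  have "0 \<le> V" using order_trans[OF norm_ge_zero b[of 1]] h by simp
  then show "0 \<le> V * h" using h by simp
 qed
 finally have R: "norm R \<le> (h + 1) * (V * h)" .
 have V0: "0 \<le> V" using order_trans[OF norm_ge_zero b[of 1]] h by simp
 have "h * norm W = norm (of_real h * W)" using h by (simp add: norm_mult)
 also have "\<dots> \<le> E * (x + h) ^ 2 + E * x ^ 2 + (h + 1) * (V * h)"
  unfolding eq using U[OF _ lxh] U[OF x0 x] x0 h R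
  by (smt (verit) norm_triangle_ineq4)
 also have "\<dots> \<le> E * (2 * x) ^ 2 + E * x ^ 2 + (2 * h) * (V * h)"
  using E h x0 V0 by (intro add_mono mult_left_mono mult_right_mono power_mono) auto
 also have "\<dots> = h * (5 * E * x ^ 2 / h + 2 * h * V)"
  using h by (simp add: field_simps power2_eq_square)
 finally show ?thesis using h unfolding W_def by simp
qed

text \<open>Summation by parts against decreasing weights: after the boundary term is subtracted,
  the weight differences telescope. The factor 2 comes from starting the sums at \<open>M\<close>
  instead of 1.\<close>

lemma sum_abel_bound:
 fixes b :: "nat \<Rightarrow> complex" and w :: "nat \<Rightarrow> real"
 assumes S: "\<And>n. M \<le> n \<Longrightarrow> n \<le> N \<Longrightarrow> norm (\<Sum>i=1..n. b i) \<le> Q"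
  and w: "\<And>n. M < n \<Longrightarrow> n \<le> N \<Longrightarrow> 0 \<le> w n \<and> w n \<le> w0" "\<And>m n. M < m \<Longrightarrow> m \<le> n \<Longrightarrow> n \<le> N \<Longrightarrow> w n \<le> w m"
  and MN: "M < N"
 shows "norm (\<Sum>n\<in>{M<..N}. b n * of_real (w n)) \<le> 2 * Q * w0"
proof -
 define B where "B n = (\<Sum>i\<in>{M<..n}. b i)" for n
 have Q0: "Q \<ge> 0" using order_trans[OF norm_ge_zero S[of M]] MN by simp
 have Bb: "norm (B n) \<le> 2 * Q" if "M \<le> n" "n \<le> N" for n
 proof -
  have "(\<Sum>i=1..n. b i) = (\<Sum>i=1..M. b i) + B n"
  proof -
   have "{1..n} = {1..M} \<union> {M<..n}" using that by auto
   then show ?thesis unfolding B_def by (simp only:) (rule sum.union_disjoint, auto)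
  qed
  then have "B n = (\<Sum>i=1..n. b i) - (\<Sum>i=1..M. b i)" by simp
  then have "norm (B n) \<le> Q + Q" using S[of n] S[of M] that MN norm_triangle_ineq4[of "\<Sum>i=1..n. b i" "\<Sum>i=1..M. b i"] by simp
  then show ?thesis by simp
 qed
 have key: "norm ((\<Sum>i\<in>{M<..n}. b i * of_real (w i)) - B n * of_real (w n)) \<le> 2 * Q * (w (Suc M) - w n)"
  if "Suc M \<le> n" "n \<le> N" for n
  using that
 proof (induction n rule: nat_induct_at_least)
  case base
  have "{M<..Suc M} = {Suc M}" by auto
  then show ?case by (simp add: B_def)
 next
  case (Suc n)
  have ins: "{M<..Suc n} = insert (Suc n) {M<..n}" using Suc.hyps by auto
  have BS: "B (Suc n) = b (Suc n) + B n" unfolding B_def ins by simp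
  have "(\<Sum>i\<in>{M<..Suc n}. b i * of_real (w i)) - B (Suc n) * of_real (w (Suc n))
   = ((\<Sum>i\<in>{M<..n}. b i * of_real (w i)) - B n * of_real (w n)) + B n * of_real (w n - w (Suc n))"
   unfolding ins BS by (simp add: algebra_simps)
  also have "norm \<dots> \<le> 2 * Q * (w (Suc M) - w n) + 2 * Q * (w n - w (Suc n))"
  proof (rule order_trans[OF norm_triangle_ineq add_mono])
   show "norm ((\<Sum>i\<in>{M<..n}. b i * of_real (w i)) - B n * of_real (w n)) \<le> 2 * Q * (w (Suc M) - w n)"
    using Suc by simp
   have "w (Suc n) \<le> w n" using w(2)[of n "Suc n"] Suc by simp
   then show "norm (B n * of_real (w n - w (Suc n))) \<le> 2 * Q * (w n - w (Suc n))"
    using Bb[of n] Suc Q0 by (simp only: norm_mult norm_of_real) (intro mult_mono, auto)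
  qed
  finally show ?case by (simp add: algebra_simps)
 qed
 have N: "Suc M \<le> N" using MN by simp
 have "norm (\<Sum>i\<in>{M<..N}. b i * of_real (w i)) \<le> 2 * Q * (w (Suc M) - w N) + norm (B N * of_real (w N))"
  using key[OF N order_refl] norm_triangle_ineq2[of "\<Sum>i\<in>{M<..N}. b i * of_real (w i)" "B N * of_real (w N)"] by linarith
 also have "norm (B N * of_real (w N)) \<le> 2 * Q * w N"
  unfolding norm_mult norm_of_real using Bb[of N] w(1)[of N] MN Q0 by (intro mult_mono) auto
 also have "2 * Q * (w (Suc M) - w N) + 2 * Q * w N = 2 * Q * w (Suc M)" by (simp add: algebra_simps)
 also have "\<dots> \<le> 2 * Q * w0" using w(1)[of "Suc M"] MN Q0 by (intro mult_left_mono) auto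
 finally show ?thesis by simp
qed

text \<open>The pointwise bound alone would give the order \<open>x * ln x ^ (2 * m + 1)\<close>;
  the gain of \<open>m\<close> logarithms is everything that is extracted from the Dirichlet
  series.\<close>

lemma weighted_partial_sum_bound:
 fixes a :: "nat \<Rightarrow> complex"
 assumes a: "\<And>n. n > 0 \<Longrightarrow> norm (a n) \<le> 1 + ln (real n)" and B: "B \<ge> 1"
  and bd: "\<And>\<sigma> t. 1 < \<sigma> \<Longrightarrow> \<sigma> \<le> 2 \<Longrightarrow>
    norm (dirichlet (\<lambda>n. a n * cln n ^ (2 * m)) (Complex \<sigma> t)) \<le> B * (\<bar>t\<bar> + 2) powr (1/2)"
  and x: "ln x \<ge> 1" "ln x ^ m \<le> x"
 shows "norm (\<Sum>n\<in>upto_real x. a n * cln n ^ (2 * m)) \<le> (120 + 2 * 3 ^ (2 * m + 1)) * B * x * ln x ^ (m + 1)"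
proof -
 define b where "b n = a n * cln n ^ (2 * m)" for n
 have ac: "abs_conv b" unfolding b_def[abs_def] by (intro abs_conv_ln_power abs_conv_ln_bounded a)
 have U: "norm (\<Sum>n\<in>upto_real y. b n * of_real (y - real n)) \<le> (24 * B) * y ^ 2" if y0: "y > 0" and y: "ln y \<ge> 1" for y
 proof -
  \<comment> \<open>With this abscissa \<open>y powr \<sigma>\<close> is \<open>y * exp 1\<close>,
    so nothing is lost by staying to the right of 1.\<close>
  define \<sigma> where "\<sigma> = 1 + 1 / ln y"
  have \<sigma>: "1 < \<sigma>" "\<sigma> \<le> 2" using y by (auto simp: \<sigma>_def field_simps)
  have "norm (\<Sum>n | 0 < n \<and> real n \<le> y. b n * of_real (1 - real n / y)) \<le> 8 * B * y powr \<sigma>"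
   by (rule perron_bound[OF ac \<sigma> y0]) (use bd[OF \<sigma>] in \<open>simp add: b_def[abs_def]\<close>)
  then have "y * norm (\<Sum>n\<in>upto_real y. b n * of_real (1 - real n / y)) \<le> y * (8 * B * y powr \<sigma>)"
   unfolding upto_real_def using y0 by (intro mult_left_mono) auto
  also have "y powr \<sigma> = y * exp 1"
  proof -
   have "y \<noteq> 1" using y by auto
   then have "y powr (1 / ln y) = exp 1" using y0 y by (simp add: powr_def)
   then show ?thesis using y0 by (simp add: \<sigma>_def powr_add)
  qed
  also have "y * (8 * B * (y * exp 1)) \<le> y * (8 * B * (y * 3))"
   using y0 B exp_le by (intro mult_left_mono) auto
  also have "y * norm (\<Sum>n\<in>upto_real y. b n * of_real (1 - real n / y)) = norm (\<Sum>n\<in>upto_real y. b n * of_real (y - real n))"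
  proof -
   have "(\<Sum>n\<in>upto_real y. b n * of_real (y - real n)) = of_real y * (\<Sum>n\<in>upto_real y. b n * of_real (1 - real n / y))"
    unfolding sum_distrib_left using y0 by (intro sum.cong refl) (simp add: field_simps)
   then show ?thesis using y0 by (simp add: norm_mult)
  qed
  finally show ?thesis by (simp add: power2_eq_square mult_ac)
 qed
 have x0: "x > 0" using x zero_less_power[of "ln x" m] by linarith
 define L where "L = ln x"
 have L: "L \<ge> 1" using x by (simp add: L_def)
 \<comment> \<open>Makes the Perron part \<open>x ^ 2 / h\<close> of size \<open>x * L ^ m\<close>
   and the trivially estimated part \<open>h * L ^ (2 * m + 1)\<close> of size
   \<open>x * L ^ (m + 1)\<close>.\<close>
 define h where "h = x / L ^ m"
 have Lm: "1 \<le> L ^ m" "L ^ m \<le> x" using one_le_power[OF L, of m] x(2) by (simp_all add: L_def)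
 have h: "1 \<le> h" using Lm by (simp add: h_def)
 have "x * 1 \<le> x * L ^ m" using Lm x0 by (intro mult_left_mono) auto
 then have h': "h \<le> x" using Lm by (simp add: h_def divide_le_eq)
 have bV: "norm (b n) \<le> (3 * L) ^ (2 * m + 1)" if n: "0 < n" "real n \<le> 2 * x" for n
 proof -
  have l: "1 + ln (real n) \<le> 3 * L" unfolding L_def by (rule one_plus_ln_le) (use x n in auto)
  have ln0: "ln (real n) \<ge> 0" using n by simp
  have "norm (b n) = norm (a n) * ln (real n) ^ (2 * m)" using ln0 by (simp add: b_def norm_mult norm_power)
  also have "\<dots> \<le> (3 * L) * (3 * L) ^ (2 * m)"
   using a[OF n(1)] l ln0 L by (intro mult_mono power_mono) auto
  finally show ?thesis by simp
 qed
 have "norm (\<Sum>n\<in>upto_real x. b n) \<le> 5 * (24 * B) * x ^ 2 / h + 2 * h * (3 * L) ^ (2 * m + 1)"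
  by (rule desmooth[OF U _ x(1) h h' bV]) (use B in auto)
 also have "5 * (24 * B) * x ^ 2 / h = 120 * B * x * L ^ m" using x0 by (simp add: h_def power2_eq_square)
 also have "2 * h * (3 * L) ^ (2 * m + 1) = 2 * 3 ^ (2 * m + 1) * x * L ^ (m + 1)"
 proof -
  have "L ^ (2 * m + 1) = L ^ m * L ^ (m + 1)" by (simp add: power_add[symmetric] mult_2)
  then show ?thesis using L unfolding h_def power_mult_distrib by simp
 qed
 also have "120 * B * x * L ^ m + 2 * 3 ^ (2 * m + 1) * x * L ^ (m + 1)
   \<le> 120 * B * x * L ^ (m + 1) + 2 * 3 ^ (2 * m + 1) * B * x * L ^ (m + 1)"
 proof (rule add_mono)
  show "120 * B * x * L ^ m \<le> 120 * B * x * L ^ (m + 1)"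
   using B x0 L by (intro mult_left_mono power_increasing) auto
  have "2 * 3 ^ (2 * m + 1) * x * L ^ (m + 1) * 1 \<le> 2 * 3 ^ (2 * m + 1) * x * L ^ (m + 1) * B"
   using B x0 L by (intro mult_left_mono) auto
  then show "2 * 3 ^ (2 * m + 1) * x * L ^ (m + 1) \<le> 2 * 3 ^ (2 * m + 1) * B * x * L ^ (m + 1)"
   by (simp add: mult_ac)
 qed
 finally show ?thesis by (simp add: b_def L_def distrib_right)
qed

lemma log2_power_le:
 assumes "p ^ j \<le> n" "p \<ge> 2"
 shows "real j \<le> 2 * ln (real n)"
proof -
 have "2 ^ j \<le> n" using assms by (meson le_trans power_mono zero_le)
 then have "(2::real) ^ j \<le> real n" by (metis of_nat_le_iff of_nat_numeral of_nat_power)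
 then have "ln ((2::real) ^ j) \<le> ln (real n)" by (intro ln_mono) auto
 then have "real j * ln 2 \<le> ln (real n)" by (simp add: ln_realpow)
 moreover have "real j * (1/2) \<le> real j * ln 2" using ln2_ge_two_thirds by (intro mult_left_mono) linarith+
 ultimately show ?thesis by linarith
qed

text \<open>Proper prime powers \<open>p ^ j \<le> x\<close> satisfy \<open>p \<le> sqrt x\<close>
  and \<open>j \<le> 2 * ln x\<close>, and each has weight at most 1.\<close>

lemma sum_prime_eq_mangoldt:
 fixes f :: "nat \<Rightarrow> complex"
 assumes f: "\<And>n. norm (f n) \<le> 1" and x: "x \<ge> 1"
 shows "norm ((\<Sum>n\<in>{2..nat \<lfloor>x\<rfloor>}. mangoldt n * f n / cln n) - (\<Sum>p\<in>primes_upto x. f p))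
   \<le> sqrt x * (2 * ln x + 1)"
proof -
 define N where "N = nat \<lfloor>x\<rfloor>"
 have N: "n \<le> N \<longleftrightarrow> real n \<le> x" for n using x unfolding N_def by (simp add: le_nat_iff le_floor_iff)
 have PN: "primes_upto x = {2..N} \<inter> {p. prime p}"
  using N prime_ge_2_nat by (auto simp: primes_upto_def)
 have e: "mangoldt n * f n / cln n = of_real (\<Lambda>0 n) * f n" for n
  by (simp add: \<Lambda>0_def)
 have L1: "\<Lambda>0 p = 1" if "prime p" for p
  using that prime_ge_2_nat[OF that] by (simp add: \<Lambda>0_def)
 define Q where "Q = {n\<in>{2..N}. primepow n \<and> \<not> prime n}"
 have "(\<Sum>n\<in>{2..N}. mangoldt n * f n / cln n) = (\<Sum>n\<in>{2..N}. of_real (\<Lambda>0 n) * f n)"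
  by (simp only: e)
 also have "\<dots> = (\<Sum>n\<in>{2..N} \<inter> {p. prime p}. of_real (\<Lambda>0 n) * f n) + (\<Sum>n\<in>{2..N} - {p. prime p}. of_real (\<Lambda>0 n) * f n)"
  by (rule sum.Int_Diff) simp
 also have "(\<Sum>n\<in>{2..N} \<inter> {p. prime p}. of_real (\<Lambda>0 n) * f n) = (\<Sum>n\<in>{2..N} \<inter> {p. prime p}. f n)"
  by (rule sum.cong) (auto simp: L1)
 also have "(\<Sum>n\<in>{2..N} - {p. prime p}. of_real (\<Lambda>0 n) * f n) = (\<Sum>n\<in>Q. of_real (\<Lambda>0 n) * f n)"
  by (rule sum.mono_neutral_right) (auto simp: Q_def \<Lambda>0_def mangoldt_def)
 finally have "(\<Sum>n\<in>{2..N}. mangoldt n * f n / cln n) - (\<Sum>p\<in>primes_upto x. f p) = (\<Sum>n\<in>Q. of_real (\<Lambda>0 n) * f n)"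
  unfolding PN by simp
 also have "norm \<dots> \<le> (\<Sum>n\<in>Q. 1)"
 proof (rule sum_norm_le)
  fix n show "norm (of_real (\<Lambda>0 n) * f n) \<le> 1"
   using f[of n] \<Lambda>0_nonneg[of n] \<Lambda>0_le_1[of n] by (simp add: norm_mult mult_le_one)
 qed
 also have "\<dots> = real (card Q)" by simp
 also have "\<dots> \<le> real (card ({1..nat \<lfloor>sqrt x\<rfloor>} \<times> {0..nat \<lfloor>2 * ln x\<rfloor>}))"
 proof -
  have "Q \<subseteq> (\<lambda>(p, j). p ^ j) ` ({1..nat \<lfloor>sqrt x\<rfloor>} \<times> {0..nat \<lfloor>2 * ln x\<rfloor>})"
  proof
   fix n assume n: "n \<in> Q"
   then obtain p j where pj: "prime p" "j > 0" "n = p ^ j" unfolding Q_def primepow_def by auto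
   have p2: "p \<ge> 2" using pj prime_ge_2_nat by blast
   have "j \<noteq> 1" using n pj by (auto simp: Q_def)
   then have j2: "j \<ge> 2" using pj by simp
   have nx: "real n \<le> x" using n N by (auto simp: Q_def)
   have n0: "n > 0" using n by (auto simp: Q_def)
   have "p ^ 2 \<le> n" unfolding pj(3) using j2 p2 by (intro power_increasing) auto
   then have "real p ^ 2 \<le> real n" by (metis of_nat_le_iff of_nat_power)
   then have "real p ^ 2 \<le> x" using nx by linarith
   then have "real p \<le> sqrt x" by (rule real_le_rsqrt)
   then have ps: "p \<le> nat \<lfloor>sqrt x\<rfloor>" by (rule le_nat_floor)
   have "real j \<le> 2 * ln (real n)" by (rule log2_power_le[of p]) (use pj p2 in auto)
   moreover have "ln (real n) \<le> ln x" using nx n0 by (intro ln_mono) auto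
   ultimately have "real j \<le> 2 * ln x" by linarith
   then have "j \<le> nat \<lfloor>2 * ln x\<rfloor>" by (rule le_nat_floor)
   with ps show "n \<in> (\<lambda>(p, j). p ^ j) ` ({1..nat \<lfloor>sqrt x\<rfloor>} \<times> {0..nat \<lfloor>2 * ln x\<rfloor>})"
    using pj p2 by (intro image_eqI[of _ _ "(p, j)"]) auto
  qed
  then have "card Q \<le> card ((\<lambda>(p, j). p ^ j) ` ({1..nat \<lfloor>sqrt x\<rfloor>} \<times> {0..nat \<lfloor>2 * ln x\<rfloor>}))"
   by (intro card_mono) auto
  also have "\<dots> \<le> card ({1..nat \<lfloor>sqrt x\<rfloor>} \<times> {0..nat \<lfloor>2 * ln x\<rfloor>})" by (rule card_image_le) auto
  finally show ?thesis by (simp only: of_nat_le_iff)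
 qed
 also have "\<dots> = real (nat \<lfloor>sqrt x\<rfloor>) * (real (nat \<lfloor>2 * ln x\<rfloor>) + 1)" by (simp add: card_cartesian_product algebra_simps)
 also have "\<dots> \<le> sqrt x * (2 * ln x + 1)"
 proof (rule mult_mono)
  show "real (nat \<lfloor>sqrt x\<rfloor>) \<le> sqrt x" using x by simp
  have "ln x \<ge> 0" using x by simp
  then show "real (nat \<lfloor>2 * ln x\<rfloor>) + 1 \<le> 2 * ln x + 1" by linarith
 qed (use x in auto)
 finally show ?thesis by (simp add: N_def)
qed

text \<open>Common passage from Dirichlet series to primes. \<open>g\<close> is the expected
  density: 0 for a nonprincipal character, 1 for the zeta function. The constants depend on
  \<open>m\<close> only, and \<open>B\<close> carries the whole dependence on the character.\<close>

lemma prime_sum_bound: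
 obtains C x0 where "C \<ge> 0" "x0 \<ge> 3" "\<And>x. x \<ge> x0 \<Longrightarrow> 1 \<le> x / ln x ^ m"
  "\<And>f g B x. (\<And>n. norm (f n) \<le> 1) \<Longrightarrow> (\<And>n. norm (g n) \<le> 1) \<Longrightarrow> B \<ge> 1 \<Longrightarrow>
   (\<And>\<sigma> t. 1 < \<sigma> \<Longrightarrow> \<sigma> \<le> 2 \<Longrightarrow>
    norm (dirichlet (\<lambda>n. (mangoldt n * f n - g n) * cln n ^ (2 * m)) (Complex \<sigma> t)) \<le> B * (\<bar>t\<bar> + 2) powr (1/2)) \<Longrightarrow>
   x \<ge> x0 \<Longrightarrow> norm ((\<Sum>p\<in>primes_upto x. f p) - (\<Sum>n\<in>{2..nat \<lfloor>x\<rfloor>}. g n / cln n)) \<le> C * B * (x / ln x ^ m)"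
proof -
 have "eventually (\<lambda>x::real. ln (sqrt x / 2) \<ge> 1 \<and> ln x ^ m \<le> sqrt x / 2 \<and> sqrt x + 1 \<le> x \<and> 4 * sqrt x \<le> x / ln x ^ m \<and> sqrt x * (2 * ln x + 1) \<le> x / ln x ^ m \<and> 1 \<le> x / ln x ^ m) at_top"
  by (intro eventually_conj; real_asymp)
 then obtain x0 where x0: "\<And>x::real. x \<ge> x0 \<Longrightarrow> ln (sqrt x / 2) \<ge> 1 \<and> ln x ^ m \<le> sqrt x / 2 \<and> sqrt x + 1 \<le> x \<and> 4 * sqrt x \<le> x / ln x ^ m \<and> sqrt x * (2 * ln x + 1) \<le> x / ln x ^ m \<and> 1 \<le> x / ln x ^ m"
  by (auto simp: eventually_at_top_linorder)
 define C0 where "C0 = (120 + 2 * 3 ^ (2 * m + 1) :: real)"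
 have C0: "C0 \<ge> 0" by (simp add: C0_def)
 define C where "C = 2 * C0 * 2 ^ (2 * m + 1) + 2"
 show ?thesis
 proof (rule that[of C "max x0 3"])
  show "C \<ge> 0" using C0 by (simp add: C_def)
  show "max x0 3 \<ge> 3" by simp
  show "1 \<le> x / ln x ^ m" if "x \<ge> max x0 3" for x using x0[of x] that by simp
  fix f g :: "nat \<Rightarrow> complex" and B x :: real
  define a where "a n = mangoldt n * f n - g n" for n
  assume fg: "\<And>n. norm (f n) \<le> 1" "\<And>n. norm (g n) \<le> 1" and B: "B \<ge> 1"
   and bd: "\<And>\<sigma> t. 1 < \<sigma> \<Longrightarrow> \<sigma> \<le> 2 \<Longrightarrow>
    norm (dirichlet (\<lambda>n. (mangoldt n * f n - g n) * cln n ^ (2 * m)) (Complex \<sigma> t)) \<le> B * (\<bar>t\<bar> + 2) powr (1/2)"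
   and xx: "x \<ge> max x0 3"
  have a: "norm (a n) \<le> 1 + ln (real n)" if "n > 0" for n
  proof -
   have "\<bar>mangoldt n :: real\<bar> * norm (f n) \<le> ln (real n) * 1"
    using mangoldt_le[OF that] mangoldt_nonneg[of n] fg(1) by (intro mult_mono) auto
   then have "norm (mangoldt n * f n) \<le> ln (real n)" by (simp add: norm_mult)
   then show ?thesis using norm_triangle_ineq4[of "mangoldt n * f n" "g n"] fg(2)[of n] unfolding a_def by linarith
  qed
  have x: "x \<ge> 1" "ln (sqrt x / 2) \<ge> 1" "ln x ^ m \<le> sqrt x / 2" "sqrt x + 1 \<le> x" "4 * sqrt x \<le> x / ln x ^ m"
   "sqrt x * (2 * ln x + 1) \<le> x / ln x ^ m"
   using xx x0[of x] by auto
  have sq: "sqrt x \<ge> 1" using x by simp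
  define L where "L = ln x"
  have lsq: "ln (sqrt x) = L / 2" using x by (simp add: L_def ln_sqrt)
  have L: "L \<ge> 2"
  proof -
   have "ln (sqrt x / 2) \<le> ln (sqrt x)" using sq by (subst ln_le_cancel_iff) auto
   then show ?thesis using x(2) lsq by simp
  qed
  \<comment> \<open>Below \<open>sqrt x\<close> the trivial bound is enough; above it every
    logarithm is at least \<open>L / 2\<close>, so the weights are of the expected size.\<close>
  define M N where "M = nat \<lfloor>sqrt x\<rfloor>" and "N = nat \<lfloor>x\<rfloor>"
  have M: "real M \<le> sqrt x" "sqrt x < real M + 1" "real M \<ge> sqrt x / 2" "M \<ge> 1"
  proof -
   have "\<lfloor>sqrt x\<rfloor> \<ge> 1" using sq by (simp add: le_floor_iff)
   then show "real M \<le> sqrt x" "sqrt x < real M + 1" "real M \<ge> sqrt x / 2" "M \<ge> 1"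
    unfolding M_def by linarith+
  qed
  have N: "real N \<le> x" "x < real N + 1" using x unfolding N_def by linarith+
  have MN: "M < N" using M N x(4) by linarith
  define b where "b n = a n * cln n ^ (2 * m)" for n
  \<comment> \<open>Removes the weight \<open>ln n ^ (2 * m)\<close> and one logarithm more, which
    turns the value of \<open>mangoldt\<close> at a prime into 1.\<close>
  define w where "w n = 1 / ln (real n) ^ (2 * m + 1)" for n :: nat
  have S: "norm (\<Sum>i=1..n. b i) \<le> C0 * B * x * L ^ (m + 1)" if n: "M \<le> n" "n \<le> N" for n
  proof -
   have nr: "sqrt x / 2 \<le> real n" "real n \<le> x" using M(3) N(1) n by linarith+
   have n1: "ln (real n) \<ge> 1" using x(2) nr sq by (meson ln_mono half_gt_zero less_le_trans order_trans zero_less_one)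
   have n2: "ln (real n) \<le> L" unfolding L_def using nr sq by (intro ln_mono; linarith)
   have "ln (real n) ^ m \<le> ln x ^ m" using n1 n2 by (intro power_mono) (auto simp: L_def)
   then have n3: "ln (real n) ^ m \<le> real n" using x(3) nr by linarith
   have "norm (\<Sum>i\<in>upto_real (real n). b i) \<le> C0 * B * real n * ln (real n) ^ (m + 1)"
    unfolding b_def C0_def by (rule weighted_partial_sum_bound[OF a B bd[folded a_def] n1 n3])
   also have "\<dots> \<le> C0 * B * x * L ^ (m + 1)"
    using C0 B nr n1 n2 sq by (intro mult_mono power_mono) auto
   also have "upto_real (real n) = {1..n}" by (auto simp: upto_real_def)
   finally show ?thesis .
  qed
  have ln_big: "L / 2 \<le> ln (real n)" if "M < n" for n
  proof -
   have "sqrt x \<le> real n" using M that by linarith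
   then have "ln (sqrt x) \<le> ln (real n)" using sq by (intro ln_mono) auto
   then show ?thesis using lsq by simp
  qed
  have main: "norm (\<Sum>n\<in>{M<..N}. b n * of_real (w n)) \<le> 2 * (C0 * B * x * L ^ (m + 1)) * (1 / (L / 2) ^ (2 * m + 1))"
  proof (rule sum_abel_bound[OF S _ _ MN])
   show "0 \<le> w n \<and> w n \<le> 1 / (L / 2) ^ (2 * m + 1)" if "M < n" "n \<le> N" for n
    unfolding w_def using ln_big[OF that(1)] L by (intro conjI divide_left_mono power_mono) (auto intro!: mult_pos_pos)
   show "w n \<le> w k" if "M < k" "k \<le> n" "n \<le> N" for k n
   proof -
    have "ln (real k) \<le> ln (real n)" using that by (intro ln_mono) auto
    moreover have "ln (real k) > 0" using ln_big[OF that(1)] L by linarith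
    ultimately show ?thesis unfolding w_def by (intro divide_left_mono power_mono) (auto intro!: mult_pos_pos)
   qed
  qed auto
  have e1: "b n * of_real (w n) = a n / cln n" if "n \<in> {M<..N}" for n
  proof -
   have "ln (real n) \<noteq> 0" using ln_big[of n] that L by auto
   then show ?thesis by (simp add: b_def w_def)
  qed
  have "2 * (C0 * B * x * L ^ (m + 1)) * (1 / (L / 2) ^ (2 * m + 1)) = (2 * C0 * 2 ^ (2 * m + 1)) * B * x / L ^ m"
  proof -
   have "L ^ (2 * m + 1) = L ^ (m + 1) * L ^ m" by (simp add: power_add[symmetric] mult_2)
   then show ?thesis using L by (simp add: power_divide)
  qed
  then have big: "norm (\<Sum>n\<in>{M<..N}. a n / cln n) \<le> (2 * C0 * 2 ^ (2 * m + 1)) * B * x / L ^ m"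
   using main sum.cong[OF refl e1, of "{M<..N}"] by simp
  have small: "norm (\<Sum>n\<in>{2..M}. a n / cln n) \<le> (\<Sum>n\<in>{2..M}. 4)"
  proof (rule sum_norm_le)
   fix n assume n: "n \<in> {2..M}"
   have "ln 2 \<le> ln (real n)" using n by (intro ln_mono) auto
   moreover have "ln 2 \<ge> (1/2::real)"
    using ln2_ge_two_thirds by linarith
   ultimately have l: "ln (real n) \<ge> 1/2" by linarith
   have "norm (a n) \<le> 1 + ln (real n)" using a n by simp
   also have "\<dots> \<le> 4 * ln (real n)" using l by simp
   finally have "norm (a n) / ln (real n) \<le> 4" using l by (simp add: divide_le_eq)
   then show "norm (a n / cln n) \<le> 4" using l by (simp add: norm_divide)
  qed
  also have "\<dots> \<le> 4 * sqrt x" using M(1) by simp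
  also have "\<dots> \<le> x / L ^ m" using x(5) by (simp add: L_def)
  also have "\<dots> \<le> B * x / L ^ m" using B x(1) L by (intro divide_right_mono) auto
  finally have small: "norm (\<Sum>n\<in>{2..M}. a n / cln n) \<le> B * x / L ^ m" .
  have "{2..N} = {2..M} \<union> {M<..N} - {1}" using MN M(4) by auto
  moreover have "(\<Sum>n\<in>{2..M} \<union> {M<..N} - {1}. a n / cln n) = (\<Sum>n\<in>{2..M} \<union> {M<..N}. a n / cln n)"
   by (rule sum.mono_neutral_left) auto
  moreover have "\<dots> = (\<Sum>n\<in>{2..M}. a n / cln n) + (\<Sum>n\<in>{M<..N}. a n / cln n)"
   by (rule sum.union_disjoint) auto
  ultimately have 1: "norm (\<Sum>n\<in>{2..N}. a n / cln n) \<le> B * x / L ^ m + (2 * C0 * 2 ^ (2 * m + 1)) * B * x / L ^ m"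
   using big small norm_triangle_ineq[of "\<Sum>n\<in>{2..M}. a n / cln n" "\<Sum>n\<in>{M<..N}. a n / cln n"] by simp
  define u where "u = (\<Sum>n\<in>{2..N}. mangoldt n * f n / cln n) - (\<Sum>p\<in>primes_upto x. f p)"
  have 2: "norm u \<le> B * x / L ^ m"
  proof -
   have "x / L ^ m \<le> B * x / L ^ m" using B x(1) L by (intro divide_right_mono) auto
   then show ?thesis using sum_prime_eq_mangoldt[of f x] fg(1) x unfolding u_def N_def L_def by (meson order_trans)
  qed
  have "(\<Sum>p\<in>primes_upto x. f p) - (\<Sum>n\<in>{2..N}. g n / cln n) = (\<Sum>n\<in>{2..N}. a n / cln n) - u"
   by (simp add: u_def a_def diff_divide_distrib sum_subtractf)
  then have "norm ((\<Sum>p\<in>primes_upto x. f p) - (\<Sum>n\<in>{2..N}. g n / cln n)) \<le> B * x / L ^ m + (2 * C0 * 2 ^ (2 * m + 1)) * B * x / L ^ m + B * x / L ^ m"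
   using order_trans[OF norm_triangle_ineq4 add_mono[OF 1 2]] by (simp only:)
  also have "\<dots> = C * B * (x / L ^ m)" by (simp add: C_def algebra_simps add_divide_distrib)
  finally show "norm ((\<Sum>p\<in>primes_upto x. f p) - (\<Sum>n\<in>{2..nat \<lfloor>x\<rfloor>}. g n / cln n)) \<le> C * B * (x / ln x ^ m)"
   by (simp add: N_def L_def)
 qed
qed

section \<open>Siegel's theorem\<close>

definition real_char :: "nat \<Rightarrow> (nat \<Rightarrow> complex) \<Rightarrow> bool" where
 "real_char q \<phi> \<longleftrightarrow> nonprincipal q \<phi> \<and> chi_sq \<phi> = principal q"

lemma real_char_cases:
 assumes "real_char q \<phi>"
 shows "\<phi> n = 0 \<or> \<phi> n = 1 \<or> \<phi> n = -1"
proof -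
 have "\<phi> n * \<phi> n = principal q n" using assms unfolding real_char_def chi_sq_def[abs_def] by metis
 then have "(\<phi> n)\<^sup>2 = 0 \<or> (\<phi> n)\<^sup>2 = 1" by (auto simp: power2_eq_square principal_def split: if_splits)
 then show ?thesis by (auto simp: power2_eq_1_iff)
qed

lemma real_char_Re: "real_char q \<phi> \<Longrightarrow> \<phi> n = of_real (Re (\<phi> n))"
 using real_char_cases[of q \<phi> n] by auto

lemma dirichlet_nonneg_real:
 assumes a: "abs_conv a" "\<And>n. a n = of_real (r n)" "\<And>n. r n \<ge> 0" and \<sigma>: "\<sigma> > 1"
 shows "\<exists>b\<ge>0. dirichlet a (of_real \<sigma>) = of_real b"
proof -
 have s1: "Re (complex_of_real \<sigma>) > 1" using \<sigma> by simp
 have e: "a n * of_nat n powr (- complex_of_real \<sigma>) = of_real (r n * real n powr (-\<sigma>))" for n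
  using powr_of_real[of "real n" "-\<sigma>"] a(2)[of n] by simp
 have "(\<lambda>n. complex_of_real (r n * real n powr (-\<sigma>))) sums dirichlet a (of_real \<sigma>)"
  using sums_dirichlet[OF a(1) s1] unfolding e .
 then have c: "(\<lambda>n. r n * real n powr (-\<sigma>)) sums Re (dirichlet a (of_real \<sigma>))"
  "(\<lambda>n. 0::real) sums Im (dirichlet a (of_real \<sigma>))"
  using sums_Re sums_Im by fastforce+
 have "Im (dirichlet a (of_real \<sigma>)) = 0" using c(2) sums_unique2 sums_zero by blast
 moreover have "Re (dirichlet a (of_real \<sigma>)) \<ge> 0"
  using sums_le[OF _ sums_zero c(1)] a(3) by simp
 ultimately show ?thesis by (intro exI[of _ "Re (dirichlet a (of_real \<sigma>))"]) (simp add: complex_eq_iff)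
qed

text \<open>The sign pattern at 2 of a Dirichlet series with nonnegative coefficients, stated for
  derivatives so that it passes to any function agreeing with \<open>G\<close> near 2. The clause
  for \<open>k = 0\<close> provides the term 1 that is played off against the residue.\<close>

definition alternating_derivs :: "(complex \<Rightarrow> complex) \<Rightarrow> bool" where
 "alternating_derivs G \<longleftrightarrow> (\<forall>k. \<exists>b\<ge>0. (deriv ^^ k) G 2 = (-1) ^ k * of_real b \<and> (k = 0 \<longrightarrow> b \<ge> 1))"

text \<open>The derivative of \<open>G\<close> is \<open>- G\<close> times a Dirichlet series with
  nonnegative coefficients, so Leibniz' rule yields the signs by induction on the order, working
  from the exponent alone.\<close>

lemma alternating_derivs_exp:
 fixes g :: "nat \<Rightarrow> real"
 assumes g: "\<And>n. 0 \<le> g n" "\<And>n. g n \<le> 4"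
 shows "alternating_derivs (\<lambda>s. exp (dirichlet (\<lambda>n. of_real (\<Lambda>0 n * g n)) s))"
proof -
 define w where "w n = complex_of_real (\<Lambda>0 n * g n)" for n
 define v where "v n = w n * cln n" for n
 define G where "G s = exp (dirichlet w s)" for s
 have acw: "abs_conv w"
 proof (rule abs_convI[OF _ abs_conv_const[of 4]])
  fix n :: nat
  have "\<Lambda>0 n * g n \<le> 1 * 4" using \<Lambda>0_nonneg \<Lambda>0_le_1 g by (intro mult_mono) auto
  moreover have "0 \<le> \<Lambda>0 n * g n" using \<Lambda>0_nonneg g by simp
  ultimately show "norm (w n) \<le> norm (4::complex)" unfolding w_def norm_of_real by simp
 qed
 have acv: "abs_conv v" unfolding v_def[abs_def] by (rule abs_conv_ln[OF acw])
 define S where "S = {s::complex. Re s > 1}"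
 have S: "open S" unfolding S_def by (rule open_halfspace_Re_gt)
 have S2: "2 \<in> S" by (simp add: S_def)
 have hw: "dirichlet w holomorphic_on S" and hv: "dirichlet v holomorphic_on S"
  unfolding S_def by (intro holomorphic_dirichlet acw acv)+
 have hG: "G holomorphic_on S" unfolding G_def[abs_def] by (intro holomorphic_intros hw)
 have dG: "deriv G z = - (G z * dirichlet v z)" if "z \<in> S" for z
 proof -
  have "(G has_field_derivative exp (dirichlet w z) * - dirichlet v z) (at z)"
   unfolding G_def[abs_def] v_def[abs_def]
   by (rule DERIV_chain2[OF DERIV_exp has_field_derivative_dirichlet[OF acw]]) (use that in \<open>simp add: S_def\<close>)
  then show ?thesis using DERIV_imp_deriv by (fastforce simp: G_def)
 qed
 have vk: "\<exists>b\<ge>0. (deriv ^^ j) (dirichlet v) 2 = (-1) ^ j * of_real b" for j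
 proof -
  have "(deriv ^^ j) (dirichlet v) 2 = (-1) ^ j * dirichlet (\<lambda>n. v n * cln n ^ j) 2"
   by (rule higher_deriv_dirichlet[OF acv]) simp
  moreover have "\<exists>b\<ge>0. dirichlet (\<lambda>n. v n * cln n ^ j) (of_real 2) = of_real b"
  proof (rule dirichlet_nonneg_real[OF abs_conv_ln_power[OF acv]])
   show "v n * cln n ^ j = of_real (\<Lambda>0 n * g n * ln (real n) * ln (real n) ^ j)" for n
    by (simp add: v_def w_def)
   show "0 \<le> \<Lambda>0 n * g n * ln (real n) * ln (real n) ^ j" for n
    using \<Lambda>0_nonneg[of n] g(1)[of n] by (cases "n = 0") auto
  qed simp
  ultimately show ?thesis by auto
 qed
 have "\<exists>b\<ge>0. (deriv ^^ k) G 2 = (-1) ^ k * of_real b \<and> (k = 0 \<longrightarrow> b \<ge> 1)" for k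
 proof (induction k rule: less_induct)
  case (less k)
  show ?case
  proof (cases k)
   case 0
   have "\<exists>b\<ge>0. dirichlet w (of_real 2) = of_real b"
    by (rule dirichlet_nonneg_real[OF acw, of "\<lambda>n. \<Lambda>0 n * g n"]) (use \<Lambda>0_nonneg g in \<open>auto simp: w_def\<close>)
   then obtain b where "b \<ge> 0" "dirichlet w 2 = of_real b" by auto
   then show ?thesis using 0 by (intro exI[of _ "exp b"]) (simp add: G_def exp_of_real)
  next
   case (Suc j)
   have "\<forall>i. \<exists>b\<ge>0. i \<le> j \<longrightarrow> (deriv ^^ i) G 2 = (-1) ^ i * of_real b"
    using less Suc by (metis le_imp_less_Suc order_refl)
   then obtain b where b: "\<And>i. b i \<ge> 0" "\<And>i. i \<le> j \<Longrightarrow> (deriv ^^ i) G 2 = (-1) ^ i * of_real (b i)" by metis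
   obtain c where c: "\<And>i. c i \<ge> 0" "\<And>i. (deriv ^^ i) (dirichlet v) 2 = (-1) ^ i * of_real (c i)" using vk by metis
   have "(deriv ^^ Suc j) G 2 = (deriv ^^ j) (deriv G) 2" by (simp add: funpow_swap1)
   also have "\<dots> = (deriv ^^ j) (\<lambda>z. - (G z * dirichlet v z)) 2"
    by (rule higher_deriv_transform_within_open[OF _ _ S S2 dG]) (intro holomorphic_intros holomorphic_deriv hG hv S)+
   also have "\<dots> = - (deriv ^^ j) (\<lambda>z. G z * dirichlet v z) 2"
    by (rule higher_deriv_uminus[OF _ S S2]) (intro holomorphic_intros hG hv)
   also have "(deriv ^^ j) (\<lambda>z. G z * dirichlet v z) 2 =
     (\<Sum>i=0..j. of_nat (j choose i) * (deriv ^^ i) G 2 * (deriv ^^ (j - i)) (dirichlet v) 2)"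
    by (rule higher_deriv_mult[OF hG hv S S2])
   also have "\<dots> = (\<Sum>i=0..j. (-1) ^ j * of_real (real (j choose i) * b i * c (j - i)))"
   proof (rule sum.cong[OF refl])
    fix i assume i: "i \<in> {0..j}"
    then have "(-1::complex) ^ j = (-1) ^ i * (-1) ^ (j - i)" by (simp add: power_add[symmetric])
    then show "of_nat (j choose i) * (deriv ^^ i) G 2 * (deriv ^^ (j - i)) (dirichlet v) 2 = (-1) ^ j * of_real (real (j choose i) * b i * c (j - i))"
     using b(2)[of i] c(2)[of "j - i"] i by simp
   qed
   also have "\<dots> = (-1) ^ j * of_real (\<Sum>i=0..j. real (j choose i) * b i * c (j - i))"
    by (simp add: sum_distrib_left)
   finally have "(deriv ^^ k) G 2 = (-1) ^ k * of_real (\<Sum>i=0..j. real (j choose i) * b i * c (j - i))"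
    unfolding Suc by simp
   moreover have "0 \<le> (\<Sum>i=0..j. real (j choose i) * b i * c (j - i))" using b(1) c(1) by (intro sum_nonneg) simp
   ultimately show ?thesis using Suc by blast
  qed
 qed
 then show ?thesis unfolding alternating_derivs_def G_def[abs_def] w_def[abs_def] by blast
qed

lemma alternating_derivsE:
 assumes "alternating_derivs G"
 obtains b where "\<And>k. b k \<ge> 0" "\<And>k. (deriv ^^ k) G 2 = (-1) ^ k * of_real (b k)" "b 0 \<ge> 1"
proof -
 have "\<exists>b. \<forall>k. b k \<ge> 0 \<and> (deriv ^^ k) G 2 = (-1) ^ k * of_real (b k) \<and> (k = 0 \<longrightarrow> b k \<ge> 1)"
  by (rule choice) (use assms in \<open>simp add: alternating_derivs_def Bex_def\<close>)
 then obtain b where "\<forall>k. b k \<ge> 0 \<and> (deriv ^^ k) G 2 = (-1) ^ k * of_real (b k) \<and> (k = 0 \<longrightarrow> b k \<ge> 1)" by (elim exE)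
 then show thesis by (intro that[of b]) (simp_all only: simp_thms)
qed

lemma higher_deriv_inverse_minus_1:
 assumes "z \<noteq> 1"
 shows "(deriv ^^ k) (\<lambda>z. 1 / (z - 1)) z = (-1) ^ k * fact k / (z - 1 :: complex) ^ (k + 1)"
 using assms
proof (induction k arbitrary: z)
 case (Suc k)
 have op: "open (- {1::complex})" by auto
 have "((\<lambda>z. (-1) ^ k * fact k / (z - 1) ^ (k + 1)) has_field_derivative
   (-1) ^ Suc k * fact (Suc k) / (z - 1) ^ (Suc k + 1)) (at z)"
 proof -
  define w where "w = z - 1"
  have w: "w \<noteq> 0" using Suc.prems by (simp add: w_def)
  have "((\<lambda>z. (-1) ^ k * fact k / (z - 1) ^ (k + 1)) has_field_derivative
   (0 * w ^ (k + 1) - (-1) ^ k * fact k * (of_nat (k + 1) * w ^ k)) / (w ^ (k + 1) * w ^ (k + 1))) (at z)"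
  proof -
   have "((\<lambda>z. z - 1) has_field_derivative 1) (at z)" by (auto intro!: derivative_eq_intros)
   from DERIV_power[OF this, of "k + 1"]
   have "((\<lambda>z. (z - 1) ^ (k + 1)) has_field_derivative of_nat (k + 1) * w ^ k) (at z)" by (simp add: w_def)
   from DERIV_divide[OF DERIV_const this, of "(-1) ^ k * fact k"] power_not_zero[OF w, of "k + 1"]
   show ?thesis unfolding w_def by blast
  qed
  also have "(0 * w ^ (k + 1) - (-1) ^ k * fact k * (of_nat (k + 1) * w ^ k)) / (w ^ (k + 1) * w ^ (k + 1))
    = (-1) ^ Suc k * fact (Suc k) * w ^ k / (w ^ k * w ^ (Suc k + 1))"
   by (simp add: mult_ac)
  also have "\<dots> = (-1) ^ Suc k * fact (Suc k) / w ^ (Suc k + 1)"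
   using w by (simp only: mult.commute[of _ "w ^ k"] mult_divide_mult_cancel_left[OF power_not_zero[OF w]])
  also have "w = z - 1" by (rule w_def)
  finally show ?thesis .
 qed
 then have "((deriv ^^ k) (\<lambda>z. 1 / (z - 1)) has_field_derivative
   (-1) ^ Suc k * fact (Suc k) / (z - 1) ^ (Suc k + 1)) (at z)"
  by (rule has_field_derivative_transform_within_open[OF _ op]) (use Suc in auto)
 then show ?case by (simp add: DERIV_imp_deriv)
qed simp

text \<open>Estermann's argument: the Taylor coefficients at \<open>2\<close> of the function with the pole removed are
 those of \<open>G\<close> diminished by the residue, while Cauchy's bound makes them geometrically small.\<close>

lemma estermann:
 assumes hol: "K holomorphic_on {s. Re s > 0}"
  and M: "M \<ge> 1" "\<And>z. norm (z - 2) \<le> 3/2 \<Longrightarrow> norm (K z) \<le> M"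
  and G: "\<And>z. Re z > 1 \<Longrightarrow> G z = K z / (z - 1)" "alternating_derivs G"
  and l: "K 1 = of_real l" and \<beta>: "9/10 \<le> \<beta>" "\<beta> < 1" and neg: "Re (K (of_real \<beta>)) \<ge> 0"
 shows "(1 - \<beta>) / 6 * (32 * M) powr (-4 * (1 - \<beta>)) \<le> l"
proof -
 define H where "H = {s::complex. Re s > 0}"
 have H: "open H" unfolding H_def by (rule open_halfspace_Re_gt)
 define J where "J = (\<lambda>z. if z = 1 then deriv K 1 else (K z - K 1) / (z - 1))"
 have hJ: "J holomorphic_on H" unfolding J_def by (rule pole_lemma_open) (use hol H in \<open>auto simp: H_def\<close>)
 have sub: "cball 2 (3/2) \<subseteq> H"
 proof
  fix z :: complex assume "z \<in> cball 2 (3/2)"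
  then have "\<bar>Re (2 - z)\<bar> \<le> 3/2" using abs_Re_le_cmod[of "2 - z"] unfolding mem_cball dist_norm by linarith
  then have "Re z > 0" unfolding minus_complex.sel complex_Re_numeral by linarith
  then show "z \<in> H" by (simp add: H_def)
 qed
 have Jb: "norm (J z) \<le> 4 * M" if z: "norm (2 - z) = 3/2" for z
 proof -
  have "norm (2 - z) \<le> norm (z - 1) + norm (1::complex)" using norm_triangle_ineq4[of 1 "z - 1"] by simp
  then have z1: "norm (z - 1) \<ge> 1/2" using z by simp
  have "norm (K z - K 1) \<le> M + M"
   using M(2)[of z] M(2)[of 1] z norm_triangle_ineq4[of "K z" "K 1"] by (simp add: norm_minus_commute)
  then have "norm (K z - K 1) / norm (z - 1) \<le> (M + M) / (1/2)" using z1 M(1) by (intro frac_le) auto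
  moreover have "z \<noteq> 1" using z1 by auto
  ultimately show ?thesis by (simp add: J_def norm_divide)
 qed
 have cd: "norm ((deriv ^^ k) J 2) \<le> fact k * (4 * M) / (3/2) ^ k" for k
 proof (rule Cauchy_inequality)
  show "J holomorphic_on ball 2 (3/2)" by (rule holomorphic_on_subset[OF hJ]) (use sub in auto)
  show "continuous_on (cball 2 (3/2)) J" using holomorphic_on_imp_continuous_on[OF hJ] sub by (rule continuous_on_subset)
 qed (use Jb in auto)
 define V where "V = {s::complex. Re s > 1}"
 have V: "open V" unfolding V_def by (rule open_halfspace_Re_gt)
 have V2: "2 \<in> V" by (simp add: V_def)
 have nz: "z - 1 \<noteq> 0" if "z \<in> V" for z using that by (auto simp: V_def)
 have hi: "(\<lambda>z. 1 / (z - 1)) holomorphic_on V" using nz by (intro holomorphic_intros) auto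
 have hG: "G holomorphic_on V"
 proof (rule holomorphic_transform)
  show "(\<lambda>z. K z / (z - 1)) holomorphic_on V"
   using nz by (intro holomorphic_intros holomorphic_on_subset[OF hol]) (auto simp: V_def)
 qed (use G(1) in \<open>simp add: V_def\<close>)
 obtain b where b: "\<And>k. b k \<ge> 0" "\<And>k. (deriv ^^ k) G 2 = (-1) ^ k * of_real (b k)" "b 0 \<ge> 1"
  by (rule alternating_derivsE[OF G(2)]) (rule that)
 have dJ: "(deriv ^^ k) J 2 = (-1) ^ k * of_real (b k - l * fact k)" for k
 proof -
  have "(deriv ^^ k) J 2 = (deriv ^^ k) (\<lambda>z. G z - of_real l * (1 / (z - 1))) 2"
  proof (rule higher_deriv_transform_within_open[OF _ _ V V2])
   show "J holomorphic_on V" by (rule holomorphic_on_subset[OF hJ]) (auto simp: V_def H_def)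
   show "(\<lambda>z. G z - of_real l * (1 / (z - 1))) holomorphic_on V" by (intro holomorphic_intros hG hi)
   fix z assume z: "z \<in> V"
   then show "J z = G z - of_real l * (1 / (z - 1))"
    using nz[OF z] G(1)[of z] by (auto simp: J_def V_def l diff_divide_distrib)
  qed
  also have "\<dots> = (deriv ^^ k) G 2 - (deriv ^^ k) (\<lambda>z. of_real l * (1 / (z - 1))) 2"
   by (rule higher_deriv_diff[OF hG _ V V2]) (intro holomorphic_intros hi)
  also have "(deriv ^^ k) (\<lambda>z. of_real l * (1 / (z - 1))) (2::complex) = of_real l * (deriv ^^ k) (\<lambda>z. 1 / (z - 1)) 2"
   by (rule higher_deriv_cmult[OF hi V2 V])
  also have "(deriv ^^ k) (\<lambda>z. 1 / (z - 1)) (2::complex) = (-1) ^ k * fact k"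
   by (subst higher_deriv_inverse_minus_1) auto
  finally show ?thesis unfolding b(2) by (simp add: algebra_simps)
 qed
 define r where "r k = b k / fact k - l" for k
 have r: "b k - l * fact k = fact k * r k" for k by (simp add: r_def field_simps)
 have rb: "\<bar>r k\<bar> \<le> 4 * M * (2/3) ^ k" for k
 proof -
  have "fact k * \<bar>r k\<bar> \<le> fact k * (4 * M) / (3/2) ^ k"
   using cd[of k] unfolding dJ r by (simp add: norm_mult norm_power)
  then have "\<bar>r k\<bar> \<le> 4 * M / (3/2) ^ k" by (simp add: field_simps)
  then show ?thesis by (simp add: power_divide divide_simps)
 qed
 \<comment> \<open>As \<open>\<beta> - 2 = - u\<close>, the signs of the Taylor coefficients cancel
   and the series at \<beta> has the terms \<open>r n * u ^ n\<close>. The bound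
   \<open>u \<le> 11/10\<close> gives \<open>2/3 * u < 3/4\<close>, a convergent geometric
   tail.\<close>
 define u where "u = 2 - \<beta>"
 have u: "1 < u" "u \<le> 11/10" "u - 1 = 1 - \<beta>" using \<beta> by (auto simp: u_def)
 have "of_real \<beta> \<in> ball (2::complex) (3/2)"
 proof -
  have "(2::complex) - of_real \<beta> = of_real (2 - \<beta>)" by simp
  then have "norm ((2::complex) - of_real \<beta>) = \<bar>2 - \<beta>\<bar>" by (simp only: norm_of_real)
  then show ?thesis using \<beta> by (simp add: dist_norm)
 qed
 then have "(\<lambda>n. (deriv ^^ n) J 2 / fact n * (of_real \<beta> - 2) ^ n) sums J (of_real \<beta>)"
  by (rule holomorphic_power_series[rotated]) (rule holomorphic_on_subset[OF hJ], use sub in auto)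
 moreover have "(deriv ^^ n) J 2 / fact n * (of_real \<beta> - 2) ^ n = of_real (r n * u ^ n)" for n
 proof -
  have "(-1) ^ n * (complex_of_real \<beta> - 2) ^ n = of_real (u ^ n)"
   unfolding power_mult_distrib[symmetric] by (simp add: u_def)
  moreover have "(deriv ^^ n) J 2 / fact n = (-1) ^ n * of_real (r n)" unfolding dJ r by simp
  ultimately show ?thesis by (simp add: mult_ac)
 qed
 ultimately have "(\<lambda>n. complex_of_real (r n * u ^ n)) sums J (of_real \<beta>)" by simp
 from sums_Re[OF this] have sR: "(\<lambda>n. r n * u ^ n) sums Re (J (of_real \<beta>))" by simp
 \<comment> \<open>Here the nonnegativity of \<open>K\<close> at \<beta> enters: divided by
   \<open>\<beta> - 1 < 0\<close> it can only decrease the value.\<close>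
 have JR: "Re (J (of_real \<beta>)) \<le> l / (1 - \<beta>)"
 proof -
  have "complex_of_real \<beta> \<noteq> 1" using \<beta> by (metis of_real_1 of_real_eq_iff less_irrefl)
  then have "J (of_real \<beta>) = (K (of_real \<beta>) - of_real l) / of_real (\<beta> - 1)" by (simp add: J_def l)
  then have "Re (J (of_real \<beta>)) = (Re (K (of_real \<beta>)) - l) / (\<beta> - 1)"
   by (simp only: Re_divide_of_real minus_complex.sel Re_complex_of_real)
  also have "\<dots> = (l - Re (K (of_real \<beta>))) / (1 - \<beta>)" using \<beta> by (simp add: field_simps)
  also have "\<dots> \<le> l / (1 - \<beta>)" using \<beta> neg by (intro divide_right_mono) auto
  finally show ?thesis .
 qed
 \<comment> \<open>Cut-off with \<open>(3/4) ^ m \<le> 1 / (32 * M)\<close>, which makes the tail at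
   most 1/2. It is logarithmic in \<open>M\<close>, so that \<open>u ^ m\<close> is at most a
   constant times a small power of \<open>M\<close>.\<close>
 define m where "m = nat \<lceil>4 * ln (32 * M)\<rceil>"
 have lnM: "ln (32 * M) > 0" using M(1) by simp
 have m: "4 * ln (32 * M) \<le> real m" "real m \<le> 4 * ln (32 * M) + 1" using lnM unfolding m_def by linarith+
 have m0: "m > 0"
 proof -
  have "real m > 0" using m(1) lnM by linarith
  then show ?thesis by (simp only: of_nat_0_less_iff)
 qed
 have "(3/4::real) ^ m = exp (real m * ln (3/4))" by (simp only: exp_of_nat_mult) simp
 also have "\<dots> \<le> exp (- ln (32 * M))"
 proof -
  have "ln (3/4::real) \<le> 3/4 - 1" by (rule ln_le_minus_one) simp
  then have "real m * ln (3/4) \<le> real m * (-1/4)" by (intro mult_left_mono) auto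
  then have "real m * ln (3/4) \<le> - ln (32 * M)" using m(1) by linarith
  then show ?thesis by (simp only: exp_le_cancel_iff)
 qed
 also have "\<dots> = 1 / (32 * M)" using M(1) by (simp only: exp_minus divide_inverse) simp
 finally have m34: "16 * M * (3/4) ^ m \<le> 1/2" using M(1) by (simp add: field_simps)
 have sm: "summable (\<lambda>n. r n * u ^ n)" using sR by (rule sums_summable)
 have tail: "- (16 * M * (3/4) ^ m) \<le> (\<Sum>n. r (n + m) * u ^ (n + m))"
 proof -
  have "norm (\<Sum>n. r (n + m) * u ^ (n + m)) \<le> (\<Sum>n. 4 * M * (3/4) ^ m * (3/4) ^ n)"
  proof (rule norm_suminf_le)
   fix n
   have "\<bar>r (n + m)\<bar> * u ^ (n + m) \<le> (4 * M * (2/3) ^ (n + m)) * u ^ (n + m)"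
    using rb u by (intro mult_right_mono) auto
   also have "\<dots> = 4 * M * (2/3 * u) ^ (n + m)" by (simp only: power_mult_distrib mult.assoc)
   also have "\<dots> \<le> 4 * M * (3/4) ^ (n + m)" using u M(1) by (intro mult_left_mono power_mono) auto
   finally show "norm (r (n + m) * u ^ (n + m)) \<le> 4 * M * (3/4) ^ m * (3/4) ^ n"
    using u by (simp add: abs_mult power_add mult_ac)
  qed (intro summable_mult summable_geometric, simp)
  also have "\<dots> = 4 * M * (3/4) ^ m * 4"
   by (subst suminf_mult) (simp_all add: suminf_geometric summable_geometric)
  finally show ?thesis by simp
 qed
 \<comment> \<open>Of the coefficients \<open>b n\<close> only \<open>b 0 \<ge> 1\<close> is kept,
   the others being nonnegative; what remains is a geometric sum multiplied by
   \<open>l\<close>.\<close>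
 have head: "1 - l * ((u ^ m - 1) / (u - 1)) \<le> (\<Sum>n<m. r n * u ^ n)"
 proof -
  have "(\<Sum>n<m. (if n = 0 then 1 else 0) - l * u ^ n) \<le> (\<Sum>n<m. r n * u ^ n)"
  proof (rule sum_mono)
   fix n
   have "(if n = 0 then 1 else 0) \<le> b n / fact n * u ^ n" using b(1)[of n] b(3) u by (cases "n = 0") auto
   then show "(if n = 0 then 1 else 0) - l * u ^ n \<le> r n * u ^ n" by (simp add: r_def left_diff_distrib)
  qed
  also have "(\<Sum>n<m. (if n = 0 then 1 else 0) - l * u ^ n) = 1 - l * (\<Sum>n<m. u ^ n)"
   using m0 by (simp add: sum_subtractf sum_distrib_left[symmetric])
  also have "(\<Sum>n<m. u ^ n) = (u ^ m - 1) / (u - 1)" using u by (simp add: geometric_sum)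
  finally show ?thesis .
 qed
 have "(\<Sum>n<m. r n * u ^ n) + (\<Sum>n. r (n + m) * u ^ (n + m)) = Re (J (of_real \<beta>))"
  using suminf_split_initial_segment[OF sm, of m] sR by (simp add: sums_iff)
 then have "1/2 - l * ((u ^ m - 1) / (1 - \<beta>)) \<le> l / (1 - \<beta>)" using head tail m34 JR u(3) by simp
 then have "1/2 \<le> l * u ^ m / (1 - \<beta>)" by (simp add: diff_divide_distrib right_diff_distrib)
 then have lu: "(1 - \<beta>) / 2 \<le> l * u ^ m" using \<beta> by (simp add: field_simps)
 have um: "u ^ m \<le> 3 * (32 * M) powr (4 * (1 - \<beta>))"
 proof -
  have "u \<le> exp (u - 1)" using exp_ge_add_one_self[of "u - 1"] by simp
  then have "u ^ m \<le> exp (u - 1) ^ m" using u by (intro power_mono) auto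
  also have "\<dots> = exp (real m * (1 - \<beta>))" unfolding u(3) by (rule exp_of_nat_mult[symmetric])
  also have "\<dots> \<le> exp ((4 * ln (32 * M) + 1) * (1 - \<beta>))" using m \<beta> by (simp add: mult_right_mono)
  also have "\<dots> = exp (1 - \<beta>) * (32 * M) powr (4 * (1 - \<beta>))"
   using M(1) by (simp add: powr_def exp_add[symmetric] algebra_simps)
  also have "\<dots> \<le> 3 * (32 * M) powr (4 * (1 - \<beta>))"
  proof (rule mult_right_mono)
   have "exp (1 - \<beta>) \<le> exp 1" using \<beta> by simp
   also have "exp 1 \<le> (3::real)" by (rule exp_le)
   finally show "exp (1 - \<beta>) \<le> 3" .
  qed simp
  finally show ?thesis .
 qed
 have l0: "l > 0"
 proof -
  have "0 < (1 - \<beta>) / 2" using \<beta> by simp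
  then have "0 < l * u ^ m" using lu by (rule less_le_trans)
  then show ?thesis using u by (simp add: zero_less_mult_iff)
 qed
 define P where "P = (32 * M) powr (4 * (1 - \<beta>))"
 have P: "P > 0" using M(1) by (simp add: P_def)
 have "(1 - \<beta>) / 2 \<le> l * (3 * P)"
  by (rule order_trans[OF lu]) (use mult_left_mono[OF um, of l] l0 in \<open>simp only: P_def\<close>)
 then have "(1 - \<beta>) / 6 * (1 / P) \<le> l" using P by (simp add: field_simps)
 moreover have "(32 * M) powr (-4 * (1 - \<beta>)) = 1 / P" unfolding P_def mult_minus_left powr_minus by (rule inverse_eq_divide)
 ultimately show ?thesis by simp
qed

text \<open>At squares prime to the modulus a real character equals 1, so these terms yield a lower
  bound that does not depend on its signs.\<close>

lemma \<Lambda>0_square: "\<Lambda>0 (m ^ 2) = \<Lambda>0 m / 2"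
proof -
 have "mangoldt (m ^ 2) = (mangoldt m :: real)"
 proof (cases "primepow m")
  case True
  then obtain p k where p: "prime p" "k > 0" "m = p ^ k" by (auto simp: primepow_def)
  then show ?thesis by (simp add: mangoldt_primepow power_mult[symmetric])
 next
  case False
  then have "\<not> primepow (m ^ 2)" by (cases "m = 0") (simp_all add: primepow_power_iff_nat)
  then show ?thesis using False by (simp add: mangoldt_def)
 qed
 then show ?thesis by (cases "m = 0") (simp_all add: \<Lambda>0_def ln_realpow)
qed

lemma dirichlet_drop:
 assumes "abs_conv a" "Re s > 1"
 shows "dirichlet (\<lambda>n. if n \<le> N then 0 else a n) s = dirichlet a s - (\<Sum>n\<le>N. a n * of_nat n powr (-s))"
proof -
 have "(\<lambda>n. if n \<in> {..N} then a n * of_nat n powr (-s) else 0) sums (\<Sum>n\<le>N. a n * of_nat n powr (-s))"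
  by (rule sums_If_finite_set) simp
 from sums_diff[OF sums_dirichlet[OF assms] this]
 have "(\<lambda>n. (if n \<le> N then 0 else a n) * of_nat n powr (-s)) sums (dirichlet a s - (\<Sum>n\<le>N. a n * of_nat n powr (-s)))"
  by (rule sums_cong[THEN iffD1, rotated]) simp
 then show ?thesis by (simp add: dirichlet_def sums_iff)
qed

lemma sum_inverse_progression_unbounded:
 obtains J where "C < (\<Sum>j\<in>{1..J}. 1 / real (1 + j * q))"
proof -
 define J where "J = nat \<lceil>exp (C * real (1 + q))\<rceil>"
 have "exp (C * real (1 + q)) < real J + 1" unfolding J_def by linarith
 then have "ln (exp (C * real (1 + q))) < ln (real J + 1)" by (subst ln_less_cancel_iff) auto
 then have "C * real (1 + q) < ln (real J + 1)" by (simp only: ln_exp)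
 also have "\<dots> \<le> harm J" by (rule ln_le_harm)
 also have "\<dots> \<le> (\<Sum>j\<in>{1..J}. real (1 + q) * (1 / real (1 + j * q)))"
  unfolding harm_def
 proof (rule sum_mono)
  fix j assume j: "j \<in> {1..J}"
  then have "real (1 + j * q) \<le> real (1 + q) * real j" by (simp add: distrib_right)
  then show "inverse (real j) \<le> real (1 + q) * (1 / real (1 + j * q))"
   using j unfolding inverse_eq_divide times_divide_eq_right mult_1_right
   by (intro mult_imp_le_div_pos) (simp_all add: mult_imp_div_pos_le del: of_nat_add of_nat_mult)
 qed
 also have "\<dots> = (\<Sum>j\<in>{1..J}. 1 / real (1 + j * q)) * real (1 + q)" by (simp only: sum_distrib_left mult.commute)
 finally have "C < (\<Sum>j\<in>{1..J}. 1 / real (1 + j * q))" by (rule mult_right_less_imp_less) simp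
 then show thesis by (rule that)
qed

text \<open>If \<open>L(1)\<close> vanished, \<open>\<zeta>(s) L(s)\<close> would be holomorphic in a disc around \<open>2\<close> containing \<open>1/2\<close>, with
 alternating derivatives at \<open>2\<close>; the same holds after removing finitely many terms from the exponent,
 which bounds the sum of \<open>\<Lambda>(m) / (m ln m)\<close> over \<open>m\<close> prime to \<open>q\<close>.\<close>

lemma real_char_Lfun_1_nonzero:
 assumes rc: "real_char q \<phi>"
 shows "Lfun \<phi> 1 \<noteq> 0"
proof
 assume L0: "Lfun \<phi> 1 = 0"
 note n = nonprincipalD[OF rc[unfolded real_char_def, THEN conjunct1]]
 define H where "H = {s::complex. Re s > 0}"
 define V where "V = {s::complex. Re s > 1}"
 have H: "open H" and V: "open V" unfolding H_def V_def by (intro open_halfspace_Re_gt)+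
 define K where "K z = zeta1 z * Lfun \<phi> z" for z
 have hK: "K holomorphic_on H" unfolding K_def[abs_def] H_def
  by (intro holomorphic_intros holomorphic_zeta1 holomorphic_Lfun[OF n(4)])
 define J where "J = (\<lambda>z. if z = 1 then deriv K 1 else (K z - K 1) / (z - 1))"
 have hJ: "J holomorphic_on H" unfolding J_def by (rule pole_lemma_open[OF hK H])
 define r where "r m = \<Lambda>0 m * (1 + Re (\<phi> m))" for m
 have r0: "r m \<ge> 0" for m unfolding r_def using \<Lambda>0_nonneg[of m] real_char_cases[OF rc, of m] by auto
 note ac = abs_conv_\<Lambda>0_times[OF cmult_const_1] abs_conv_\<Lambda>0_times[OF n(5)]
 have acr: "abs_conv (\<lambda>m. of_real (r m))"
  using abs_conv_add[OF ac] real_char_Re[OF rc] by (simp add: r_def distrib_left)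
 have Jeq: "J z = exp (dirichlet (\<lambda>m. of_real (r m)) z)" if "z \<in> V" for z
 proof -
  have z: "Re z > 1" "z - 1 \<noteq> 0" using that by (auto simp: V_def)
  have "J z = dirichlet (\<lambda>_. 1) z * dirichlet \<phi> z"
   using z(2) L0 zeta1_eq_dirichlet[OF z(1)] Lfun_eq_dirichlet[OF n(4) z(1)] by (auto simp: J_def K_def)
  then show ?thesis
   unfolding dirichlet_eq_exp[OF cmult_const_1 z(1)] dirichlet_eq_exp[OF n(5) z(1)] exp_add[symmetric] dirichlet_add[OF ac z(1), symmetric]
   using real_char_Re[OF rc] by (simp add: r_def distrib_left)
 qed
 define Q where "Q N z = (\<Sum>m\<le>N. of_real (r m) * of_nat m powr (-z))" for N and z :: complex
 have hQ: "Q N holomorphic_on A" for N A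
  unfolding Q_def[abs_def] by (intro holomorphic_intros)
 \<comment> \<open>Dividing out the first terms of the exponent leaves an exponent with nonnegative
   coefficients. The Taylor series of \<open>F\<close> at 2, evaluated at 1/2, then has nonnegative
   terms and a leading term at least 1, for every \<open>N\<close>.\<close>
 have low: "exp (Re (Q N (1/2))) \<le> norm (J (1/2))" for N
 proof -
  define F where "F z = J z * exp (- Q N z)" for z
  define G where "G z = exp (dirichlet (\<lambda>m. of_real (\<Lambda>0 m * (if m \<le> N then 0 else 1 + Re (\<phi> m)))) z)" for z
  have hF: "F holomorphic_on H" unfolding F_def[abs_def] by (intro holomorphic_intros hJ hQ)
  have FG: "F z = G z" if "z \<in> V" for z
  proof -
   have "(\<lambda>m. complex_of_real (\<Lambda>0 m * (if m \<le> N then 0 else 1 + Re (\<phi> m)))) = (\<lambda>m. if m \<le> N then 0 else of_real (r m))"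
    by (auto simp: r_def)
   then show ?thesis using dirichlet_drop[OF acr, of z N] that
    unfolding F_def G_def Jeq[OF that] Q_def by (simp add: exp_diff exp_minus divide_inverse V_def)
  qed
  have aG: "alternating_derivs G" unfolding G_def[abs_def]
  proof (rule alternating_derivs_exp)
   show "0 \<le> (if m \<le> N then 0 else 1 + Re (\<phi> m))" "(if m \<le> N then 0 else 1 + Re (\<phi> m)) \<le> 4" for m
    using real_char_cases[OF rc, of m] by auto
  qed
  have eq: "(deriv ^^ k) F 2 = (deriv ^^ k) G 2" for k
   by (rule higher_deriv_cong_ev[OF eventually_mono[OF eventually_nhds_in_open[OF V] FG] refl]) (simp add: V_def)
  have "alternating_derivs F" using aG unfolding alternating_derivs_def eq .
  then obtain b where b: "\<And>k. b k \<ge> 0" "\<And>k. (deriv ^^ k) F 2 = (-1) ^ k * of_real (b k)" "b 0 \<ge> 1"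
   by (rule alternating_derivsE) (rule that)
  have "(\<lambda>k. (deriv ^^ k) F 2 / fact k * (1/2 - 2) ^ k) sums F (1/2)"
  proof (rule holomorphic_power_series)
   show "F holomorphic_on ball 2 (7/4)"
   proof (rule holomorphic_on_subset[OF hF], rule subsetI)
    fix z :: complex assume "z \<in> ball 2 (7/4)"
    then have "\<bar>Re (2 - z)\<bar> < 7/4" using abs_Re_le_cmod[of "2 - z"] unfolding mem_ball dist_norm by linarith
    then have "Re z > 0" unfolding minus_complex.sel complex_Re_numeral by linarith
    then show "z \<in> H" by (simp add: H_def)
   qed
   show "(1/2::complex) \<in> ball 2 (7/4)" by (simp add: dist_norm)
  qed
  moreover have "(deriv ^^ k) F 2 / fact k * (1/2 - 2) ^ k = of_real (b k / fact k * (3/2) ^ k)" for k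
  proof -
   have "(-1) ^ k * (1/2 - 2 :: complex) ^ k = (3/2) ^ k" unfolding power_mult_distrib[symmetric] by simp
   then show ?thesis using b by (simp add: mult_ac)
  qed
  ultimately have "(\<lambda>k. complex_of_real (b k / fact k * (3/2) ^ k)) sums F (1/2)" by (simp only:)
  from sums_Re[OF this] have s: "(\<lambda>k. b k / fact k * (3/2) ^ k) sums Re (F (1/2))" by (simp only: Re_complex_of_real)
  have "(\<Sum>k<1. b k / fact k * (3/2) ^ k) \<le> Re (F (1/2))"
   unfolding sums_unique[OF s] by (rule sum_le_suminf[OF sums_summable[OF s]]) (use b in auto)
  then have "1 \<le> norm (F (1/2))" using b complex_Re_le_cmod[of "F (1/2)"] by (auto intro: order_trans)
  then have "1 \<le> norm (J (1/2)) * exp (- Re (Q N (1/2)))" by (simp add: F_def norm_mult)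
  then show ?thesis by (simp add: exp_minus field_simps)
 qed
 define C where "C = ln (norm (J (1/2)))"
 have "norm (J (1/2)) > 0" using low[of 0] exp_gt_zero less_le_trans by blast
 then have QC: "Re (Q N (1/2)) \<le> C" for N using low[of N] by (simp add: C_def ln_ge_iff)
 define s where "s m = \<Lambda>0 m * Re (principal q m)" for m
 have s0: "s m \<ge> 0" for m unfolding s_def principal_def using \<Lambda>0_nonneg[of m] by simp
 \<comment> \<open>Only the squares among the indices of \<open>Q\<close> are kept: for
   \<open>m\<close> prime to \<open>q\<close> the character is 1 at \<open>m ^ 2\<close>, the
   coefficient is \<open>2 * \<Lambda>0 (m ^ 2) = \<Lambda>0 m\<close>, and \<open>m ^ 2\<close> to
   the power -1/2 is \<open>1 / m\<close>.\<close>
 have SC: "(\<Sum>m\<le>M. s m / real m) \<le> C" for M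
 proof -
  have inj: "inj_on (\<lambda>m. m ^ 2) {..M}" by (auto intro!: inj_onI)
  have Qr: "Re (Q N (1/2)) = (\<Sum>m\<le>N. r m * real m powr (-(1/2)))" for N
   unfolding Q_def Re_sum
  proof (rule sum.cong[OF refl])
   fix m
   have "complex_of_real (real m) powr of_real (-(1/2)) = of_real (real m powr (-(1/2)))" by (rule powr_of_real) simp
   then show "Re (of_real (r m) * of_nat m powr (- (1/2))) = r m * real m powr (-(1/2))" by simp
  qed
  have "(\<Sum>m\<le>M. s m / real m) \<le> (\<Sum>m\<le>M. r (m ^ 2) * real (m ^ 2) powr (-(1/2)))"
  proof (rule sum_mono)
   fix m
   have "real (m ^ 2) powr (-(1/2)) = 1 / real m"
    by (cases "m = 0") (simp_all add: powr_minus_divide powr_half_sqrt)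
   moreover have "s m \<le> r (m ^ 2)"
   proof (cases "coprime m q")
    case True
    have "chi_sq \<phi> m = principal q m" using rc by (simp add: real_char_def)
    then have "\<phi> (m ^ 2) = 1"
     using dchar_mult[OF n(2,1), of m m] True by (simp add: chi_sq_def principal_def power2_eq_square)
    then show ?thesis by (simp add: s_def r_def \<Lambda>0_square principal_def True)
   qed (use r0[of "m ^ 2"] in \<open>simp add: s_def principal_def\<close>)
   ultimately show "s m / real m \<le> r (m ^ 2) * real (m ^ 2) powr (-(1/2))" by (simp add: divide_right_mono)
  qed
  also have "\<dots> = (\<Sum>m\<in>(\<lambda>m. m ^ 2) ` {..M}. r m * real m powr (-(1/2)))"
   by (simp only: sum.reindex[OF inj] o_def)
  also have "\<dots> \<le> Re (Q (M ^ 2) (1/2))"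
   unfolding Qr by (intro sum_mono2) (auto simp: r0 power_mono)
  also have "\<dots> \<le> C" by (rule QC)
  finally show ?thesis .
 qed
 have dc: "cmult (principal q)" by (rule dchar_imp_cmult[OF dchar_principal n(1)])
 have pr: "principal q m = of_real (Re (principal q m))" for m by (simp add: principal_def)
 \<comment> \<open>The bound is uniform in \<sigma>. Letting \<sigma> decrease to 1 bounds the
   reciprocals of the integers congruent to 1 modulo \<open>q\<close>, whose sum is
   unbounded.\<close>
 have part: "(\<Sum>j\<in>{1..J}. real (1 + j * q) powr (-\<sigma>)) \<le> exp C" if \<sigma>: "\<sigma> > 1" for \<sigma> J
 proof -
  have s1: "Re (complex_of_real \<sigma>) > 1" using \<sigma> by simp
  have sR: "(\<lambda>m. w m * real m powr (-\<sigma>)) sums Re (dirichlet (\<lambda>m. of_real (w m)) (of_real \<sigma>))"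
   if "abs_conv (\<lambda>m. complex_of_real (w m))" for w
  proof -
   have "complex_of_real (w m) * of_nat m powr (- of_real \<sigma>) = of_real (w m * real m powr (-\<sigma>))" for m
    using powr_of_real[of "real m" "-\<sigma>"] by simp
   from sums_Re[OF sums_dirichlet[OF that s1], unfolded this Re_complex_of_real] show ?thesis .
  qed
  have ac: "abs_conv (\<lambda>m. complex_of_real (s m))" "abs_conv (\<lambda>m. complex_of_real (Re (principal q m)))"
   using abs_conv_\<Lambda>0_times[OF dc] abs_conv_cmult_fun[OF dc] pr by (simp_all add: s_def)
  have "Re (dirichlet (\<lambda>m. of_real (s m)) (of_real \<sigma>)) \<le> C"
   unfolding sums_unique[OF sR[OF ac(1)]]
  proof (rule suminf_le_const[OF sums_summable[OF sR[OF ac(1)]]])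
   fix M
   have "(\<Sum>m<M. s m * real m powr (-\<sigma>)) \<le> (\<Sum>m\<le>M. s m / real m)"
   proof (intro order_trans[OF sum_mono sum_mono2])
    fix m show "s m * real m powr (-\<sigma>) \<le> s m / real m"
     using s0[of m] \<sigma> powr_mono[of "-\<sigma>" "-1" "real m"]
     by (cases "m = 0") (auto simp: powr_minus_divide divide_inverse intro!: mult_left_mono)
   qed (auto simp: s0)
   then show "(\<Sum>m<M. s m * real m powr (-\<sigma>)) \<le> C" using SC[of M] by linarith
  qed
  moreover have "dirichlet (principal q) (of_real \<sigma>) = exp (dirichlet (\<lambda>m. of_real (s m)) (of_real \<sigma>))"
   unfolding dirichlet_eq_exp[OF dc s1] s_def using pr by (simp add: of_real_mult)
  ultimately have "norm (dirichlet (principal q) (of_real \<sigma>)) \<le> exp C" by simp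
  then have 1: "Re (dirichlet (principal q) (of_real \<sigma>)) \<le> exp C" using complex_Re_le_cmod order_trans by blast
  have inj: "inj_on (\<lambda>j. 1 + j * q) {1..J}" using n(1) by (auto intro!: inj_onI)
  have "(\<Sum>j\<in>{1..J}. real (1 + j * q) powr (-\<sigma>)) = (\<Sum>m\<in>(\<lambda>j. 1 + j * q) ` {1..J}. real m powr (-\<sigma>))"
   by (simp only: sum.reindex[OF inj] o_def)
  also have "\<dots> = (\<Sum>m\<in>(\<lambda>j. 1 + j * q) ` {1..J}. Re (principal q m) * real m powr (-\<sigma>))"
  proof (intro sum.cong refl)
   fix m assume "m \<in> (\<lambda>j. 1 + j * q) ` {1..J}"
   then obtain j where "m = Suc (j * q)" by auto
   then have "coprime m q" using coprime_Suc_left_nat[of "j * q"] by simp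
   then show "real m powr (-\<sigma>) = Re (principal q m) * real m powr (-\<sigma>)" by (simp add: principal_def)
  qed
  also have "\<dots> \<le> (\<Sum>m. Re (principal q m) * real m powr (-\<sigma>))"
   by (rule sum_le_suminf[OF sums_summable[OF sR[OF ac(2)]]]) (auto simp: principal_def)
  also have "\<dots> \<le> exp C" using 1 sums_unique[OF sR[OF ac(2)]] pr by simp
  finally show ?thesis .
 qed
 obtain J where J: "exp C < (\<Sum>j\<in>{1..J}. 1 / real (1 + j * q))" by (rule sum_inverse_progression_unbounded)
 have "((\<lambda>\<sigma>. \<Sum>j\<in>{1..J}. real (1 + j * q) powr (-\<sigma>)) \<longlongrightarrow> (\<Sum>j\<in>{1..J}. real (1 + j * q) powr (-1))) (at_right 1)"
  by (intro tendsto_intros) (auto simp: add_nonneg_eq_0_iff)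
 then have "(\<Sum>j\<in>{1..J}. real (1 + j * q) powr (-1)) \<le> exp C"
  by (rule tendsto_upperbound) (use part in \<open>auto simp: eventually_at_right_less intro: eventually_at_rightI[of 1 2]\<close>)
 then show False using J by (simp add: powr_minus_divide)
qed

section \<open>Siegel's theorem for real characters\<close>

lemma Reals_of_nat_powr: "x \<in> \<real> \<Longrightarrow> of_nat n powr (x :: complex) \<in> \<real>"
 by (auto elim!: Reals_cases simp: powr_Reals_eq)

lemma Reals_suminf:
 fixes f :: "nat \<Rightarrow> complex"
 assumes "summable f" "\<And>n. f n \<in> \<real>"
 shows "suminf f \<in> \<real>"
proof -
 have "(\<lambda>n. Im (f n)) sums Im (suminf f)" using summable_sums[OF assms(1)] by (rule sums_Im)
 then have "(\<lambda>n. 0) sums Im (suminf f)" using assms(2) by (simp add: complex_is_Real_iff)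
 then show ?thesis using sums_unique2[OF _ sums_zero] by (simp add: complex_is_Real_iff)
qed

lemma Lfun_Reals:
 assumes f: "bounded_sums q f" "\<And>n. f n \<in> \<real>" and s: "s \<in> \<real>" "Re s > 0"
 shows "Lfun f s \<in> \<real>"
 unfolding Lfun_def
proof (rule Reals_suminf)
 have q: "q \<ge> 0" using f(1) norm_ge_zero order_trans unfolding bounded_sums_def by blast
 show "summable (\<lambda>n. (\<Sum>m\<le>Suc n. f m) * (of_nat (Suc n) powr (-s) - of_nat (Suc (Suc n)) powr (-s)))"
  by (rule sums_split_tail_bound(1)[where c = "q * norm s" and \<sigma> = "Re s" and M = 1])
    (use Lfun_term_bound[OF f(1) s(2)] q s in \<open>auto simp del: of_nat_Suc\<close>)
 show "(\<Sum>m\<le>Suc n. f m) * (of_nat (Suc n) powr (-s) - of_nat (Suc (Suc n)) powr (-s)) \<in> \<real>" for n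
  by (intro Reals_mult Reals_diff Reals_of_nat_powr Reals_minus sum_in_Reals f(2) s(1))
qed

lemma zeta1_Reals:
 assumes s: "s \<in> \<real>" "Re s > 0"
 shows "zeta1 s \<in> \<real>"
 unfolding zeta1_def
proof (rule Reals_add[OF Reals_1 Reals_suminf])
 show "summable (\<lambda>n. (s - 1) * of_nat (Suc n) powr (-s) - of_nat (Suc n) powr (1 - s) + of_nat (Suc (Suc n)) powr (1 - s))"
  by (rule sums_split_tail_bound(1)[where c = "norm s * norm (s - 1)" and \<sigma> = "Re s" and M = 1])
    (use zeta1_term_bound[OF s(2)] s in \<open>auto simp del: of_nat_Suc\<close>)
 show "(s - 1) * of_nat (Suc n) powr (-s) - of_nat (Suc n) powr (1 - s) + of_nat (Suc (Suc n)) powr (1 - s) \<in> \<real>" for n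
  by (intro Reals_add Reals_mult Reals_diff Reals_of_nat_powr Reals_minus Reals_1 s(1))
qed

text \<open>The general bounds with \<open>M = 1\<close>; the disc of Estermann's argument lies in
  \<open>Re z \<ge> 1/2\<close>, where crude constants suffice.\<close>

lemma disc_bounds:
 assumes z: "norm (z - 2) \<le> 3/2"
 shows "norm (zeta1 z) \<le> 22" "bounded_sums q f \<Longrightarrow> norm (Lfun f z) \<le> 9 * q"
proof -
 have "\<bar>Re (z - 2)\<bar> \<le> 3/2" using abs_Re_le_cmod[of "z - 2"] z by linarith
 then have Re: "Re z \<ge> 1/2" unfolding minus_complex.sel complex_Re_numeral by linarith
 then have Re0: "Re z > 0" by linarith
 have n: "norm z \<le> 7/2" "norm (z - 1) \<le> 5/2"
  using norm_triangle_ineq[of "z - 2" 2] norm_triangle_ineq[of "z - 2" 1] z by simp_all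
 have p1: "real (Suc 1) powr (- Re z) \<le> 1" using powr_mono[of "- Re z" 0 2] Re by simp
 have p2: "real (Suc 1) powr (1 - Re z) \<le> 2" using powr_mono[of "1 - Re z" 1 2] Re by simp
 have inv: "1 / Re z \<le> 2" using Re by (simp add: field_simps)
 have "norm z * (1 / Re z) \<le> 7/2 * 2" using n inv Re by (intro mult_mono) auto
 then have nr: "norm z * (1 / Re z) \<le> 7" by simp
 have "norm (zeta1 z) \<le> norm (z - 1) + real (Suc 1) powr (1 - Re z) + norm (z - 1) * (norm z * (1 / Re z))"
  using norm_zeta1_le[OF Re0, of 1] by (simp add: mult_ac)
 also have "\<dots> \<le> 5/2 + 2 + 5/2 * 7" using n nr p2 Re by (intro add_mono mult_mono) auto
 finally show "norm (zeta1 z) \<le> 22" by simp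
 assume f: "bounded_sums q f"
 have f1: "norm (\<Sum>m\<le>1. f m) \<le> q" "f 0 = 0" "cmult f" using f unfolding bounded_sums_def by blast+
 have "(\<Sum>m\<le>1. f m) = 1" using f1(2,3) by (simp add: cmult_def)
 then have q: "q \<ge> 1" using f1(1) by simp
 have "norm (Lfun f z) \<le> 1 + q * real (Suc 1) powr (- Re z) + q * (norm z * (1 / Re z))"
  using norm_Lfun_le[OF f Re0, of 1] by (simp add: mult_ac)
 also have "\<dots> \<le> q + q * 1 + q * 7" using q nr p1 by (intro add_mono mult_left_mono) auto
 finally show "norm (Lfun f z) \<le> 9 * q" by simp
qed

text \<open>\<open>F\<close> is the product of the L-functions without the zeta factor; the full
  product has the nonnegative logarithmic coefficients \<open>\<Lambda>0 n * h n\<close>. The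
  constant is \<open>704 = 32 * 22\<close>, with 22 bounding \<open>zeta1\<close> on the
  disc.\<close>

lemma estermann_real:
 fixes h :: "nat \<Rightarrow> real"
 assumes h: "\<And>n. 0 \<le> h n" "\<And>n. h n \<le> 4"
  and hol: "F holomorphic_on {s. Re s > 0}"
  and F: "\<And>z. Re z > 1 \<Longrightarrow> F z = exp (dirichlet (\<lambda>n. of_real (\<Lambda>0 n) * (of_real (h n) - 1)) z)"
  and B: "B \<ge> 1" "\<And>z. norm (z - 2) \<le> 3/2 \<Longrightarrow> norm (F z) \<le> B"
  and l: "F 1 = of_real l" and \<beta>: "9/10 \<le> \<beta>" "\<beta> < 1" and neg: "Re (zeta1 (of_real \<beta>) * F (of_real \<beta>)) \<ge> 0"
 shows "(1 - \<beta>) / 6 * (704 * B) powr (-4 * (1 - \<beta>)) \<le> l"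
proof -
 define G where "G s = exp (dirichlet (\<lambda>n. of_real (\<Lambda>0 n * h n)) s)" for s
 have ac: "abs_conv (\<lambda>n. of_real (\<Lambda>0 n) * of_real (h n))"
 proof (rule abs_convI[OF _ abs_conv_const[of 4]])
  fix n :: nat
  have "\<Lambda>0 n * h n \<le> 1 * 4" using \<Lambda>0_nonneg \<Lambda>0_le_1 h by (intro mult_mono) auto
  then show "norm (of_real (\<Lambda>0 n) * complex_of_real (h n)) \<le> norm (4::complex)"
   using \<Lambda>0_nonneg h by (simp add: norm_mult)
 qed
 note ac1 = abs_conv_\<Lambda>0_times[OF cmult_const_1]
 have "(1 - \<beta>) / 6 * (32 * (22 * B)) powr (-4 * (1 - \<beta>)) \<le> l"
 proof (rule estermann[where K = "\<lambda>z. zeta1 z * F z" and G = G])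
  show "(\<lambda>z. zeta1 z * F z) holomorphic_on {s. Re s > 0}" by (intro holomorphic_intros holomorphic_zeta1 hol)
  show "alternating_derivs G" unfolding G_def[abs_def] by (rule alternating_derivs_exp[OF h])
  show "norm (zeta1 z * F z) \<le> 22 * B" if "norm (z - 2) \<le> 3/2" for z
   unfolding norm_mult using disc_bounds(1)[OF that] B(2)[OF that] by (intro mult_mono) auto
  show "G z = zeta1 z * F z / (z - 1)" if z: "Re z > 1" for z
  proof -
   have "dirichlet (\<lambda>n. of_real (\<Lambda>0 n) * of_real (h n)) z
    = dirichlet (\<lambda>n. of_real (\<Lambda>0 n) * of_real (h n) - of_real (\<Lambda>0 n) * 1) z + dirichlet (\<lambda>n. of_real (\<Lambda>0 n) * 1) z"
    unfolding dirichlet_diff[OF ac ac1 z] by simp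
   then have "G z = F z * dirichlet (\<lambda>n. 1) z"
    unfolding F[OF z] dirichlet_eq_exp[OF cmult_const_1 z] G_def exp_add[symmetric] by (simp add: right_diff_distrib)
   moreover have "z \<noteq> 1" using z by auto
   ultimately show ?thesis unfolding zeta1_eq_dirichlet[OF z] by simp
  qed
 qed (use B l \<beta> neg zeta1_1 in auto)
 then show ?thesis by simp
qed

lemma real_char_in_Reals: "real_char q \<phi> \<Longrightarrow> \<phi> n \<in> \<real>"
 using real_char_Re[of q \<phi> n] by (metis Reals_of_real)

lemma real_char_np: "real_char q \<phi> \<Longrightarrow> nonprincipal q \<phi>"
 by (simp add: real_char_def)

lemma Re_real_char: "real_char q \<phi> \<Longrightarrow> -1 \<le> Re (\<phi> n) \<and> Re (\<phi> n) \<le> 1"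
 using real_char_cases[of q \<phi> n] by auto

text \<open>The product \<open>zeta1 * Lfun \<phi>\<close> is real on the positive real axis and
  positive beyond 1. Having no zero in \<open>[\<beta>, 1]\<close>, it cannot change sign there, so
  it is nonnegative at \<beta> as Estermann's argument demands.\<close>

lemma siegel_no_zero:
 assumes rc: "real_char q \<phi>" and \<beta>: "9/10 \<le> \<beta>" "\<beta> < 1"
  and nz: "\<And>\<sigma>. \<beta> \<le> \<sigma> \<Longrightarrow> \<sigma> \<le> 1 \<Longrightarrow> zeta1 (of_real \<sigma>) * Lfun \<phi> (of_real \<sigma>) \<noteq> 0"
 shows "(1 - \<beta>) / 6 * (704 * (9 * real q)) powr (-4 * (1 - \<beta>)) \<le> norm (Lfun \<phi> 1)"
proof -
 note np = nonprincipalD[OF real_char_np[OF rc]]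
 note re = real_char_in_Reals[OF rc]
 have "Lfun \<phi> 1 \<in> \<real>" by (rule Lfun_Reals[OF np(4) re]) auto
 then obtain l where l: "Lfun \<phi> 1 = of_real l" by (auto elim: Reals_cases)
 have F: "Lfun \<phi> z = exp (dirichlet (\<lambda>n. of_real (\<Lambda>0 n) * (of_real (1 + Re (\<phi> n)) - 1)) z)" if "Re z > 1" for z
  unfolding Lfun_eq_dirichlet[OF np(4) that] dirichlet_eq_exp[OF np(5) that]
  using real_char_Re[OF rc] by simp
 have "(1 - \<beta>) / 6 * (704 * (9 * real q)) powr (-4 * (1 - \<beta>)) \<le> l"
 proof (rule estermann_real[where F = "Lfun \<phi>" and h = "\<lambda>n. 1 + Re (\<phi> n)", OF _ _ holomorphic_Lfun[OF np(4)] F _ disc_bounds(2)[OF _ np(4)] l \<beta>])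
  show "0 \<le> 1 + Re (\<phi> n)" "1 + Re (\<phi> n) \<le> 4" for n using Re_real_char[OF rc, of n] by linarith+
  show "1 \<le> 9 * real q" using np(6) by linarith
  define k where "k \<sigma> = Re (zeta1 (of_real \<sigma>) * Lfun \<phi> (of_real \<sigma>))" for \<sigma>
  have kr: "zeta1 (of_real \<sigma>) * Lfun \<phi> (of_real \<sigma>) = of_real (k \<sigma>)" if "\<sigma> > 0" for \<sigma>
  proof -
   have "zeta1 (of_real \<sigma>) * Lfun \<phi> (of_real \<sigma>) \<in> \<real>"
    using that by (intro Reals_mult zeta1_Reals Lfun_Reals[OF np(4) re]) auto
   then show ?thesis unfolding k_def by (metis of_real_Re)
  qed
  have kpos: "k \<sigma> > 0" if s: "\<sigma> > 1" for \<sigma>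
  proof -
   have s1: "Re (complex_of_real \<sigma>) > 1" using s by simp
   have "dirichlet (\<lambda>n. of_real (\<Lambda>0 n) * 1) (of_real \<sigma>) \<in> \<real>"
    "dirichlet (\<lambda>n. of_real (\<Lambda>0 n) * \<phi> n) (of_real \<sigma>) \<in> \<real>"
    unfolding dirichlet_def
    by (intro Reals_suminf Reals_mult Reals_of_real Reals_1 re Reals_of_nat_powr Reals_minus
       sums_summable[OF sums_dirichlet[OF abs_conv_\<Lambda>0_times s1]] cmult_const_1 np(5))+
   then obtain a b where ab: "dirichlet (\<lambda>n. of_real (\<Lambda>0 n) * 1) (of_real \<sigma>) = of_real a"
    "dirichlet (\<lambda>n. of_real (\<Lambda>0 n) * \<phi> n) (of_real \<sigma>) = of_real b" by (elim Reals_cases)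
   have "zeta1 (of_real \<sigma>) * Lfun \<phi> (of_real \<sigma>) = of_real ((\<sigma> - 1) * exp a * exp b)"
    unfolding zeta1_eq_dirichlet[OF s1] Lfun_eq_dirichlet[OF np(4) s1] dirichlet_eq_exp[OF np(5) s1]
     dirichlet_eq_exp[OF cmult_const_1 s1] ab by (simp add: exp_of_real)
   then show ?thesis unfolding k_def using s by simp
  qed
  show "0 \<le> Re (zeta1 (of_real \<beta>) * Lfun \<phi> (of_real \<beta>))"
  proof (rule ccontr)
   assume "\<not> ?thesis"
   then have kb: "k \<beta> \<le> 0" by (simp add: k_def)
   have "continuous_on {\<beta>..2} k"
    unfolding k_def using \<beta>
    by (intro continuous_intros continuous_on_compose2[OF holomorphic_on_imp_continuous_on[OF holomorphic_zeta1]]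
       continuous_on_compose2[OF holomorphic_on_imp_continuous_on[OF holomorphic_Lfun[OF np(4)]]]) auto
   then obtain \<sigma> where s: "\<beta> \<le> \<sigma>" "\<sigma> \<le> 2" "k \<sigma> = 0"
    using IVT'[of k \<beta> 0 2] kb kpos[of 2] \<beta> by (auto simp: less_imp_le)
   then have "\<sigma> \<le> 1" using kpos[of \<sigma>] by force
   then show False using nz[OF s(1)] kr[of \<sigma>] s \<beta> by simp
  qed
 qed
 also have "l \<le> norm (Lfun \<phi> 1)" unfolding l by simp
 finally show ?thesis .
qed

text \<open>Estermann's argument for \<open>\<zeta> L(\<psi>) L(\<phi>) L(\<psi> \<phi>)\<close>,
  with logarithmic coefficients proportional to \<open>(1 + \<psi>) (1 + \<phi>) \<ge> 0\<close>.
  The zero of \<open>L(\<psi>)\<close> makes the product vanish at \<beta>, which settles the sign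
  there; \<open>729 = 9 ^ 3\<close> comes from three uses of \<open>disc_bounds\<close>.\<close>

lemma siegel_zero:
 assumes rc: "real_char q \<phi>" and rc1: "real_char q1 \<psi>" and np12: "nonprincipal (q1 * q) (\<lambda>n. \<psi> n * \<phi> n)"
  and \<beta>: "9/10 \<le> \<beta>" "\<beta> < 1" and zero: "Lfun \<psi> (of_real \<beta>) = 0"
 shows "(1 - \<beta>) / 6 * (704 * (729 * real q1 ^ 2 * real q ^ 2)) powr (-4 * (1 - \<beta>))
   \<le> norm (Lfun \<psi> 1) * norm (Lfun \<phi> 1) * norm (Lfun (\<lambda>n. \<psi> n * \<phi> n) 1)"
proof -
 define \<omega> where "\<omega> = (\<lambda>n. \<psi> n * \<phi> n)"
 note np = nonprincipalD[OF real_char_np[OF rc]] and np1 = nonprincipalD[OF real_char_np[OF rc1]]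
  and npw = nonprincipalD[OF np12, folded \<omega>_def]
 note re = real_char_in_Reals[OF rc] and re1 = real_char_in_Reals[OF rc1]
 have rew: "\<omega> n \<in> \<real>" for n unfolding \<omega>_def by (intro Reals_mult re re1)
 define F where "F z = Lfun \<psi> z * Lfun \<phi> z * Lfun \<omega> z" for z
 have "F 1 \<in> \<real>" unfolding F_def
  by (intro Reals_mult Lfun_Reals[OF np(4) re] Lfun_Reals[OF np1(4) re1] Lfun_Reals[OF npw(4) rew]) auto
 then obtain l where l: "F 1 = of_real l" by (auto elim: Reals_cases)
 define h where "h n = (1 + Re (\<psi> n)) * (1 + Re (\<phi> n))" for n
 have h: "complex_of_real (h n) - 1 = \<psi> n + \<phi> n + \<omega> n" for n
  using real_char_Re[OF rc, of n] real_char_Re[OF rc1, of n] by (simp add: h_def \<omega>_def algebra_simps)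
 define B where "B = 729 * real q1 ^ 2 * real q ^ 2"
 have "(1 - \<beta>) / 6 * (704 * B) powr (-4 * (1 - \<beta>)) \<le> l"
 proof (rule estermann_real[where F = F and h = h, OF _ _ _ _ _ _ l \<beta>])
  show "0 \<le> h n" "h n \<le> 4" for n
  proof -
   show "0 \<le> h n" unfolding h_def using Re_real_char[OF rc, of n] Re_real_char[OF rc1, of n] by (intro mult_nonneg_nonneg) linarith+
   have "h n \<le> 2 * 2" unfolding h_def using Re_real_char[OF rc, of n] Re_real_char[OF rc1, of n] by (intro mult_mono) linarith+
   then show "h n \<le> 4" by simp
  qed
  show "F holomorphic_on {s. Re s > 0}" unfolding F_def[abs_def]
   by (intro holomorphic_intros holomorphic_Lfun[OF np(4)] holomorphic_Lfun[OF np1(4)] holomorphic_Lfun[OF npw(4)])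
  show "F z = exp (dirichlet (\<lambda>n. of_real (\<Lambda>0 n) * (of_real (h n) - 1)) z)" if z: "Re z > 1" for z
  proof -
   note a = abs_conv_\<Lambda>0_times[OF np(5)] and a1 = abs_conv_\<Lambda>0_times[OF np1(5)] and aw = abs_conv_\<Lambda>0_times[OF npw(5)]
   have "F z = exp (dirichlet (\<lambda>n. of_real (\<Lambda>0 n) * \<psi> n) z + dirichlet (\<lambda>n. of_real (\<Lambda>0 n) * \<phi> n) z
     + dirichlet (\<lambda>n. of_real (\<Lambda>0 n) * \<omega> n) z)"
    unfolding F_def exp_add Lfun_eq_dirichlet[OF np(4) z] Lfun_eq_dirichlet[OF np1(4) z] Lfun_eq_dirichlet[OF npw(4) z]
     dirichlet_eq_exp[OF np(5) z] dirichlet_eq_exp[OF np1(5) z] dirichlet_eq_exp[OF npw(5) z] ..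
   also have "\<dots> = exp (dirichlet (\<lambda>n. of_real (\<Lambda>0 n) * \<psi> n + of_real (\<Lambda>0 n) * \<phi> n + of_real (\<Lambda>0 n) * \<omega> n) z)"
    unfolding dirichlet_add[OF abs_conv_add[OF a1 a] aw z] dirichlet_add[OF a1 a z] ..
   finally show ?thesis unfolding h by (simp add: distrib_left)
  qed
  show "norm (F z) \<le> B" if z: "norm (z - 2) \<le> 3/2" for z
  proof -
   have "norm (F z) \<le> (9 * real q1) * (9 * real q) * (9 * real (q1 * q))"
    unfolding F_def norm_mult
    using disc_bounds(2)[OF z np(4)] disc_bounds(2)[OF z np1(4)] disc_bounds(2)[OF z npw(4)] by (intro mult_mono) auto
   also have "\<dots> = B" by (simp add: B_def power2_eq_square)
   finally show ?thesis .
  qed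
  have "1 * 1 \<le> real q1 ^ 2 * real q ^ 2" using np(6) np1(6) by (intro mult_mono one_le_power) auto
  then show "1 \<le> B" by (simp add: B_def)
  show "0 \<le> Re (zeta1 (of_real \<beta>) * F (of_real \<beta>))" by (simp add: F_def zero)
 qed
 also have "l \<le> norm (F 1)" unfolding l by simp
 finally show ?thesis unfolding F_def B_def \<omega>_def norm_mult .
qed

text \<open>If no real character has a zero within \<delta> of 1, the bound is explicit. Otherwise
  one character with such a zero is fixed, and the constants depend on it, which makes the theorem
  ineffective. The argument fails exactly when the product with the fixed character is principal, so
  these characters are listed as exceptions.\<close>

theorem siegel:
 assumes e: "\<epsilon> > 0"
 obtains c S where "c > 0" "finite S" "\<And>q1 \<psi>. (q1, \<psi>) \<in> S \<Longrightarrow> real_char q1 \<psi>"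
  "\<And>q \<phi>. real_char q \<phi> \<Longrightarrow> (\<exists>(q1, \<psi>)\<in>S. (\<lambda>n. \<psi> n * \<phi> n) = principal (q1 * q)) \<or> c * real q powr (-\<epsilon>) \<le> norm (Lfun \<phi> 1)"
proof -
 have "isCont zeta1 1"
  by (rule continuous_on_interior[OF holomorphic_on_imp_continuous_on[OF holomorphic_zeta1]])
    (simp add: interior_open[OF open_halfspace_Re_gt])
 then obtain r where r: "r > 0" "\<And>z. dist z 1 < r \<Longrightarrow> dist (zeta1 z) (zeta1 1) < 1"
  unfolding continuous_at_eps_delta by (metis zero_less_one)
 \<comment> \<open>\<open>\<epsilon> / 16\<close>, because the case with a zero loses
   \<open>q powr (8 * \<delta>)\<close> and may spend half of \<epsilon> on it; \<open>r / 2\<close>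
   keeps \<open>zeta1\<close> nonzero on \<open>[1 - \<delta>, 1]\<close>; \<open>1 / 10\<close> is
   the range allowed in \<open>estermann\<close>.\<close>
 define \<delta> where "\<delta> = min (min (\<epsilon> / 16) (r / 2)) (1 / 10)"
 have \<delta>: "0 < \<delta>" "\<delta> \<le> \<epsilon> / 16" "\<delta> < r" "\<delta> \<le> 1 / 10" using e r(1) by (auto simp: \<delta>_def min_def)
 have zz: "zeta1 (of_real \<sigma>) \<noteq> 0" if "1 - \<delta> \<le> \<sigma>" "\<sigma> \<le> 1" for \<sigma>
 proof -
  have "norm (complex_of_real \<sigma> - 1) = norm (complex_of_real (\<sigma> - 1))" by simp
  then have "dist (complex_of_real \<sigma>) 1 < r" using that \<delta> unfolding dist_norm by (simp only: norm_of_real)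
  from r(2)[OF this] show ?thesis by (auto simp: zeta1_1 dist_norm)
 qed
 show thesis
 proof (cases "\<exists>q1 \<psi> \<beta>. real_char q1 \<psi> \<and> 1 - \<delta> \<le> \<beta> \<and> \<beta> < 1 \<and> Lfun \<psi> (of_real \<beta>) = 0")
  case False
  define c where "c = \<delta> / 6 * 6336 powr (-4 * \<delta>)"
  show ?thesis
  proof (rule that[of c "{}"])
   show "c > 0" using \<delta> by (simp add: c_def)
   fix q \<phi> assume rc: "real_char q \<phi>"
   note np = nonprincipalD[OF real_char_np[OF rc]]
   have "c * real q powr (-\<epsilon>) \<le> c * real q powr (-4 * \<delta>)"
    using \<open>c > 0\<close> np(6) \<delta> e by (intro mult_left_mono powr_mono) auto
   also have "\<dots> = (1 - (1 - \<delta>)) / 6 * (704 * (9 * real q)) powr (-4 * (1 - (1 - \<delta>)))"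
    by (simp add: c_def powr_mult)
   also have "\<dots> \<le> norm (Lfun \<phi> 1)"
   proof (rule siegel_no_zero[OF rc])
    show "zeta1 (of_real \<sigma>) * Lfun \<phi> (of_real \<sigma>) \<noteq> 0" if s: "1 - \<delta> \<le> \<sigma>" "\<sigma> \<le> 1" for \<sigma>
    proof -
     have "Lfun \<phi> (of_real \<sigma>) \<noteq> 0" using False rc s real_char_Lfun_1_nonzero[OF rc] by (cases "\<sigma> = 1") force+
     then show ?thesis using zz[OF s] by simp
    qed
   qed (use \<delta> in auto)
   finally show "(\<exists>(q1, \<psi>)\<in>{}. (\<lambda>n. \<psi> n * \<phi> n) = principal (q1 * q)) \<or> c * real q powr (-\<epsilon>) \<le> norm (Lfun \<phi> 1)" by blast
  qed simp_all
 next
  case True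
  then obtain q1 \<psi> \<beta> where rc1: "real_char q1 \<psi>" and \<beta>: "1 - \<delta> \<le> \<beta>" "\<beta> < 1" and zero: "Lfun \<psi> (of_real \<beta>) = 0" by blast
  note np1 = nonprincipalD[OF real_char_np[OF rc1]]
  \<comment> \<open>The other half of \<epsilon> pays for the upper bound at 1 of the L-function of
    the product character, which is of size \<open>q powr (2 * \<eta>)\<close>.\<close>
  define \<eta> where "\<eta> = min (\<epsilon> / 4) (1/2)"
  have \<eta>: "0 < \<eta>" "\<eta> \<le> 1/2" "\<eta> \<le> \<epsilon> / 4" using e by (auto simp: \<eta>_def)
  obtain A where A: "A \<ge> 1" "\<And>q f t z. 1 \<le> q \<Longrightarrow> bounded_sums q f \<Longrightarrow> 1 - \<eta> \<le> Re z \<Longrightarrow> Re z \<le> 3 \<Longrightarrow> \<bar>Im z - t\<bar> \<le> 1 \<Longrightarrow>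
   norm (Lfun f z) \<le> A * (q * (\<bar>t\<bar> + 2)) powr (2 * \<eta>)" by (rule Lfun_growth[OF \<eta>(1,2)]) blast
  define c1 where "c1 = (1 - \<beta>) / 6 * (704 * (729 * real q1 ^ 2)) powr (-4 * \<delta>)"
  define c2 where "c2 = norm (Lfun \<psi> 1) * A * (2 * real q1) powr (2 * \<eta>)"
  have c1: "c1 > 0" using \<beta> np1(6) by (simp add: c1_def)
  have c2: "c2 > 0" using A(1) np1(6) real_char_Lfun_1_nonzero[OF rc1] by (simp add: c2_def)
  show ?thesis
  proof (rule that[of "c1 / c2" "{(q1, \<psi>)}"])
   show "c1 / c2 > 0" using c1 c2 by simp
   fix q \<phi> assume rc: "real_char q \<phi>"
   note np = nonprincipalD[OF real_char_np[OF rc]]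
   have q: "real q > 0" using np(6) by linarith
   have "c1 / c2 * real q powr (-\<epsilon>) \<le> norm (Lfun \<phi> 1)" if ne: "(\<lambda>n. \<psi> n * \<phi> n) \<noteq> principal (q1 * q)"
   proof -
    have npw: "nonprincipal (q1 * q) (\<lambda>n. \<psi> n * \<phi> n)"
     unfolding nonprincipal_def using ne np(1) np1(1) dchar_times[OF np1(2) np(2)] by simp
    define R where "R = 704 * (729 * real q1 ^ 2 * real q ^ 2)"
    have "1 * 1 \<le> real q1 ^ 2 * real q ^ 2" using np(6) np1(6) by (intro mult_mono one_le_power) auto
    then have R: "R \<ge> 1" by (simp add: R_def)
    have "c1 * real q powr (-8 * \<delta>) = (1 - \<beta>) / 6 * R powr (-4 * \<delta>)"
    proof -
     have "R = 704 * (729 * real q1 ^ 2) * real q powr 2" using q by (simp add: R_def powr_numeral)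
     then have "R powr (-4 * \<delta>) = (704 * (729 * real q1 ^ 2)) powr (-4 * \<delta>) * real q powr (2 * (-4 * \<delta>))"
      by (simp only: powr_mult powr_powr)
     then show ?thesis by (simp add: c1_def)
    qed
    also have "\<dots> \<le> (1 - \<beta>) / 6 * R powr (-4 * (1 - \<beta>))"
     using \<beta> R by (intro mult_left_mono[OF powr_mono]) auto
    also have "\<dots> \<le> norm (Lfun \<psi> 1) * norm (Lfun \<phi> 1) * norm (Lfun (\<lambda>n. \<psi> n * \<phi> n) 1)"
     unfolding R_def using \<beta> \<delta> by (intro siegel_zero[OF rc rc1 npw _ _ zero]) auto
    also have "\<dots> \<le> norm (Lfun \<psi> 1) * norm (Lfun \<phi> 1) * (A * (real (q1 * q) * (\<bar>0\<bar> + 2)) powr (2 * \<eta>))"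
     using \<eta> by (intro mult_left_mono A(2)[OF nonprincipalD(6)[OF npw] nonprincipalD(4)[OF npw]]) auto
    also have "\<dots> = c2 * real q powr (2 * \<eta>) * norm (Lfun \<phi> 1)"
     unfolding c2_def using q np1(6) by (simp add: powr_mult mult_ac)
    also have "\<dots> \<le> c2 * real q powr (\<epsilon> / 2) * norm (Lfun \<phi> 1)"
     using c2 \<eta> np(6) by (intro mult_left_mono mult_right_mono powr_mono) auto
    finally have 1: "c1 * real q powr (-8 * \<delta>) \<le> c2 * real q powr (\<epsilon> / 2) * norm (Lfun \<phi> 1)" .
    have "c1 * real q powr (- \<epsilon> / 2) \<le> c1 * real q powr (-8 * \<delta>)"
     using c1 \<delta> np(6) by (intro mult_left_mono powr_mono) auto
    then have "c1 * real q powr (- \<epsilon> / 2) * real q powr (- \<epsilon> / 2) \<le> c2 * real q powr (\<epsilon> / 2) * norm (Lfun \<phi> 1) * real q powr (- \<epsilon> / 2)"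
     using 1 by (intro mult_right_mono) auto
    moreover have "real q powr (- \<epsilon> / 2) * real q powr (- \<epsilon> / 2) = real q powr (-\<epsilon>)"
     "real q powr (\<epsilon> / 2) * real q powr (- \<epsilon> / 2) = 1" using q by (simp_all add: powr_add[symmetric])
    ultimately have "c1 * real q powr (- \<epsilon>) \<le> c2 * norm (Lfun \<phi> 1)" by (simp add: mult_ac)
    then show ?thesis using c2 by (simp add: field_simps)
   qed
   then show "(\<exists>(q1, \<psi>')\<in>{(q1, \<psi>)}. (\<lambda>n. \<psi>' n * \<phi> n) = principal (q1 * q)) \<or> c1 / c2 * real q powr (-\<epsilon>) \<le> norm (Lfun \<phi> 1)" by blast
  qed (use rc1 in auto)
 qed
qed

section \<open>Primes congruent to 1\<close>

text \<open>An exceptional real character agrees with one of finitely many fixed characters at every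
  \<open>n\<close> prime to both moduli. That fixed character takes its place: its value at 1 is one
  of finitely many positive numbers, and the two differ only at primes dividing
  \<open>q' * q\<close>.\<close>

lemma siegel_replacement:
 assumes e: "\<epsilon> > 0"
 obtains c Q where "c > 0" "Q \<ge> (1::nat)" "\<And>q \<phi>. nonprincipal q \<phi> \<Longrightarrow>
  \<exists>q' \<psi>. nonprincipal q' \<psi> \<and> q' \<le> Q * q \<and> (\<forall>n. coprime n (q' * q) \<longrightarrow> \<psi> n = \<phi> n) \<and> c * real q powr (-\<epsilon>) \<le> defect q' \<psi>"
proof -
 obtain c0 S where c0: "c0 > 0" and S: "finite S" "\<And>q1 \<psi>. (q1, \<psi>) \<in> S \<Longrightarrow> real_char q1 \<psi>" and
  si: "\<And>q \<phi>. real_char q \<phi> \<Longrightarrow> (\<exists>(q1, \<psi>)\<in>S. (\<lambda>n. \<psi> n * \<phi> n) = principal (q1 * q)) \<or> c0 * real q powr (-\<epsilon>) \<le> norm (Lfun \<phi> 1)"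
  by (rule siegel[OF e]) blast
 define T where "T = insert 1 ((\<lambda>(q1, \<psi>). norm (Lfun \<psi> 1)) ` S)"
 have T: "finite T" "T \<noteq> {}" "\<And>t. t \<in> T \<Longrightarrow> t > 0"
  using S(1) real_char_Lfun_1_nonzero[OF S(2)] by (auto simp: T_def)
 define c where "c = min c0 (Min T)"
 define Q where "Q = Max (insert 1 (fst ` S))"
 have c: "c > 0" "c \<le> c0" "c \<le> 1"
 proof -
  have "Min T \<le> 1" "Min T > 0" using T by (auto intro!: Min_le simp: T_def)
  then show "c > 0" "c \<le> c0" "c \<le> 1" using c0 by (auto simp: c_def)
 qed
 show thesis
 proof (rule that[of c Q])
  show "Q \<ge> 1" using S(1) by (simp add: Q_def)
  fix q \<phi> assume np: "nonprincipal q \<phi>"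
  note q = nonprincipalD(6)[OF np]
  have pw: "real q powr (-\<epsilon>) \<le> 1" using powr_mono[of "-\<epsilon>" 0 "real q"] q e by simp
  have cq: "c * real q powr (-\<epsilon>) \<le> c" using mult_left_mono[OF pw, of c] c by simp
  then have c1: "c * real q powr (-\<epsilon>) \<le> 1" using c by linarith
  have qQ: "q \<le> Q * q" using \<open>Q \<ge> 1\<close> by simp
  show "\<exists>q' \<psi>. nonprincipal q' \<psi> \<and> q' \<le> Q * q \<and> (\<forall>n. coprime n (q' * q) \<longrightarrow> \<psi> n = \<phi> n) \<and> c * real q powr (-\<epsilon>) \<le> defect q' \<psi>"
  proof (cases "real_char q \<phi>")
   case False
   then have "defect q \<phi> = 1" using np by (simp add: defect_def real_char_def)
   then show ?thesis using np qQ c1 by (intro exI[of _ q] exI[of _ \<phi>]) simp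
  next
   case rc: True
   show ?thesis
   proof (cases "\<exists>(q1, \<psi>)\<in>S. (\<lambda>n. \<psi> n * \<phi> n) = principal (q1 * q)")
    case True
    then obtain q1 \<psi> where p: "(q1, \<psi>) \<in> S" "(\<lambda>n. \<psi> n * \<phi> n) = principal (q1 * q)" by blast
    note rc1 = S(2)[OF p(1)]
    have "q1 \<le> Q" unfolding Q_def using S(1) p(1) by (intro Max_ge) force+
    then have "q1 \<le> Q * q" using q by (metis le_square mult_le_mono mult.right_neutral nonprincipalD(1)[OF np] One_nat_def Suc_leI)
    moreover have "\<psi> n = \<phi> n" if "coprime n (q1 * q)" for n
    proof -
     have "\<psi> n * \<phi> n = 1" using fun_cong[OF p(2), of n] that by (simp add: principal_def)
     then show ?thesis using real_char_cases[OF rc, of n] real_char_cases[OF rc1, of n] by auto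
    qed
    moreover have "c \<le> norm (Lfun \<psi> 1)"
    proof -
     have "norm (Lfun \<psi> 1) \<in> T" using p(1) by (force simp: T_def)
     then show ?thesis unfolding c_def using Min_le[OF T(1)] by fastforce
    qed
    then have "c * real q powr (-\<epsilon>) \<le> defect q1 \<psi>" using cq c1 unfolding defect_def by (simp del: mult_le_cancel_left_pos)
    ultimately show ?thesis using real_char_np[OF rc1] by blast
   next
    case False
    then have "c0 * real q powr (-\<epsilon>) \<le> norm (Lfun \<phi> 1)" using si[OF rc] by blast
    moreover have "c * real q powr (-\<epsilon>) \<le> c0 * real q powr (-\<epsilon>)" using c by (intro mult_right_mono) auto
    ultimately have "c * real q powr (-\<epsilon>) \<le> defect q \<phi>" using c1 unfolding defect_def by simp
    then show ?thesis using np qQ by (intro exI[of _ q] exI[of _ \<phi>]) simp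
   qed
  qed
 qed (rule c)
qed

text \<open>Bounds the cost of exchanging characters that differ only at primes dividing
  \<open>M\<close>; there are at most \<open>M\<close> such primes.\<close>

lemma norm_sum_zero_on_coprime:
 fixes h :: "nat \<Rightarrow> complex"
 assumes h: "\<And>n. coprime n M \<Longrightarrow> h n = 0" "\<And>n. norm (h n) \<le> 2" and M: "M > 0"
 shows "norm (\<Sum>p\<in>primes_upto x. h p) \<le> 2 * real M"
proof -
 have "(\<Sum>p\<in>primes_upto x. h p) = (\<Sum>p | p \<in> primes_upto x \<and> p dvd M. h p)"
  by (rule sum.mono_neutral_right) (use finite_primes_upto[of x] in \<open>auto simp: primes_upto_def coprime_commute intro!: h prime_imp_coprime\<close>)
 also have "norm \<dots> \<le> (\<Sum>p | p \<in> primes_upto x \<and> p dvd M. 2)" by (intro order_trans[OF norm_sum] sum_mono h(2))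
 also have "\<dots> = 2 * real (card {p \<in> primes_upto x. p dvd M})" by simp
 also have "card {p \<in> primes_upto x. p dvd M} \<le> card {1..M}"
  using M by (intro card_mono subsetI) (auto simp: primes_upto_def dest: dvd_imp_le prime_gt_0_nat)
 finally show ?thesis by simp
qed

lemma char_prime_sum:
 obtains C x0 where "C \<ge> 0" "x0 \<ge> 3" "\<And>q \<phi> x. nonprincipal q \<phi> \<Longrightarrow> x \<ge> x0 \<Longrightarrow>
  norm (\<Sum>p\<in>primes_upto x. \<phi> p) \<le> C * real q ^ 2 * (x / ln x ^ m)"
proof -
 \<comment> \<open>With the exponent \<open>1 / (2 m + 1)\<close> the \<open>(2 m + 1)\<close>-th
   power of the defect is at least a constant divided by \<open>q\<close>, so the final bound is
   polynomial in \<open>q\<close>.\<close>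
 obtain c Q where c: "c > 0" and Q: "Q \<ge> (1::nat)" and rep: "\<And>q \<phi>. nonprincipal q \<phi> \<Longrightarrow>
  \<exists>q' \<psi>. nonprincipal q' \<psi> \<and> q' \<le> Q * q \<and> (\<forall>n. coprime n (q' * q) \<longrightarrow> \<psi> n = \<phi> n) \<and> c * real q powr (- (1 / real (2 * m + 1))) \<le> defect q' \<psi>"
  by (rule siegel_replacement[of "1 / real (2 * m + 1)"]) (force, blast)
 obtain C where C: "C \<ge> 0" "\<And>q \<phi> s. nonprincipal q \<phi> \<Longrightarrow> 1 < Re s \<Longrightarrow> Re s \<le> 2 \<Longrightarrow> defect q \<phi> > 0 \<Longrightarrow>
  norm (dirichlet (\<lambda>n. mangoldt n * \<phi> n * cln n ^ (2 * m)) s)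
   \<le> C * (real q * (\<bar>Im s\<bar> + 2)) powr (1/2) / defect q \<phi> ^ (2 * m + 1)"
  by (rule mangoldt_dirichlet_bound[of "1/2" "2 * m"]) (simp, blast)
 obtain C1 x1 where C1: "C1 \<ge> 0" "x1 \<ge> 3" "\<And>x. x \<ge> x1 \<Longrightarrow> 1 \<le> x / ln x ^ m"
  and ps: "\<And>f g B x. (\<And>n. norm (f n) \<le> 1) \<Longrightarrow> (\<And>n. norm (g n) \<le> 1) \<Longrightarrow> B \<ge> 1 \<Longrightarrow>
   (\<And>\<sigma> t. 1 < \<sigma> \<Longrightarrow> \<sigma> \<le> 2 \<Longrightarrow>
    norm (dirichlet (\<lambda>n. (mangoldt n * f n - g n) * cln n ^ (2 * m)) (Complex \<sigma> t)) \<le> B * (\<bar>t\<bar> + 2) powr (1/2)) \<Longrightarrow>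
   x \<ge> x1 \<Longrightarrow> norm ((\<Sum>p\<in>primes_upto x. f p) - (\<Sum>n\<in>{2..nat \<lfloor>x\<rfloor>}. g n / cln n)) \<le> C1 * B * (x / ln x ^ m)"
  by (rule prime_sum_bound) blast
 define A where "A = 1 + C * real Q / c ^ (2 * m + 1)"
 have A: "A \<ge> 1" using C(1) c by (simp add: A_def)
 show thesis
 proof (rule that[of "C1 * A + 2 * real Q" x1])
  show "C1 * A + 2 * real Q \<ge> 0" using C1(1) A by simp
  fix q \<phi> x assume np: "nonprincipal q \<phi>" and x: "x1 \<le> x"
  obtain q' \<psi> where np': "nonprincipal q' \<psi>" and q': "q' \<le> Q * q" and eq: "\<And>n. coprime n (q' * q) \<Longrightarrow> \<psi> n = \<phi> n"
   and df: "c * real q powr (- (1 / real (2 * m + 1))) \<le> defect q' \<psi>" using rep[OF np] by blast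
  note n = nonprincipalD[OF np] and n' = nonprincipalD[OF np']
  have q0: "real q > 0" using n(6) by linarith
  have q2: "1 \<le> real q ^ 2" using n(6) by (rule one_le_power)
  have dpos: "defect q' \<psi> > 0" by (rule less_le_trans[OF _ df]) (use c q0 in simp)
  have dl: "c ^ (2 * m + 1) / real q \<le> defect q' \<psi> ^ (2 * m + 1)"
  proof -
   have "c ^ (2 * m + 1) * (real q powr (- (1 / real (2 * m + 1)))) ^ (2 * m + 1) \<le> defect q' \<psi> ^ (2 * m + 1)"
    unfolding power_mult_distrib[symmetric] using c by (intro power_mono df) auto
   moreover have "(real q powr (- (1 / real (2 * m + 1)))) ^ (2 * m + 1) = real q powr (- 1)"
    using q0 by (subst powr_realpow[symmetric]) (simp, simp only: powr_powr, simp add: field_simps)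
   ultimately show ?thesis using q0 by (simp add: powr_minus divide_inverse)
  qed
  have qq: "real q' \<le> real Q * real q" using q' by (metis of_nat_le_iff of_nat_mult)
  define B where "B = A * real q ^ 2"
  have B: "B \<ge> 1" unfolding B_def using mult_mono[OF A q2] A by simp
  have bd: "norm (dirichlet (\<lambda>n. mangoldt n * \<psi> n * cln n ^ (2 * m)) (Complex \<sigma> t)) \<le> B * (\<bar>t\<bar> + 2) powr (1/2)"
   if s: "1 < \<sigma>" "\<sigma> \<le> 2" for \<sigma> t
  proof -
   have "norm (dirichlet (\<lambda>n. mangoldt n * \<psi> n * cln n ^ (2 * m)) (Complex \<sigma> t))
     \<le> C * (real q' * (\<bar>t\<bar> + 2)) powr (1/2) / defect q' \<psi> ^ (2 * m + 1)"
    using C(2)[OF np' _ _ dpos, of "Complex \<sigma> t"] s by simp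
   also have "\<dots> \<le> C * (real q' * (\<bar>t\<bar> + 2)) powr (1/2) / (c ^ (2 * m + 1) / real q)"
    using dl c q0 C(1) dpos by (intro divide_left_mono mult_pos_pos divide_pos_pos zero_less_power) auto
   also have "\<dots> = (C / c ^ (2 * m + 1) * real q) * (real q' powr (1/2) * (\<bar>t\<bar> + 2) powr (1/2))"
    using n'(6) by (simp add: powr_mult)
   also have "\<dots> \<le> (C / c ^ (2 * m + 1) * real q) * ((real Q * real q) * (\<bar>t\<bar> + 2) powr (1/2))"
   proof (intro mult_left_mono mult_right_mono)
    show "real q' powr (1/2) \<le> real Q * real q"
     using powr_mono[of "1/2" 1 "real q'"] n'(6) qq by simp
   qed (use C(1) c in auto)
   also have "\<dots> = (C * real Q / c ^ (2 * m + 1) * real q ^ 2) * (\<bar>t\<bar> + 2) powr (1/2)"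
    by (simp add: power2_eq_square)
   also have "\<dots> \<le> B * (\<bar>t\<bar> + 2) powr (1/2)"
    unfolding B_def A_def by (intro mult_right_mono) auto
   finally show ?thesis .
  qed
  have xm: "1 \<le> x / ln x ^ m" by (rule C1(3)[OF x])
  have 1: "norm (\<Sum>p\<in>primes_upto x. \<psi> p) \<le> C1 * B * (x / ln x ^ m)"
   using ps[of \<psi> "\<lambda>_. 0", OF cmult_norm[OF n'(5)] _ B _ x] bd by simp
  have 3: "norm (\<Sum>p\<in>primes_upto x. \<phi> p - \<psi> p) \<le> 2 * real (q' * q)"
  proof (rule norm_sum_zero_on_coprime)
   show "norm (\<phi> k - \<psi> k) \<le> 2" for k
    using norm_triangle_ineq4[of "\<phi> k" "\<psi> k"] cmult_norm[OF n(5), of k] cmult_norm[OF n'(5), of k] by linarith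
  qed (use eq n(1) n'(1) in auto)
  have "norm (\<Sum>p\<in>primes_upto x. \<phi> p) \<le> C1 * B * (x / ln x ^ m) + 2 * real (q' * q)"
   using 1 3 norm_triangle_ineq[of "\<Sum>p\<in>primes_upto x. \<psi> p" "\<Sum>p\<in>primes_upto x. \<phi> p - \<psi> p"] by (simp add: sum_subtractf)
  also have "\<dots> \<le> C1 * B * (x / ln x ^ m) + 2 * (real Q * real q ^ 2) * (x / ln x ^ m)"
  proof (rule add_left_mono)
   have "real (q' * q) * 1 \<le> (real Q * real q ^ 2) * (x / ln x ^ m)"
   proof (rule mult_mono[OF _ xm])
    show "real (q' * q) \<le> real Q * real q ^ 2"
     using mult_right_mono[OF qq, of "real q"] q0 by (simp add: power2_eq_square)
   qed auto
   then show "2 * real (q' * q) \<le> 2 * (real Q * real q ^ 2) * (x / ln x ^ m)" by simp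
  qed
  also have "\<dots> = (C1 * A + 2 * real Q) * real q ^ 2 * (x / ln x ^ m)"
   unfolding B_def by (simp only: distrib_right mult.assoc)
  finally show "norm (\<Sum>p\<in>primes_upto x. \<phi> p) \<le> (C1 * A + 2 * real Q) * real q ^ 2 * (x / ln x ^ m)" .
 qed (rule C1)
qed

section \<open>The logarithmic integral, the prime number theorem and the residue class of 1\<close>

lemma Li_integrable: "2 \<le> a \<Longrightarrow> (\<lambda>t. 1 / ln t) integrable_on {a..b::real}"
 by (intro integrable_continuous_real continuous_intros) auto

lemma Li_integral_bounds:
 fixes a b :: real
 assumes "2 \<le> a" "a \<le> b"
 shows "(b - a) / ln b \<le> integral {a..b} (\<lambda>t. 1 / ln t)" "integral {a..b} (\<lambda>t. 1 / ln t) \<le> (b - a) / ln a"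
proof -
 have "integral {a..b} (\<lambda>_. 1 / ln b) \<le> integral {a..b} (\<lambda>t. 1 / ln t)"
  using assms by (intro integral_le Li_integrable) (auto intro!: divide_left_mono)
 then show "(b - a) / ln b \<le> integral {a..b} (\<lambda>t. 1 / ln t)" using assms by simp
 have "integral {a..b} (\<lambda>t. 1 / ln t) \<le> integral {a..b} (\<lambda>_. 1 / ln a)"
  using assms by (intro integral_le Li_integrable) (auto intro!: divide_left_mono)
 then show "integral {a..b} (\<lambda>t. 1 / ln t) \<le> (b - a) / ln a" using assms by simp
qed

lemma Li_split: "2 \<le> a \<Longrightarrow> a \<le> b \<Longrightarrow> Li b = Li a + integral {a..b} (\<lambda>t. 1 / ln t)"
 unfolding Li_def by (rule Henstock_Kurzweil_Integration.integral_combine[symmetric]) (auto intro: Li_integrable)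

lemma Li_bounds:
 assumes "x \<ge> 2"
 shows "0 \<le> Li x" "Li x \<le> 2 * x"
proof -
 have l2: "ln (2::real) \<ge> 2/3" by (rule ln2_ge_two_thirds)
 show "0 \<le> Li x" using Li_integral_bounds(1)[of 2 x] assms by (simp add: Li_def) (rule order_trans[OF divide_nonneg_nonneg], auto)
 have "(x - 2) / ln 2 \<le> x / (1/2)" using assms l2 by (intro frac_le) auto
 then show "Li x \<le> 2 * x" using Li_integral_bounds(2)[of 2 x] assms by (simp add: Li_def)
qed

lemma Li_sum_approx:
 assumes x: "x \<ge> 2"
 shows "\<bar>(\<Sum>n\<in>{2..nat \<lfloor>x\<rfloor>}. 1 / ln (real n)) - Li x\<bar> \<le> 4"
proof -
 define f :: "real \<Rightarrow> real" where "f t = 1 / ln t" for t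
 have l2: "ln (2::real) \<ge> 2/3" by (rule ln2_ge_two_thirds)
 then have f2: "f 2 \<le> 2" unfolding f_def by (simp add: field_simps)
 have main: "Li (real N) + f (real N) \<le> (\<Sum>n\<in>{2..N}. f (real n)) \<and> (\<Sum>n\<in>{2..N}. f (real n)) \<le> Li (real N) + f 2"
  if "N \<ge> 2" for N using that
 proof (induction N rule: dec_induct)
  case base
  have "{2..2} = {2::nat}" by auto
  then show ?case by (simp add: Li_def)
 next
  case (step N)
  have "Li (real (Suc N)) = Li (real N) + integral {real N..real (Suc N)} (\<lambda>t. 1 / ln t)"
   using step by (intro Li_split) auto
  moreover have "f (real (Suc N)) \<le> integral {real N..real (Suc N)} (\<lambda>t. 1 / ln t)"
   "integral {real N..real (Suc N)} (\<lambda>t. 1 / ln t) \<le> f (real N)"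
   using Li_integral_bounds[of "real N" "real (Suc N)"] step by (simp_all add: f_def)
  moreover have "(\<Sum>n\<in>{2..Suc N}. f (real n)) = (\<Sum>n\<in>{2..N}. f (real n)) + f (real (Suc N))"
   using step by simp
  ultimately show ?case using step.IH by linarith
 qed
 define N where "N = nat \<lfloor>x\<rfloor>"
 have N: "N \<ge> 2" "real N \<le> x" "x \<le> real N + 1" using x unfolding N_def by linarith+
 have "Li x = Li (real N) + integral {real N..x} (\<lambda>t. 1 / ln t)" using N by (intro Li_split) auto
 moreover have "0 \<le> integral {real N..x} (\<lambda>t. 1 / ln t)"
  using N by (intro integral_nonneg Li_integrable) auto
 moreover have "integral {real N..x} (\<lambda>t. 1 / ln t) \<le> f 2"
 proof -
  have "ln 2 \<le> ln (real N)" using N by simp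
  then have "(x - real N) / ln (real N) \<le> 1 / ln 2" using N l2 by (intro frac_le) auto
  then show ?thesis using Li_integral_bounds(2)[of "real N" x] N by (simp add: f_def)
 qed
 moreover have "0 \<le> f (real N)" using N by (simp add: f_def)
 ultimately show ?thesis using main[OF N(1)] f2 unfolding N_def[symmetric] f_def[symmetric] by linarith
qed

text \<open>\<open>prime_sum_bound\<close> with \<open>f\<close> and \<open>g\<close> constantly 1:
  the subtracted density accounts for the pole of zeta and produces the sum of
  \<open>1 / ln n\<close>, which stays within 4 of \<open>Li x\<close>.\<close>

lemma pnt:
 obtains C x0 where "C \<ge> 0" "x0 \<ge> 3" "\<And>x. x \<ge> x0 \<Longrightarrow> \<bar>real (card (primes_upto x)) - Li x\<bar> \<le> C * (x / ln x ^ m)"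
proof -
 obtain C where C: "C \<ge> 0" "\<And>s. 1 < Re s \<Longrightarrow> Re s \<le> 2 \<Longrightarrow>
  norm (mangoldt_error (2 * m) s) \<le> C * (\<bar>Im s\<bar> + 2) powr (1/2)"
  by (rule zeta_mangoldt_bound[of "1/2" "2 * m"]) (simp, blast)
 obtain C1 x1 where C1: "C1 \<ge> 0" "x1 \<ge> 3" "\<And>x. x \<ge> x1 \<Longrightarrow> 1 \<le> x / ln x ^ m"
  and ps: "\<And>f g B x. (\<And>n. norm (f n) \<le> 1) \<Longrightarrow> (\<And>n. norm (g n) \<le> 1) \<Longrightarrow> B \<ge> 1 \<Longrightarrow>
   (\<And>\<sigma> t. 1 < \<sigma> \<Longrightarrow> \<sigma> \<le> 2 \<Longrightarrow>
    norm (dirichlet (\<lambda>n. (mangoldt n * f n - g n) * cln n ^ (2 * m)) (Complex \<sigma> t)) \<le> B * (\<bar>t\<bar> + 2) powr (1/2)) \<Longrightarrow>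
   x \<ge> x1 \<Longrightarrow> norm ((\<Sum>p\<in>primes_upto x. f p) - (\<Sum>n\<in>{2..nat \<lfloor>x\<rfloor>}. g n / cln n)) \<le> C1 * B * (x / ln x ^ m)"
  by (rule prime_sum_bound) blast
 show thesis
 proof (rule that[of "C1 * (1 + C) + 4" x1])
  show "C1 * (1 + C) + 4 \<ge> 0" using C1(1) C(1) by simp
  fix x assume x: "x1 \<le> x"
  have "norm ((\<Sum>p\<in>primes_upto x. 1) - (\<Sum>n\<in>{2..nat \<lfloor>x\<rfloor>}. 1 / cln n) :: complex) \<le> C1 * (1 + C) * (x / ln x ^ m)"
  proof (rule ps)
   show "norm (dirichlet (\<lambda>n. (mangoldt n * 1 - 1) * cln n ^ (2 * m)) (Complex \<sigma> t)) \<le> (1 + C) * (\<bar>t\<bar> + 2) powr (1/2)"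
    if "1 < \<sigma>" "\<sigma> \<le> 2" for \<sigma> t
    using C(2)[of "Complex \<sigma> t"] that by (simp add: distrib_right add_increasing)
  qed (use x C(1) in auto)
  also have "(\<Sum>p\<in>primes_upto x. 1) - (\<Sum>n\<in>{2..nat \<lfloor>x\<rfloor>}. 1 / cln n)
   = complex_of_real (real (card (primes_upto x)) - (\<Sum>n\<in>{2..nat \<lfloor>x\<rfloor>}. 1 / ln (real n)))" by simp
  finally have "\<bar>real (card (primes_upto x)) - (\<Sum>n\<in>{2..nat \<lfloor>x\<rfloor>}. 1 / ln (real n))\<bar> \<le> C1 * (1 + C) * (x / ln x ^ m)"
   by (simp only: norm_of_real)
  moreover have "\<bar>(\<Sum>n\<in>{2..nat \<lfloor>x\<rfloor>}. 1 / ln (real n)) - Li x\<bar> \<le> 4" using x C1(2) by (intro Li_sum_approx) auto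
  ultimately have "\<bar>real (card (primes_upto x)) - Li x\<bar> \<le> C1 * (1 + C) * (x / ln x ^ m) + 4 * (x / ln x ^ m)" using C1(3)[OF x] by linarith
  then show "\<bar>real (card (primes_upto x)) - Li x\<bar> \<le> (C1 * (1 + C) + 4) * (x / ln x ^ m)" by (simp only: distrib_right)
 qed (rule C1)
qed

definition primes_1_mod :: "nat \<Rightarrow> real \<Rightarrow> nat set" where
 "primes_1_mod d x = {p \<in> primes_upto x. [p = 1] (mod d)}"

text \<open>Orthogonality over all characters modulo \<open>d\<close>. Since the average is over
  \<open>totient d\<close> characters and is divided by the same number, the error is that of a
  single character.\<close>

theorem siegel_walfisz:
 fixes A D :: nat
 obtains C x0 where "C \<ge> 0" "x0 \<ge> 3" "\<And>x d. x \<ge> x0 \<Longrightarrow> d > 0 \<Longrightarrow> real d \<le> ln x ^ A \<Longrightarrow>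
  \<bar>real (card (primes_1_mod d x)) - Li x / real (totient d)\<bar> \<le> C * (x / ln x ^ D)"
proof -
 \<comment> \<open>The character bound carries a factor \<open>d ^ 2 \<le> ln x ^ (2 * A)\<close>,
   which the additional \<open>2 * A\<close> logarithms of saving cancel.\<close>
 define m where "m = 2 * A + D"
 obtain C1 x1 where 1: "C1 \<ge> 0" "x1 \<ge> 3" "\<And>q \<phi> x. nonprincipal q \<phi> \<Longrightarrow> x \<ge> x1 \<Longrightarrow>
  norm (\<Sum>p\<in>primes_upto x. \<phi> p) \<le> C1 * real q ^ 2 * (x / ln x ^ m)" by (rule char_prime_sum) blast
 obtain C2 x2 where 2: "C2 \<ge> 0" "x2 \<ge> 3" "\<And>x. x \<ge> x2 \<Longrightarrow> \<bar>real (card (primes_upto x)) - Li x\<bar> \<le> C2 * (x / ln x ^ m)"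
  by (rule pnt) blast
 have "eventually (\<lambda>x::real. 1 \<le> x / ln x ^ m) at_top" by real_asymp
 then obtain x3 where x3: "\<And>x::real. x \<ge> x3 \<Longrightarrow> 1 \<le> x / ln x ^ m" by (auto simp: eventually_at_top_linorder)
 show thesis
 proof (rule that[of "C1 + C2 + 2" "max x1 (max x2 x3)"])
  show "C1 + C2 + 2 \<ge> 0" "max x1 (max x2 x3) \<ge> 3" using 1 2 by auto
  fix x :: real and d :: nat
  assume x: "max x1 (max x2 x3) \<le> x" and d: "d > 0" "real d \<le> ln x ^ A"
  have x3': "x \<ge> 3" using x 1(2) by auto
  have lnx: "ln x > 0" using x3' by simp
  define E where "E = x / ln x ^ m"
  have E: "1 \<le> E" using x3[of x] x by (simp add: E_def)
  define F where "F = (C1 + C2 + 2) * real d ^ 2 * E"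
  define P where "P = card (primes_1_mod d x)"
  have d2: "real d ^ 2 \<ge> 1" using d(1) by (intro one_le_power) auto
  have F1: "C1 * real d ^ 2 * E \<le> F" and F2: "C2 * E + 2 * real d \<le> F"
  proof -
   show "C1 * real d ^ 2 * E \<le> F" unfolding F_def using 2(1) E by (intro mult_right_mono) auto
   have "C2 * E \<le> C2 * (real d ^ 2 * E)" using d2 E 2(1) mult_right_mono[of 1 "real d ^ 2" E] by (intro mult_left_mono) auto
   moreover have "real d * 1 \<le> real d ^ 2 * E" using d(1) E by (intro mult_mono) (auto simp: power2_eq_square)
   moreover have "0 \<le> C1 * (real d ^ 2 * E)" using 1(1) E by simp
   ultimately show "C2 * E + 2 * real d \<le> F" unfolding F_def by (simp add: distrib_right mult.assoc)
  qed
  define T where "T \<phi> = (\<Sum>p\<in>primes_upto x. \<phi> p :: complex)" for \<phi>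
  have pd: "principal d \<in> dchars d" by (simp add: dchars_def dchar_principal)
  have "(\<Sum>\<phi>\<in>dchars d. T \<phi>) = (\<Sum>p\<in>primes_upto x. if [p = 1] (mod d) then of_nat (totient d) else 0)"
   unfolding T_def by (subst sum.swap) (simp only: sum_dchars[OF d(1)])
  also have "\<dots> = of_nat (totient d) * of_nat P"
   unfolding P_def primes_1_mod_def by (simp add: sum.If_cases Int_def conj_commute)
  finally have sm: "(\<Sum>\<phi>\<in>dchars d. T \<phi>) = of_nat (totient d) * of_nat P" .
  \<comment> \<open>The deviation of each character sum from its expected value, \<open>Li x\<close>
    for the principal character and 0 for the others.\<close>
  define R where "R \<phi> = (if \<phi> = principal d then T \<phi> - of_real (Li x) else T \<phi>)" for \<phi>
  have "(\<Sum>\<phi>\<in>dchars d. R \<phi>) = (\<Sum>\<phi>\<in>dchars d. T \<phi> - (if \<phi> = principal d then of_real (Li x) else 0))"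
   unfolding R_def by (rule sum.cong) auto
  also have "\<dots> = of_nat (totient d) * of_nat P - of_real (Li x)"
   unfolding sum_subtractf sm using finite_dchars[OF d(1)] pd by simp
  finally have sR: "(\<Sum>\<phi>\<in>dchars d. R \<phi>) = of_real (real (totient d) * real P - Li x)" by simp
  have "norm (R \<phi>) \<le> F" if "\<phi> \<in> dchars d" for \<phi>
  proof (cases "\<phi> = principal d")
   case False
   then have "nonprincipal d \<phi>" using that d(1) by (simp add: nonprincipal_def dchars_def)
   from 1(3)[OF this, of x] have "norm (T \<phi>) \<le> C1 * real d ^ 2 * E" using x by (simp add: T_def E_def)
   then show ?thesis using F1 False by (simp add: R_def)
  next
   case True
   have "norm (\<Sum>p\<in>primes_upto x. principal d p - 1) \<le> 2 * real d"
    by (rule norm_sum_zero_on_coprime) (use d(1) in \<open>auto simp: principal_def\<close>)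
   then have "norm (T \<phi> - of_nat (card (primes_upto x))) \<le> 2 * real d" by (simp add: T_def True sum_subtractf)
   moreover have "norm (of_nat (card (primes_upto x)) - of_real (Li x) :: complex) \<le> C2 * E"
   proof -
    have "of_nat (card (primes_upto x)) - of_real (Li x) = complex_of_real (real (card (primes_upto x)) - Li x)" by simp
    then show ?thesis using 2(3)[of x] x unfolding E_def by (simp only: norm_of_real)
   qed
   moreover have "norm (R \<phi>) \<le> norm (T \<phi> - of_nat (card (primes_upto x))) + norm (of_nat (card (primes_upto x)) - of_real (Li x) :: complex)"
    using norm_triangle_ineq[of "T \<phi> - of_nat (card (primes_upto x))" "of_nat (card (primes_upto x)) - of_real (Li x)"]
    by (simp add: R_def True)
   ultimately show ?thesis using F2 by linarith
  qed
  then have "norm (\<Sum>\<phi>\<in>dchars d. R \<phi>) \<le> real (card (dchars d)) * F" by (intro sum_norm_bound)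
  then have b: "\<bar>real (totient d) * real P - Li x\<bar> \<le> real (totient d) * F"
   unfolding sR norm_of_real card_dchars[OF d(1)] .
  have t: "real (totient d) > 0" using d(1) by simp
  have "real (totient d) * \<bar>real P - Li x / real (totient d)\<bar> = \<bar>real (totient d) * real P - Li x\<bar>"
   using t by (simp add: abs_mult[symmetric, of "real (totient d)", simplified] right_diff_distrib)
  then have "real (totient d) * \<bar>real P - Li x / real (totient d)\<bar> \<le> real (totient d) * F" using b by (simp only:)
  then have "\<bar>real P - Li x / real (totient d)\<bar> \<le> F" using t by (rule mult_left_le_imp_le)
  also have "F \<le> (C1 + C2 + 2) * (ln x ^ A) ^ 2 * E"
   unfolding F_def using 1(1) 2(1) E d by (intro mult_right_mono mult_left_mono power_mono) auto
  also have "\<dots> = (C1 + C2 + 2) * (x / ln x ^ D)"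
   unfolding E_def m_def using lnx by (simp add: power_add power_mult[symmetric] mult.commute[of A 2])
  finally show "\<bar>real (card (primes_1_mod d x)) - Li x / real (totient d)\<bar> \<le> (C1 + C2 + 2) * (x / ln x ^ D)" unfolding P_def .
 qed
qed

section \<open>Stephens' constant\<close>

lemma prime_power_mult_eq_iff:
 assumes p: "prime (p::nat)" and "\<not> p dvd d" "\<not> p dvd e" "d > 0" "e > 0" "p ^ i * d = p ^ j * e"
 shows "i = j \<and> d = e"
proof -
 have "multiplicity p (p ^ i * d) = i" "multiplicity p (p ^ j * e) = j"
  using assms(1-5) by (auto simp: prime_elem_multiplicity_mult_distrib not_dvd_imp_multiplicity_0)
 then have "i = j" using assms(6) by simp
 then show ?thesis using assms(6) prime_gt_0_nat[OF p] by simp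
qed

lemma sum_divisors_prime_power_mult:
 fixes F :: "nat \<Rightarrow> 'a::comm_monoid_add"
 assumes p: "prime p" and m: "\<not> p dvd m" "m > 0"
 shows "(\<Sum>d | d dvd p ^ k * m. F d) = (\<Sum>i\<le>k. \<Sum>d | d dvd m. F (p ^ i * d))"
proof -
 have inj: "inj_on (\<lambda>(i, d). p ^ i * d) ({..k} \<times> {d. d dvd m})"
 proof (rule inj_onI, clarify)
  fix i d j e assume A: "d dvd m" "e dvd m" "p ^ i * d = p ^ j * e"
  have "\<not> p dvd d" "\<not> p dvd e" using A m by (meson dvd_trans)+
  moreover have "d > 0" "e > 0" using A m by (auto intro: Nat.gr0I)
  ultimately show "i = j \<and> d = e" using prime_power_mult_eq_iff[OF p] A(3) by blast
 qed
 have "{d. d dvd p ^ k * m} = (\<lambda>(i, d). p ^ i * d) ` ({..k} \<times> {d. d dvd m})"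
 proof (intro equalityI subsetI)
  fix d assume "d \<in> {d. d dvd p ^ k * m}"
  then obtain b c where bc: "d = b * c" "b dvd p ^ k" "c dvd m" using division_decomp[of d "p ^ k" m] by auto
  then obtain i where "i \<le> k" "b = p ^ i" using divides_primepow_nat[OF p] by blast
  then show "d \<in> (\<lambda>(i, d). p ^ i * d) ` ({..k} \<times> {d. d dvd m})" using bc by auto
 next
  fix d assume "d \<in> (\<lambda>(i, d). p ^ i * d) ` ({..k} \<times> {d. d dvd m})"
  then show "d \<in> {d. d dvd p ^ k * m}" by (auto intro: mult_dvd_mono le_imp_power_dvd)
 qed
 then have "(\<Sum>d | d dvd p ^ k * m. F d) = sum (F \<circ> (\<lambda>(i, d). p ^ i * d)) ({..k} \<times> {d. d dvd m})"
  by (simp only: sum.reindex[OF inj])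
 also have "\<dots> = (\<Sum>(i, d)\<in>{..k} \<times> {d. d dvd m}. F (p ^ i * d))" by (simp add: o_def case_prod_beta)
 finally have "(\<Sum>d | d dvd p ^ k * m. F d) = (\<Sum>(i, d)\<in>{..k} \<times> {d. d dvd m}. F (p ^ i * d))" .
 then show ?thesis using m by (simp add: sum.cartesian_product)
qed

lemma prime_power_decomp:
 assumes "n > (1::nat)"
 obtains p k m where "prime p" "k > 0" "n = p ^ k * m" "\<not> p dvd m" "m > 0" "m < n"
proof -
 obtain p where p: "prime p" "p dvd n" using prime_factor_nat[of n] assms by auto
 define k where "k = multiplicity p n"
 obtain m where m: "n = p ^ k * m" "\<not> p dvd m"
  unfolding k_def by (rule multiplicity_decompose'[of n p]) (use p assms in auto)
 have k: "k > 0" using p assms unfolding k_def by (simp add: prime_multiplicity_gt_zero_iff)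
 have m0: "m > 0" using m assms by (auto intro: Nat.gr0I)
 have "p ^ k > 1" using p k prime_gt_1_nat one_less_power by blast
 then have "m < n" using m m0 by simp
 then show ?thesis using that p k m m0 by blast
qed

text \<open>The coefficients of the expansion \<open>1 / n = (\<Sum>d | d dvd n. index_coeff d / d)\<close>.\<close>

definition index_coeff :: "nat \<Rightarrow> real" where
 "index_coeff d = (\<Prod>q\<in>prime_factors d. 1 - real q)"

lemma index_coeff_prime_power_mult:
 assumes p: "prime p" and m: "\<not> p dvd m" "m > 0"
 shows "index_coeff (p ^ i * m) = (if i = 0 then 1 else 1 - real p) * index_coeff m"
proof (cases "i = 0")
 case False
 have "prime_factors (p ^ i * m) = insert p (prime_factors m)"
  using p m False prime_gt_0_nat[OF p] by (auto simp: prime_factors_product prime_prime_factors prime_factorization_prime_power)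
 moreover have "p \<notin> prime_factors m" using m by auto
 ultimately show ?thesis using False by (simp add: index_coeff_def)
qed simp

text \<open>Splitting off a full prime power \<open>p ^ k\<close> reduces the claim to the local
  identity \<open>1 + (1 - p) (1 / p + ... + 1 / p ^ k) = 1 / p ^ k\<close>, whose sum
  telescopes.\<close>

lemma sum_index_coeff:
 "n > 0 \<Longrightarrow> (\<Sum>d | d dvd n. index_coeff d / real d) = 1 / real n"
proof (induction n rule: less_induct)
 case (less n)
 show ?case
 proof (cases "n = 1")
  case False
  then have "n > 1" using less by simp
  then obtain p k m where n: "prime p" "k > 0" "n = p ^ k * m" "\<not> p dvd m" "m > 0" "m < n"
   by (rule prime_power_decomp)
  have p: "real p > 1" using prime_gt_1_nat[OF n(1)] by simp
  have "(\<Sum>d | d dvd n. index_coeff d / real d) = (\<Sum>i\<le>k. \<Sum>d | d dvd m. index_coeff (p ^ i * d) / real (p ^ i * d))"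
   unfolding n(3) by (rule sum_divisors_prime_power_mult[OF n(1,4,5)])
  also have "\<dots> = (\<Sum>i\<le>k. (if i = 0 then 1 else 1 - real p) / real p ^ i * (1 / real m))"
  proof (rule sum.cong[OF refl])
   fix i assume "i \<in> {..k}"
   have "(\<Sum>d | d dvd m. index_coeff (p ^ i * d) / real (p ^ i * d))
     = (\<Sum>d | d dvd m. (if i = 0 then 1 else 1 - real p) / real p ^ i * (index_coeff d / real d))"
   proof (rule sum.cong[OF refl])
    fix d assume "d \<in> {d. d dvd m}"
    then have "\<not> p dvd d" "d > 0" using n dvd_trans by (auto intro: Nat.gr0I)
    from index_coeff_prime_power_mult[OF n(1) this, of i]
    show "index_coeff (p ^ i * d) / real (p ^ i * d) = (if i = 0 then 1 else 1 - real p) / real p ^ i * (index_coeff d / real d)"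
     by simp
   qed
   then show "(\<Sum>d | d dvd m. index_coeff (p ^ i * d) / real (p ^ i * d)) = (if i = 0 then 1 else 1 - real p) / real p ^ i * (1 / real m)"
    using less.IH[OF n(6,5)] by (simp only: sum_distrib_left[symmetric])
  qed
  also have "\<dots> = (\<Sum>i\<le>k. (if i = 0 then 1 else 1 - real p) / real p ^ i) * (1 / real m)"
   by (simp only: sum_distrib_right)
  also have "(\<Sum>i\<le>k. (if i = 0 then 1 else 1 - real p) / real p ^ i) = 1 / real p ^ k"
  proof (induction k)
   case (Suc k)
   then show ?case using p by (simp add: field_simps)
  qed simp
  finally show ?thesis by (simp add: n(3))
 qed (simp add: index_coeff_def)
qed

text \<open>Prime by prime, \<open>p - 1\<close> is at most \<open>totient (p ^ k)\<close>.
  Comparison with the totient is what makes the terms of Stephens' series as small as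
  \<open>1 / d ^ 2\<close>.\<close>

lemma abs_index_coeff_le:
 "d > 0 \<Longrightarrow> \<bar>index_coeff d\<bar> \<le> real (totient d)"
proof (induction d rule: less_induct)
 case (less d)
 show ?case
 proof (cases "d = 1")
  case False
  then have "d > 1" using less by simp
  then obtain p k m where n: "prime p" "k > 0" "d = p ^ k * m" "\<not> p dvd m" "m > 0" "m < d"
   by (rule prime_power_decomp)
  have p: "real p > 1" using prime_gt_1_nat[OF n(1)] by simp
  have "coprime (p ^ k) m" using n prime_imp_coprime[OF n(1,4)] by simp
  then have t: "totient d = p ^ (k - 1) * (p - 1) * totient m"
   unfolding n(3) using n(1,2) by (simp add: totient_mult_coprime totient_prime_power)
  have "\<bar>index_coeff d\<bar> = (real p - 1) * \<bar>index_coeff m\<bar>"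
   unfolding n(3) index_coeff_prime_power_mult[OF n(1,4,5)] using n(2) p by (simp add: abs_mult)
  also have "\<dots> \<le> (real p ^ (k - 1) * (real p - 1)) * real (totient m)"
   using p less.IH[OF n(6,5)] by (intro mult_mono) auto
  finally show ?thesis unfolding t using p by (simp add: of_nat_diff)
 qed (simp add: index_coeff_def)
qed

text \<open>The share of the divisor \<open>d\<close> in the main term: its coefficient times the
  density \<open>1 / totient d\<close> of the primes congruent to 1 modulo \<open>d\<close>.\<close>

definition stephens_term :: "nat \<Rightarrow> real" where
 "stephens_term d = index_coeff d / real d ^ 2 / real (totient d)"

lemma abs_stephens_term_le: "\<bar>stephens_term d\<bar> \<le> 1 / real d ^ 2"
proof (cases "d > 0")
 case True
 then have "\<bar>index_coeff d\<bar> / real (totient d) \<le> 1" using abs_index_coeff_le[OF True] by simp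
 then have "\<bar>index_coeff d\<bar> / real (totient d) / real d ^ 2 \<le> 1 / real d ^ 2" by (rule divide_right_mono) simp
 then show ?thesis by (simp add: stephens_term_def abs_mult mult.commute)
qed (simp add: stephens_term_def)

lemma abs_index_coeff_div_le: "\<bar>index_coeff d / real d ^ 2\<bar> \<le> 1 / real d"
proof (cases "d > 0")
 case True
 have "\<bar>index_coeff d\<bar> \<le> real d" using abs_index_coeff_le[OF True] totient_le[of d] by linarith
 then have "\<bar>index_coeff d\<bar> / real d ^ 2 \<le> real d / real d ^ 2" by (rule divide_right_mono) simp
 then show ?thesis using True by (simp add: power2_eq_square)
qed simp

lemma stephens_term_prime_power_mult:
 assumes p: "prime p" and m: "\<not> p dvd m" "m > 0"
 shows "stephens_term (p ^ i * m) = (if i = 0 then 1 else - (real p * (1 / real p ^ 3) ^ i)) * stephens_term m"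
proof (cases "i = 0")
 case False
 have p1: "real p > 1" using prime_gt_1_nat[OF p] by simp
 have "coprime (p ^ i) m" using prime_imp_coprime[OF p m(1)] by simp
 then have "totient (p ^ i * m) = p ^ (i - 1) * (p - 1) * totient m"
  using p False by (simp add: totient_mult_coprime totient_prime_power)
 then have t: "real (totient (p ^ i * m)) = real p ^ (i - 1) * (real p - 1) * real (totient m)"
  using p1 by (simp add: of_nat_diff)
 have pi: "real p ^ i = real p * real p ^ (i - 1)" using False by (cases i) auto
 have "stephens_term (p ^ i * m) = (1 - real p) / ((real p ^ i) ^ 2 * (real p ^ (i - 1) * (real p - 1))) * stephens_term m"
  unfolding stephens_term_def t index_coeff_prime_power_mult[OF p m] using False by (simp add: power_mult_distrib)
 also have "(1 - real p) / ((real p ^ i) ^ 2 * (real p ^ (i - 1) * (real p - 1))) = - (real p * (1 / real p ^ 3) ^ i)"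
 proof -
  define P where "P = real p ^ i"
  have P: "P > 0" using p1 by (simp add: P_def)
  have "real p ^ (i - 1) = P / real p" using pi p1 by (simp add: P_def)
  moreover have "(1 / real p ^ 3) ^ i = 1 / P ^ 3"
   by (simp add: P_def power_divide power_mult[symmetric] mult.commute)
  ultimately show ?thesis using P p1 unfolding P_def[symmetric]
   by (simp add: divide_simps power2_eq_square power3_eq_cube) (simp add: algebra_simps)
 qed
 finally show ?thesis using False by simp
qed simp

text \<open>The terms with \<open>i \<ge> 1\<close> form a geometric series with ratio
  \<open>1 / x ^ 3\<close> and sum \<open>- x / (x ^ 3 - 1)\<close>; extending it to
  \<open>i = 0\<close> requires the correction \<open>1 + x\<close> there.\<close>

lemma local_factor_has_sum:
 assumes "x > (1::real)"
 shows "((\<lambda>i. if i = 0 then 1 else - (x * (1 / x ^ 3) ^ i)) has_sum (1 - x / (x ^ 3 - 1))) (UNIV :: nat set)"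
proof -
 define y where "y = 1 / x ^ 3"
 have x3: "x ^ 3 > 1" using assms by simp
 then have y: "0 < y" "y < 1" using assms by (simp_all add: y_def divide_less_eq)
 have g: "(\<lambda>i. - (x * y ^ i)) sums - (x * (1 / (1 - y)))"
  using y by (intro sums_minus sums_mult geometric_sums) auto
 have s1: "(\<lambda>i. if i = 0 then 1 + x else 0) sums (1 + x)" by (rule sums_single)
 have e: "(\<lambda>i. - (x * y ^ i) + (if i = 0 then 1 + x else 0)) = (\<lambda>i. if i = 0 then 1 else - (x * y ^ i))" by auto
 have v: "- (x * (1 / (1 - y))) + (1 + x) = 1 - x / (x ^ 3 - 1)"
  using x3 by (simp add: y_def field_simps)
 have "(\<lambda>i. if i = 0 then 1 else - (x * y ^ i)) sums (1 - x / (x ^ 3 - 1))"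
  using sums_add[OF g s1] unfolding e v .
 moreover have "summable (\<lambda>i. norm (if i = 0 then 1 else - (x * y ^ i)))"
 proof (rule summable_comparison_test)
  show "summable (\<lambda>i. (1 + x) * y ^ i)" using y by (intro summable_mult summable_geometric) auto
  show "\<exists>N. \<forall>n\<ge>N. norm (norm (if n = 0 then 1 else - (x * y ^ n))) \<le> (1 + x) * y ^ n"
   using y assms by (auto simp: abs_mult distrib_right)
 qed
 ultimately show ?thesis unfolding y_def[symmetric] by (intro norm_summable_imp_has_sum)
qed

lemma summable_norm_stephens_term: "summable (\<lambda>d. norm (stephens_term d))"
 by (rule summable_comparison_test[OF _ inverse_power_summable[of 2, where 'a = real]])
   (use abs_stephens_term_le in \<open>auto simp: divide_inverse\<close>)

text \<open>Finite Euler product by induction on the set of primes: each admissible \<open>d\<close>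
  is \<open>p ^ i\<close> times a number free of \<open>p\<close> in exactly one way, and absolute
  summability lets the double sum be iterated.\<close>

lemma stephens_has_sum:
 assumes "finite S" "\<And>p. p \<in> S \<Longrightarrow> prime p"
 shows "(stephens_term has_sum (\<Prod>p\<in>S. 1 - real p / (real p ^ 3 - 1))) {d. d > 0 \<and> prime_factors d \<subseteq> S}"
 using assms
proof (induction S rule: finite_induct)
 case empty
 have "{d. d > 0 \<and> prime_factors d \<subseteq> {}} = {1::nat}" by (auto simp: prime_factorization_empty_iff)
 then show ?case using has_sum_finite[of "{1::nat}" stephens_term] by (simp add: stephens_term_def[of "Suc 0"] index_coeff_def)
next
 case (insert p S)
 have p: "prime p" using insert by blast
 define B where "B = {d. d > 0 \<and> prime_factors d \<subseteq> S}"
 define c where "c i = (if i = 0 then 1 else - (real p * (1 / real p ^ 3) ^ i))" for i :: nat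
 define h where "h = (\<lambda>(i, d). p ^ i * d)"
 have nd: "\<not> p dvd d" "d > 0" if "d \<in> B" for d
  using that p insert.hyps(2) by (auto simp: B_def prime_factors_dvd)
 have inj: "inj_on h (UNIV \<times> B)"
 proof (rule inj_onI, clarsimp simp: h_def)
  fix i d j e assume "d \<in> B" "e \<in> B" "p ^ i * d = p ^ j * e"
  then show "i = j \<and> d = e" using prime_power_mult_eq_iff[OF p] nd by blast
 qed
 have im: "h ` (UNIV \<times> B) = {d. d > 0 \<and> prime_factors d \<subseteq> insert p S}"
 proof (intro equalityI subsetI)
  fix n assume "n \<in> h ` (UNIV \<times> B)"
  then obtain i d where n: "n = p ^ i * d" "d \<in> B" by (auto simp: h_def)
  then have "prime_factors n \<subseteq> insert p (prime_factors d)"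
  proof -
   have "x = p \<or> x dvd d" if "prime x" "x dvd p ^ i * d" for x
   proof (cases "x dvd d")
    case False
    then have "x dvd p ^ i" using that prime_dvd_mult_iff by blast
    then show ?thesis using that(1) p prime_dvd_power primes_dvd_imp_eq by blast
   qed simp
   then show ?thesis using nd[OF n(2)] by (auto simp: prime_factors_dvd n(1))
  qed
  then show "n \<in> {d. d > 0 \<and> prime_factors d \<subseteq> insert p S}"
   using n(2) n(1) prime_gt_0_nat[OF p] by (auto simp: B_def)
 next
  fix n assume "n \<in> {d. d > 0 \<and> prime_factors d \<subseteq> insert p S}"
  then have n: "n > 0" "prime_factors n \<subseteq> insert p S" by auto
  obtain m where m: "n = p ^ multiplicity p n * m" "\<not> p dvd m"
   by (rule multiplicity_decompose'[of n p]) (use p n in auto)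
  have "m > 0" using m(2) by (auto intro: Nat.gr0I)
  moreover have "prime_factors m \<subseteq> S"
  proof
   fix q assume q: "q \<in> prime_factors m"
   then have "q dvd n" using m(1) by (metis dvd_mult in_prime_factors_imp_dvd)
   then have "q \<in> prime_factors n" using q n(1) by (auto simp: prime_factors_dvd)
   then show "q \<in> S" using n(2) q m(2) by auto
  qed
  ultimately show "n \<in> h ` (UNIV \<times> B)" using m(1) by (force simp: h_def B_def)
 qed
 have val: "stephens_term (h (i, d)) = c i * stephens_term d" if "d \<in> B" for i d
  unfolding h_def c_def using stephens_term_prime_power_mult[OF p nd[OF that]] by simp
 have sm: "(stephens_term \<circ> h) summable_on (UNIV \<times> B)"
  unfolding summable_on_reindex[OF inj, symmetric]
  by (rule summable_on_subset[OF norm_summable_imp_summable_on[OF summable_norm_stephens_term]]) simp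
 define L where "L = (\<Prod>p\<in>S. 1 - real p / (real p ^ 3 - 1))"
 have IH: "(stephens_term has_sum L) B" unfolding L_def B_def using insert by blast
 have "((stephens_term \<circ> h) has_sum ((1 - real p / (real p ^ 3 - 1)) * L)) (UNIV \<times> B)"
 proof (rule has_sum_SigmaI[OF _ _ sm])
  show "((\<lambda>d. (stephens_term \<circ> h) (i, d)) has_sum (c i * L)) B" for i
   using has_sum_cmult_right[OF IH, of "c i"] by (rule has_sum_cong[THEN iffD1, rotated]) (simp add: val)
  show "((\<lambda>i. c i * L) has_sum ((1 - real p / (real p ^ 3 - 1)) * L)) UNIV"
   unfolding c_def using prime_gt_1_nat[OF p] by (intro has_sum_cmult_left local_factor_has_sum) simp
 qed
 then have "(stephens_term has_sum ((1 - real p / (real p ^ 3 - 1)) * L)) (h ` (UNIV \<times> B))"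
  unfolding has_sum_reindex[OF inj] .
 then show ?case unfolding im L_def using insert.hyps by simp
qed

text \<open>The products over primes up to \<open>n\<close> are sums over the integers with all
  prime factors at most \<open>n\<close>. By dominated convergence these tend to the full series,
  which also shows that the \<open>lim\<close> in \<open>stephens_C\<close> is a genuine
  limit.\<close>

lemma suminf_stephens_term: "(\<Sum>d. stephens_term d) = stephens_C"
proof -
 define P where "P n = {p::nat. prime p \<and> p \<le> n}" for n
 define f where "f n d = (if d > 0 \<and> prime_factors d \<subseteq> P n then stephens_term d else 0)" for n d
 have fin: "finite (P n)" for n by (rule finite_subset[of _ "{..n}"]) (auto simp: P_def)
 have "f n sums (\<Prod>p\<in>P n. 1 - real p / (real p ^ 3 - 1))" for n
 proof (rule has_sum_imp_sums)
  have "(stephens_term has_sum (\<Prod>p\<in>P n. 1 - real p / (real p ^ 3 - 1))) {d. d > 0 \<and> prime_factors d \<subseteq> P n}"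
   by (rule stephens_has_sum[OF fin]) (simp add: P_def)
  then show "(f n has_sum (\<Prod>p\<in>P n. 1 - real p / (real p ^ 3 - 1))) UNIV"
   by (rule has_sum_cong_neutral[THEN iffD1, rotated 3]) (auto simp: f_def)
 qed
 then have eq: "(\<Prod>p\<in>P n. 1 - real p / (real p ^ 3 - 1)) = (\<Sum>d. f n d)" for n by (simp add: sums_iff)
 have "(\<lambda>n. \<Sum>d. f n d) \<longlonglongrightarrow> (\<Sum>d. stephens_term d)"
 proof (rule tannerys_theorem[where a = "\<lambda>d n. f n d", THEN conjunct2, THEN conjunct2])
  show "(\<lambda>n. f n d) \<longlonglongrightarrow> stephens_term d" for d
  proof (rule tendsto_eventually, rule eventually_sequentiallyI)
   fix n assume n: "d \<le> n"
   show "f n d = stephens_term d"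
   proof (cases "d = 0")
    case False
    then have "prime_factors d \<subseteq> P n" using n by (auto simp: P_def prime_factors_dvd dest: dvd_imp_le)
    then show ?thesis using False by (simp add: f_def)
   qed (simp add: f_def stephens_term_def)
  qed
  show "\<forall>\<^sub>F (d, n) in at_top \<times>\<^sub>F sequentially. norm (f n d) \<le> norm (stephens_term d)"
   by (rule always_eventually) (auto simp: f_def)
  show "summable (\<lambda>d. norm (stephens_term d))" by (rule summable_norm_stephens_term)
 qed simp
 then show ?thesis unfolding eq[symmetric] stephens_C_def P_def by (rule limI[symmetric])
qed

text \<open>The positive integer \<open>(p - 1) div d\<close> determines \<open>p\<close>. Counting
  it gives \<open>x / d\<close> without an additive constant, which matters for \<open>d\<close> of
  the order of \<open>x\<close>.\<close>

lemma card_primes_1_mod_le: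
 assumes "d > 0" "x \<ge> 0"
 shows "real (card (primes_1_mod d x)) \<le> x / real d"
proof -
 have fin: "finite {1..nat \<lfloor>x / real d\<rfloor>}" by simp
 have "card (primes_1_mod d x) \<le> card {1..nat \<lfloor>x / real d\<rfloor>}"
 proof (rule card_inj_on_le[OF _ _ fin])
  have dv: "d dvd p - 1" "p > 1" "real p \<le> x" if "p \<in> primes_1_mod d x" for p
   using that prime_gt_1_nat[of p] cong_to_1_nat[of p d] by (auto simp: primes_1_mod_def primes_upto_def)
  show "inj_on (\<lambda>p. (p - 1) div d) (primes_1_mod d x)"
  proof (rule inj_onI)
   fix p q assume pq: "p \<in> primes_1_mod d x" "q \<in> primes_1_mod d x" "(p - 1) div d = (q - 1) div d"
   then have "p - 1 = q - 1" using dv(1) by (metis dvd_div_mult_self)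
   then show "p = q" using dv(2) pq by (metis Suc_pred' less_trans zero_less_one)
  qed
  show "(\<lambda>p. (p - 1) div d) ` primes_1_mod d x \<subseteq> {1..nat \<lfloor>x / real d\<rfloor>}"
  proof (rule image_subsetI)
   fix p assume p: "p \<in> primes_1_mod d x"
   obtain k where k: "p - 1 = d * k" using dv(1)[OF p] by (elim dvdE)
   have "k > 0" using k dv(2)[OF p] by (cases k) auto
   moreover have "real d * real k \<le> x" using k dv[OF p] by (metis of_nat_mult diff_le_self of_nat_le_iff order_trans)
   then have "k \<le> nat \<lfloor>x / real d\<rfloor>" using assms by (intro le_nat_floor) (simp add: field_simps)
   ultimately show "(p - 1) div d \<in> {1..nat \<lfloor>x / real d\<rfloor>}" using k assms by simp
  qed
 qed
 then have "real (card (primes_1_mod d x)) \<le> real (nat \<lfloor>x / real d\<rfloor>)" by simp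
 also have "\<dots> \<le> x / real d" using assms by simp
 finally show ?thesis .
qed

lemma sum_divisors_shifted_primes:
 assumes x: "x \<ge> 1"
 shows "(\<Sum>p\<in>primes_upto x. \<Sum>d | d dvd p - 1. g d) = (\<Sum>d\<in>{1..nat \<lfloor>x\<rfloor>}. g d * real (card (primes_1_mod d x)))"
proof -
 define N where "N = nat \<lfloor>x\<rfloor>"
 have N: "\<And>n. real n \<le> x \<Longrightarrow> n \<le> N" using x unfolding N_def by (auto simp: le_nat_floor)
 have "(\<Sum>p\<in>primes_upto x. \<Sum>d | d dvd p - 1. g d) = (\<Sum>p\<in>primes_upto x. \<Sum>d\<in>{1..N}. if [p = 1] (mod d) then g d else 0)"
 proof (rule sum.cong[OF refl])
  fix p assume "p \<in> primes_upto x"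
  then have p: "p > 1" "real p \<le> x" using prime_gt_1_nat by (auto simp: primes_upto_def)
  have c: "[p = 1] (mod d) \<longleftrightarrow> d dvd p - 1" for d
   using p(1) cong_to_1_nat[of p d] by (metis cong_altdef_nat less_imp_le)
  have "{d. d dvd p - 1} = {d \<in> {1..N}. d dvd p - 1}"
  proof (intro equalityI subsetI)
   fix d assume "d \<in> {d. d dvd p - 1}"
   then have d: "d dvd p - 1" by simp
   then have "d \<le> p - 1" "d > 0" using p(1) by (auto dest: dvd_imp_le intro: Nat.gr0I)
   moreover have "p \<le> N" using N p by blast
   ultimately show "d \<in> {d \<in> {1..N}. d dvd p - 1}" using d by auto
  qed auto
  then show "(\<Sum>d | d dvd p - 1. g d) = (\<Sum>d\<in>{1..N}. if [p = 1] (mod d) then g d else 0)"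
   unfolding c by (simp only: sum.inter_filter[symmetric] finite_atLeastAtMost)
 qed
 also have "\<dots> = (\<Sum>d\<in>{1..N}. g d * real (card (primes_1_mod d x)))"
  by (subst sum.swap) (simp add: primes_1_mod_def sum.inter_filter[symmetric] mult.commute)
 finally show ?thesis unfolding N_def .
qed

lemma suminf_inverse_squares_tail:
 assumes "M \<ge> 1"
 shows "summable (\<lambda>n. 1 / real (n + Suc M) ^ 2)" "(\<Sum>n. 1 / real (n + Suc M) ^ 2) \<le> 1 / real M"
proof -
 have e: "real (Suc (n + M)) powr (-1 - 1) = 1 / real (n + Suc M) ^ 2" for n
  by (simp add: powr_minus powr_numeral[symmetric] divide_inverse del: powr_numeral)
 have "real M powr (-1) / 1 = 1 / real M" by (simp add: powr_minus divide_inverse)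
 then show "summable (\<lambda>n. 1 / real (n + Suc M) ^ 2)" "(\<Sum>n. 1 / real (n + Suc M) ^ 2) \<le> 1 / real M"
  using tail_sum[of 1 M] assms unfolding e by simp_all
qed

text \<open>Up to \<open>ln x ^ D\<close> there are as many divisors \<open>d\<close> as the bound
  says, so Siegel-Walfisz is used with the doubled saving \<open>2 * D\<close>. Beyond, the trivial
  count of primes and the bound \<open>1 / d\<close> for the coefficients leave a tail of the sum of
  \<open>x / d ^ 2\<close>.\<close>

theorem main_term:
 fixes D :: nat
 obtains K x0 where "\<And>x. x \<ge> x0 \<Longrightarrow>
  \<bar>(\<Sum>p\<in>primes_upto x. \<Sum>d | d dvd p - 1. index_coeff d / real d ^ 2) - stephens_C * Li x\<bar> \<le> K * (x / ln x ^ D)"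
proof -
 define g where "g d = index_coeff d / real d ^ 2" for d
 obtain C x1 where C: "C \<ge> 0" "x1 \<ge> 3" "\<And>x d. x \<ge> x1 \<Longrightarrow> d > 0 \<Longrightarrow> real d \<le> ln x ^ D \<Longrightarrow>
  \<bar>real (card (primes_1_mod d x)) - Li x / real (totient d)\<bar> \<le> C * (x / ln x ^ (2 * D))"
  by (rule siegel_walfisz) blast
 have "eventually (\<lambda>x::real. ln x ^ D \<le> x) at_top" by real_asymp
 then obtain x2 where x2: "\<And>x::real. x \<ge> x2 \<Longrightarrow> ln x ^ D \<le> x" by (auto simp: eventually_at_top_linorder)
 show thesis
 proof (rule that[of "max x1 x2" "C + 6"])
  fix x :: real assume x: "max x1 x2 \<le> x"
  have x3: "x \<ge> 3" using x C(2) by auto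
  have "exp 1 \<le> x" using exp_le x3 by linarith
  then have l1: "ln x \<ge> 1" using x3 by (simp add: ln_ge_iff)
  define L where "L = ln x ^ D"
  have L: "L \<ge> 1" "L \<le> x" using l1 x2[of x] x by (auto simp: L_def)
  define M where "M = nat \<lfloor>L\<rfloor>"
  have M: "M \<ge> 1" "real M \<le> L" "L \<le> real M + 1" using L unfolding M_def by linarith+
  then have M2: "1 / real M \<le> 2 / L" using L by (simp add: field_simps)
  define N where "N = nat \<lfloor>x\<rfloor>"
  have N: "real N \<le> x" "\<And>n. real n \<le> x \<Longrightarrow> n \<le> N" using x3 unfolding N_def by (auto simp: le_nat_floor)
  have MN: "M \<le> N" using M L by (intro N(2)) linarith
  define T where "T d = real (card (primes_1_mod d x))" for d
  have gb: "\<bar>g d\<bar> \<le> 1 / real d" for d unfolding g_def by (rule abs_index_coeff_div_le)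
  have gt: "g d / real (totient d) = stephens_term d" for d by (simp add: g_def stephens_term_def)
  have "(\<Sum>p\<in>primes_upto x. \<Sum>d | d dvd p - 1. g d) = (\<Sum>d\<in>{1..N}. g d * T d)"
   unfolding T_def N_def using x3 by (intro sum_divisors_shifted_primes) auto
  also have "{1..N} = {1..M} \<union> {Suc M..N}" using MN by auto
  also have "(\<Sum>d\<in>\<dots>. g d * T d) = (\<Sum>d\<in>{1..M}. g d * T d) + (\<Sum>d\<in>{Suc M..N}. g d * T d)"
   by (rule sum.union_disjoint) auto
  finally have e1: "(\<Sum>p\<in>primes_upto x. \<Sum>d | d dvd p - 1. g d) = (\<Sum>d\<in>{1..M}. g d * T d) + (\<Sum>d\<in>{Suc M..N}. g d * T d)" .
  note st = summable_norm_cancel[OF summable_norm_stephens_term]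
  have "stephens_C = (\<Sum>d<Suc M. stephens_term d) + (\<Sum>n. stephens_term (n + Suc M))"
   unfolding suminf_stephens_term[symmetric] using suminf_split_initial_segment[OF st, of "Suc M"] by simp
  also have "(\<Sum>d<Suc M. stephens_term d) = (\<Sum>d\<in>{1..M}. stephens_term d)"
   by (rule sum.mono_neutral_right) (auto simp: stephens_term_def)
  finally have e2: "stephens_C = (\<Sum>d\<in>{1..M}. stephens_term d) + (\<Sum>n. stephens_term (n + Suc M))" .
  note tail = suminf_inverse_squares_tail[OF M(1)]
  have b1: "\<bar>(\<Sum>d\<in>{1..M}. g d * T d) - (\<Sum>d\<in>{1..M}. stephens_term d) * Li x\<bar> \<le> C * (x / L)"
  proof -
   have "\<bar>(\<Sum>d\<in>{1..M}. g d * T d) - (\<Sum>d\<in>{1..M}. stephens_term d) * Li x\<bar> = \<bar>\<Sum>d\<in>{1..M}. g d * (T d - Li x / real (totient d))\<bar>"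
    unfolding gt[symmetric] sum_distrib_right sum_subtractf[symmetric] by (simp add: right_diff_distrib)
   also have "\<dots> \<le> (\<Sum>d\<in>{1..M}. \<bar>g d * (T d - Li x / real (totient d))\<bar>)" by (rule sum_abs)
   also have "\<dots> \<le> (\<Sum>d\<in>{1..M}. C * (x / L ^ 2))"
   proof (rule sum_mono)
    fix d assume d: "d \<in> {1..M}"
    then have "1 / real d \<le> 1" by simp
    then have "\<bar>g d\<bar> \<le> 1" using gb[of d] by linarith
    moreover have "\<bar>T d - Li x / real (totient d)\<bar> \<le> C * (x / ln x ^ (2 * D))"
     unfolding T_def using d M(2) x by (intro C(3)) (auto simp: L_def)
    ultimately have "\<bar>g d\<bar> * \<bar>T d - Li x / real (totient d)\<bar> \<le> 1 * (C * (x / ln x ^ (2 * D)))" by (intro mult_mono) auto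
    moreover have "ln x ^ (2 * D) = L ^ 2" by (simp add: L_def power_mult[symmetric] mult.commute)
    ultimately show "\<bar>g d * (T d - Li x / real (totient d))\<bar> \<le> C * (x / L ^ 2)" by (simp add: abs_mult)
   qed
   also have "\<dots> = real M * (C * (x / L ^ 2))" by simp
   also have "\<dots> \<le> L * (C * (x / L ^ 2))" using M(2) C(1) x3 by (intro mult_right_mono) auto
   also have "\<dots> = C * (x / L)" using L by (simp add: power2_eq_square)
   finally show ?thesis .
  qed
  have b2: "\<bar>\<Sum>d\<in>{Suc M..N}. g d * T d\<bar> \<le> 2 * (x / L)"
  proof -
   have "\<bar>\<Sum>d\<in>{Suc M..N}. g d * T d\<bar> \<le> (\<Sum>d\<in>{Suc M..N}. \<bar>g d * T d\<bar>)" by (rule sum_abs)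
   also have "\<dots> \<le> (\<Sum>d\<in>{Suc M..N}. x * (1 / real d ^ 2))"
   proof (rule sum_mono)
    fix d assume d: "d \<in> {Suc M..N}"
    have "\<bar>g d\<bar> * T d \<le> 1 / real d * (x / real d)"
     unfolding T_def using d x3 by (intro mult_mono gb card_primes_1_mod_le) auto
    then show "\<bar>g d * T d\<bar> \<le> x * (1 / real d ^ 2)" by (simp add: abs_mult T_def power2_eq_square)
   qed
   also have "\<dots> = x * (\<Sum>n\<in>{..<N - M}. 1 / real (n + Suc M) ^ 2)"
    unfolding sum_distrib_left
    by (rule sum.reindex_bij_witness[of _ "\<lambda>n. n + Suc M" "\<lambda>d. d - Suc M"]) auto
   also have "\<dots> \<le> x * (1 / real M)"
    using x3 tail by (intro mult_left_mono order_trans[OF sum_le_suminf[OF tail(1)] tail(2)]) auto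
   also have "\<dots> \<le> x * (2 / L)" using M2 x3 by (intro mult_left_mono) auto
   finally show ?thesis by (simp add: mult.commute)
  qed
  have b3: "\<bar>(\<Sum>n. stephens_term (n + Suc M)) * Li x\<bar> \<le> 4 * (x / L)"
  proof -
   have "norm (\<Sum>n. stephens_term (n + Suc M)) \<le> (\<Sum>n. 1 / real (n + Suc M) ^ 2)"
    by (rule norm_suminf_le[OF _ tail(1)]) (simp only: real_norm_def abs_stephens_term_le)
   then have "\<bar>\<Sum>n. stephens_term (n + Suc M)\<bar> \<le> 2 / L" using tail(2) M2 by simp
   moreover have "\<bar>Li x\<bar> \<le> 2 * x" using Li_bounds[of x] x3 by simp
   ultimately have "\<bar>\<Sum>n. stephens_term (n + Suc M)\<bar> * \<bar>Li x\<bar> \<le> 2 / L * (2 * x)" using L by (intro mult_mono) auto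
   then show ?thesis by (simp add: abs_mult)
  qed
  have "\<bar>(\<Sum>p\<in>primes_upto x. \<Sum>d | d dvd p - 1. g d) - stephens_C * Li x\<bar> \<le> C * (x / L) + 2 * (x / L) + 4 * (x / L)"
   unfolding e1 e2 distrib_right using b1 b2 b3 by linarith
  also have "\<dots> = (C + 6) * (x / L)" by (simp only: distrib_right[symmetric]) simp
  finally show "\<bar>(\<Sum>p\<in>primes_upto x. \<Sum>d | d dvd p - 1. index_coeff d / real d ^ 2) - stephens_C * Li x\<bar> \<le> (C + 6) * (x / ln x ^ D)"
   unfolding g_def L_def .
 qed
qed

section \<open>The large sieve\<close>

lemma norm_1_minus_cis: "norm (1 - cis t) = 2 * \<bar>sin (t / 2)\<bar>"
proof -
 have "(norm (1 - cis t)) ^ 2 = (1 - cos t) ^ 2 + sin t ^ 2" by (simp add: cmod_power2)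
 also have "\<dots> = 2 - 2 * cos (2 * (t / 2))" using sin_cos_squared_add[of t] by (simp add: power2_diff)
 also have "\<dots> = (2 * \<bar>sin (t / 2)\<bar>) ^ 2" unfolding cos_double_sin by (simp add: power_mult_distrib)
 finally show ?thesis by (rule power2_eq_imp_eq) auto
qed

text \<open>With \<open>y = pi * t \<le> 8/5\<close> the Taylor bound gives
  \<open>sin y \<ge> y - y ^ 3 / 6 \<ge> y / 2\<close>, and \<open>pi / 2 > 1\<close>.\<close>

lemma sin_pi_lower:
 assumes t: "0 \<le> t" "t \<le> 1/2"
 shows "t \<le> sin (pi * t)"
proof -
 define y where "y = pi * t"
 have pi: "pi < 4" "pi > 3" using pi_less_4 pi_gt3 by auto
 have pi32: "pi < 16/5" using pi_approx(2) by simp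
 have y: "0 \<le> y" "y \<le> 8/5" using t mult_mono[of pi "16/5" t "1/2"] pi32 by (auto simp: y_def)
 have "\<bar>sin y - (\<Sum>m<3. sin_coeff m * y ^ m)\<bar> \<le> inverse (fact 3) * \<bar>y\<bar> ^ 3" by (rule Maclaurin_sin_bound)
 moreover have "(\<Sum>m<3. sin_coeff m * y ^ m) = y" by (simp add: numeral_eq_Suc sin_coeff_def)
 moreover have "inverse (fact 3 :: real) = 1/6" by (simp add: fact_numeral)
 ultimately have "\<bar>sin y - y\<bar> \<le> 1 / 6 * y ^ 3" using y by simp
 then have "y - y ^ 3 / 6 \<le> sin y" by linarith
 moreover have "y ^ 2 \<le> 3"
 proof -
  have "y ^ 2 \<le> (8/5) ^ 2" using y by (intro power_mono) auto
  then show ?thesis by (simp add: power2_eq_square)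
 qed
 then have "y * y ^ 2 \<le> y * 3" using y by (intro mult_left_mono) auto
 then have "y ^ 3 / 6 \<le> y / 2" by (simp add: power3_eq_cube power2_eq_square)
 ultimately have "y / 2 \<le> sin y" by linarith
 moreover have "t \<le> y / 2" using mult_right_mono[of 2 pi t] pi t by (simp add: y_def mult.commute)
 ultimately show ?thesis by (simp add: y_def)
qed

abbreviation unit_exp :: "nat \<Rightarrow> real \<Rightarrow> complex" where "unit_exp n t \<equiv> cis (2 * pi * real n * t)"

text \<open>The geometric sum is at most the reciprocal of the distance from \<open>t\<close> to the
  nearest integer. Writing it as two reciprocals, one for each end of the unit interval, separates
  the two sums over spaced points.\<close>

lemma norm_exp_sum_le:
 assumes t: "0 < \<bar>t\<bar>" "\<bar>t\<bar> < 1"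
 shows "norm (\<Sum>n\<in>{1..M}. unit_exp n t) \<le> 1 / \<bar>t\<bar> + 1 / (1 - \<bar>t\<bar>)"
proof -
 define z where "z = cis (2 * pi * t)"
 have sp: "\<bar>sin (pi * t)\<bar> \<ge> min \<bar>t\<bar> (1 - \<bar>t\<bar>)"
 proof -
  have "min s (1 - s) \<le> sin (pi * s)" if "0 < s" "s < 1" for s
  proof (cases "s \<le> 1/2")
   case True
   then show ?thesis using sin_pi_lower[of s] that by simp
  next
   case False
   have "sin (pi * (1 - s)) = sin (pi * s)" by (simp add: right_diff_distrib sin_pi_minus)
   then show ?thesis using sin_pi_lower[of "1 - s"] that False by simp
  qed
  from this[OF t] show ?thesis using t by (cases "t \<ge> 0") (auto simp: abs_if split: if_splits)
 qed
 then have sp0: "\<bar>sin (pi * t)\<bar> > 0" using t by auto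
 have nz: "norm (1 - z) = 2 * \<bar>sin (pi * t)\<bar>" unfolding z_def norm_1_minus_cis by simp
 have z1: "z \<noteq> 1" using nz sp0 by auto
 have "unit_exp n t = z ^ n" for n unfolding z_def Complex.DeMoivre by (simp add: algebra_simps)
 then have "(\<Sum>n\<in>{1..M}. unit_exp n t) = (\<Sum>n\<in>{1..M}. z ^ n)" by simp
 also have "\<dots> = z * (\<Sum>n<M. z ^ n)"
  unfolding sum_distrib_left by (rule sum.reindex_bij_witness[of _ Suc "\<lambda>n. n - 1"]) (auto simp flip: power_Suc)
 also have "(\<Sum>n<M. z ^ n) = (1 - z ^ M) / (1 - z)" using z1 by (simp add: sum_gp_strict)
 finally have "norm (\<Sum>n\<in>{1..M}. unit_exp n t) = norm (1 - z ^ M) / norm (1 - z)"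
  by (simp add: norm_mult norm_divide z_def)
 also have "\<dots> \<le> 2 / norm (1 - z)"
 proof (rule divide_right_mono)
  have "norm (1 - z ^ M) \<le> norm (1::complex) + norm (z ^ M)" by (rule norm_triangle_ineq4)
  then show "norm (1 - z ^ M) \<le> 2" by (simp add: norm_power z_def)
 qed simp
 also have "\<dots> = 1 / \<bar>sin (pi * t)\<bar>" unfolding nz by simp
 also have "\<dots> \<le> 1 / min \<bar>t\<bar> (1 - \<bar>t\<bar>)" using sp sp0 t by (intro divide_left_mono) auto
 also have "\<dots> \<le> 1 / \<bar>t\<bar> + 1 / (1 - \<bar>t\<bar>)" using t by (simp add: min_def)
 finally show ?thesis .
qed

text \<open>Numbers spaced by \<delta> have distinct integer parts \<open>k i\<close> after division
  by \<delta>, so the sum is dominated by a harmonic sum of length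
  \<open>1 / \<delta>\<close>.\<close>

lemma spaced_reciprocal_sum:
 fixes u :: "'a \<Rightarrow> real"
 assumes fin: "finite S" and \<delta>: "0 < \<delta>" "\<delta> \<le> 1"
  and u: "\<And>i. i \<in> S \<Longrightarrow> \<delta> \<le> u i \<and> u i \<le> 1"
  and sp: "\<And>i j. i \<in> S \<Longrightarrow> j \<in> S \<Longrightarrow> i \<noteq> j \<Longrightarrow> \<delta> \<le> \<bar>u i - u j\<bar>"
 shows "(\<Sum>i\<in>S. 1 / u i) \<le> (1 + ln (1 / \<delta>)) / \<delta>"
proof -
 define k where "k i = nat \<lfloor>u i / \<delta>\<rfloor>" for i
 define K where "K = nat \<lfloor>1 / \<delta>\<rfloor>"
 have u1: "1 \<le> u i / \<delta>" "u i / \<delta> \<le> 1 / \<delta>" if "i \<in> S" for i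
  using u[OF that] \<delta> by (simp_all add: divide_right_mono)
 have kb: "real (k i) \<le> u i / \<delta>" "u i / \<delta> < real (k i) + 1" "k i \<ge> 1" if "i \<in> S" for i
  using u1[OF that] unfolding k_def by linarith+
 have "1 \<le> 1 / \<delta>" using \<delta> by simp
 then have K: "K \<ge> 1" "real K \<le> 1 / \<delta>" unfolding K_def by linarith+
 have kK: "k i \<le> K" if "i \<in> S" for i unfolding k_def K_def using u1[OF that] by (intro nat_mono floor_mono)
 have inj: "inj_on k S"
 proof (rule inj_onI, rule ccontr)
  fix i j assume ij: "i \<in> S" "j \<in> S" "k i = k j" "i \<noteq> j"
  have "\<bar>u i / \<delta> - u j / \<delta>\<bar> < 1" using kb[OF ij(1)] kb[OF ij(2)] ij(3) by linarith
  then have "\<bar>u i - u j\<bar> / \<delta> < 1" using \<delta> by (simp add: diff_divide_distrib[symmetric])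
  then have "\<bar>u i - u j\<bar> < \<delta>" using \<delta> by simp
  then show False using sp ij by fastforce
 qed
 have "(\<Sum>i\<in>S. 1 / u i) \<le> (\<Sum>i\<in>S. 1 / \<delta> * (1 / real (k i)))"
 proof (rule sum_mono)
  fix i assume i: "i \<in> S"
  have "real (k i) * \<delta> \<le> u i" using kb(1)[OF i] \<delta> by (simp add: pos_le_divide_eq)
  moreover have "0 < real (k i) * \<delta>" using kb(3)[OF i] \<delta> by simp
  ultimately have "1 / u i \<le> 1 / (real (k i) * \<delta>)" by (intro divide_left_mono) auto
  then show "1 / u i \<le> 1 / \<delta> * (1 / real (k i))" by (simp add: mult.commute)
 qed
 also have "\<dots> = 1 / \<delta> * (\<Sum>n\<in>k ` S. 1 / real n)"
  by (simp only: sum_distrib_left[symmetric] sum.reindex[OF inj] o_def)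
 also have "\<dots> \<le> 1 / \<delta> * (\<Sum>n=1..K. 1 / real n)"
  using kb(3) kK \<delta> by (intro mult_left_mono sum_mono2) auto
 also have "\<dots> \<le> 1 / \<delta> * (1 + ln (1 / \<delta>))"
 proof (rule mult_left_mono)
  have "(\<Sum>n=1..K. 1 / real n) \<le> 1 + ln (real K)" by (rule sum_inverse_le_ln[OF K(1)])
  also have "ln (real K) \<le> ln (1 / \<delta>)" using K by (intro ln_mono) auto
  finally show "(\<Sum>n=1..K. 1 / real n) \<le> 1 + ln (1 / \<delta>)" by simp
 qed (use \<delta> in simp)
 finally show ?thesis by simp
qed

text \<open>On each side of \<open>\<alpha> i\<close> both the distances and their complements to 1
  are again spaced by \<delta>. Two sides and two reciprocals account for the factor 4, and
  \<open>M\<close> is the diagonal term.\<close>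

lemma spaced_exp_sums:
 fixes \<alpha> :: "'a \<Rightarrow> real"
 assumes fin: "finite S" and \<delta>: "0 < \<delta>" "\<delta> \<le> 1"
  and sp: "\<And>i j. i \<in> S \<Longrightarrow> j \<in> S \<Longrightarrow> i \<noteq> j \<Longrightarrow> \<delta> \<le> \<bar>\<alpha> i - \<alpha> j\<bar> \<and> \<bar>\<alpha> i - \<alpha> j\<bar> \<le> 1 - \<delta>"
  and i: "i \<in> S"
 shows "(\<Sum>j\<in>S. norm (\<Sum>n\<in>{1..M}. unit_exp n (\<alpha> i - \<alpha> j))) \<le> real M + 4 / \<delta> * (1 + ln (1 / \<delta>))"
proof -
 define w where "w j = norm (\<Sum>n\<in>{1..M}. unit_exp n (\<alpha> i - \<alpha> j))" for j
 define P where "P = {j \<in> S. j \<noteq> i \<and> \<alpha> j < \<alpha> i}"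
 define Q where "Q = {j \<in> S. j \<noteq> i \<and> \<not> \<alpha> j < \<alpha> i}"
 define B where "B = (1 + ln (1 / \<delta>)) / \<delta>"
 have S: "S = insert i (P \<union> Q)" "i \<notin> P \<union> Q" "P \<inter> Q = {}" "finite P" "finite Q"
  using i fin by (auto simp: P_def Q_def)
 have s: "(\<Sum>j\<in>S. w j) = w i + ((\<Sum>j\<in>P. w j) + (\<Sum>j\<in>Q. w j))"
  using S(2-5) by (subst S(1)) (simp add: sum.union_disjoint)
 have wi: "w i = real M" by (simp add: w_def)
 have ws: "w j \<le> 1 / \<bar>\<alpha> i - \<alpha> j\<bar> + 1 / (1 - \<bar>\<alpha> i - \<alpha> j\<bar>)" if "j \<in> S" "j \<noteq> i" for j
  unfolding w_def using sp[OF i that(1)] that \<delta> by (intro norm_exp_sum_le) auto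
 have side: "(\<Sum>j\<in>R. w j) \<le> 2 * B"
  if R: "R \<subseteq> S" "i \<notin> R" and sg: "(\<forall>j\<in>R. \<alpha> j < \<alpha> i) \<or> (\<forall>j\<in>R. \<alpha> i \<le> \<alpha> j)" for R
 proof -
  have "(\<Sum>j\<in>R. w j) \<le> (\<Sum>j\<in>R. 1 / \<bar>\<alpha> i - \<alpha> j\<bar> + 1 / (1 - \<bar>\<alpha> i - \<alpha> j\<bar>))"
   by (intro sum_mono ws) (use R in auto)
  also have "\<dots> = (\<Sum>j\<in>R. 1 / \<bar>\<alpha> i - \<alpha> j\<bar>) + (\<Sum>j\<in>R. 1 / (1 - \<bar>\<alpha> i - \<alpha> j\<bar>))" by (rule sum.distrib)
  also have "\<dots> \<le> B + B" unfolding B_def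
  proof (intro add_mono spaced_reciprocal_sum \<delta>)
   show "finite R" "finite R" using R(1) fin by (auto dest: finite_subset)
   fix j assume j: "j \<in> R"
   then have "\<delta> \<le> \<bar>\<alpha> i - \<alpha> j\<bar> \<and> \<bar>\<alpha> i - \<alpha> j\<bar> \<le> 1 - \<delta>" using sp[OF i, of j] R by blast
   then show "\<delta> \<le> \<bar>\<alpha> i - \<alpha> j\<bar> \<and> \<bar>\<alpha> i - \<alpha> j\<bar> \<le> 1" "\<delta> \<le> 1 - \<bar>\<alpha> i - \<alpha> j\<bar> \<and> 1 - \<bar>\<alpha> i - \<alpha> j\<bar> \<le> 1" using \<delta> by auto
   fix k assume k: "k \<in> R" "j \<noteq> k"
   have "\<delta> \<le> \<bar>\<alpha> j - \<alpha> k\<bar>" using sp[of j k] j k R(1) by blast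
   moreover have "\<alpha> j < \<alpha> i \<and> \<alpha> k < \<alpha> i \<or> \<alpha> i \<le> \<alpha> j \<and> \<alpha> i \<le> \<alpha> k" using sg j k(1) by blast
   then have "\<bar>\<bar>\<alpha> i - \<alpha> j\<bar> - \<bar>\<alpha> i - \<alpha> k\<bar>\<bar> = \<bar>\<alpha> j - \<alpha> k\<bar>" by auto
   ultimately show "\<delta> \<le> \<bar>\<bar>\<alpha> i - \<alpha> j\<bar> - \<bar>\<alpha> i - \<alpha> k\<bar>\<bar>" "\<delta> \<le> \<bar>1 - \<bar>\<alpha> i - \<alpha> j\<bar> - (1 - \<bar>\<alpha> i - \<alpha> k\<bar>)\<bar>" by linarith+
  qed
  finally show ?thesis by simp
 qed
 have p: "(\<Sum>j\<in>P. w j) \<le> 2 * B" and q: "(\<Sum>j\<in>Q. w j) \<le> 2 * B"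
  by (rule side; auto simp: P_def Q_def)+
 have "(\<Sum>j\<in>S. w j) \<le> real M + 4 * B" using s wi p q by linarith
 then show ?thesis unfolding w_def B_def by simp
qed

lemma sum_norm_sum_square:
 fixes c :: "'a \<Rightarrow> complex" and e :: "'b \<Rightarrow> 'a \<Rightarrow> complex"
 shows "complex_of_real (\<Sum>n\<in>N. norm (\<Sum>i\<in>S. c i * e n i) ^ 2)
   = (\<Sum>i\<in>S. \<Sum>j\<in>S. c i * cnj (c j) * (\<Sum>n\<in>N. e n i * cnj (e n j)))"
proof -
 have "complex_of_real (\<Sum>n\<in>N. norm (\<Sum>i\<in>S. c i * e n i) ^ 2) = (\<Sum>n\<in>N. \<Sum>i\<in>S. \<Sum>j\<in>S. c i * cnj (c j) * (e n i * cnj (e n j)))"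
  unfolding of_real_sum complex_norm_square cnj_sum sum_product complex_cnj_mult by (intro sum.cong refl) (simp only: mult_ac)
 also have "\<dots> = (\<Sum>i\<in>S. \<Sum>n\<in>N. \<Sum>j\<in>S. c i * cnj (c j) * (e n i * cnj (e n j)))" by (rule sum.swap)
 finally show ?thesis unfolding sum_distrib_left by (simp only:) (rule sum.cong[OF refl], rule sum.swap)
qed

text \<open>Schur's test: the square is opened, \<open>norm (c i) * norm (c j)\<close> is replaced
  by the mean of the squares, and by symmetry of the kernel only its row sums remain.\<close>

lemma dual_large_sieve:
 fixes \<alpha> :: "'a \<Rightarrow> real" and c :: "'a \<Rightarrow> complex"
 assumes fin: "finite S"
  and B: "\<And>i. i \<in> S \<Longrightarrow> (\<Sum>j\<in>S. norm (\<Sum>n\<in>{1..M}. unit_exp n (\<alpha> i - \<alpha> j))) \<le> B"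
 shows "(\<Sum>n\<in>{1..M}. norm (\<Sum>i\<in>S. c i * unit_exp n (\<alpha> i)) ^ 2) \<le> B * (\<Sum>i\<in>S. norm (c i) ^ 2)"
proof -
 define w where "w i j = norm (\<Sum>n\<in>{1..M}. unit_exp n (\<alpha> i - \<alpha> j))" for i j
 have wsym: "w i j = w j i" for i j
 proof -
  have "unit_exp n (\<alpha> i - \<alpha> j) = cnj (unit_exp n (\<alpha> j - \<alpha> i))" for n
   by (simp add: cis_cnj algebra_simps)
  then have "(\<Sum>n\<in>{1..M}. unit_exp n (\<alpha> i - \<alpha> j)) = cnj (\<Sum>n\<in>{1..M}. unit_exp n (\<alpha> j - \<alpha> i))"
   by (simp only: cnj_sum)
  then show ?thesis unfolding w_def by (simp only: complex_mod_cnj)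
 qed
 have "unit_exp n (\<alpha> i) * cnj (unit_exp n (\<alpha> j)) = unit_exp n (\<alpha> i - \<alpha> j)" for i j n
  by (simp add: cis_cnj cis_mult right_diff_distrib)
 then have eq: "complex_of_real (\<Sum>n\<in>{1..M}. norm (\<Sum>i\<in>S. c i * unit_exp n (\<alpha> i)) ^ 2)
   = (\<Sum>i\<in>S. \<Sum>j\<in>S. c i * cnj (c j) * (\<Sum>n\<in>{1..M}. unit_exp n (\<alpha> i - \<alpha> j)))"
  by (simp only: sum_norm_sum_square)
 have "(\<Sum>n\<in>{1..M}. norm (\<Sum>i\<in>S. c i * unit_exp n (\<alpha> i)) ^ 2)
   = norm (complex_of_real (\<Sum>n\<in>{1..M}. norm (\<Sum>i\<in>S. c i * unit_exp n (\<alpha> i)) ^ 2))"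
  by (simp only: norm_of_real abs_of_nonneg[OF sum_nonneg[OF zero_le_power2]])
 also have "\<dots> \<le> (\<Sum>i\<in>S. \<Sum>j\<in>S. norm (c i) * norm (c j) * w i j)"
  unfolding eq w_def
  by (intro order_trans[OF norm_sum] sum_mono) (simp add: norm_mult)
 also have "\<dots> \<le> (\<Sum>i\<in>S. \<Sum>j\<in>S. norm (c i) ^ 2 * w i j / 2 + norm (c j) ^ 2 * w j i / 2)"
 proof (intro sum_mono)
  fix i j
  have "norm (c i) * norm (c j) \<le> (norm (c i) ^ 2 + norm (c j) ^ 2) / 2"
   using sum_squares_bound[of "norm (c i)" "norm (c j)"] by simp
  then have "norm (c i) * norm (c j) * w i j \<le> (norm (c i) ^ 2 + norm (c j) ^ 2) / 2 * w i j"
   by (rule mult_right_mono) (simp add: w_def)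
  then show "norm (c i) * norm (c j) * w i j \<le> norm (c i) ^ 2 * w i j / 2 + norm (c j) ^ 2 * w j i / 2"
   unfolding wsym[of j i] by (simp add: distrib_right add_divide_distrib)
 qed
 also have "\<dots> = (\<Sum>i\<in>S. \<Sum>j\<in>S. norm (c i) ^ 2 * w i j / 2) + (\<Sum>i\<in>S. \<Sum>j\<in>S. norm (c j) ^ 2 * w j i / 2)"
  by (simp only: sum.distrib)
 also have "(\<Sum>i\<in>S. \<Sum>j\<in>S. norm (c j) ^ 2 * w j i / 2) = (\<Sum>i\<in>S. \<Sum>j\<in>S. norm (c i) ^ 2 * w i j / 2)"
  by (rule sum.swap)
 also have "(\<Sum>i\<in>S. \<Sum>j\<in>S. norm (c i) ^ 2 * w i j / 2) + (\<Sum>i\<in>S. \<Sum>j\<in>S. norm (c i) ^ 2 * w i j / 2)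
   = (\<Sum>i\<in>S. norm (c i) ^ 2 * (\<Sum>j\<in>S. w i j))"
  by (simp add: sum.distrib[symmetric] sum_distrib_left mult.commute[of "w _ _"] del: sum_distrib_right)
 also have "\<dots> \<le> (\<Sum>i\<in>S. norm (c i) ^ 2 * B)" using B by (intro sum_mono mult_left_mono) (auto simp: w_def)
 also have "\<dots> = B * (\<Sum>i\<in>S. norm (c i) ^ 2)" by (simp add: sum_distrib_left mult.commute)
 finally show ?thesis .
qed

text \<open>Duality. The left side \<open>F\<close> equals the sum of \<open>a n * d n\<close>,
  where \<open>d n\<close> are the exponential sums weighted by the conjugates of
  \<open>f i\<close>; Cauchy-Schwarz and the dual inequality give
  \<open>F ^ 2 \<le> A * B * F\<close>.\<close>

lemma large_sieve:
 fixes \<alpha> :: "'a \<Rightarrow> real" and a :: "nat \<Rightarrow> complex"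
 assumes fin: "finite S" and \<delta>: "0 < \<delta>" "\<delta> \<le> 1"
  and sp: "\<And>i j. i \<in> S \<Longrightarrow> j \<in> S \<Longrightarrow> i \<noteq> j \<Longrightarrow> \<delta> \<le> \<bar>\<alpha> i - \<alpha> j\<bar> \<and> \<bar>\<alpha> i - \<alpha> j\<bar> \<le> 1 - \<delta>"
 shows "(\<Sum>i\<in>S. norm (\<Sum>n\<in>{1..M}. a n * unit_exp n (\<alpha> i)) ^ 2)
  \<le> (real M + 4 / \<delta> * (1 + ln (1 / \<delta>))) * (\<Sum>n\<in>{1..M}. norm (a n) ^ 2)"
proof -
 define B where "B = real M + 4 / \<delta> * (1 + ln (1 / \<delta>))"
 have "ln (1 / \<delta>) \<ge> 0" using \<delta> by (simp add: ln_ge_zero)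
 then have B0: "B \<ge> 0" using \<delta> by (simp add: B_def)
 define f where "f i = (\<Sum>n\<in>{1..M}. a n * unit_exp n (\<alpha> i))" for i
 define d where "d n = (\<Sum>i\<in>S. cnj (f i) * unit_exp n (\<alpha> i))" for n
 define F where "F = (\<Sum>i\<in>S. norm (f i) ^ 2)"
 define A where "A = (\<Sum>n\<in>{1..M}. norm (a n) ^ 2)"
 have F0: "F \<ge> 0" and A0: "A \<ge> 0" unfolding F_def A_def by (intro sum_nonneg; simp)+
 have dd: "(\<Sum>n\<in>{1..M}. norm (d n) ^ 2) \<le> B * F"
 proof -
  have "(\<Sum>j\<in>S. norm (\<Sum>n\<in>{1..M}. unit_exp n (\<alpha> i - \<alpha> j))) \<le> B" if "i \<in> S" for i
   unfolding B_def by (rule spaced_exp_sums[OF fin \<delta> _ that]) (rule sp)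
  from dual_large_sieve[OF fin this, of "\<lambda>i. cnj (f i)"] show ?thesis unfolding d_def F_def by simp
 qed
 have "complex_of_real F = (\<Sum>i\<in>S. cnj (f i) * f i)"
  unfolding F_def by (simp add: complex_norm_square mult.commute flip: of_real_power)
 also have "\<dots> = (\<Sum>i\<in>S. \<Sum>n\<in>{1..M}. a n * (cnj (f i) * unit_exp n (\<alpha> i)))"
  by (subst (2) f_def) (simp only: sum_distrib_left mult_ac)
 also have "\<dots> = (\<Sum>n\<in>{1..M}. \<Sum>i\<in>S. a n * (cnj (f i) * unit_exp n (\<alpha> i)))" by (rule sum.swap)
 also have "\<dots> = (\<Sum>n\<in>{1..M}. a n * d n)" by (simp only: d_def sum_distrib_left)
 finally have "norm (complex_of_real F) \<le> (\<Sum>n\<in>{1..M}. norm (a n) * norm (d n))"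
  by (simp only:) (rule order_trans[OF norm_sum], simp add: norm_mult)
 then have "F \<le> (\<Sum>n\<in>{1..M}. norm (a n) * norm (d n))" using F0 by simp
 then have "F ^ 2 \<le> (\<Sum>n\<in>{1..M}. norm (a n) * norm (d n)) ^ 2" using F0 by (rule power_mono)
 also have "\<dots> \<le> A * (\<Sum>n\<in>{1..M}. norm (d n) ^ 2)" unfolding A_def by (rule Cauchy_Schwarz_ineq_sum)
 also have "\<dots> \<le> A * (B * F)" by (rule mult_left_mono[OF dd A0])
 finally have "F * F \<le> (B * A) * F" by (simp add: power2_eq_square mult_ac)
 then have "F \<le> B * A" using F0 A0 B0 by (cases "F = 0") (auto simp: mult_le_cancel_right)
 then show ?thesis unfolding F_def A_def B_def f_def .
qed

text \<open>Distinct fractions \<open>k / p\<close> and \<open>l / q\<close> differ by at least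
  \<open>1 / (p q) \<ge> 1 / x ^ 2\<close>. They lie between \<open>1 / p\<close> and
  \<open>1 - 1 / p\<close>, which also keeps the spacing across 0 modulo 1.\<close>

lemma large_sieve_primes:
 fixes a :: "nat \<Rightarrow> complex"
 assumes x: "x \<ge> 1"
 shows "(\<Sum>p\<in>primes_upto x. \<Sum>k\<in>{1..<p}. norm (\<Sum>n\<in>{1..M}. a n * unit_exp n (real k / real p)) ^ 2)
  \<le> (real M + 4 * x ^ 2 * (1 + 2 * ln x)) * (\<Sum>n\<in>{1..M}. norm (a n) ^ 2)"
proof -
 define S where "S = Sigma (primes_upto x) (\<lambda>p. {1..<p})"
 define \<alpha> where "\<alpha> = (\<lambda>(p, k). real k / real p)"
 define \<delta> where "\<delta> = 1 / x ^ 2"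
 have x2: "x ^ 2 \<ge> 1" "x ^ 2 > 0" using x by (auto intro: one_le_power)
 have \<delta>: "0 < \<delta>" "\<delta> \<le> 1" using x2 by (simp_all add: \<delta>_def)
 have sp: "\<delta> \<le> \<bar>\<alpha> i - \<alpha> j\<bar> \<and> \<bar>\<alpha> i - \<alpha> j\<bar> \<le> 1 - \<delta>" if ij: "i \<in> S" "j \<in> S" "i \<noteq> j" for i j
 proof -
  obtain p k where i: "i = (p, k)" "prime p" "real p \<le> x" "0 < k" "k < p"
   using ij(1) by (cases i) (auto simp: S_def primes_upto_def)
  obtain q l where j: "j = (q, l)" "prime q" "real q \<le> x" "0 < l" "l < q"
   using ij(2) by (cases j) (auto simp: S_def primes_upto_def)
  have pq: "real p > 0" "real q > 0" using prime_gt_0_nat i(2) j(2) by auto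
  have pqx: "real p * real q \<le> x ^ 2" unfolding power2_eq_square using i j x by (intro mult_mono) auto
  have ne: "int k * int q \<noteq> int l * int p"
  proof
   assume "int k * int q = int l * int p"
   then have e: "k * q = l * p" by (metis of_nat_eq_iff of_nat_mult)
   then have "p dvd k * q" by simp
   moreover have "\<not> p dvd k" using i by (auto dest: dvd_imp_le)
   ultimately have "p dvd q" using i(2) prime_dvd_mult_iff by blast
   then have "p = q" using i(2) j(2) primes_dvd_imp_eq by blast
   then show False using e ij i j pq by simp
  qed
  have d: "\<alpha> i - \<alpha> j = of_int (int k * int q - int l * int p) / (real p * real q)"
   using pq by (simp add: \<alpha>_def i j field_simps)
  have "1 \<le> \<bar>int k * int q - int l * int p\<bar>" using ne by linarith
  then have "1 \<le> \<bar>real_of_int (int k * int q - int l * int p)\<bar>" by linarith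
  then have "1 / x ^ 2 \<le> \<bar>real_of_int (int k * int q - int l * int p)\<bar> / (real p * real q)"
   using pq pqx by (intro frac_le) auto
  then have 1: "\<delta> \<le> \<bar>\<alpha> i - \<alpha> j\<bar>" unfolding d \<delta>_def using pq by (simp add: abs_mult)
  have dp: "1 / real p \<ge> \<delta>" "1 / real q \<ge> \<delta>"
  proof -
   have "x \<le> x ^ 2" using mult_left_mono[OF x, of x] x by (simp add: power2_eq_square)
   then show "1 / real p \<ge> \<delta>" "1 / real q \<ge> \<delta>" unfolding \<delta>_def using i j pq by (auto intro!: divide_left_mono)
  qed
  have "real k \<le> real p - 1" "real l \<le> real q - 1" "real k \<ge> 1" "real l \<ge> 1" using i j by linarith+
  then have "real k / real p \<le> (real p - 1) / real p" "real l / real q \<le> (real q - 1) / real q"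
   "real k / real p > 0" "real l / real q > 0"
   using pq by (auto intro!: divide_right_mono)
  then have "\<alpha> i \<le> 1 - 1 / real p" "\<alpha> j \<le> 1 - 1 / real q" "\<alpha> i > 0" "\<alpha> j > 0"
   using pq by (auto simp: \<alpha>_def i j diff_divide_distrib)
  then have "\<bar>\<alpha> i - \<alpha> j\<bar> \<le> 1 - \<delta>" using dp by linarith
  with 1 show ?thesis ..
 qed
 have fin: "finite S" by (auto simp: S_def)
 have "(\<Sum>i\<in>S. norm (\<Sum>n\<in>{1..M}. a n * unit_exp n (\<alpha> i)) ^ 2)
  \<le> (real M + 4 / \<delta> * (1 + ln (1 / \<delta>))) * (\<Sum>n\<in>{1..M}. norm (a n) ^ 2)"
  by (rule large_sieve[OF fin \<delta>]) (rule sp)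
 moreover have "4 / \<delta> * (1 + ln (1 / \<delta>)) = 4 * x ^ 2 * (1 + 2 * ln x)" using x by (simp add: \<delta>_def ln_realpow)
 ultimately show ?thesis unfolding S_def \<alpha>_def by (simp add: sum.Sigma case_prod_beta)
qed

section \<open>Characters to a prime modulus and power residues\<close>

definition zeta_root :: "nat \<Rightarrow> complex" where "zeta_root n = cis (2 * pi / real n)"

lemma zeta_root_power: "zeta_root n ^ m = cis (2 * pi * real m / real n)"
 by (simp add: zeta_root_def Complex.DeMoivre mult_ac)

lemma norm_zeta_root_power [simp]: "norm (zeta_root n ^ m) = 1"
 by (simp add: zeta_root_power)

lemma zeta_root_power_self: "n > 0 \<Longrightarrow> zeta_root n ^ n = 1"
 by (simp add: zeta_root_power)

lemma zeta_root_power_mod: "n > 0 \<Longrightarrow> zeta_root n ^ (m mod n) = zeta_root n ^ m"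
 using power_add[of "zeta_root n" "n * (m div n)" "m mod n"] by (simp add: power_mult zeta_root_power_self)

lemma zeta_root_power_cong: "n > 0 \<Longrightarrow> [k = l] (mod n) \<Longrightarrow> zeta_root n ^ k = zeta_root n ^ l"
 using zeta_root_power_mod unfolding cong_def by metis

lemma zeta_root_power_inj:
 assumes "k < n" "l < n" "zeta_root n ^ k = zeta_root n ^ l"
 shows "k = l"
proof -
 have "inj_on (\<lambda>k. cis (2 * pi * real k / real n)) {..<n}"
  using Complex.bij_betw_roots_unity[of n] assms(1) by (simp add: bij_betw_def)
 then show ?thesis using assms unfolding zeta_root_power by (auto dest: inj_onD)
qed

lemma zeta_root_power_eq_1_iff:
 assumes n: "n > 0"
 shows "zeta_root n ^ m = 1 \<longleftrightarrow> n dvd m"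
proof
 assume "zeta_root n ^ m = 1"
 then have "zeta_root n ^ (m mod n) = zeta_root n ^ 0" using zeta_root_power_mod[OF n] by simp
 then have "m mod n = 0" using n by (intro zeta_root_power_inj[of _ n]) auto
 then show "n dvd m" by blast
qed (auto simp: power_mult zeta_root_power_self[OF n])

lemma sum_powers_root_of_unity:
 fixes w :: complex
 assumes "w ^ n = 1"
 shows "(\<Sum>j<n. w ^ j) = (if w = 1 then of_nat n else 0)"
 using assms by (simp add: sum_gp_strict)

text \<open>As \<open>h\<close> is injective with values below \<open>n\<close>, an off-diagonal
  term is a complete sum of powers of a nontrivial root of unity. \<open>h\<close> is the identity
  for additive characters and the discrete logarithm for multiplicative ones.\<close>

lemma parseval:
 fixes A :: "'a \<Rightarrow> complex"
 assumes B: "finite B" and h: "inj_on h B" "\<And>b. b \<in> B \<Longrightarrow> h b < n" and n: "n > 0"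
 shows "(\<Sum>j<n. norm (\<Sum>b\<in>B. A b * zeta_root n ^ (j * h b)) ^ 2) = real n * (\<Sum>b\<in>B. norm (A b) ^ 2)"
proof -
 define w where "w b c = zeta_root n ^ h b * cnj (zeta_root n ^ h c)" for b c
 have wn: "w b c ^ n = 1" for b c
 proof -
  have "w b c ^ n = (zeta_root n ^ n) ^ h b * cnj ((zeta_root n ^ n) ^ h c)"
   by (simp only: w_def power_mult_distrib complex_cnj_power[symmetric] power_mult[symmetric] mult.commute)
  then show ?thesis by (simp add: zeta_root_power_self[OF n])
 qed
 have w1: "w b c = 1 \<longleftrightarrow> b = c" if "b \<in> B" "c \<in> B" for b c
 proof
  assume "w b c = 1"
  then have "zeta_root n ^ h b * (cnj (zeta_root n ^ h c) * zeta_root n ^ h c) = zeta_root n ^ h c"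
   unfolding w_def mult.assoc[symmetric] by (simp only: mult_1)
  moreover have "cnj (zeta_root n ^ h c) * zeta_root n ^ h c = 1"
   using complex_norm_square[of "zeta_root n ^ h c"] by (simp only: norm_zeta_root_power) (simp add: mult.commute)
  ultimately have "zeta_root n ^ h b = zeta_root n ^ h c" by (simp only: mult_1_right)
  then have "h b = h c" using h(2) that by (intro zeta_root_power_inj[of _ n]) auto
  then show "b = c" using h(1) that by (auto dest: inj_onD)
 next
  assume "b = c"
  then show "w b c = 1" using complex_norm_square[of "zeta_root n ^ h c"] by (simp only: norm_zeta_root_power w_def) simp
 qed
 have "zeta_root n ^ (j * h b) * cnj (zeta_root n ^ (j * h c)) = w b c ^ j" for j b c
  by (simp only: w_def power_mult_distrib complex_cnj_power[symmetric] power_mult[symmetric] mult.commute)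
 then have "complex_of_real (\<Sum>j<n. norm (\<Sum>b\<in>B. A b * zeta_root n ^ (j * h b)) ^ 2)
   = (\<Sum>b\<in>B. \<Sum>c\<in>B. A b * cnj (A c) * (\<Sum>j<n. w b c ^ j))" by (simp only: sum_norm_sum_square)
 also have "\<dots> = (\<Sum>b\<in>B. \<Sum>c\<in>B. if c = b then A b * cnj (A b) * of_nat n else 0)"
  unfolding sum_powers_root_of_unity[OF wn] using w1 by (intro sum.cong refl) auto
 also have "\<dots> = (\<Sum>b\<in>B. complex_of_real (real n * norm (A b) ^ 2))"
  using B by (intro sum.cong refl) (simp add: complex_norm_square[symmetric] mult.commute)
 finally have "complex_of_real (\<Sum>j<n. norm (\<Sum>b\<in>B. A b * zeta_root n ^ (j * h b)) ^ 2) = of_real (real n * (\<Sum>b\<in>B. norm (A b) ^ 2))"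
  by (simp only: of_real_sum sum_distrib_left)
 then show ?thesis by (simp only: of_real_eq_iff)
qed

section \<open>Characters modulo a prime through discrete logarithms\<close>

definition croot :: "nat \<Rightarrow> nat" where "croot p = (SOME g. residue_primroot p g)"

definition dlog :: "nat \<Rightarrow> nat \<Rightarrow> nat" where
 "dlog p a = (SOME k. k < p - 1 \<and> [croot p ^ k = a] (mod p))"

text \<open>All characters modulo the prime \<open>p\<close>, with \<open>j\<close> running modulo
  \<open>p - 1\<close> and \<open>j = 0\<close> principal. For \<open>d dvd p - 1\<close>, those
  whose \<open>d\<close>-th power is principal are the multiples of
  \<open>(p - 1) div d\<close>.\<close>

definition pchar :: "nat \<Rightarrow> nat \<Rightarrow> nat \<Rightarrow> complex" where
 "pchar p j a = (if p dvd a then 0 else zeta_root (p - 1) ^ (j * dlog p a))"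

context
 fixes p :: nat assumes p: "prime p"
begin

lemma p1: "p > 1" "p - 1 > 0" "p > 0"
 using prime_gt_1_nat[OF p] by auto

lemma croot: "residue_primroot p (croot p)"
 unfolding croot_def using prime_primitive_root_exists[OF p1(1) p] by (rule someI_ex)

lemma ord_croot: "ord p (croot p) = p - 1" and coprime_croot: "coprime p (croot p)"
 using croot totient_prime[OF p] by (auto simp: residue_primroot_def)

lemma dlog:
 assumes "\<not> p dvd a"
 shows "dlog p a < p - 1" "[croot p ^ dlog p a = a] (mod p)"
proof -
 have "coprime a p" using assms prime_imp_coprime[OF p] by (simp add: coprime_commute)
 then have "a mod p \<in> totatives p"
  using p1 assms by (auto simp: totatives_def coprime_mod_left_iff mod_greater_zero_iff_not_dvd less_imp_le)
 then obtain k where "k < p - 1" "croot p ^ k mod p = a mod p"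
  using residue_primroot_is_generator[OF p1(1) croot] totient_prime[OF p] by (force simp: bij_betw_def)
 then have "\<exists>k. k < p - 1 \<and> [croot p ^ k = a] (mod p)" by (auto simp: cong_def)
 from someI_ex[OF this] show "dlog p a < p - 1" "[croot p ^ dlog p a = a] (mod p)" unfolding dlog_def by auto
qed

lemma croot_power_cong: "[croot p ^ k = croot p ^ l] (mod p) \<longleftrightarrow> [k = l] (mod (p - 1))"
 using order_divides_expdiff[OF coprime_croot] ord_croot by simp

lemma dlog_cong: "[a = b] (mod p) \<Longrightarrow> dlog p a = dlog p b"
 unfolding dlog_def cong_def by simp

lemma dlog_mult:
 assumes "\<not> p dvd a" "\<not> p dvd b"
 shows "[dlog p (a * b) = dlog p a + dlog p b] (mod (p - 1))"
proof -
 have "\<not> p dvd a * b" using assms prime_dvd_mult_iff[OF p] by simp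
 then have "[croot p ^ dlog p (a * b) = a * b] (mod p)" by (rule dlog)
 also have "[a * b = croot p ^ dlog p a * croot p ^ dlog p b] (mod p)"
  by (intro cong_mult cong_sym[OF dlog(2)] assms)
 finally show ?thesis by (simp add: power_add[symmetric] croot_power_cong)
qed

lemma dlog_inj: "inj_on (dlog p) {1..<p}"
proof (rule inj_onI)
 fix a b assume ab: "a \<in> {1..<p}" "b \<in> {1..<p}" "dlog p a = dlog p b"
 then have "\<not> p dvd a" "\<not> p dvd b" by (auto dest: dvd_imp_le)
 then have "[a = b] (mod p)" using dlog(2)[of a] dlog(2)[of b] ab(3) cong_trans cong_sym by metis
 then show "a = b" using ab by (simp add: cong_def)
qed

lemma pchar_cong: "[a = b] (mod p) \<Longrightarrow> pchar p j a = pchar p j b"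
 unfolding pchar_def using dlog_cong cong_dvd_iff[of a b p] by auto

lemma pchar_mod: "pchar p j (a mod p) = pchar p j a"
 by (rule pchar_cong) (simp add: cong_def)

lemma pchar_mult: "pchar p j (a * b) = pchar p j a * pchar p j b"
proof (cases "p dvd a \<or> p dvd b")
 case False
 then have "[j * dlog p (a * b) = j * (dlog p a + dlog p b)] (mod (p - 1))" by (intro cong_mult cong_refl dlog_mult) auto
 from zeta_root_power_cong[OF p1(2) this] False show ?thesis
  by (simp add: pchar_def prime_dvd_mult_iff[OF p] distrib_left power_add)
qed (auto simp: pchar_def)

lemma pchar_1: "pchar p j 1 = 1"
 using pchar_mult[of j 1 1] p1 by (simp add: pchar_def zeta_root_def split: if_splits)

lemma pchar_0: "pchar p 0 a = (if p dvd a then 0 else 1)"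
 by (simp add: pchar_def)

lemma pchar_prod: "finite I \<Longrightarrow> pchar p j (\<Prod>i\<in>I. f i) = (\<Prod>i\<in>I. pchar p j (f i))"
 by (induction I rule: finite_induct) (auto simp: pchar_mult pchar_1[simplified])

text \<open>Both sides are evaluated by Parseval, so that no Gauss sums are needed; their difference is
 \<open>(\<Sum>b=1..<p. (A b - A 0)\<^sup>2)\<close>, where \<open>A b\<close> is the total weight of the residue class of \<open>b\<close>.\<close>

lemma pchar_sums_le_exp_sums:
 fixes a :: "nat \<Rightarrow> real"
 shows "(\<Sum>j\<in>{1..<p - 1}. norm (\<Sum>n\<in>{1..M}. of_real (a n) * pchar p j n) ^ 2)
   \<le> (\<Sum>k\<in>{1..<p}. norm (\<Sum>n\<in>{1..M}. of_real (a n) * unit_exp n (real k / real p)) ^ 2)"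
proof -
 define A where "A b = (\<Sum>n | n \<in> {1..M} \<and> n mod p = b. a n)" for b
 have grp: "(\<Sum>n\<in>{1..M}. of_real (a n) * F (n mod p)) = (\<Sum>b<p. of_real (A b) * F b)" for F :: "nat \<Rightarrow> complex"
 proof -
  have "(\<Sum>n\<in>{1..M}. of_real (a n) * F (n mod p)) = (\<Sum>b<p. \<Sum>n | n \<in> {1..M} \<and> n mod p = b. of_real (a n) * F (n mod p))"
   by (rule sum.group[symmetric]) (use p1 in auto)
  also have "\<dots> = (\<Sum>b<p. of_real (A b) * F b)"
   unfolding A_def of_real_sum sum_distrib_right by (intro sum.cong refl) auto
  finally show ?thesis .
 qed
 have lp: "{..<p} = insert 0 {1..<p}" using p1 by auto
 define s where "s = (\<Sum>b\<in>{1..<p}. A b)"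
 define Q where "Q = (\<Sum>b\<in>{1..<p}. A b ^ 2)"
 have "(\<Sum>n\<in>{1..M}. of_real (a n) * pchar p j n) = (\<Sum>b\<in>{1..<p}. of_real (A b) * zeta_root (p - 1) ^ (j * dlog p b))" for j
 proof -
  have "(\<Sum>n\<in>{1..M}. of_real (a n) * pchar p j n) = (\<Sum>n\<in>{1..M}. of_real (a n) * pchar p j (n mod p))"
   by (simp only: pchar_mod)
  also have "\<dots> = (\<Sum>b\<in>{1..<p}. of_real (A b) * pchar p j b)"
   unfolding grp[of "pchar p j"] lp by (simp add: pchar_def)
  also have "\<dots> = (\<Sum>b\<in>{1..<p}. of_real (A b) * zeta_root (p - 1) ^ (j * dlog p b))"
   by (intro sum.cong refl) (auto simp: pchar_def dest: dvd_imp_le)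
  finally show ?thesis .
 qed
 then have "(\<Sum>j<p - 1. norm (\<Sum>n\<in>{1..M}. of_real (a n) * pchar p j n) ^ 2)
   = (\<Sum>j<p - 1. norm (\<Sum>b\<in>{1..<p}. of_real (A b) * zeta_root (p - 1) ^ (j * dlog p b)) ^ 2)" by simp
 also have "\<dots> = real (p - 1) * (\<Sum>b\<in>{1..<p}. norm (complex_of_real (A b)) ^ 2)"
 proof (rule parseval[OF _ dlog_inj _ p1(2)])
  fix b assume "b \<in> {1..<p}"
  then show "dlog p b < p - 1" by (intro dlog(1)) (auto dest: dvd_imp_le)
 qed simp
 finally have l: "(\<Sum>j<p - 1. norm (\<Sum>n\<in>{1..M}. of_real (a n) * pchar p j n) ^ 2) = real (p - 1) * Q" by (simp add: Q_def)
 have "norm (\<Sum>n\<in>{1..M}. of_real (a n) * pchar p 0 n) = \<bar>s\<bar>"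
 proof -
  have "(\<Sum>n\<in>{1..M}. of_real (a n) * pchar p 0 n) = (\<Sum>n\<in>{1..M}. of_real (a n) * pchar p 0 (n mod p))"
   by (simp only: pchar_mod)
  also have "\<dots> = (\<Sum>b\<in>{1..<p}. of_real (A b) * pchar p 0 b)"
   unfolding grp[of "pchar p 0"] lp by (simp add: pchar_def)
  also have "\<dots> = of_real s"
   unfolding s_def of_real_sum by (intro sum.cong refl) (auto simp: pchar_def dest: dvd_imp_le)
  finally show ?thesis by (simp only: norm_of_real)
 qed
 moreover have "{..<p - 1} = insert 0 {1..<p - 1}" using p1 by auto
 ultimately have L: "(\<Sum>j\<in>{1..<p - 1}. norm (\<Sum>n\<in>{1..M}. of_real (a n) * pchar p j n) ^ 2) = real (p - 1) * Q - s ^ 2"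
  using l by simp
 have ce: "unit_exp n (real k / real p) = zeta_root p ^ (k * (n mod p))" for n k
 proof -
  have "[k * (n mod p) = k * n] (mod p)" by (intro cong_mult) (auto simp: cong_def)
  from zeta_root_power_cong[OF p1(3) this] show ?thesis by (simp add: zeta_root_power mult_ac)
 qed
 have ex: "(\<Sum>n\<in>{1..M}. of_real (a n) * unit_exp n (real k / real p)) = (\<Sum>b<p. of_real (A b) * zeta_root p ^ (k * b))" for k
  unfolding ce by (rule grp)
 have "(\<Sum>k<p. norm (\<Sum>b<p. of_real (A b) * zeta_root p ^ (k * b)) ^ 2) = real p * (\<Sum>b<p. norm (complex_of_real (A b)) ^ 2)"
  by (rule parseval[where h = "\<lambda>b. b"]) (use p1 in auto)
 also have "\<dots> = real p * (A 0 ^ 2 + Q)" unfolding lp Q_def by simp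
 finally have "(\<Sum>k<p. norm (\<Sum>b<p. of_real (A b) * zeta_root p ^ (k * b)) ^ 2) = real p * (A 0 ^ 2 + Q)" .
 moreover have "norm (\<Sum>b<p. of_real (A b) * zeta_root p ^ (0 * b)) = \<bar>A 0 + s\<bar>"
 proof -
  have "(\<Sum>b<p. of_real (A b) * zeta_root p ^ (0 * b)) = complex_of_real (A 0 + s)" unfolding lp s_def by simp
  then show ?thesis by (simp only: norm_of_real)
 qed
 ultimately have R: "(\<Sum>k\<in>{1..<p}. norm (\<Sum>b<p. of_real (A b) * zeta_root p ^ (k * b)) ^ 2) = real p * (A 0 ^ 2 + Q) - (A 0 + s) ^ 2"
  by (subst (asm) lp) simp
 have "0 \<le> (\<Sum>b\<in>{1..<p}. (A b - A 0) ^ 2)" by (intro sum_nonneg) simp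
 also have "\<dots> = Q - 2 * A 0 * s + real (p - 1) * A 0 ^ 2"
  unfolding Q_def s_def by (simp add: power2_diff sum.distrib sum_subtractf sum_distrib_left sum_distrib_right mult_ac)
 finally have "real (p - 1) * Q - s ^ 2 \<le> real p * (A 0 ^ 2 + Q) - (A 0 + s) ^ 2"
  using p1 by (simp add: of_nat_diff power2_sum algebra_simps)
 then show ?thesis unfolding L ex R .
qed

text \<open>For \<open>a\<close> prime to \<open>p\<close> the quotient is
  \<open>1 / gcd k (p - 1)\<close> with \<open>k\<close> the discrete logarithm of \<open>a\<close>.
  \<open>sum_index_coeff\<close> expands it over the divisors \<open>d\<close> of
  \<open>p - 1\<close> with \<open>d dvd k\<close>, a condition detected by averaging over the
  \<open>d\<close> characters of exponent \<open>d\<close>. For \<open>p dvd a\<close> both sides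
  are 0.\<close>

lemma ord_expansion:
 "complex_of_real (real (ord p a) / (real p - 1)) =
   (\<Sum>d | d dvd p - 1. of_real (index_coeff d / real d ^ 2) * (\<Sum>i<d. pchar p (i * ((p - 1) div d)) a))"
proof (cases "p dvd a")
 case True
 then have "ord p a = 0" using p1 by (simp add: ord_eq_0 coprime_absorb_left)
 then show ?thesis using True by (simp add: pchar_def)
next
 case False
 define n k where "n = p - 1" and "k = dlog p a"
 have n: "n > 0" using p1 by (simp add: n_def)
 have rn: "real p - 1 = real n" using p1 by (simp add: n_def of_nat_diff)
 have "ord p (croot p ^ k) * gcd k n = n" using ord_power_aux[of p "croot p" k] ord_croot by (simp add: n_def)
 moreover have "ord p (croot p ^ k) = ord p a" unfolding k_def by (rule ord_cong[OF dlog(2)[OF False]])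
 ultimately have og: "real (ord p a) * real (gcd k n) = real n" by (metis of_nat_mult)
 have g: "gcd k n > 0" using n by simp
 have "real (ord p a) / (real p - 1) = 1 / real (gcd k n)" unfolding rn using og g n by (simp add: field_simps)
 also have "\<dots> = (\<Sum>d | d dvd gcd k n. index_coeff d / real d)" using sum_index_coeff[OF g] by simp
 also have "\<dots> = (\<Sum>d | d dvd n. if d dvd k then index_coeff d / real d else 0)"
  using n by (simp add: sum.inter_filter[symmetric] conj_commute)
 finally have e: "complex_of_real (real (ord p a) / (real p - 1)) = (\<Sum>d | d dvd n. of_real (if d dvd k then index_coeff d / real d else 0))"
  by (simp only: of_real_sum)
 show ?thesis unfolding e n_def[symmetric]
 proof (rule sum.cong[OF refl])
  fix d assume "d \<in> {d. d dvd n}"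
  then have d: "d dvd n" by simp
  then have d0: "d > 0" using n by (auto intro: Nat.gr0I)
  define m where "m = n div d"
  have m: "n = m * d" "m > 0" using d n d0 by (auto simp: m_def)
  define w where "w = zeta_root n ^ (m * k)"
  have "w ^ d = (zeta_root n ^ n) ^ k" unfolding w_def power_mult[symmetric] m(1) by (simp add: mult_ac)
  then have wd: "w ^ d = 1" by (simp add: zeta_root_power_self[OF n])
  have w1: "w = 1 \<longleftrightarrow> d dvd k" unfolding w_def zeta_root_power_eq_1_iff[OF n] unfolding m(1) using m(2) by simp
  have "(\<Sum>i<d. pchar p (i * (n div d)) a) = (\<Sum>i<d. w ^ i)"
   using False by (intro sum.cong refl) (simp add: pchar_def w_def n_def k_def m_def power_mult[symmetric] mult_ac)
  also have "\<dots> = (if d dvd k then of_nat d else 0)" unfolding sum_powers_root_of_unity[OF wd] w1 ..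
  finally show "complex_of_real (if d dvd k then index_coeff d / real d else 0)
    = of_real (index_coeff d / real d ^ 2) * (\<Sum>i<d. pchar p (i * (n div d)) a)"
   using d0 by (simp add: power2_eq_square)
 qed
qed

text \<open>Averaging \<open>ord_expansion\<close> over \<open>a \<le> N\<close>, the principal
  character gives the main sum except for the multiples of \<open>p\<close>, a relative loss of
  \<open>1 / p\<close>. Each nonprincipal mean is split at \<open>1 / V\<close>: small ones cost
  \<open>1 / V\<close> per divisor because the coefficient is at most \<open>1 / d\<close>, large
  ones are left to the \<open>2 r\<close>-th moment.\<close>

lemma sum_ord_error:
 fixes N r :: nat and V :: real
 assumes N: "N \<ge> 1" and r: "r \<ge> 1" and V: "V > 0"
 shows "\<bar>(1 / real N) * (\<Sum>a\<in>{1..N}. real (ord p a) / (real p - 1)) - (\<Sum>d | d dvd p - 1. index_coeff d / real d ^ 2)\<bar>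
  \<le> (1 + ln (real p)) / real p + real (card {d. d dvd p - 1}) / V
   + (1 + ln (real p)) * V ^ (2 * r - 1) * (\<Sum>j\<in>{1..<p - 1}. (norm (\<Sum>a\<in>{1..N}. pchar p j a) / real N) ^ (2 * r))"
proof -
 define n where "n = p - 1"
 have n: "n > 0" using p1 by (simp add: n_def)
 define g where "g d = index_coeff d / real d ^ 2" for d
 define S where "S j = (\<Sum>a\<in>{1..N}. pchar p j a)" for j
 define y where "y j = norm (S j) / real N" for j
 define Y where "Y = (\<Sum>j\<in>{1..<n}. y j ^ (2 * r))"
 define c where "c = card {a \<in> {1..N}. p dvd a}"
 define T where "T = (\<Sum>a\<in>{1..N}. real (ord p a) / (real p - 1))"
 have fd: "finite {d. d dvd n}" using n by simp
 have N0: "real N > 0" using N by simp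
 have y0: "y j \<ge> 0" for j by (simp add: y_def)
 have Y0: "Y \<ge> 0" unfolding Y_def by (intro sum_nonneg zero_le_power y0)
 have gb: "\<bar>g d\<bar> \<le> 1 / real d" for d unfolding g_def by (rule abs_index_coeff_div_le)
 have gs: "(\<Sum>d | d dvd n. \<bar>g d\<bar>) \<le> 1 + ln (real p)"
 proof -
  have "(\<Sum>d | d dvd n. \<bar>g d\<bar>) \<le> (\<Sum>d | d dvd n. 1 / real d)" by (intro sum_mono gb)
  also have "\<dots> \<le> (\<Sum>d=1..n. 1 / real d)" using n by (intro sum_mono2) (auto dest: dvd_imp_le intro: Nat.gr0I)
  also have "\<dots> \<le> 1 + ln (real n)" using n by (intro sum_inverse_le_ln) auto
  also have "\<dots> \<le> 1 + ln (real p)" using n by (simp add: n_def)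
  finally show ?thesis .
 qed
 have S0: "S 0 = of_nat N - of_nat c"
 proof -
  have "S 0 = (\<Sum>a\<in>{1..N}. 1 - (if p dvd a then 1 else 0))" unfolding S_def pchar_0 by (intro sum.cong) auto
  also have "\<dots> = of_nat N - of_nat c" unfolding sum_subtractf c_def by (simp add: sum.inter_filter[symmetric])
  finally show ?thesis .
 qed
 have cN: "real c / real N \<le> 1 / real p"
 proof -
  have "c \<le> card ((\<lambda>k. k * p) ` {1..N div p})" unfolding c_def
  proof (intro card_mono subsetI)
   fix a assume "a \<in> {a \<in> {1..N}. p dvd a}"
   then obtain k where "a = k * p" "1 \<le> a" "a \<le> N" by (auto elim!: dvdE simp: mult.commute)
   then show "a \<in> (\<lambda>k. k * p) ` {1..N div p}" using p1
    by (intro image_eqI[of _ _ k]) (auto simp: less_eq_div_iff_mult_less_eq Suc_le_eq)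
  qed simp
  also have "\<dots> \<le> N div p" using card_image_le[of "{1..N div p}" "\<lambda>k. k * p"] by simp
  finally have "real c \<le> real (N div p)" by simp
  also have "\<dots> \<le> real N / real p" by (rule of_nat_div_le_of_nat)
  finally show ?thesis using N0 p1 by (simp add: field_simps)
 qed
 have "complex_of_real T = (\<Sum>a\<in>{1..N}. \<Sum>d | d dvd n. of_real (g d) * (\<Sum>i<d. pchar p (i * (n div d)) a))"
  unfolding T_def of_real_sum ord_expansion g_def n_def ..
 also have "\<dots> = (\<Sum>d | d dvd n. of_real (g d) * (\<Sum>i<d. S (i * (n div d))))"
  unfolding S_def by (subst sum.swap, intro sum.cong refl) (simp only: sum_distrib_left[symmetric], subst sum.swap, rule refl)
 finally have T: "complex_of_real T = (\<Sum>d | d dvd n. of_real (g d) * (\<Sum>i<d. S (i * (n div d))))" .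
 have split: "(\<Sum>i<d. S (i * (n div d))) = of_nat N - of_nat c + (\<Sum>i\<in>{1..<d}. S (i * (n div d)))" if "d dvd n" for d
 proof -
  have "d > 0" using that n by (auto intro: Nat.gr0I)
  then have "{..<d} = insert 0 {1..<d}" by auto
  then show ?thesis by (simp add: S0)
 qed
 have "complex_of_real (T - real N * (\<Sum>d | d dvd n. g d)) =
   (\<Sum>d | d dvd n. of_real (g d) * (- of_nat c + (\<Sum>i\<in>{1..<d}. S (i * (n div d)))))"
 proof -
  have "complex_of_real (T - real N * (\<Sum>d | d dvd n. g d)) = complex_of_real T - (\<Sum>d | d dvd n. of_nat N * of_real (g d))"
   by (simp add: sum_distrib_left)
  then show ?thesis unfolding T sum_subtractf[symmetric]
   by (simp only:) (rule sum.cong[OF refl], simp only: mem_Collect_eq split, simp add: algebra_simps)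
 qed
 then have "norm (complex_of_real (T - real N * (\<Sum>d | d dvd n. g d))) \<le>
   (\<Sum>d | d dvd n. \<bar>g d\<bar> * (real c + (\<Sum>i\<in>{1..<d}. norm (S (i * (n div d))))))"
 proof (simp only:, intro order_trans[OF norm_sum] sum_mono)
  fix d
  have "norm (- of_nat c + (\<Sum>i\<in>{1..<d}. S (i * (n div d)))) \<le> real c + (\<Sum>i\<in>{1..<d}. norm (S (i * (n div d))))"
   by (rule order_trans[OF norm_triangle_ineq]) (simp add: norm_sum)
  then show "norm (of_real (g d) * (- of_nat c + (\<Sum>i\<in>{1..<d}. S (i * (n div d))))) \<le> \<bar>g d\<bar> * (real c + (\<Sum>i\<in>{1..<d}. norm (S (i * (n div d)))))"
   unfolding norm_mult norm_of_real by (rule mult_left_mono) simp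
 qed
 then have "\<bar>T - real N * (\<Sum>d | d dvd n. g d)\<bar> / real N \<le> (\<Sum>d | d dvd n. \<bar>g d\<bar> * (real c + (\<Sum>i\<in>{1..<d}. norm (S (i * (n div d)))))) / real N"
  unfolding norm_of_real using N0 by (intro divide_right_mono) auto
 also have "\<dots> = (\<Sum>d | d dvd n. \<bar>g d\<bar> * (real c / real N + (\<Sum>i\<in>{1..<d}. y (i * (n div d)))))"
  by (simp only: y_def sum_divide_distrib[symmetric] add_divide_distrib[symmetric] times_divide_eq_right)
 also have "\<dots> \<le> (\<Sum>d | d dvd n. \<bar>g d\<bar> / real p + 1 / V + \<bar>g d\<bar> * (V ^ (2 * r - 1) * Y))"
 proof (rule sum_mono)
  fix d assume "d \<in> {d. d dvd n}"
  then have d: "d dvd n" by simp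
  then have d0: "d > 0" using n by (auto intro: Nat.gr0I)
  define m where "m = n div d"
  have m: "n = m * d" "m > 0" using d n d0 by (auto simp: m_def)
  \<comment> \<open>Either \<open>t\<close> is at most \<open>1 / V\<close>, or
    \<open>V * t \<ge> 1\<close> and multiplying \<open>t\<close> by
    \<open>(V * t) ^ (2 * r - 1)\<close> only enlarges it.\<close>
  have pw: "t \<le> 1 / V + V ^ (2 * r - 1) * t ^ (2 * r)" if "t \<ge> 0" for t
  proof (cases "t \<le> 1 / V")
   case True
   moreover have "0 \<le> V ^ (2 * r - 1) * t ^ (2 * r)" using V that by simp
   ultimately show ?thesis by linarith
  next
   case False
   then have "1 \<le> V * t" using V by (simp add: field_simps)
   then have "1 \<le> (V * t) ^ (2 * r - 1)" by (rule one_le_power)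
   then have "1 * t \<le> (V * t) ^ (2 * r - 1) * t" using that by (intro mult_right_mono)
   also have "\<dots> = V ^ (2 * r - 1) * (t ^ (2 * r - 1) * t)" by (simp add: power_mult_distrib)
   also have "t ^ (2 * r - 1) * t = t ^ (2 * r)" using r by (cases r) auto
   finally show ?thesis using V by (simp add: add_increasing)
  qed
  have "(\<Sum>i\<in>{1..<d}. y (i * m)) \<le> (\<Sum>i\<in>{1..<d}. 1 / V + V ^ (2 * r - 1) * y (i * m) ^ (2 * r))"
   by (intro sum_mono pw y0)
  also have "\<dots> = real (d - 1) / V + V ^ (2 * r - 1) * (\<Sum>i\<in>{1..<d}. y (i * m) ^ (2 * r))"
   by (simp add: sum.distrib sum_distrib_left)
  also have "\<dots> \<le> real d / V + V ^ (2 * r - 1) * Y"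
  proof (intro add_mono mult_left_mono divide_right_mono)
   \<comment> \<open>The indices \<open>i * m\<close> are distinct and lie in
     \<open>{1..<n}\<close>, so the characters belonging to one divisor are covered by the sum
     \<open>Y\<close> over all nonprincipal ones.\<close>
   have inj: "inj_on (\<lambda>i. i * m) {1..<d}" using m(2) by (intro inj_onI) simp
   have "(\<Sum>i\<in>{1..<d}. y (i * m) ^ (2 * r)) = (\<Sum>j\<in>(\<lambda>i. i * m) ` {1..<d}. y j ^ (2 * r))"
    by (simp only: sum.reindex[OF inj] o_def)
   also have "\<dots> \<le> Y" unfolding Y_def using m y0 by (intro sum_mono2) (auto simp: Suc_le_eq mult.commute)
   finally show "(\<Sum>i\<in>{1..<d}. y (i * m) ^ (2 * r)) \<le> Y" .
  qed (use V in auto)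
  finally have s: "(\<Sum>i\<in>{1..<d}. y (i * m)) \<le> real d / V + V ^ (2 * r - 1) * Y" .
  have "\<bar>g d\<bar> * (real c / real N + (\<Sum>i\<in>{1..<d}. y (i * (n div d)))) \<le> \<bar>g d\<bar> * (1 / real p + (real d / V + V ^ (2 * r - 1) * Y))"
   using s cN unfolding m_def by (intro mult_left_mono add_mono) auto
  also have "\<dots> = \<bar>g d\<bar> / real p + (\<bar>g d\<bar> * real d) / V + \<bar>g d\<bar> * (V ^ (2 * r - 1) * Y)" by (simp add: distrib_left)
  also have "(\<bar>g d\<bar> * real d) / V \<le> 1 / V"
   using gb[of d] d0 V by (intro divide_right_mono) (auto simp: field_simps)
  finally show "\<bar>g d\<bar> * (real c / real N + (\<Sum>i\<in>{1..<d}. y (i * (n div d)))) \<le> \<bar>g d\<bar> / real p + 1 / V + \<bar>g d\<bar> * (V ^ (2 * r - 1) * Y)" by simp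
 qed
 also have "\<dots> = (\<Sum>d | d dvd n. \<bar>g d\<bar>) / real p + real (card {d. d dvd n}) / V + (\<Sum>d | d dvd n. \<bar>g d\<bar>) * (V ^ (2 * r - 1) * Y)"
  by (simp add: sum.distrib sum_divide_distrib sum_distrib_right)
 also have "\<dots> \<le> (1 + ln (real p)) / real p + real (card {d. d dvd n}) / V + (1 + ln (real p)) * (V ^ (2 * r - 1) * Y)"
  using gs V Y0 by (intro add_mono mult_right_mono divide_right_mono) auto
 finally have "\<bar>T - real N * (\<Sum>d | d dvd n. g d)\<bar> / real N \<le> \<dots>" .
 moreover have "\<bar>T - real N * (\<Sum>d | d dvd n. g d)\<bar> / real N = \<bar>(1 / real N) * T - (\<Sum>d | d dvd n. g d)\<bar>"
 proof -
  have "\<bar>T - real N * (\<Sum>d | d dvd n. g d)\<bar> / real N = \<bar>(T - real N * (\<Sum>d | d dvd n. g d)) / real N\<bar>" by simp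
  also have "(T - real N * (\<Sum>d | d dvd n. g d)) / real N = (1 / real N) * T - (\<Sum>d | d dvd n. g d)"
   using N0 by (simp add: diff_divide_distrib)
  finally show ?thesis .
 qed
 ultimately show ?thesis unfolding T_def Y_def y_def S_def g_def n_def by (simp only: mult.assoc)
qed

end

section \<open>Moments of character sums\<close>

lemma dvd_prod_decomp:
 fixes b :: "nat \<Rightarrow> nat"
 assumes "a dvd (\<Prod>j<s. b j)"
 obtains d where "a = (\<Prod>j<s. d j)" "\<And>j. j < s \<Longrightarrow> d j dvd b j"
proof -
 have "\<exists>d. a = (\<Prod>j<s. d j) \<and> (\<forall>j<s. d j dvd b j)" using assms
 proof (induction s arbitrary: a)
  case (Suc s)
  have "a dvd (\<Prod>j<s. b j) * b s" using Suc.prems by (simp add: mult.commute)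
  then obtain u v where uv: "a = u * v" "u dvd (\<Prod>j<s. b j)" "v dvd b s" using division_decomp by blast
  then obtain d where d: "u = (\<Prod>j<s. d j)" "\<forall>j<s. d j dvd b j" using Suc.IH by blast
  show ?case
   by (rule exI[of _ "d(s := v)"]) (use uv d in \<open>auto simp: less_Suc_eq\<close>)
 qed simp
 then show thesis using that by blast
qed

text \<open>Two factorisations of one number fit into a matrix with the row products
  \<open>a i\<close> and the column products \<open>b j\<close>. The last row is obtained by
  distributing \<open>a r\<close> over the factors \<open>b j\<close>; dividing it out leaves a
  smaller instance.\<close>

lemma common_refinement:
 fixes a b :: "nat \<Rightarrow> nat"
 assumes "\<And>j. j < s \<Longrightarrow> b j > 0" "(\<Prod>i<r. a i) = (\<Prod>j<s. b j)"
 shows "\<exists>c. (\<forall>i<r. a i = (\<Prod>j<s. c i j)) \<and> (\<forall>j<s. b j = (\<Prod>i<r. c i j))"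
 using assms
proof (induction r arbitrary: b)
 case 0
 then have "\<forall>j<s. b j = 1" by (metis (no_types, lifting) finite_lessThan lessThan_iff lessThan_0 prod.empty prod_eq_1_iff)
 then show ?case by simp
next
 case (Suc r)
 have "a r dvd (\<Prod>j<s. b j)" unfolding Suc.prems(2)[symmetric] by simp
 then obtain d where d: "a r = (\<Prod>j<s. d j)" "\<And>j. j < s \<Longrightarrow> d j dvd b j" by (rule dvd_prod_decomp) blast
 define b' where "b' j = b j div d j" for j
 have bb: "b j = b' j * d j" if "j < s" for j using d(2)[OF that] by (simp add: b'_def)
 have b'0: "b' j > 0" "d j > 0" if "j < s" for j using bb[OF that] Suc.prems(1)[OF that] by (auto intro: Nat.gr0I)
 have "(\<Prod>i<r. a i) * a r = (\<Prod>j<s. b' j) * a r"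
 proof -
  have "(\<Prod>i<r. a i) * a r = (\<Prod>j<s. b j)" using Suc.prems(2) by (simp add: mult.commute)
  also have "\<dots> = (\<Prod>j<s. b' j * d j)" using bb by (intro prod.cong) auto
  finally show ?thesis by (simp add: prod.distrib d(1))
 qed
 moreover have "a r > 0" unfolding d(1) using b'0(2) by (simp add: prod_pos)
 ultimately have "(\<Prod>i<r. a i) = (\<Prod>j<s. b' j)" by simp
 from Suc.IH[OF b'0(1) this] obtain c where c: "\<forall>i<r. a i = (\<Prod>j<s. c i j)" "\<forall>j<s. b' j = (\<Prod>i<r. c i j)" by blast
 have "b j = (\<Prod>i<Suc r. (c(r := d)) i j)" if "j < s" for j
 proof -
  have "(\<Prod>i<Suc r. (c(r := d)) i j) = (\<Prod>i<r. c i j) * d j" by (simp add: mult.commute)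
  then show ?thesis using bb[OF that] c(2) that by simp
 qed
 moreover have "a i = (\<Prod>j<s. (c(r := d)) i j)" if "i < Suc r" for i
  using that c(1) d(1) by (auto simp: less_Suc_eq)
 ultimately show ?case by (intro exI[of _ "c(r := d)"]) auto
qed

text \<open>Extensional functions, so that the set is finite and two tuples are equal as soon as
  their entries below \<open>r\<close> agree.\<close>

definition tuples :: "nat \<Rightarrow> nat \<Rightarrow> (nat \<Rightarrow> nat) set" where
 "tuples r N = ({..<r} \<rightarrow>\<^sub>E {1..N})"

definition tprod :: "nat \<Rightarrow> (nat \<Rightarrow> nat) \<Rightarrow> nat" where
 "tprod r f = (\<Prod>i<r. f i)"

definition mult_energy :: "nat \<Rightarrow> nat \<Rightarrow> nat" where
 "mult_energy r N = card {(f, g). f \<in> tuples r N \<and> g \<in> tuples r N \<and> tprod r f = tprod r g}"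

lemma finite_tuples [simp]: "finite (tuples r N)"
 unfolding tuples_def by (intro finite_PiE) auto

lemma finite_energy_set: "finite {(f, g). f \<in> tuples r N \<and> g \<in> tuples r N \<and> tprod r f = tprod r g}"
 by (rule finite_subset[of _ "tuples r N \<times> tuples r N"]) auto

lemma tuples_bounds: "f \<in> tuples r N \<Longrightarrow> i < r \<Longrightarrow> 1 \<le> f i \<and> f i \<le> N"
 unfolding tuples_def by (auto dest!: PiE_mem)

lemma tuples_eqI: "f \<in> tuples r N \<Longrightarrow> g \<in> tuples r N \<Longrightarrow> (\<And>i. i < r \<Longrightarrow> f i = g i) \<Longrightarrow> f = g"
 unfolding tuples_def by (rule PiE_ext) auto

lemma tprod_bounds: "f \<in> tuples r N \<Longrightarrow> 1 \<le> tprod r f \<and> tprod r f \<le> N ^ r"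
proof -
 assume f: "f \<in> tuples r N"
 have "tprod r f \<le> (\<Prod>i<r. N)" unfolding tprod_def using tuples_bounds[OF f] by (intro prod_mono) auto
 moreover have "0 < tprod r f" unfolding tprod_def using tuples_bounds[OF f] by (intro prod_pos) force
 ultimately show ?thesis by simp
qed

lemma mult_energy_1: "mult_energy 1 N \<le> N"
proof -
 have "mult_energy 1 N \<le> card {1..N}" unfolding mult_energy_def
 proof (rule card_inj_on_le[of "\<lambda>(f, g). f 0"])
  show "inj_on (\<lambda>(f, g). f 0) {(f, g). f \<in> tuples 1 N \<and> g \<in> tuples 1 N \<and> tprod 1 f = tprod 1 g}"
   by (rule inj_onI) (auto simp: tprod_def intro!: tuples_eqI[of _ 1 N])
 qed (use tuples_bounds[of _ 1 N 0] in auto)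
 then show ?thesis by simp
qed

text \<open>Rankin's trick. A solution is recovered from an \<open>r\<close> by \<open>r\<close>
  matrix of common factors whose entries multiply to \<open>P \<le> N ^ r\<close>. Weighting each
  matrix by \<open>(N ^ r / P) powr \<sigma> \<ge> 1\<close> and then admitting all matrices with
  entries up to \<open>N\<close> makes the sum factor.\<close>

lemma mult_energy_le:
 assumes \<sigma>: "\<sigma> > 0" and N: "N \<ge> 1"
 shows "real (mult_energy r N) \<le> real N powr (real r * \<sigma>) * (\<Sum>c\<in>{1..N}. real c powr (-\<sigma>)) ^ (r * r)"
proof -
 define E where "E = {(f, g). f \<in> tuples r N \<and> g \<in> tuples r N \<and> tprod r f = tprod r g}"
 define I where "I = {..<r} \<times> {..<r}"
 define C where "C = (I \<rightarrow>\<^sub>E {1..N})"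
 have fI: "finite I" by (simp add: I_def)
 have "\<forall>z\<in>E. \<exists>c\<in>C. (\<forall>i<r. fst z i = (\<Prod>j<r. c (i, j))) \<and> (\<forall>j<r. snd z j = (\<Prod>i<r. c (i, j)))"
 proof
  fix z assume "z \<in> E"
  then obtain f g where z: "z = (f, g)" and f: "f \<in> tuples r N" and g: "g \<in> tuples r N" and e: "tprod r f = tprod r g"
   by (auto simp: E_def)
  have "\<exists>c. (\<forall>i<r. f i = (\<Prod>j<r. c i j)) \<and> (\<forall>j<r. g j = (\<Prod>i<r. c i j))"
   by (rule common_refinement) (use tuples_bounds[OF g] e in \<open>force simp: tprod_def\<close>)+
  then obtain c where c: "\<And>i. i < r \<Longrightarrow> f i = (\<Prod>j<r. c i j)" "\<And>j. j < r \<Longrightarrow> g j = (\<Prod>i<r. c i j)" by blast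
  have cb: "1 \<le> c i j \<and> c i j \<le> N" if "i < r" "j < r" for i j
  proof -
   have "c i j dvd f i" unfolding c(1)[OF that(1)] using that by (intro dvd_prodI) auto
   then show ?thesis using tuples_bounds[OF f that(1)] dvd_imp_le[of "c i j" "f i"] by (cases "c i j = 0") auto
  qed
  define c' where "c' = restrict (\<lambda>(i, j). c i j) I"
  have "c' \<in> C" unfolding C_def c'_def I_def using cb by auto
  then show "\<exists>c\<in>C. (\<forall>i<r. fst z i = (\<Prod>j<r. c (i, j))) \<and> (\<forall>j<r. snd z j = (\<Prod>i<r. c (i, j)))"
   using c by (intro bexI[of _ c']) (auto simp: z c'_def I_def)
 qed
 then obtain h where h: "\<And>z. z \<in> E \<Longrightarrow> h z \<in> C" "\<And>z i. z \<in> E \<Longrightarrow> i < r \<Longrightarrow> fst z i = (\<Prod>j<r. h z (i, j))"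
  "\<And>z j. z \<in> E \<Longrightarrow> j < r \<Longrightarrow> snd z j = (\<Prod>i<r. h z (i, j))" by metis
 have inj: "inj_on h E"
 proof (rule inj_onI)
  fix z w assume zw: "z \<in> E" "w \<in> E" "h z = h w"
  have "fst z = fst w" by (rule tuples_eqI[of _ r N]) (use zw h(2)[of z] h(2)[of w] in \<open>auto simp: E_def\<close>)
  moreover have "snd z = snd w" by (rule tuples_eqI[of _ r N]) (use zw h(3)[of z] h(3)[of w] in \<open>auto simp: E_def\<close>)
  ultimately show "z = w" by (rule prod_eqI)
 qed
 have "real (mult_energy r N) = (\<Sum>z\<in>E. 1)" by (simp add: mult_energy_def E_def)
 also have "\<dots> \<le> (\<Sum>z\<in>E. real N powr (real r * \<sigma>) * (\<Prod>u\<in>I. real (h z u) powr (-\<sigma>)))"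
 proof (rule sum_mono)
  fix z assume z: "z \<in> E"
  have f: "fst z \<in> tuples r N" using z by (auto simp: E_def)
  define P where "P = tprod r (fst z)"
  have P: "1 \<le> real P" "real P \<le> real N ^ r" using tprod_bounds[OF f] unfolding P_def by (simp_all flip: of_nat_power)
  have "P = (\<Prod>i<r. \<Prod>j<r. h z (i, j))" unfolding P_def tprod_def using h(2)[OF z] by (intro prod.cong) auto
  also have "\<dots> = (\<Prod>u\<in>I. h z u)" unfolding I_def by (simp add: prod.cartesian_product case_prod_beta)
  finally have "(\<Prod>u\<in>I. real (h z u) powr (-\<sigma>)) = real P powr (-\<sigma>)" by (simp add: prod_powr_distrib)
  moreover have "real N powr (real r * \<sigma>) = (real N ^ r) powr \<sigma>" using N by (simp add: powr_powr[symmetric] powr_realpow)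
  moreover have "real P powr \<sigma> \<le> (real N ^ r) powr \<sigma>" using P \<sigma> by (intro powr_mono2) auto
  moreover have "real P powr \<sigma> * real P powr (-\<sigma>) = 1" using P by (simp flip: powr_add)
  ultimately show "1 \<le> real N powr (real r * \<sigma>) * (\<Prod>u\<in>I. real (h z u) powr (-\<sigma>))"
   by (metis mult_right_mono powr_ge_zero)
 qed
 also have "\<dots> = real N powr (real r * \<sigma>) * (\<Sum>c\<in>h ` E. \<Prod>u\<in>I. real (c u) powr (-\<sigma>))"
  by (simp only: sum_distrib_left[symmetric] sum.reindex[OF inj] o_def)
 also have "\<dots> \<le> real N powr (real r * \<sigma>) * (\<Sum>c\<in>C. \<Prod>u\<in>I. real (c u) powr (-\<sigma>))"
  using h(1) fI by (intro mult_left_mono sum_mono2) (auto simp: C_def intro!: finite_PiE prod_nonneg)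
 also have "(\<Sum>c\<in>C. \<Prod>u\<in>I. real (c u) powr (-\<sigma>)) = (\<Prod>u\<in>I. \<Sum>c\<in>{1..N}. real c powr (-\<sigma>))"
  unfolding C_def by (rule prod_sum_PiE[symmetric]) (use fI in auto)
 also have "\<dots> = (\<Sum>c\<in>{1..N}. real c powr (-\<sigma>)) ^ (r * r)" by (simp add: I_def)
 finally show ?thesis .
qed

text \<open>The choice \<open>\<sigma> = 23/20\<close> trades the loss
  \<open>N powr (3/20 * r)\<close> over the diagonal size \<open>N ^ r\<close> against the zeta sum,
  which is at most \<open>1 + 20/3 = 23/3\<close>.\<close>

lemma energy_bound: "N \<ge> 1 \<Longrightarrow> real (mult_energy r N) \<le> real N powr (23/20 * real r) * (23/3) ^ (r * r)"
proof -
 assume N: "N \<ge> 1"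
 have s: "summable (\<lambda>n. real (Suc (n + 1)) powr (- (3/20) - 1))" "(\<Sum>n. real (Suc (n + 1)) powr (- (3/20) - 1)) \<le> 20/3"
  using tail_sum[of "3/20" 1] by simp_all
 have "{1..N} = insert 1 {2..N}" using N by auto
 then have "(\<Sum>c\<in>{1..N}. real c powr (- (23/20))) = 1 + (\<Sum>c\<in>{2..N}. real c powr (- (23/20)))" by simp
 also have "(\<Sum>c\<in>{2..N}. real c powr (- (23/20))) = (\<Sum>n<N - 1. real (Suc (n + 1)) powr (- (3/20) - 1))"
  by (rule sum.reindex_bij_witness[of _ "\<lambda>n. n + 2" "\<lambda>c. c - 2"]) (auto simp: numeral_2_eq_2)
 also have "\<dots> \<le> 20/3" using sum_le_suminf[OF s(1), of "{..<N - 1}"] s(2) by simp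
 finally have z: "(\<Sum>c\<in>{1..N}. real c powr (- (23/20))) \<le> 23/3" by simp
 have "real (mult_energy r N) \<le> real N powr (real r * (23/20)) * (\<Sum>c\<in>{1..N}. real c powr (- (23/20))) ^ (r * r)"
  by (rule mult_energy_le[OF _ N]) simp
 also have "\<dots> \<le> real N powr (real r * (23/20)) * (23/3) ^ (r * r)"
  using z by (intro mult_left_mono power_mono sum_nonneg) auto
 finally show ?thesis by (simp add: mult.commute)
qed

text \<open>The \<open>r\<close>-th power of a character sum is a sum of length
  \<open>N ^ r\<close>, weighted by the number \<open>T n\<close> of ways to write \<open>n\<close>
  as an ordered product of \<open>r\<close> factors up to \<open>N\<close>. Its mean square falls to
  the large sieve, and the squares of \<open>T n\<close> add up to the multiplicative
  energy.\<close>

theorem moment_bound: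
 assumes x: "x \<ge> 1"
 shows "(\<Sum>p\<in>primes_upto x. \<Sum>j\<in>{1..<p - 1}. norm (\<Sum>a\<in>{1..N}. pchar p j a) ^ (2 * r))
  \<le> (real N ^ r + 4 * x ^ 2 * (1 + 2 * ln x)) * real (mult_energy r N)"
proof -
 define T where "T n = real (card {f \<in> tuples r N. tprod r f = n})" for n
 have img: "tprod r ` tuples r N \<subseteq> {1..N ^ r}" using tprod_bounds by auto
 have pw: "(\<Sum>a\<in>{1..N}. pchar p j a) ^ r = (\<Sum>n\<in>{1..N ^ r}. of_real (T n) * pchar p j n)" if p: "prime p" for p j
 proof -
  have "(\<Sum>a\<in>{1..N}. pchar p j a) ^ r = (\<Prod>i<r. \<Sum>a\<in>{1..N}. pchar p j a)" by simp
  also have "\<dots> = (\<Sum>f\<in>tuples r N. \<Prod>i<r. pchar p j (f i))" unfolding tuples_def by (rule prod_sum_PiE) auto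
  also have "\<dots> = (\<Sum>f\<in>tuples r N. pchar p j (tprod r f))" unfolding tprod_def by (simp add: pchar_prod[OF p])
  also have "\<dots> = (\<Sum>n\<in>{1..N ^ r}. \<Sum>f | f \<in> tuples r N \<and> tprod r f = n. pchar p j (tprod r f))"
   by (rule sum.group[symmetric]) (use img in auto)
  also have "\<dots> = (\<Sum>n\<in>{1..N ^ r}. of_real (T n) * pchar p j n)" by (intro sum.cong refl) (simp add: T_def)
  finally show ?thesis .
 qed
 have TT: "(\<Sum>n\<in>{1..N ^ r}. T n ^ 2) = real (mult_energy r N)"
 proof -
  define E where "E = {(f, g). f \<in> tuples r N \<and> g \<in> tuples r N \<and> tprod r f = tprod r g}"
  have "real (mult_energy r N) = (\<Sum>z\<in>E. 1)" by (simp add: mult_energy_def E_def)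
  also have "\<dots> = (\<Sum>n\<in>{1..N ^ r}. \<Sum>z | z \<in> E \<and> tprod r (fst z) = n. 1)"
   by (rule sum.group[symmetric]) (use img finite_energy_set in \<open>auto simp: E_def\<close>)
  also have "\<dots> = (\<Sum>n\<in>{1..N ^ r}. T n ^ 2)"
  proof (rule sum.cong[OF refl])
   fix n
   define F where "F = {f \<in> tuples r N. tprod r f = n}"
   have "{z. z \<in> E \<and> tprod r (fst z) = n} = F \<times> F" by (auto simp: E_def F_def)
   then show "(\<Sum>z | z \<in> E \<and> tprod r (fst z) = n. 1) = T n ^ 2"
    by (simp add: T_def F_def[symmetric] card_cartesian_product power2_eq_square)
  qed
  finally show ?thesis ..
 qed
 have "(\<Sum>p\<in>primes_upto x. \<Sum>j\<in>{1..<p - 1}. norm (\<Sum>a\<in>{1..N}. pchar p j a) ^ (2 * r))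
   = (\<Sum>p\<in>primes_upto x. \<Sum>j\<in>{1..<p - 1}. norm (\<Sum>n\<in>{1..N ^ r}. of_real (T n) * pchar p j n) ^ 2)"
 proof (intro sum.cong refl)
  fix p j assume "p \<in> primes_upto x"
  then have p: "prime p" by (simp add: primes_upto_def)
  have "norm (\<Sum>a\<in>{1..N}. pchar p j a) ^ (2 * r) = norm ((\<Sum>a\<in>{1..N}. pchar p j a) ^ r) ^ 2"
   by (simp add: norm_power power_mult[symmetric] mult.commute)
  then show "norm (\<Sum>a\<in>{1..N}. pchar p j a) ^ (2 * r) = norm (\<Sum>n\<in>{1..N ^ r}. of_real (T n) * pchar p j n) ^ 2"
   by (simp only: pw[OF p])
 qed
 also have "\<dots> \<le> (\<Sum>p\<in>primes_upto x. \<Sum>k\<in>{1..<p}. norm (\<Sum>n\<in>{1..N ^ r}. of_real (T n) * unit_exp n (real k / real p)) ^ 2)"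
  by (intro sum_mono pchar_sums_le_exp_sums) (simp add: primes_upto_def)
 also have "\<dots> \<le> (real (N ^ r) + 4 * x ^ 2 * (1 + 2 * ln x)) * (\<Sum>n\<in>{1..N ^ r}. norm (complex_of_real (T n)) ^ 2)"
  by (rule large_sieve_primes[OF x])
 finally show ?thesis using TT by simp
qed

section \<open>Choice of the moment exponent\<close>

abbreviation moment_ratio :: "real \<Rightarrow> real \<Rightarrow> nat \<Rightarrow> nat \<Rightarrow> real" where
 "moment_ratio x L N r \<equiv> (real N ^ r + 4 * x ^ 2 * (1 + 2 * L)) * real (mult_energy r N) / real N ^ (2 * r)"

text \<open>\<open>1023/500\<close> is a rational upper bound for the logarithm of
  \<open>23/3\<close>; a quadratic Taylor polynomial at one twentieth of it, raised to the power 20,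
  is precise enough.\<close>

lemma exp_lower: "23/3 \<le> exp (1023/500::real)"
proof -
 have "(443/400::real) \<le> exp (1023 / 10000)"
  using exp_lower_Taylor_quadratic[of "1023 / 10000 :: real"] by (simp add: power2_eq_square)
 then have "(443/400::real) ^ 20 \<le> exp (1023 / 10000) ^ 20" by (intro power_mono) auto
 also have "\<dots> = exp (1023/500::real)" by (simp flip: exp_of_nat_mult)
 finally have "(443/400::real) ^ 20 \<le> exp (1023/500)" .
 moreover have "(23/3::real) \<le> (443/400) ^ 20" by (simp add: field_simps)
 ultimately show ?thesis by linarith
qed

text \<open>Divided by \<open>L\<close> every term tends to 0, except \<open>s\<close> and the
  leading part \<open>1023/500 * b ^ 2\<close> of the square.\<close>

lemma exponent_asymp:
 fixes b c D s w :: real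
 assumes "1023/500 * b ^ 2 + s < 1"
 shows "eventually (\<lambda>L. ln ((1 + L) * (5 + 8 * L)) + c * ln L * (b * sqrt L + 1) + (s * L + w * sqrt L)
   + 1023/500 * (b * sqrt L + 1) ^ 2 \<le> L - D * ln L) at_top"
proof -
 have 1: "((\<lambda>L. ln ((1 + L) * (5 + 8 * L)) / L + (c + D) * (ln L / L) + c * b * (ln L * sqrt L / L)
   + (w + 1023/250 * b) * (sqrt L / L) + 1023/500 * (1 / L))
  \<longlongrightarrow> 0 + (c + D) * 0 + c * b * 0 + (w + 1023/250 * b) * 0 + 1023/500 * 0) at_top"
  by (intro tendsto_intros) real_asymp+
 have "eventually (\<lambda>L. ln ((1 + L) * (5 + 8 * L)) / L + (c + D) * (ln L / L) + c * b * (ln L * sqrt L / L)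
   + (w + 1023/250 * b) * (sqrt L / L) + 1023/500 * (1 / L) < 1 - (1023/500 * b ^ 2 + s)) at_top"
  by (rule order_tendstoD(2)[OF 1]) (use assms in simp)
 then show ?thesis using eventually_gt_at_top[of 0]
 proof eventually_elim
  case (elim L)
  have *: "(ln ((1 + L) * (5 + 8 * L)) / L + (c + D) * (ln L / L) + c * b * (ln L * sqrt L / L)
   + (w + 1023/250 * b) * (sqrt L / L) + 1023/500 * (1 / L)) * L \<le> (1 - (1023/500 * b ^ 2 + s)) * L"
   using elim by (intro mult_right_mono) auto
  have "ln ((1 + L) * (5 + 8 * L)) + (c + D) * ln L + c * b * (ln L * sqrt L)
   + (w + 1023/250 * b) * sqrt L + 1023/500 \<le> (1 - (1023/500 * b ^ 2 + s)) * L"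
  proof -
   have "z / L * L = z" for z using elim(2) by simp
   with * show ?thesis by (simp only: distrib_right mult.assoc)
  qed
  moreover have "(b * sqrt L + 1) ^ 2 = b ^ 2 * L + 2 * b * sqrt L + 1"
   using elim(2) by (simp add: power2_sum power_mult_distrib)
  ultimately show ?case by (simp add: algebra_simps add_divide_distrib)
 qed
qed

text \<open>The exponent of \<open>x\<close> is at most \<open>0.3 + 2.046 (2 / 3.42)\<^sup>2 < 0.9998\<close>, attained for the smallest
 admissible \<open>N\<close>; this is where the constant \<open>3.42\<close> enters.\<close>

lemma exponent_bound:
 fixes D :: nat
 shows "eventually (\<lambda>L. \<forall>l q. 3.42 * sqrt L \<le> l \<and> l \<le> 2 * L \<and> 0 \<le> q \<and> q \<le> 2 * L / l + 1 \<longrightarrow>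
  ln ((1 + L) * (5 + 8 * L)) + 2 * real (D + 1) * ln L * q + 3/20 * q * l + 1023/500 * q ^ 2 \<le> L - real D * ln L) at_top"
proof -
 define c where "c = 2 * real (D + 1)"
 have c: "c \<ge> 0" by (simp add: c_def)
 \<comment> \<open>\<open>731/1250\<close> lies just above \<open>2 / 3.42\<close>, the coefficient
   of \<open>sqrt L\<close> in the bound for \<open>q\<close> at the smallest
   \<open>l\<close>.\<close>
 have "eventually (\<lambda>L. ln ((1 + L) * (5 + 8 * L)) + c * ln L * (731/1250 * sqrt L + 1) + (3/10 * L + 3/5 * sqrt L)
   + 1023/500 * (731/1250 * sqrt L + 1) ^ 2 \<le> L - real D * ln L) at_top"
  by (rule exponent_asymp) (simp add: power2_eq_square)
 moreover have "eventually (\<lambda>L. ln ((1 + L) * (5 + 8 * L)) + c * ln L * (1/2 * sqrt L + 1) + (9/20 * L + 0 * sqrt L)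
   + 1023/500 * (1/2 * sqrt L + 1) ^ 2 \<le> L - real D * ln L) at_top"
  by (rule exponent_asymp) (simp add: power2_eq_square)
 moreover have "eventually (\<lambda>L. ln ((1 + L) * (5 + 8 * L)) + c * ln L * 3 + 3/5 * L + 1023/500 * 3 ^ 2 \<le> L - real D * ln L) at_top"
  by real_asymp
 ultimately show ?thesis using eventually_gt_at_top[of 1]
 proof eventually_elim
  case (elim L)
  have L: "L > 1" "ln L > 0" "sqrt L > 0" using elim(4) by simp_all
  show ?case
  proof (intro allI impI)
   fix l q assume A: "3.42 * sqrt L \<le> l \<and> l \<le> 2 * L \<and> 0 \<le> q \<and> q \<le> 2 * L / l + 1"
   have "0 < 3.42 * sqrt L" using L(3) by simp
   then have l: "l > 0" using A by linarith
   have ql: "q * l \<le> 2 * L + l"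
   proof -
    have "q * l \<le> (2 * L / l + 1) * l" using A l by (intro mult_right_mono) auto
    then show ?thesis using l by (simp add: distrib_right)
   qed
   have gen: "ln ((1 + L) * (5 + 8 * L)) + c * ln L * q + 3/20 * q * l + 1023/500 * q ^ 2
    \<le> ln ((1 + L) * (5 + 8 * L)) + c * ln L * Q + 3/20 * W + 1023/500 * Q ^ 2" if "q \<le> Q" "q * l \<le> W" for Q W
   proof -
    have "c * ln L * q \<le> c * ln L * Q" using that c L by (intro mult_left_mono) auto
    moreover have "q ^ 2 \<le> Q ^ 2" using that A by (intro power_mono) auto
    ultimately show ?thesis using that(2) by (simp add: mult.assoc)
   qed
   have "ln ((1 + L) * (5 + 8 * L)) + c * ln L * q + 3/20 * q * l + 1023/500 * q ^ 2 \<le> L - real D * ln L"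
   proof -
    \<comment> \<open>For small \<open>l\<close> the quadratic term in \<open>q\<close> dominates
      and \<open>q * l\<close> must be kept close to \<open>2 * L\<close>. From
      \<open>4 * sqrt L\<close> on, the smaller \<open>q\<close> leaves room for the weaker
      \<open>q * l \<le> 3 * L\<close>, and from \<open>L\<close> on \<open>q\<close> is at most
      3.\<close>
    consider "l \<le> 4 * sqrt L" | "4 * sqrt L \<le> l" "l \<le> L" | "L \<le> l" by linarith
    then show ?thesis
    proof cases
     case 1
     have "2 * L / l \<le> 2 * L / (3.42 * sqrt L)" using A L l by (intro divide_left_mono) auto
     also have "\<dots> = 2 / 3.42 * (L / sqrt L)" by simp
     also have "\<dots> \<le> 731/1250 * sqrt L" using L by (simp add: real_div_sqrt)
     finally have "q \<le> 731/1250 * sqrt L + 1" using A by linarith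
     moreover have "q * l \<le> 2 * L + 4 * sqrt L" using 1 ql by linarith
     moreover have e: "3/20 * (2 * L + 4 * sqrt L) = 3/10 * L + 3/5 * sqrt L" by simp
     ultimately show ?thesis by (intro order_trans[OF gen[where W = "2 * L + 4 * sqrt L", unfolded e] elim(1)])
    next
     case 2
     have "2 * L / l \<le> 2 * L / (4 * sqrt L)" using 2 L l by (intro divide_left_mono) auto
     also have "\<dots> = 1 / 2 * sqrt L" using L by (simp add: real_div_sqrt)
     finally have "q \<le> 1 / 2 * sqrt L + 1" using A by linarith
     moreover have "q * l \<le> 3 * L" using 2 ql by linarith
     moreover have e: "3/20 * (3 * L) = 9/20 * L + 0 * sqrt L" by simp
     ultimately show ?thesis by (intro order_trans[OF gen[where W = "3 * L", unfolded e] elim(2)])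
    next
     case 3
     have "2 * L / l \<le> 2 * L / L" using 3 L l by (intro divide_left_mono) auto
     then have "q \<le> 3" using A L by simp
     moreover have "q * l \<le> 4 * L" using A ql by linarith
     moreover have e: "3/20 * (4 * L) = 3/5 * L" by simp
     ultimately show ?thesis by (intro order_trans[OF gen[where W = "4 * L", unfolded e] elim(3)])
    qed
   qed
   then show "ln ((1 + L) * (5 + 8 * L)) + 2 * real (D + 1) * ln L * q + 3/20 * q * l + 1023/500 * q ^ 2 \<le> L - real D * ln L"
    unfolding c_def .
  qed
 qed
qed

text \<open>Uniformity in \<open>N\<close> is the point: \<open>N\<close> enters only through
  \<open>l = ln N\<close>, over whose whole range up to \<open>2 * ln x\<close> the estimate
  \<open>exponent_bound\<close> is uniform. For \<open>N \<ge> x ^ 2\<close> the exponent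
  \<open>r = 1\<close> works with the trivial energy \<open>N\<close>.\<close>

lemma high_moment_small:
 fixes D :: nat
 shows "eventually (\<lambda>x. \<forall>N::nat. real N > exp (3.42 * sqrt (ln x)) \<longrightarrow> (\<exists>r\<ge>1.
  (1 + ln x) * ((ln x ^ (D + 1)) ^ (2 * r - 1) * (moment_ratio x (ln x) N r))
   \<le> x / ln x ^ D)) at_top"
proof -
 have "eventually (\<lambda>x::real. (1 + ln x) * (5 + 8 * ln x) * ln x ^ (D + 1) \<le> x / ln x ^ D) at_top" by real_asymp
 moreover note eventually_compose_filterlim[OF exponent_bound[of D] ln_at_top]
 moreover have "eventually (\<lambda>x::real. ln x \<ge> 1) at_top" by real_asymp
 ultimately show ?thesis using eventually_gt_at_top[of 1]
 proof eventually_elim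
  case (elim x)
  define L where "L = ln x"
  define V where "V = L ^ (D + 1)"
  have L: "L \<ge> 1" using elim(3) by (simp add: L_def)
  have x: "x > 1" by (rule elim(4))
  have xL: "x = exp L" using x by (simp add: L_def)
  have V: "V \<ge> 1" unfolding V_def using L by (rule one_le_power)
  show ?case unfolding L_def[symmetric] V_def[symmetric]
  proof (intro allI impI)
   fix N :: nat assume N: "real N > exp (3.42 * sqrt L)"
   define l where "l = ln (real N)"
   have N0: "real N > 0" by (rule less_trans[OF exp_gt_zero N])
   have N1: "N \<ge> 1" using N0 by simp
   have l1: "3.42 * sqrt L < l"
   proof -
    have "ln (exp (3.42 * sqrt L)) < ln (real N)" using N N0 by (subst ln_less_cancel_iff) auto
    then show ?thesis by (simp add: l_def)
   qed
   moreover have "0 < 3.42 * sqrt L" using L by simp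
   ultimately have l0: "l > 0" by linarith
   have Nl: "real N = exp l" using N0 by (simp add: l_def)
   \<comment> \<open>Once \<open>N ^ r\<close> dominates \<open>x ^ 2\<close>, the sieve factor
     costs only \<open>5 + 8 * L\<close> times \<open>N ^ r\<close>, and what remains is the ratio
     of the energy to its diagonal size.\<close>
   have red: "(real N ^ r + 4 * x ^ 2 * (1 + 2 * L)) * e / real N ^ (2 * r) \<le> (5 + 8 * L) * (e / real N ^ r)"
    if "x ^ 2 \<le> real N ^ r" "e \<ge> 0" for r e
   proof -
    have "4 * x ^ 2 * (1 + 2 * L) \<le> 4 * real N ^ r * (1 + 2 * L)" using that L by (intro mult_right_mono) auto
    then have "real N ^ r + 4 * x ^ 2 * (1 + 2 * L) \<le> (5 + 8 * L) * real N ^ r" by (simp add: algebra_simps)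
    then have "(real N ^ r + 4 * x ^ 2 * (1 + 2 * L)) * e / real N ^ (2 * r) \<le> (5 + 8 * L) * real N ^ r * e / real N ^ (2 * r)"
     using that N0 by (intro divide_right_mono mult_right_mono) auto
    also have "\<dots> = (5 + 8 * L) * (e / real N ^ r)" using N0 by (simp add: mult_2 power_add)
    finally show ?thesis .
   qed
   show "\<exists>r\<ge>1. (1 + L) * (V ^ (2 * r - 1) * (moment_ratio x L N r)) \<le> x / L ^ D"
   proof (cases "x ^ 2 \<le> real N")
    case True
    have "(1 + L) * (V ^ (2 * 1 - 1) * (moment_ratio x L N 1))
      \<le> (1 + L) * (V * (5 + 8 * L))"
    proof (intro mult_left_mono mult_mono)
     have "moment_ratio x L N 1 \<le> (5 + 8 * L) * (real (mult_energy 1 N) / real N ^ 1)"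
      by (rule red) (use True in auto)
     also have "\<dots> \<le> (5 + 8 * L) * 1"
      using mult_energy_1[of N] N0 L by (intro mult_left_mono) auto
     finally show "moment_ratio x L N 1 \<le> 5 + 8 * L" by simp
    qed (use L V N0 x in auto)
    also have "\<dots> \<le> x / L ^ D" using elim(1) by (simp add: L_def V_def mult_ac)
    finally show ?thesis by blast
   next
    case False
    then have "exp l < exp (2 * L)" unfolding Nl xL by (simp flip: exp_of_nat_mult)
    then have l2: "l < 2 * L" by simp
    define r where "r = nat \<lceil>2 * L / l\<rceil>"
    have "2 * L / l > 0" using L l0 by simp
    then have r: "2 * L / l \<le> real r" "real r \<le> 2 * L / l + 1" "r \<ge> 1" unfolding r_def by linarith+
    have "2 * L \<le> real r * l" using r(1) l0 by (simp add: pos_divide_le_eq)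
    then have "exp (2 * L) \<le> exp (real r * l)" by simp
    then have Nr: "x ^ 2 \<le> real N ^ r" unfolding Nl xL by (simp add: exp_of_nat_mult flip: exp_of_nat_mult[of 2, simplified])
    have en: "real (mult_energy r N) / real N ^ r \<le> exp (3/20 * real r * l + 1023/500 * real r ^ 2)"
    proof -
     have "real (mult_energy r N) \<le> real N powr (23/20 * real r) * (23/3) ^ (r * r)" by (rule energy_bound[OF N1])
     also have "\<dots> \<le> exp (23/20 * real r * l) * exp (1023/500) ^ (r * r)"
      using exp_lower N0 by (intro mult_mono power_mono) (auto simp: powr_def l_def)
     also have "\<dots> = exp (real r * l) * exp (3/20 * real r * l + 1023/500 * real r ^ 2)"
      by (simp add: exp_of_nat_mult[symmetric] exp_add[symmetric] power2_eq_square algebra_simps)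
     also have "exp (real r * l) = real N ^ r" unfolding Nl by (rule exp_of_nat_mult)
     finally show ?thesis using N0 by (simp add: pos_divide_le_eq mult.commute)
    qed
    have "(1 + L) * (V ^ (2 * r - 1) * (moment_ratio x L N r))
      \<le> (1 + L) * (V ^ (2 * r) * ((5 + 8 * L) * exp (3/20 * real r * l + 1023/500 * real r ^ 2)))"
    proof (intro mult_left_mono mult_mono)
     show "V ^ (2 * r - 1) \<le> V ^ (2 * r)" using V by (intro power_increasing) auto
     show "moment_ratio x L N r
       \<le> (5 + 8 * L) * exp (3/20 * real r * l + 1023/500 * real r ^ 2)"
      by (rule order_trans[OF red[OF Nr] mult_left_mono[OF en]]) (use L in auto)
    qed (use L V N0 x in auto)
    also have "\<dots> = exp (ln ((1 + L) * (5 + 8 * L)) + 2 * real (D + 1) * ln L * real r + 3/20 * real r * l + 1023/500 * real r ^ 2)"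
    proof -
     have "V ^ (2 * r) = L ^ (2 * (D + 1) * r)" unfolding V_def power_mult[symmetric] by (simp only: mult_ac)
     also have "\<dots> = exp (real (2 * (D + 1) * r) * ln L)" using L by (subst exp_of_nat_mult) simp
     also have "real (2 * (D + 1) * r) * ln L = 2 * real (D + 1) * ln L * real r" by (simp only: of_nat_mult of_nat_numeral mult_ac)
     finally have "V ^ (2 * r) = exp (2 * real (D + 1) * ln L * real r)" .
     moreover have "(1 + L) * (5 + 8 * L) = exp (ln ((1 + L) * (5 + 8 * L)))" using L by simp
     ultimately show ?thesis by (simp only: exp_add mult_ac)
    qed
    also have "\<dots> \<le> exp (L - real D * ln L)"
     using elim(2) l1 l2 r by (auto simp: L_def)
    also have "\<dots> = x / L ^ D" using L by (simp add: exp_diff xL exp_of_nat_mult)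
    finally show ?thesis using r(3) by blast
   qed
  qed
 qed
qed

theorem theorem1p1:
  fixes D :: real
  assumes "D > 0"
  shows "\<exists>K x0. \<forall>x::real. \<forall>N::nat. x \<ge> x0 \<and> real N > exp (3.42 * sqrt (ln x)) \<longrightarrow>
           \<bar>(1 / real N) * (\<Sum>a\<in>{1..N}. \<Sum>p\<in>{p::nat. prime p \<and> real p \<le> x}.
                real (ell a p) / (real p - 1)) - stephens_C * Li x\<bar>
           \<le> K * x / (ln x) powr D"
proof -
 define d where "d = nat \<lceil>D\<rceil>"
 have d: "D \<le> real d" using assms unfolding d_def by linarith
 obtain K x1 where main: "\<And>x. x \<ge> x1 \<Longrightarrow>
  \<bar>(\<Sum>p\<in>primes_upto x. \<Sum>d | d dvd p - 1. index_coeff d / real d ^ 2) - stephens_C * Li x\<bar> \<le> K * (x / ln x ^ d)"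
  by (rule main_term) blast
 define P where "P x = ((1 + ln x) ^ 2 \<le> x / ln x ^ d \<and> ln x \<ge> 1 \<and> x \<ge> 1)" for x :: real
 define R where "R x N r = ((1 + ln x) * ((ln x ^ (d + 1)) ^ (2 * r - 1) * (moment_ratio x (ln x) N r))
   \<le> x / ln x ^ d)" for x N r
 have "eventually P at_top" unfolding P_def[abs_def] by (intro eventually_conj; real_asymp)
 moreover have "eventually (\<lambda>x. \<forall>N. real N > exp (3.42 * sqrt (ln x)) \<longrightarrow> (\<exists>r\<ge>1. R x N r)) at_top"
  unfolding R_def by (rule high_moment_small)
 ultimately have "eventually (\<lambda>x. P x \<and> (\<forall>N. real N > exp (3.42 * sqrt (ln x)) \<longrightarrow> (\<exists>r\<ge>1. R x N r))) at_top"
  by (rule eventually_conj)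
 then obtain x2 where x2: "\<And>x. x \<ge> x2 \<Longrightarrow> P x" "\<And>x N. x \<ge> x2 \<Longrightarrow> real N > exp (3.42 * sqrt (ln x)) \<Longrightarrow> \<exists>r\<ge>1. R x N r"
  unfolding eventually_at_top_linorder by blast
 have fin: "\<bar>(1 / real N) * (\<Sum>a\<in>{1..N}. \<Sum>p\<in>{p::nat. prime p \<and> real p \<le> x}. real (ell a p) / (real p - 1)) - stephens_C * Li x\<bar>
   \<le> (\<bar>K\<bar> + 4) * x / (ln x) powr D"
  if x: "x \<ge> max x1 x2" and N: "real N > exp (3.42 * sqrt (ln x))" for x :: real and N :: nat
 proof -
  define L where "L = ln x"
  \<comment> \<open>One logarithm more than the saving: the divisors of \<open>p - 1\<close>,
    counted over all \<open>p \<le> x\<close>, number about \<open>x * ln x\<close> at most, and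
    their count is divided by \<open>V\<close>.\<close>
  define V where "V = L ^ (d + 1)"
  define E where "E = x / L ^ d"
  have l: "(1 + L) ^ 2 \<le> E" "L \<ge> 1" "x \<ge> 1" using x2(1)[of x] x by (simp_all add: P_def L_def E_def)
  obtain r where r: "r \<ge> 1" "(1 + L) * (V ^ (2 * r - 1) * (moment_ratio x L N r)) \<le> E"
   using x2(2)[OF _ N] x unfolding R_def L_def E_def V_def by auto
  have V: "V > 0" using l(2) by (simp add: V_def)
  have N0: "real N > 0" by (rule less_trans[OF exp_gt_zero N])
  have N1: "N \<ge> 1" using N0 by simp
  define g where "g n = index_coeff n / real n ^ 2" for n
  define Y where "Y p = (\<Sum>j\<in>{1..<p - 1}. (norm (\<Sum>a\<in>{1..N}. pchar p j a) / real N) ^ (2 * r))" for p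
  have Y0: "Y p \<ge> 0" for p unfolding Y_def by (intro sum_nonneg) simp
  define M where "M = nat \<lfloor>x\<rfloor>"
  have M: "M \<ge> 1" "real M \<le> x" using l(3) unfolding M_def by linarith+
  have hs: "(\<Sum>n=1..M. 1 / real n) \<le> 1 + L"
  proof -
   have "ln (real M) \<le> L" unfolding L_def using M by (subst ln_le_cancel_iff) auto
   then show ?thesis using sum_inverse_le_ln[OF M(1)] by linarith
  qed
  have lp: "1 + ln (real p) \<le> 1 + L" "0 < real p" "real p \<le> x" if "p \<in> primes_upto x" for p
  proof -
   show p: "0 < real p" "real p \<le> x" using that prime_gt_0_nat by (auto simp: primes_upto_def)
   show "1 + ln (real p) \<le> 1 + L" unfolding L_def using p by simp
  qed
  have e1: "(\<Sum>p\<in>primes_upto x. (1 + ln (real p)) / real p) \<le> E"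
  proof -
   have "(\<Sum>p\<in>primes_upto x. (1 + ln (real p)) / real p) \<le> (\<Sum>p\<in>primes_upto x. (1 + L) * (1 / real p))"
    using lp by (intro sum_mono) (simp add: divide_right_mono)
   also have "\<dots> \<le> (\<Sum>n=1..M. (1 + L) * (1 / real n))"
    using l prime_gt_0_nat by (intro sum_mono2) (auto simp: primes_upto_def M_def le_nat_floor Suc_le_eq)
   also have "\<dots> \<le> (1 + L) * (1 + L)" unfolding sum_distrib_left[symmetric] using hs l by (intro mult_left_mono) auto
   finally show ?thesis using l(1) by (simp add: power2_eq_square)
  qed
  have e2: "(\<Sum>p\<in>primes_upto x. real (card {n. n dvd p - 1}) / V) \<le> 2 * E"
  proof -
   have "(\<Sum>p\<in>primes_upto x. real (card {n. n dvd p - 1})) = (\<Sum>p\<in>primes_upto x. \<Sum>n | n dvd p - 1. 1)" by simp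
   also have "\<dots> = (\<Sum>n\<in>{1..M}. 1 * real (card (primes_1_mod n x)))"
    unfolding M_def by (rule sum_divisors_shifted_primes[OF l(3)])
   also have "\<dots> \<le> (\<Sum>n\<in>{1..M}. x * (1 / real n))"
    using card_primes_1_mod_le[of _ x] l(3) by (intro sum_mono) simp
   also have "\<dots> \<le> x * (2 * L)"
    unfolding sum_distrib_left[symmetric] using hs l by (intro mult_left_mono) auto
   finally have "(\<Sum>p\<in>primes_upto x. real (card {n. n dvd p - 1})) / V \<le> x * (2 * L) / V" using V by (intro divide_right_mono) auto
   also have "\<dots> = 2 * E" using l(2) by (simp add: V_def E_def)
   finally show ?thesis by (simp add: sum_divide_distrib)
  qed
  have e3: "(\<Sum>p\<in>primes_upto x. (1 + ln (real p)) * V ^ (2 * r - 1) * Y p) \<le> E"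
  proof -
   have Y1: "(\<Sum>p\<in>primes_upto x. Y p) = (\<Sum>p\<in>primes_upto x. \<Sum>j\<in>{1..<p - 1}. norm (\<Sum>a\<in>{1..N}. pchar p j a) ^ (2 * r)) / real N ^ (2 * r)"
    by (simp only: Y_def power_divide sum_divide_distrib)
   have Y2: "(\<Sum>p\<in>primes_upto x. \<Sum>j\<in>{1..<p - 1}. norm (\<Sum>a\<in>{1..N}. pchar p j a) ^ (2 * r)) \<le> (real N ^ r + 4 * x ^ 2 * (1 + 2 * L)) * real (mult_energy r N)"
    unfolding L_def by (rule moment_bound[OF l(3)])
   have Y: "(\<Sum>p\<in>primes_upto x. Y p) \<le> moment_ratio x L N r"
    unfolding Y1 by (rule divide_right_mono[OF Y2]) simp
   have "(\<Sum>p\<in>primes_upto x. (1 + ln (real p)) * V ^ (2 * r - 1) * Y p) \<le> (\<Sum>p\<in>primes_upto x. (1 + L) * V ^ (2 * r - 1) * Y p)"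
   proof (rule sum_mono)
    fix p assume p: "p \<in> primes_upto x"
    have "0 \<le> V ^ (2 * r - 1)" using V by simp
    from mult_right_mono[OF mult_right_mono[OF lp(1)[OF p] this] Y0]
    show "(1 + ln (real p)) * V ^ (2 * r - 1) * Y p \<le> (1 + L) * V ^ (2 * r - 1) * Y p" .
   qed
   also have "\<dots> = (1 + L) * (V ^ (2 * r - 1) * (\<Sum>p\<in>primes_upto x. Y p))" by (simp add: sum_distrib_left mult.assoc)
   finally have e: "(\<Sum>p\<in>primes_upto x. (1 + ln (real p)) * V ^ (2 * r - 1) * Y p) \<le> (1 + L) * (V ^ (2 * r - 1) * (\<Sum>p\<in>primes_upto x. Y p))" .
   have "(1 + L) * (V ^ (2 * r - 1) * (\<Sum>p\<in>primes_upto x. Y p))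
     \<le> (1 + L) * (V ^ (2 * r - 1) * (moment_ratio x L N r))"
    using l(2) V by (intro mult_left_mono[OF mult_left_mono[OF Y]]) simp_all
   from order_trans[OF e order_trans[OF this r(2)]] show ?thesis .
  qed
  define S where "S = (1 / real N) * (\<Sum>a\<in>{1..N}. \<Sum>p\<in>primes_upto x. real (ell a p) / (real p - 1))"
  define G where "G = (\<Sum>p\<in>primes_upto x. \<Sum>n | n dvd p - 1. g n)"
  have S: "S = (\<Sum>p\<in>primes_upto x. (1 / real N) * (\<Sum>a\<in>{1..N}. real (ell a p) / (real p - 1)))"
   unfolding S_def sum_distrib_left by (rule sum.swap)
  have SG: "S - G = (\<Sum>p\<in>primes_upto x. (1 / real N) * (\<Sum>a\<in>{1..N}. real (ell a p) / (real p - 1)) - (\<Sum>n | n dvd p - 1. g n))"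
   unfolding S G_def by (rule sum_subtractf[symmetric])
  have "\<bar>S - G\<bar> \<le> (\<Sum>p\<in>primes_upto x. (1 + ln (real p)) / real p + real (card {n. n dvd p - 1}) / V + (1 + ln (real p)) * V ^ (2 * r - 1) * Y p)"
   unfolding SG g_def Y_def
   by (rule order_trans[OF sum_abs sum_mono], rule sum_ord_error[OF _ N1 r(1) V]) (simp add: primes_upto_def)
  also have "\<dots> \<le> E + 2 * E + E" unfolding sum.distrib by (intro add_mono e1 e2 e3)
  finally have "\<bar>S - G\<bar> \<le> 4 * E" by simp
  moreover have "\<bar>G - stephens_C * Li x\<bar> \<le> \<bar>K\<bar> * E"
  proof -
   have "K * E \<le> \<bar>K\<bar> * E" using l by (intro mult_right_mono) (auto simp: E_def)
   then show ?thesis using main[of x] x unfolding G_def g_def E_def L_def by simp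
  qed
  ultimately have "\<bar>S - stephens_C * Li x\<bar> \<le> (\<bar>K\<bar> + 4) * E" by (simp add: distrib_right)
  also have "\<dots> \<le> (\<bar>K\<bar> + 4) * (x / L powr D)"
  proof (rule mult_left_mono)
   have "L powr D \<le> L powr real d" using l(2) d by (intro powr_mono) auto
   then have "L powr D \<le> L ^ d" using l(2) by (simp add: powr_realpow)
   then show "E \<le> x / L powr D" unfolding E_def using l by (intro divide_left_mono) auto
  qed simp
  finally show ?thesis unfolding S_def primes_upto_def L_def by simp
 qed
 show ?thesis by (intro exI[of _ "\<bar>K\<bar> + 4"] exI[of _ "max x1 x2"]) (use fin in blast)
qed

end
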